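(* There exists a Fell algebra $A$ with trivial Dixmier–Douady invariant whose spectrum is a compact smooth non-Hausdorff manifold admitting a surjective local homeomorphism from a smooth compact manifold, such that the $K$-theory $K_*(A)$ is infinitely generated (i.e. not finitely generated as an abelian group).
   Context: Spaces are not assumed Hausdorff unless stated; compact means that every open cover has a finite subcover. A smooth non-Hausdorff manifold is a second countable, non-Hausdorff space that is locally homeomorphic to Euclidean space of a fixed dimension and equipped with a smooth atlas; a smooth compact manifold without the qualifier "non-Hausdorff" is Hausdorff. The spectrum $\hat A$ of a $C^*$-algebra $A$ is the set of equivalence classes of irreducible representations with its usual (Fell/Jacobson) topology. A $C^*$-algebra $A$ is a Fell algebra if every $[\pi_0]\in\hat A$ has a neighborhood $U$ and an element $b\in A$ such that $\pi(b)$ is a rank one projection for all $[\pi]\in U$. Dixmier–Douady invariant: separable Fell algebras have a Dixmier–Douady invariant (Huef–Kumjian–Sims). A separable Fell algebra $A$ has trivial invariant if and only if $A\otimes\mathbb{K}\cong C^*(R(\psi))\otimes\mathbb{K}$ for some surjective local homeomorphism $\psi:Y\to\hat A$ with $Y$ second countable, locally compact Hausdorff; this may be taken as the definition. Here $\mathbb{K}$ is the algebra of compact operators on a separable infinite-dimensional Hilbert space and $C^*(R(\psi))$ is the groupoid $C^*$-algebra of the étale groupoid $R(\psi)=\{(y_1,y_2)\in Y\times Y:\psi(y_1)=\psi(y_2)\}$ with the subspace topology. *)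

theory Defs
  imports "HOL-Analysis.Analysis" "HOL-Algebra.Generated_Groups"
begin

section \<open>Complex vector spaces, Hilbert spaces, *-algebras and C*-algebras\<close>

text \<open>
  Everything is carrier based, because the main statement quantifies existentially over a
  C*-algebra and builds further algebras (completions, tensor products, unitizations) from it.
\<close>

record 'a cvs =
  vcar :: "'a set"
  vadd :: "'a \<Rightarrow> 'a \<Rightarrow> 'a"
  vzero :: "'a"
  vscale :: "complex \<Rightarrow> 'a \<Rightarrow> 'a"

record 'a hilb = "'a cvs" +
  hinner :: "'a \<Rightarrow> 'a \<Rightarrow> complex"

record 'a staralg = "'a cvs" +
  atimes :: "'a \<Rightarrow> 'a \<Rightarrow> 'a"
  astar :: "'a \<Rightarrow> 'a"

record 'a cstar = "'a staralg" +
  nrm :: "'a \<Rightarrow> real"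

definition vdiff :: "('a, 'm) cvs_scheme \<Rightarrow> 'a \<Rightarrow> 'a \<Rightarrow> 'a" where
  "vdiff V x y = vadd V x (vscale V (-1) y)"

primrec vsum :: "('a, 'm) cvs_scheme \<Rightarrow> (nat \<Rightarrow> 'a) \<Rightarrow> nat \<Rightarrow> 'a" where
  "vsum V f 0 = vzero V"
| "vsum V f (Suc n) = vadd V (vsum V f n) (f n)"

locale complex_vs =
  fixes V :: "('a, 'm) cvs_scheme"
  assumes add_closed: "\<lbrakk>x \<in> vcar V; y \<in> vcar V\<rbrakk> \<Longrightarrow> vadd V x y \<in> vcar V"
    and add_assoc: "\<lbrakk>x \<in> vcar V; y \<in> vcar V; z \<in> vcar V\<rbrakk>
          \<Longrightarrow> vadd V (vadd V x y) z = vadd V x (vadd V y z)"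
    and add_comm: "\<lbrakk>x \<in> vcar V; y \<in> vcar V\<rbrakk> \<Longrightarrow> vadd V x y = vadd V y x"
    and zero_closed: "vzero V \<in> vcar V"
    and zero_add: "x \<in> vcar V \<Longrightarrow> vadd V (vzero V) x = x"
    and neg_ex: "x \<in> vcar V \<Longrightarrow> \<exists>y\<in>vcar V. vadd V x y = vzero V"
    and scale_closed: "x \<in> vcar V \<Longrightarrow> vscale V c x \<in> vcar V"
    and scale_add: "\<lbrakk>x \<in> vcar V; y \<in> vcar V\<rbrakk>
          \<Longrightarrow> vscale V c (vadd V x y) = vadd V (vscale V c x) (vscale V c y)"
    and add_scale: "x \<in> vcar V \<Longrightarrow> vscale V (c + d) x = vadd V (vscale V c x) (vscale V d x)"
    and scale_scale: "x \<in> vcar V \<Longrightarrow> vscale V c (vscale V d x) = vscale V (c * d) x"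
    and scale_one: "x \<in> vcar V \<Longrightarrow> vscale V 1 x = x"

definition vsubspace :: "('a, 'm) cvs_scheme \<Rightarrow> 'a set \<Rightarrow> bool" where
  "vsubspace V W \<longleftrightarrow> W \<subseteq> vcar V \<and> vzero V \<in> W \<and>
     (\<forall>x\<in>W. \<forall>y\<in>W. vadd V x y \<in> W) \<and> (\<forall>c. \<forall>x\<in>W. vscale V c x \<in> W)"

definition linear_on :: "('a, 'm) cvs_scheme \<Rightarrow> ('b, 'k) cvs_scheme \<Rightarrow> ('a \<Rightarrow> 'b) \<Rightarrow> bool" where
  "linear_on V W f \<longleftrightarrow> (\<forall>x\<in>vcar V. f x \<in> vcar W) \<and>
     (\<forall>x\<in>vcar V. \<forall>y\<in>vcar V. f (vadd V x y) = vadd W (f x) (f y)) \<and>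
     (\<forall>c. \<forall>x\<in>vcar V. f (vscale V c x) = vscale W c (f x))"

definition N_Cauchy :: "('a, 'm) cvs_scheme \<Rightarrow> ('a \<Rightarrow> real) \<Rightarrow> (nat \<Rightarrow> 'a) \<Rightarrow> bool" where
  "N_Cauchy V N x \<longleftrightarrow> range x \<subseteq> vcar V \<and>
     (\<forall>e>0. \<exists>M. \<forall>m\<ge>M. \<forall>n\<ge>M. N (vdiff V (x m) (x n)) < e)"

definition N_tendsto :: "('a, 'm) cvs_scheme \<Rightarrow> ('a \<Rightarrow> real) \<Rightarrow> (nat \<Rightarrow> 'a) \<Rightarrow> 'a \<Rightarrow> bool" where
  "N_tendsto V N x l \<longleftrightarrow> (\<lambda>n. N (vdiff V (x n) l)) \<longlonglongrightarrow> 0"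

definition N_complete :: "('a, 'm) cvs_scheme \<Rightarrow> ('a \<Rightarrow> real) \<Rightarrow> bool" where
  "N_complete V N \<longleftrightarrow> (\<forall>x. N_Cauchy V N x \<longrightarrow> (\<exists>l\<in>vcar V. N_tendsto V N x l))"

definition N_closed :: "('a, 'm) cvs_scheme \<Rightarrow> ('a \<Rightarrow> real) \<Rightarrow> 'a set \<Rightarrow> bool" where
  "N_closed V N W \<longleftrightarrow>
     (\<forall>x. \<forall>l\<in>vcar V. range x \<subseteq> W \<and> N_tendsto V N x l \<longrightarrow> l \<in> W)"

definition hnorm :: "('a, 'm) hilb_scheme \<Rightarrow> 'a \<Rightarrow> real" where
  "hnorm H x = sqrt (Re (hinner H x x))"

locale hilbert_space = complex_vs H
  for H :: "('a, 'm) hilb_scheme" +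
  assumes inner_add: "\<lbrakk>x \<in> vcar H; y \<in> vcar H; z \<in> vcar H\<rbrakk>
          \<Longrightarrow> hinner H (vadd H x y) z = hinner H x z + hinner H y z"
    and inner_scale: "\<lbrakk>x \<in> vcar H; y \<in> vcar H\<rbrakk>
          \<Longrightarrow> hinner H (vscale H c x) y = c * hinner H x y"
    and inner_cnj: "\<lbrakk>x \<in> vcar H; y \<in> vcar H\<rbrakk> \<Longrightarrow> hinner H y x = cnj (hinner H x y)"
    and inner_nonneg: "x \<in> vcar H \<Longrightarrow> 0 \<le> Re (hinner H x x)"
    and inner_eq_zero: "\<lbrakk>x \<in> vcar H; hinner H x x = 0\<rbrakk> \<Longrightarrow> x = vzero H"
    and complete: "N_complete H (hnorm H)"

locale star_algebra = complex_vs A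
  for A :: "('a, 'm) staralg_scheme" +
  assumes times_closed: "\<lbrakk>x \<in> vcar A; y \<in> vcar A\<rbrakk> \<Longrightarrow> atimes A x y \<in> vcar A"
    and times_assoc: "\<lbrakk>x \<in> vcar A; y \<in> vcar A; z \<in> vcar A\<rbrakk>
          \<Longrightarrow> atimes A (atimes A x y) z = atimes A x (atimes A y z)"
    and times_add: "\<lbrakk>x \<in> vcar A; y \<in> vcar A; z \<in> vcar A\<rbrakk>
          \<Longrightarrow> atimes A x (vadd A y z) = vadd A (atimes A x y) (atimes A x z)"
    and add_times: "\<lbrakk>x \<in> vcar A; y \<in> vcar A; z \<in> vcar A\<rbrakk>
          \<Longrightarrow> atimes A (vadd A x y) z = vadd A (atimes A x z) (atimes A y z)"
    and scale_times: "\<lbrakk>x \<in> vcar A; y \<in> vcar A\<rbrakk>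
          \<Longrightarrow> atimes A (vscale A c x) y = vscale A c (atimes A x y)"
    and times_scale: "\<lbrakk>x \<in> vcar A; y \<in> vcar A\<rbrakk>
          \<Longrightarrow> atimes A x (vscale A c y) = vscale A c (atimes A x y)"
    and star_closed: "x \<in> vcar A \<Longrightarrow> astar A x \<in> vcar A"
    and star_star: "x \<in> vcar A \<Longrightarrow> astar A (astar A x) = x"
    and star_add: "\<lbrakk>x \<in> vcar A; y \<in> vcar A\<rbrakk>
          \<Longrightarrow> astar A (vadd A x y) = vadd A (astar A x) (astar A y)"
    and star_scale: "x \<in> vcar A \<Longrightarrow> astar A (vscale A c x) = vscale A (cnj c) (astar A x)"
    and star_times: "\<lbrakk>x \<in> vcar A; y \<in> vcar A\<rbrakk>
          \<Longrightarrow> astar A (atimes A x y) = atimes A (astar A y) (astar A x)"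

locale cstar_algebra = star_algebra A
  for A :: "('a, 'm) cstar_scheme" +
  assumes nrm_nonneg: "x \<in> vcar A \<Longrightarrow> 0 \<le> nrm A x"
    and nrm_eq_zero: "x \<in> vcar A \<Longrightarrow> nrm A x = 0 \<longleftrightarrow> x = vzero A"
    and nrm_triangle: "\<lbrakk>x \<in> vcar A; y \<in> vcar A\<rbrakk> \<Longrightarrow> nrm A (vadd A x y) \<le> nrm A x + nrm A y"
    and nrm_scale: "x \<in> vcar A \<Longrightarrow> nrm A (vscale A c x) = cmod c * nrm A x"
    and nrm_times: "\<lbrakk>x \<in> vcar A; y \<in> vcar A\<rbrakk> \<Longrightarrow> nrm A (atimes A x y) \<le> nrm A x * nrm A y"
    and cstar_identity: "x \<in> vcar A \<Longrightarrow> nrm A (atimes A (astar A x) x) = (nrm A x)\<^sup>2"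
    and nrm_complete: "N_complete A (nrm A)"

definition separable :: "('a, 'm) cstar_scheme \<Rightarrow> bool" where
  "separable A \<longleftrightarrow> (\<exists>D\<subseteq>vcar A. countable D \<and>
     (\<forall>x\<in>vcar A. \<forall>e>0. \<exists>d\<in>D. nrm A (vdiff A x d) < e))"

text \<open>Bijective *-homomorphisms between C*-algebras are automatically isometric.\<close>

definition cstar_iso :: "('a, 'm) cstar_scheme \<Rightarrow> ('b, 'k) cstar_scheme \<Rightarrow> bool" where
  "cstar_iso A B \<longleftrightarrow> (\<exists>\<phi>. bij_betw \<phi> (vcar A) (vcar B) \<and> linear_on A B \<phi> \<and>
     (\<forall>x\<in>vcar A. \<forall>y\<in>vcar A. \<phi> (atimes A x y) = atimes B (\<phi> x) (\<phi> y)) \<and>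
     (\<forall>x\<in>vcar A. \<phi> (astar A x) = astar B (\<phi> x)))"


section \<open>Representations and the spectrum\<close>

definition opnorm :: "('h, 'm) hilb_scheme \<Rightarrow> ('h \<Rightarrow> 'h) \<Rightarrow> real" where
  "opnorm H T = Sup {hnorm H (T \<xi>) | \<xi>. \<xi> \<in> vcar H \<and> hnorm H \<xi> \<le> 1}"

definition bounded_op :: "('h, 'm) hilb_scheme \<Rightarrow> ('h \<Rightarrow> 'h) \<Rightarrow> bool" where
  "bounded_op H T \<longleftrightarrow> linear_on H H T \<and>
     (\<exists>C. \<forall>\<xi>\<in>vcar H. hnorm H (T \<xi>) \<le> C * hnorm H \<xi>)"

definition representation ::
  "('a, 'm) staralg_scheme \<Rightarrow> ('h, 'k) hilb_scheme \<Rightarrow> ('a \<Rightarrow> 'h \<Rightarrow> 'h) \<Rightarrow> bool" where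
  "representation A H \<pi> \<longleftrightarrow> hilbert_space H \<and> (\<forall>a\<in>vcar A. bounded_op H (\<pi> a)) \<and>
     (\<forall>a\<in>vcar A. \<forall>b\<in>vcar A. \<forall>\<xi>\<in>vcar H.
        \<pi> (vadd A a b) \<xi> = vadd H (\<pi> a \<xi>) (\<pi> b \<xi>) \<and> \<pi> (atimes A a b) \<xi> = \<pi> a (\<pi> b \<xi>)) \<and>
     (\<forall>c. \<forall>a\<in>vcar A. \<forall>\<xi>\<in>vcar H. \<pi> (vscale A c a) \<xi> = vscale H c (\<pi> a \<xi>)) \<and>
     (\<forall>a\<in>vcar A. \<forall>\<xi>\<in>vcar H. \<forall>\<eta>\<in>vcar H.
        hinner H (\<pi> (astar A a) \<xi>) \<eta> = hinner H \<xi> (\<pi> a \<eta>))"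

text \<open>The nonvanishing condition excludes the zero representation on a one-dimensional space.\<close>

definition irreducible_rep ::
  "('a, 'm) staralg_scheme \<Rightarrow> ('h, 'k) hilb_scheme \<Rightarrow> ('a \<Rightarrow> 'h \<Rightarrow> 'h) \<Rightarrow> bool" where
  "irreducible_rep A H \<pi> \<longleftrightarrow> representation A H \<pi> \<and>
     (\<exists>a\<in>vcar A. \<exists>\<xi>\<in>vcar H. \<pi> a \<xi> \<noteq> vzero H) \<and>
     (\<forall>W. vsubspace H W \<and> N_closed H (hnorm H) W \<and> (\<forall>a\<in>vcar A. \<forall>\<xi>\<in>W. \<pi> a \<xi> \<in> W)
          \<longrightarrow> W = {vzero H} \<or> W = vcar H)"

definition unitarily_equivalent ::
  "('a, 'm) staralg_scheme \<Rightarrow> 'h hilb \<times> ('a \<Rightarrow> 'h \<Rightarrow> 'h) \<Rightarrow> 'h hilb \<times> ('a \<Rightarrow> 'h \<Rightarrow> 'h) \<Rightarrow> bool"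
where
  "unitarily_equivalent A = (\<lambda>(H, \<pi>) (H', \<pi>').
     \<exists>U. bij_betw U (vcar H) (vcar H') \<and> linear_on H H' U \<and>
       (\<forall>\<xi>\<in>vcar H. \<forall>\<eta>\<in>vcar H. hinner H' (U \<xi>) (U \<eta>) = hinner H \<xi> \<eta>) \<and>
       (\<forall>a\<in>vcar A. \<forall>\<xi>\<in>vcar H. U (\<pi> a \<xi>) = \<pi>' a (U \<xi>)))"

text \<open>
  Hilbert spaces carried by sets of sequences in \<open>A\<close> suffice: a cyclic representation space is the
  closure of an image of \<open>A\<close>, hence has at most as many elements as there are sequences in \<open>A\<close>.
  So every irreducible representation is equivalent to one of this kind.
\<close>

type_synonym 'a rep = "(nat \<Rightarrow> 'a) hilb \<times> ('a \<Rightarrow> (nat \<Rightarrow> 'a) \<Rightarrow> (nat \<Rightarrow> 'a))"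

definition irreps :: "('a, 'm) staralg_scheme \<Rightarrow> 'a rep set" where
  "irreps A = {(H, \<pi>). irreducible_rep A H \<pi>}"

definition spectrum_points :: "('a, 'm) staralg_scheme \<Rightarrow> 'a rep set set" where
  "spectrum_points A =
     irreps A // {(r, s). r \<in> irreps A \<and> s \<in> irreps A \<and> unitarily_equivalent A r s}"

definition closed_ideal :: "('a, 'm) cstar_scheme \<Rightarrow> 'a set \<Rightarrow> bool" where
  "closed_ideal A I \<longleftrightarrow> vsubspace A I \<and> N_closed A (nrm A) I \<and>
     (\<forall>a\<in>vcar A. \<forall>x\<in>I. atimes A a x \<in> I \<and> atimes A x a \<in> I)"

text \<open>
  The open sets of the Jacobson topology are the sets of classes of representations
  that do not vanish on a given closed two-sided ideal. These sets already form a topology.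
\<close>

definition spectrum :: "('a, 'm) cstar_scheme \<Rightarrow> 'a rep set topology" where
  "spectrum A = topology_generated_by
     {{c \<in> spectrum_points A. \<exists>(H, \<pi>)\<in>c. \<exists>a\<in>I. \<exists>\<xi>\<in>vcar H. \<pi> a \<xi> \<noteq> vzero H} | I. closed_ideal A I}"

definition rank_one_projection :: "('h, 'm) hilb_scheme \<Rightarrow> ('h \<Rightarrow> 'h) \<Rightarrow> bool" where
  "rank_one_projection H P \<longleftrightarrow> bounded_op H P \<and>
     (\<forall>\<xi>\<in>vcar H. P (P \<xi>) = P \<xi>) \<and>
     (\<forall>\<xi>\<in>vcar H. \<forall>\<eta>\<in>vcar H. hinner H (P \<xi>) \<eta> = hinner H \<xi> (P \<eta>)) \<and>
     (\<exists>\<xi>\<in>vcar H. \<xi> \<noteq> vzero H \<and> P ` vcar H = {vscale H c \<xi> | c. True})"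

definition Fell_algebra :: "('a, 'm) cstar_scheme \<Rightarrow> bool" where
  "Fell_algebra A \<longleftrightarrow> cstar_algebra A \<and>
     (\<forall>c0 \<in> spectrum_points A. \<exists>U. openin (spectrum A) U \<and> c0 \<in> U \<and>
        (\<exists>b\<in>vcar A. \<forall>c\<in>U. \<forall>(H, \<pi>)\<in>c. rank_one_projection H (\<pi> b)))"


section \<open>Enveloping C*-algebras\<close>

definition completion_rel ::
  "('a, 'm) staralg_scheme \<Rightarrow> ('a \<Rightarrow> real) \<Rightarrow> ((nat \<Rightarrow> 'a) \<times> (nat \<Rightarrow> 'a)) set" where
  "completion_rel A p = {(x, y). N_Cauchy A p x \<and> N_Cauchy A p y \<and>
     (\<lambda>n. p (vdiff A (x n) (y n))) \<longlonglongrightarrow> 0}"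

definition completion :: "('a, 'm) staralg_scheme \<Rightarrow> ('a \<Rightarrow> real) \<Rightarrow> (nat \<Rightarrow> 'a) set cstar" where
  "completion A p = (let R = completion_rel A p in
    \<lparr> vcar = {x. N_Cauchy A p x} // R,
      vadd = (\<lambda>X Y. \<Union>x\<in>X. \<Union>y\<in>Y. R `` {\<lambda>n. vadd A (x n) (y n)}),
      vzero = R `` {\<lambda>n. vzero A},
      vscale = (\<lambda>c X. \<Union>x\<in>X. R `` {\<lambda>n. vscale A c (x n)}),
      atimes = (\<lambda>X Y. \<Union>x\<in>X. \<Union>y\<in>Y. R `` {\<lambda>n. atimes A (x n) (y n)}),
      astar = (\<lambda>X. \<Union>x\<in>X. R `` {\<lambda>n. astar A (x n)}),
      nrm = (\<lambda>X. lim (\<lambda>n. p ((SOME x. x \<in> X) n))) \<rparr>)"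

text \<open>
  The supremum of \<open>\<parallel>\<pi>(a)\<parallel>\<close> over all *-representations by bounded operators. Cyclic representations
  compute it, so Hilbert spaces carried by sequences in \<open>A\<close> suffice, as for the spectrum.
  It is finite for the two kinds of *-algebras to which it is applied below.
\<close>

definition universal_seminorm :: "('a, 'm) staralg_scheme \<Rightarrow> 'a \<Rightarrow> real" where
  "universal_seminorm A a =
     Sup {opnorm H (\<pi> a) | (H :: (nat \<Rightarrow> 'a) hilb) \<pi>. representation A H \<pi>}"

definition enveloping_cstar :: "('a, 'm) staralg_scheme \<Rightarrow> (nat \<Rightarrow> 'a) set cstar" where
  "enveloping_cstar A = completion A (universal_seminorm A)"


section \<open>Groupoid C*-algebras\<close>

record 'g groupoid =
  gtop :: "'g topology"
  grange :: "'g \<Rightarrow> 'g"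
  ginv :: "'g \<Rightarrow> 'g"
  gmult :: "'g \<Rightarrow> 'g \<Rightarrow> 'g"

text \<open>
  The convolution *-algebra of an etale, locally compact Hausdorff groupoid. Functions are
  extended by \<open>0\<close> outside the groupoid. The convolution
  \<open>(f * g)(\<gamma>) = \<Sum> f(\<alpha>) g(\<alpha>\<inverse>\<gamma>)\<close>, over all \<open>\<alpha>\<close> with \<open>r(\<alpha>) = r(\<gamma>)\<close>, has only finitely many
  nonzero terms because range fibres are closed and discrete; the restriction to \<open>f \<alpha> \<noteq> 0\<close> makes
  the index set finite.
\<close>

definition convolution_algebra :: "'g groupoid \<Rightarrow> ('g \<Rightarrow> complex) staralg" where
  "convolution_algebra G = (let X = topspace (gtop G) in
    \<lparr> vcar = {f. continuous_map (gtop G) euclidean f \<and> (\<forall>\<gamma>. \<gamma> \<notin> X \<longrightarrow> f \<gamma> = 0) \<and>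
                 compactin (gtop G) (gtop G closure_of {\<gamma>\<in>X. f \<gamma> \<noteq> 0})},
      vadd = (\<lambda>f g \<gamma>. f \<gamma> + g \<gamma>),
      vzero = (\<lambda>\<gamma>. 0),
      vscale = (\<lambda>c f \<gamma>. c * f \<gamma>),
      atimes = (\<lambda>f g \<gamma>. if \<gamma> \<in> X
         then \<Sum>\<alpha> | \<alpha> \<in> X \<and> grange G \<alpha> = grange G \<gamma> \<and> f \<alpha> \<noteq> 0. f \<alpha> * g (gmult G (ginv G \<alpha>) \<gamma>)
         else 0),
      astar = (\<lambda>f \<gamma>. if \<gamma> \<in> X then cnj (f (ginv G \<gamma>)) else 0) \<rparr>)"

definition groupoid_cstar :: "'g groupoid \<Rightarrow> (nat \<Rightarrow> 'g \<Rightarrow> complex) set cstar" where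
  "groupoid_cstar G = enveloping_cstar (convolution_algebra G)"

definition equivalence_groupoid :: "'y topology \<Rightarrow> ('y \<Rightarrow> 'x) \<Rightarrow> ('y \<times> 'y) groupoid" where
  "equivalence_groupoid Y \<psi> =
    \<lparr> gtop = subtopology (prod_topology Y Y)
               {(y1, y2). y1 \<in> topspace Y \<and> y2 \<in> topspace Y \<and> \<psi> y1 = \<psi> y2},
      grange = (\<lambda>(y1, y2). (y1, y1)),
      ginv = (\<lambda>(y1, y2). (y2, y1)),
      gmult = (\<lambda>(y1, y2) (y3, y4). (y1, y4)) \<rparr>"


section \<open>Compact operators and tensor products\<close>

text \<open>Operators are normalised to be \<open>0\<close> outside the Hilbert space, so that equality is extensional.\<close>

definition bounded_ops :: "('h, 'm) hilb_scheme \<Rightarrow> ('h \<Rightarrow> 'h) set" where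
  "bounded_ops H = {T. bounded_op H T \<and> (\<forall>\<xi>. \<xi> \<notin> vcar H \<longrightarrow> T \<xi> = vzero H)}"

definition compact_op :: "('h, 'm) hilb_scheme \<Rightarrow> ('h \<Rightarrow> 'h) \<Rightarrow> bool" where
  "compact_op H T \<longleftrightarrow>
     (\<forall>x :: nat \<Rightarrow> 'h. (\<forall>n. x n \<in> vcar H \<and> hnorm H (x n) \<le> 1) \<longrightarrow>
        (\<exists>r l. strict_mono r \<and> l \<in> vcar H \<and> N_tendsto H (hnorm H) (\<lambda>n. T (x (r n))) l))"

definition compact_operators :: "('h, 'm) hilb_scheme \<Rightarrow> ('h \<Rightarrow> 'h) cstar" where
  "compact_operators H =
    \<lparr> vcar = {T \<in> bounded_ops H. compact_op H T},
      vadd = (\<lambda>S T \<xi>. vadd H (S \<xi>) (T \<xi>)),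
      vzero = (\<lambda>\<xi>. vzero H),
      vscale = (\<lambda>c T \<xi>. vscale H c (T \<xi>)),
      atimes = (\<lambda>S T. S \<circ> T),
      astar = (\<lambda>T. THE S. S \<in> bounded_ops H \<and>
                 (\<forall>\<xi>\<in>vcar H. \<forall>\<eta>\<in>vcar H. hinner H (S \<xi>) \<eta> = hinner H \<xi> (T \<eta>))),
      nrm = opnorm H \<rparr>"

definition ell2 :: "(nat \<Rightarrow> complex) hilb" where
  "ell2 =
    \<lparr> vcar = {x. summable (\<lambda>n. (cmod (x n))\<^sup>2)},
      vadd = (\<lambda>x y n. x n + y n),
      vzero = (\<lambda>n. 0),
      vscale = (\<lambda>c x n. c * x n),
      hinner = (\<lambda>x y. \<Sum>n. x n * cnj (y n)) \<rparr>"

abbreviation compacts :: "((nat \<Rightarrow> complex) \<Rightarrow> (nat \<Rightarrow> complex)) cstar" where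
  "compacts \<equiv> compact_operators ell2"

text \<open>
  The algebraic tensor product, as the quotient of the free complex vector space on \<open>A \<times> B\<close>
  (finitely supported functions) by the bilinearity relations.
\<close>

definition free_space ::
  "('a, 'm) staralg_scheme \<Rightarrow> ('b, 'k) staralg_scheme \<Rightarrow> ('a \<times> 'b \<Rightarrow> complex) set" where
  "free_space A B = {f. finite {z. f z \<noteq> 0} \<and> {z. f z \<noteq> 0} \<subseteq> vcar A \<times> vcar B}"

definition point_mass :: "'z \<Rightarrow> 'z \<Rightarrow> complex" where
  "point_mass z = (\<lambda>w. if w = z then 1 else 0)"

inductive_set bilinear_relations ::
  "('a, 'm) staralg_scheme \<Rightarrow> ('b, 'k) staralg_scheme \<Rightarrow> ('a \<times> 'b \<Rightarrow> complex) set"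
  for A B where
  add_left: "\<lbrakk>a \<in> vcar A; a' \<in> vcar A; b \<in> vcar B\<rbrakk> \<Longrightarrow>
     (\<lambda>z. point_mass (vadd A a a', b) z - point_mass (a, b) z - point_mass (a', b) z)
       \<in> bilinear_relations A B"
| add_right: "\<lbrakk>a \<in> vcar A; b \<in> vcar B; b' \<in> vcar B\<rbrakk> \<Longrightarrow>
     (\<lambda>z. point_mass (a, vadd B b b') z - point_mass (a, b) z - point_mass (a, b') z)
       \<in> bilinear_relations A B"
| scale_left: "\<lbrakk>a \<in> vcar A; b \<in> vcar B\<rbrakk> \<Longrightarrow>
     (\<lambda>z. point_mass (vscale A c a, b) z - c * point_mass (a, b) z) \<in> bilinear_relations A B"
| scale_right: "\<lbrakk>a \<in> vcar A; b \<in> vcar B\<rbrakk> \<Longrightarrow>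
     (\<lambda>z. point_mass (a, vscale B c b) z - c * point_mass (a, b) z) \<in> bilinear_relations A B"
| zero: "(\<lambda>z. 0) \<in> bilinear_relations A B"
| plus: "\<lbrakk>f \<in> bilinear_relations A B; g \<in> bilinear_relations A B\<rbrakk> \<Longrightarrow>
     (\<lambda>z. f z + g z) \<in> bilinear_relations A B"
| scale: "f \<in> bilinear_relations A B \<Longrightarrow> (\<lambda>z. c * f z) \<in> bilinear_relations A B"

definition tensor_rel :: "('a, 'm) staralg_scheme \<Rightarrow> ('b, 'k) staralg_scheme \<Rightarrow>
    (('a \<times> 'b \<Rightarrow> complex) \<times> ('a \<times> 'b \<Rightarrow> complex)) set" where
  "tensor_rel A B = {(f, g). f \<in> free_space A B \<and> g \<in> free_space A B \<and>
     (\<lambda>z. f z - g z) \<in> bilinear_relations A B}"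

text \<open>
  On the free space, the product and involution extend \<open>(a, b) (a', b') = (a a', b b')\<close> and
  \<open>(a, b)* = (a*, b*)\<close> bilinearly and antilinearly.
\<close>

definition algebraic_tensor :: "('a, 'm) staralg_scheme \<Rightarrow> ('b, 'k) staralg_scheme \<Rightarrow>
    ('a \<times> 'b \<Rightarrow> complex) set staralg" where
  "algebraic_tensor A B = (let R = tensor_rel A B in
    \<lparr> vcar = free_space A B // R,
      vadd = (\<lambda>X Y. \<Union>f\<in>X. \<Union>g\<in>Y. R `` {\<lambda>z. f z + g z}),
      vzero = R `` {\<lambda>z. 0},
      vscale = (\<lambda>c X. \<Union>f\<in>X. R `` {\<lambda>z. c * f z}),
      atimes = (\<lambda>X Y. \<Union>f\<in>X. \<Union>g\<in>Y. R `` {\<lambda>z.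
         \<Sum>(u, v) | f u \<noteq> 0 \<and> g v \<noteq> 0 \<and> (atimes A (fst u) (fst v), atimes B (snd u) (snd v)) = z.
           f u * g v}),
      astar = (\<lambda>X. \<Union>f\<in>X. R `` {\<lambda>z.
         \<Sum>u | f u \<noteq> 0 \<and> (astar A (fst u), astar B (snd u)) = z. cnj (f u)}) \<rparr>)"

text \<open>
  The maximal C*-tensor product. It is only used with \<open>B\<close> the compact operators, which are nuclear,
  so that it coincides with every other C*-tensor product.
\<close>

definition cstar_tensor :: "('a, 'm) staralg_scheme \<Rightarrow> ('b, 'k) staralg_scheme \<Rightarrow>
    (nat \<Rightarrow> ('a \<times> 'b \<Rightarrow> complex) set) set cstar" where
  "cstar_tensor A B = enveloping_cstar (algebraic_tensor A B)"


section \<open>Local homeomorphisms and the Dixmier--Douady invariant\<close>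

definition local_homeomorphism :: "'y topology \<Rightarrow> 'x topology \<Rightarrow> ('y \<Rightarrow> 'x) \<Rightarrow> bool" where
  "local_homeomorphism Y X \<psi> \<longleftrightarrow> continuous_map Y X \<psi> \<and>
     (\<forall>y\<in>topspace Y. \<exists>V. openin Y V \<and> y \<in> V \<and> openin X (\<psi> ` V) \<and>
        homeomorphic_map (subtopology Y V) (subtopology X (\<psi> ` V)) \<psi>)"

definition surjective_local_homeomorphism ::
  "'y topology \<Rightarrow> 'x topology \<Rightarrow> ('y \<Rightarrow> 'x) \<Rightarrow> bool" where
  "surjective_local_homeomorphism Y X \<psi> \<longleftrightarrow>
     local_homeomorphism Y X \<psi> \<and> \<psi> ` topspace Y = topspace X"

text \<open>
  A second countable Hausdorff space has at most continuum many points, so spaces \<open>Y\<close> with points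
  in \<open>nat \<Rightarrow> real\<close> suffice.
\<close>

definition trivial_Dixmier_Douady :: "('a, 'm) cstar_scheme \<Rightarrow> bool" where
  "trivial_Dixmier_Douady A \<longleftrightarrow> Fell_algebra A \<and> separable A \<and>
     (\<exists>(Y :: (nat \<Rightarrow> real) topology) \<psi>.
        second_countable Y \<and> locally_compact_space Y \<and> Hausdorff_space Y \<and>
        surjective_local_homeomorphism Y (spectrum A) \<psi> \<and>
        cstar_iso (cstar_tensor A compacts)
          (cstar_tensor (groupoid_cstar (equivalence_groupoid Y \<psi>)) compacts))"


section \<open>Smooth manifolds, possibly non-Hausdorff\<close>

text \<open>\<open>C_k k n V f\<close>: the real function \<open>f\<close> is \<open>k\<close> times continuously differentiable on the open
  subset \<open>V\<close> of \<open>Euclidean_space n\<close>, in terms of iterated partial derivatives.\<close>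

primrec C_k :: "nat \<Rightarrow> nat \<Rightarrow> (nat \<Rightarrow> real) set \<Rightarrow> ((nat \<Rightarrow> real) \<Rightarrow> real) \<Rightarrow> bool" where
  "C_k 0 n V f = continuous_map (subtopology (Euclidean_space n) V) euclideanreal f"
| "C_k (Suc k) n V f = (continuous_map (subtopology (Euclidean_space n) V) euclideanreal f \<and>
     (\<forall>i<n. \<exists>g. C_k k n V g \<and>
        (\<forall>x\<in>V. ((\<lambda>t. f (x(i := t))) has_real_derivative g x) (at (x i)))))"

definition smooth_map :: "nat \<Rightarrow> (nat \<Rightarrow> real) set \<Rightarrow> ((nat \<Rightarrow> real) \<Rightarrow> (nat \<Rightarrow> real)) \<Rightarrow> bool" where
  "smooth_map n V F \<longleftrightarrow> (\<forall>k. \<forall>j<n. C_k k n V (\<lambda>x. F x j))"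

definition chart :: "nat \<Rightarrow> 'x topology \<Rightarrow> 'x set \<Rightarrow> ('x \<Rightarrow> nat \<Rightarrow> real) \<Rightarrow> bool" where
  "chart n X U \<phi> \<longleftrightarrow> openin X U \<and> openin (Euclidean_space n) (\<phi> ` U) \<and>
     homeomorphic_map (subtopology X U) (subtopology (Euclidean_space n) (\<phi> ` U)) \<phi>"

definition smooth_atlas ::
  "nat \<Rightarrow> 'x topology \<Rightarrow> ('x set \<times> ('x \<Rightarrow> nat \<Rightarrow> real)) set \<Rightarrow> bool" where
  "smooth_atlas n X \<A> \<longleftrightarrow> (\<forall>(U, \<phi>)\<in>\<A>. chart n X U \<phi>) \<and> (\<Union>(U, \<phi>)\<in>\<A>. U) = topspace X \<and>
     (\<forall>(U, \<phi>)\<in>\<A>. \<forall>(U', \<phi>')\<in>\<A>. smooth_map n (\<phi> ` (U \<inter> U')) (\<phi>' \<circ> inv_into U \<phi>))"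

definition smooth_manifold :: "'x topology \<Rightarrow> bool" where
  "smooth_manifold X \<longleftrightarrow> second_countable X \<and> Hausdorff_space X \<and> (\<exists>n \<A>. smooth_atlas n X \<A>)"

definition smooth_nonHausdorff_manifold :: "'x topology \<Rightarrow> bool" where
  "smooth_nonHausdorff_manifold X \<longleftrightarrow>
     second_countable X \<and> \<not> Hausdorff_space X \<and> (\<exists>n \<A>. smooth_atlas n X \<A>)"


section \<open>K-theory\<close>

text \<open>A matrix is a function \<open>nat \<Rightarrow> nat \<Rightarrow> 'a\<close> that vanishes outside its index range.\<close>

definition matrices :: "('a, 'm) staralg_scheme \<Rightarrow> nat \<Rightarrow> nat \<Rightarrow> (nat \<Rightarrow> nat \<Rightarrow> 'a) set" where
  "matrices B m n = {a. \<forall>i j. (if i < m \<and> j < n then a i j \<in> vcar B else a i j = vzero B)}"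

definition mat_times :: "('a, 'm) staralg_scheme \<Rightarrow> nat \<Rightarrow>
    (nat \<Rightarrow> nat \<Rightarrow> 'a) \<Rightarrow> (nat \<Rightarrow> nat \<Rightarrow> 'a) \<Rightarrow> (nat \<Rightarrow> nat \<Rightarrow> 'a)" where
  "mat_times B k a b = (\<lambda>i j. vsum B (\<lambda>l. atimes B (a i l) (b l j)) k)"

definition mat_star :: "('a, 'm) staralg_scheme \<Rightarrow> (nat \<Rightarrow> nat \<Rightarrow> 'a) \<Rightarrow> (nat \<Rightarrow> nat \<Rightarrow> 'a)" where
  "mat_star B a = (\<lambda>i j. astar B (a j i))"

definition alg_unit :: "('a, 'm) staralg_scheme \<Rightarrow> 'a" where
  "alg_unit B = (THE e. e \<in> vcar B \<and> (\<forall>x\<in>vcar B. atimes B e x = x \<and> atimes B x e = x))"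

definition mat_unit :: "('a, 'm) staralg_scheme \<Rightarrow> nat \<Rightarrow> (nat \<Rightarrow> nat \<Rightarrow> 'a)" where
  "mat_unit B n = (\<lambda>i j. if i = j \<and> i < n then alg_unit B else vzero B)"

text \<open>Square matrices of all sizes are pairs of a size and a matrix; \<open>dsum\<close> is the block sum.\<close>

type_synonym 'a sqmat = "nat \<times> (nat \<Rightarrow> nat \<Rightarrow> 'a)"

definition dsum :: "('a, 'm) staralg_scheme \<Rightarrow> 'a sqmat \<Rightarrow> 'a sqmat \<Rightarrow> 'a sqmat" where
  "dsum B = (\<lambda>(m, a) (n, b). (m + n, \<lambda>i j.
     if i < m \<and> j < m then a i j
     else if m \<le> i \<and> m \<le> j then b (i - m) (j - m) else vzero B))"

definition projections :: "('a, 'm) staralg_scheme \<Rightarrow> 'a sqmat set" where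
  "projections B = {(n, p). p \<in> matrices B n n \<and> mat_times B n p p = p \<and> mat_star B p = p}"

definition MvN_equivalent :: "('a, 'm) staralg_scheme \<Rightarrow> 'a sqmat \<Rightarrow> 'a sqmat \<Rightarrow> bool" where
  "MvN_equivalent B = (\<lambda>(n, p) (m, q). \<exists>v\<in>matrices B m n.
     mat_times B m (mat_star B v) v = p \<and> mat_times B n v (mat_star B v) = q)"

text \<open>
  For unital \<open>B\<close>, \<open>K0_unital B\<close> is the Grothendieck group of the semigroup of Murray--von Neumann
  classes of projections over \<open>B\<close>: the class of \<open>(p, q)\<close> is the formal difference \<open>[p] - [q]\<close>.
\<close>

definition K0_rel :: "('a, 'm) staralg_scheme \<Rightarrow>
    (('a sqmat \<times> 'a sqmat) \<times> ('a sqmat \<times> 'a sqmat)) set" where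
  "K0_rel B = {((p, q), (p', q')). p \<in> projections B \<and> q \<in> projections B \<and>
     p' \<in> projections B \<and> q' \<in> projections B \<and>
     (\<exists>r\<in>projections B. MvN_equivalent B (dsum B (dsum B p q') r) (dsum B (dsum B p' q) r))}"

definition K0_unital :: "('a, 'm) staralg_scheme \<Rightarrow> ('a sqmat \<times> 'a sqmat) set monoid" where
  "K0_unital B =
    \<lparr> carrier = (projections B \<times> projections B) // K0_rel B,
      monoid.mult = (\<lambda>X Y. \<Union>(p, q)\<in>X. \<Union>(p', q')\<in>Y. K0_rel B `` {(dsum B p p', dsum B q q')}),
      one = K0_rel B `` {((0, \<lambda>i j. vzero B), (0, \<lambda>i j. vzero B))} \<rparr>"

definition K0_map :: "('b, 'k) staralg_scheme \<Rightarrow> ('a \<Rightarrow> 'b) \<Rightarrow>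
    ('a sqmat \<times> 'a sqmat) set \<Rightarrow> ('b sqmat \<times> 'b sqmat) set" where
  "K0_map C \<phi> X = (\<Union>((n, p), (m, q))\<in>X.
     K0_rel C `` {((n, \<lambda>i j. \<phi> (p i j)), (m, \<lambda>i j. \<phi> (q i j)))})"

definition complex_alg :: "complex staralg" where
  "complex_alg = \<lparr> vcar = UNIV, vadd = (+), vzero = 0, vscale = (*), atimes = (*), astar = cnj \<rparr>"

text \<open>
  The unitization \<open>A \<oplus> \<complex>\<close>, where a unit is adjoined even if \<open>A\<close> already has one. The maximum with
  \<open>|\<lambda>|\<close> in the norm matters only for unital \<open>A\<close>, where left multiplication on \<open>A\<close> is not faithful.
\<close>

definition unitization :: "('a, 'm) cstar_scheme \<Rightarrow> ('a \<times> complex) cstar" where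
  "unitization A =
    \<lparr> vcar = vcar A \<times> UNIV,
      vadd = (\<lambda>(a, l) (b, m). (vadd A a b, l + m)),
      vzero = (vzero A, 0),
      vscale = (\<lambda>c (a, l). (vscale A c a, c * l)),
      atimes = (\<lambda>(a, l) (b, m).
        (vadd A (atimes A a b) (vadd A (vscale A l b) (vscale A m a)), l * m)),
      astar = (\<lambda>(a, l). (astar A a, cnj l)),
      nrm = (\<lambda>(a, l). max (cmod l)
        (Sup {nrm A (vadd A (atimes A a b) (vscale A l b)) | b. b \<in> vcar A \<and> nrm A b \<le> 1})) \<rparr>"

definition K0 :: "('a, 'm) cstar_scheme \<Rightarrow>
    (('a \<times> complex) sqmat \<times> ('a \<times> complex) sqmat) set monoid" where
  "K0 A = (K0_unital (unitization A))
     \<lparr> carrier := kernel (K0_unital (unitization A)) (K0_unital complex_alg)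
                    (K0_map complex_alg snd) \<rparr>"

definition unitaries :: "('a, 'm) staralg_scheme \<Rightarrow> nat \<Rightarrow> (nat \<Rightarrow> nat \<Rightarrow> 'a) set" where
  "unitaries B n = {u \<in> matrices B n n.
     mat_times B n (mat_star B u) u = mat_unit B n \<and> mat_times B n u (mat_star B u) = mat_unit B n}"

text \<open>Paths in the unitary group; entrywise norm convergence is norm convergence in \<open>M\<^sub>n(B)\<close>.\<close>

definition unitary_homotopic ::
  "('a, 'm) cstar_scheme \<Rightarrow> nat \<Rightarrow> (nat \<Rightarrow> nat \<Rightarrow> 'a) \<Rightarrow> (nat \<Rightarrow> nat \<Rightarrow> 'a) \<Rightarrow> bool" where
  "unitary_homotopic B n u v \<longleftrightarrow> (\<exists>w :: real \<Rightarrow> nat \<Rightarrow> nat \<Rightarrow> 'a.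
     (\<forall>t\<in>{0..1}. w t \<in> unitaries B n) \<and> w 0 = u \<and> w 1 = v \<and>
     (\<forall>t\<in>{0..1}. \<forall>i<n. \<forall>j<n.
        ((\<lambda>s. nrm B (vdiff B (w s i j) (w t i j))) \<longlongrightarrow> 0) (at t within {0..1})))"

text \<open>Unitaries of different sizes are compared after stabilising by identity blocks.\<close>

definition K1_rel :: "('a, 'm) cstar_scheme \<Rightarrow> ('a sqmat \<times> 'a sqmat) set" where
  "K1_rel B = {((n, u), (m, v)). u \<in> unitaries B n \<and> v \<in> unitaries B m \<and>
     (\<exists>k\<ge>max n m. unitary_homotopic B k
        (snd (dsum B (n, u) (k - n, mat_unit B (k - n))))
        (snd (dsum B (m, v) (k - m, mat_unit B (k - m)))))}"

definition K1 :: "('a, 'm) cstar_scheme \<Rightarrow> ('a \<times> complex) sqmat set monoid" where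
  "K1 A = (let B = unitization A in
    \<lparr> carrier = {(n, u). u \<in> unitaries B n} // K1_rel B,
      monoid.mult = (\<lambda>X Y. \<Union>x\<in>X. \<Union>y\<in>Y. K1_rel B `` {dsum B x y}),
      one = K1_rel B `` {(0, \<lambda>i j. vzero B)} \<rparr>)"

definition K_theory :: "('a, 'm) cstar_scheme \<Rightarrow>
    ((('a \<times> complex) sqmat \<times> ('a \<times> complex) sqmat) set \<times> ('a \<times> complex) sqmat set) monoid" where
  "K_theory A = K0 A \<times>\<times> K1 A"

definition finitely_generated :: "('g, 'm) monoid_scheme \<Rightarrow> bool" where
  "finitely_generated G \<longleftrightarrow> (\<exists>S\<subseteq>carrier G. finite S \<and> generate G S = carrier G)"

text \<open>
  The type of the elements of the algebra in the main statement: functions on \<open>Y \<times> Y\<close> for spaces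
  \<open>Y\<close> with points in \<open>nat \<Rightarrow> real\<close>. It has more than continuum many elements,
  so every separable C*-algebra has an isomorphic copy carried by it.
\<close>

type_synonym kernel_function = "(nat \<Rightarrow> real) \<times> (nat \<Rightarrow> real) \<Rightarrow> complex"

end

(* Two copies of the unit circle T are glued along the complement of the branch set
   S = {1} \<union> {exp(i / (n + 1))}, which accumulates at 1. The quotient is a compact smooth
   non-Hausdorff 1-manifold with the two circles as a local homeomorphic cover, and the
   C*-algebra of the corresponding groupoid consists of the continuous functions T \<rightarrow> M_2(\<complex>)
   whose values on S are diagonal. Contractivity of all representations comes from an explicit
   square root in that algebra, so the convolution algebra and its completion have the same
   stabilization. Each isolated point of S gives a character of the algebra, hence a homomorphism
   K_0 \<rightarrow> \<complex>. A projection whose range turns from one sheet at the m-th isolated point to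
   the other sheet at the rest of S takes the values \<delta>_{mn} under these homomorphisms, so K_0 has
   infinite rank. *)

theory Submission
  imports Defs "HOL-Library.Function_Algebras"
begin

text \<open>Infinitely many isolated branch points on a compact circle must accumulate. This does no
  harm: gluing by the identity along the open complement of a closed set always keeps the cover a
  local homeomorphism and the coordinate changes translations of the angle. The obstacle is that the
  groupoid C*-algebra consists of classes of Cauchy sequences, in another type than the algebra to
  be exhibited, and that its seminorm is a supremum over all representations. The algebra is
  therefore realised by concrete matrix functions, and the convolution algebra is recognised in it
  as the dense set of functions that are diagonal near S. Bounding the seminorm from above requires
  a witness for the positivity of s^2 - f* f inside this dense set; the closed formula for the
  square root of a two-by-two matrix is continuous and keeps vanishing off-diagonal entries zero, so
  it does not leave the set. Functoriality of the tensor product then gives the stabilised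
  statement. The bump projections belong to the algebra because their lines are coordinate lines at
  every point of S and tilt only in between. One factor of infinite rank settles K_*, so only K_0 is
  examined.\<close>

section \<open>Arithmetic in complex vector spaces\<close>

context complex_vs
begin

lemma add_zero: "x \<in> vcar V \<Longrightarrow> vadd V x (vzero V) = x"
  by (metis add_comm zero_add zero_closed)

lemma add_left_cancel:
  assumes "x \<in> vcar V" "y \<in> vcar V" "z \<in> vcar V" "vadd V x y = vadd V x z"
  shows "y = z"
proof -
  obtain n where n: "n \<in> vcar V" "vadd V x n = vzero V" using neg_ex assms(1) by blast
  then have nx: "vadd V n x = vzero V" using add_comm assms(1) by metis
  have "y = vadd V (vadd V n x) y" using nx assms zero_add by simp
  also have "\<dots> = vadd V (vadd V n x) z" using add_assoc n assms by metis
  finally show ?thesis using nx assms zero_add by simp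
qed

lemma scale_zero_left:
  assumes "x \<in> vcar V" shows "vscale V 0 x = vzero V"
proof -
  have "vadd V (vscale V 0 x) (vscale V 0 x) = vadd V (vscale V 0 x) (vzero V)"
    using add_scale[OF assms, of 0 0] add_zero scale_closed[OF assms] by simp
  then show ?thesis using add_left_cancel scale_closed[OF assms] zero_closed by metis
qed

lemma scale_zero: "vscale V c (vzero V) = vzero V"
  by (metis mult_zero_right scale_scale scale_zero_left zero_closed)

lemma diff_closed: "\<lbrakk>x \<in> vcar V; y \<in> vcar V\<rbrakk> \<Longrightarrow> vdiff V x y \<in> vcar V"
  by (simp add: vdiff_def add_closed scale_closed)

lemma add_neg: "x \<in> vcar V \<Longrightarrow> vadd V x (vscale V (-1) x) = vzero V"
  using add_scale[of x 1 "-1"] by (simp add: scale_one scale_zero_left)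

lemma diff_self: "x \<in> vcar V \<Longrightarrow> vdiff V x x = vzero V"
  by (simp add: vdiff_def add_neg)

lemma diff_add_cancel: "\<lbrakk>x \<in> vcar V; y \<in> vcar V\<rbrakk> \<Longrightarrow> vadd V (vdiff V x y) y = x"
  unfolding vdiff_def
  by (metis add_assoc add_comm add_neg add_zero scale_closed)

lemma diff_eq_zero: "\<lbrakk>x \<in> vcar V; y \<in> vcar V\<rbrakk> \<Longrightarrow> vdiff V x y = vzero V \<longleftrightarrow> x = y"
  by (metis diff_add_cancel diff_self zero_add)

lemma diff_zero: "x \<in> vcar V \<Longrightarrow> vdiff V x (vzero V) = x"
  by (simp add: vdiff_def scale_zero add_zero)

lemma scale_diff: "\<lbrakk>x \<in> vcar V; y \<in> vcar V\<rbrakk>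
    \<Longrightarrow> vscale V c (vdiff V x y) = vdiff V (vscale V c x) (vscale V c y)"
  by (simp add: vdiff_def scale_add scale_closed scale_scale mult.commute)

lemma add_swap: "\<lbrakk>a \<in> vcar V; b \<in> vcar V; c \<in> vcar V; d \<in> vcar V\<rbrakk>
    \<Longrightarrow> vadd V (vadd V a b) (vadd V c d) = vadd V (vadd V a c) (vadd V b d)"
  by (metis add_assoc add_closed add_comm)

lemma diff_add_add: "\<lbrakk>a \<in> vcar V; b \<in> vcar V; c \<in> vcar V; d \<in> vcar V\<rbrakk>
    \<Longrightarrow> vdiff V (vadd V a b) (vadd V c d) = vadd V (vdiff V a c) (vdiff V b d)"
  by (simp add: vdiff_def scale_add scale_closed add_swap)

lemma diff_triangle: "\<lbrakk>a \<in> vcar V; b \<in> vcar V; c \<in> vcar V\<rbrakk>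
    \<Longrightarrow> vdiff V a c = vadd V (vdiff V a b) (vdiff V b c)"
  unfolding vdiff_def
  by (metis add_assoc add_closed add_comm add_neg add_zero scale_closed)

lemma subspace_complex_vs:
  assumes "vsubspace V W" shows "complex_vs (V\<lparr>vcar := W\<rparr>)"
proof -
  have W: "\<And>x. x \<in> W \<Longrightarrow> x \<in> vcar V" "\<And>x y. x \<in> W \<Longrightarrow> y \<in> W \<Longrightarrow> vadd V x y \<in> W"
    "\<And>c x. x \<in> W \<Longrightarrow> vscale V c x \<in> W" "vzero V \<in> W"
    using assms unfolding vsubspace_def by auto
  show ?thesis
    by unfold_locales
      (auto simp: W add_assoc scale_add add_scale scale_scale scale_one zero_add
         intro!: add_comm bexI[of _ "vscale V (-1) _"] add_neg W)
qed

end

section \<open>Hilbert space geometry\<close>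

context hilbert_space
begin

lemma inner_add_right: "\<lbrakk>x \<in> vcar H; y \<in> vcar H; z \<in> vcar H\<rbrakk>
    \<Longrightarrow> hinner H x (vadd H y z) = hinner H x y + hinner H x z"
  by (metis add_closed complex_cnj_add inner_add inner_cnj)

lemma inner_scale_right: "\<lbrakk>x \<in> vcar H; y \<in> vcar H\<rbrakk>
    \<Longrightarrow> hinner H x (vscale H c y) = cnj c * hinner H x y"
  by (metis complex_cnj_mult inner_cnj inner_scale scale_closed)

lemma inner_zero: "x \<in> vcar H \<Longrightarrow> hinner H (vzero H) x = 0"
    "x \<in> vcar H \<Longrightarrow> hinner H x (vzero H) = 0"
  using inner_scale[of x x 0] inner_scale_right[of x x 0] by (auto simp: scale_zero_left)

lemma inner_diff: "\<lbrakk>x \<in> vcar H; y \<in> vcar H; z \<in> vcar H\<rbrakk>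
    \<Longrightarrow> hinner H (vdiff H x y) z = hinner H x z - hinner H y z"
  "\<lbrakk>x \<in> vcar H; y \<in> vcar H; z \<in> vcar H\<rbrakk>
    \<Longrightarrow> hinner H z (vdiff H x y) = hinner H z x - hinner H z y"
  by (simp_all add: vdiff_def inner_add inner_add_right inner_scale inner_scale_right scale_closed)

lemma inner_self: 
  assumes "x \<in> vcar H" shows "hinner H x x = of_real ((hnorm H x)\<^sup>2)"
proof -
  have "Im (hinner H x x) = 0" using inner_cnj[OF assms assms] by (metis complex_cnj_cancel_iff cnj.simps(2) equal_neg_zero)
  then show ?thesis using inner_nonneg[OF assms] by (simp add: hnorm_def complex_eq_iff)
qed

lemma hnorm_nonneg: "x \<in> vcar H \<Longrightarrow> 0 \<le> hnorm H x"
  by (simp add: hnorm_def inner_nonneg)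

lemma hnorm_eq_zero: "x \<in> vcar H \<Longrightarrow> hnorm H x = 0 \<longleftrightarrow> x = vzero H"
  by (metis inner_eq_zero inner_self inner_zero(1) of_real_eq_0_iff zero_eq_power2)

lemma hnorm_zero: "hnorm H (vzero H) = 0"
  using hnorm_eq_zero zero_closed by blast

lemma hnorm_scale: 
  assumes "x \<in> vcar H" shows "hnorm H (vscale H c x) = cmod c * hnorm H x"
proof -
  have "hinner H (vscale H c x) (vscale H c x) = c * cnj c * hinner H x x"
    using assms by (simp add: inner_scale inner_scale_right scale_closed)
  also have "\<dots> = of_real ((cmod c * hnorm H x)\<^sup>2)"
    using assms by (simp add: inner_self power_mult_distrib flip: complex_norm_square)
  finally have "hinner H (vscale H c x) (vscale H c x) = of_real ((cmod c * hnorm H x)\<^sup>2)" .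
  then show ?thesis using hnorm_nonneg[OF assms] by (simp add: hnorm_def real_sqrt_mult)
qed

lemma Cauchy_Schwarz:
  assumes x: "x \<in> vcar H" and y: "y \<in> vcar H"
  shows "cmod (hinner H x y) \<le> hnorm H x * hnorm H y"
proof (cases "y = vzero H")
  case True then show ?thesis using x by (simp add: inner_zero hnorm_zero)
next
  case False
  then have n: "hnorm H y > 0" using hnorm_eq_zero hnorm_nonneg y by (metis less_eq_real_def)
  \<comment> \<open>\<open>c\<close> is the coefficient of the orthogonal projection of
    \<open>x\<close> to the line of \<open>y\<close>; the squared norm of the remainder
    \<open>?z\<close> is the defect in the inequality.\<close>
  define c where "c = hinner H x y / of_real ((hnorm H y)\<^sup>2)"
  let ?z = "vdiff H x (vscale H c y)"
  have cy: "vscale H c y \<in> vcar H" using y scale_closed by blast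
  have "hinner H ?z ?z = hinner H x x - cnj c * hinner H x y - c * hinner H y x + c * cnj c * hinner H y y"
    using x y cy by (simp add: inner_diff diff_closed inner_scale inner_scale_right algebra_simps)
  also have "\<dots> = of_real ((hnorm H x)\<^sup>2 - (cmod (hinner H x y))\<^sup>2 / (hnorm H y)\<^sup>2)"
  proof -
    let ?h = "hinner H x y" and ?N = "complex_of_real ((hnorm H y)\<^sup>2)"
    have N: "?N \<noteq> 0" "cnj ?N = ?N" using n by auto
    have c: "c = ?h / ?N" "cnj c = cnj ?h / ?N" unfolding c_def by auto
    have "hinner H x x - cnj c * ?h - c * cnj ?h + c * cnj c * ?N = hinner H x x - (?h * cnj ?h) / ?N"
    proof -
      have "X - k / N * h - h / N * k + h / N * (k / N) * N = X - (h * k) / N"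
        if "N \<noteq> 0" for X h k N :: complex using that by (simp add: field_simps)
      from this[OF N(1)] show ?thesis unfolding c(2) unfolding c(1) .
    qed
    moreover have "?h * cnj ?h = of_real ((cmod ?h)\<^sup>2)" by (simp only: complex_norm_square)
    ultimately show ?thesis by (simp add: inner_self x y inner_cnj[OF x y])
  qed
  finally have "0 \<le> (hnorm H x)\<^sup>2 - (cmod (hinner H x y))\<^sup>2 / (hnorm H y)\<^sup>2"
    using inner_nonneg[of ?z] diff_closed[OF x cy] by simp
  then have "(cmod (hinner H x y))\<^sup>2 \<le> (hnorm H x * hnorm H y)\<^sup>2"
    using n by (simp add: field_simps power_mult_distrib)
  then show ?thesis using hnorm_nonneg x y by (meson abs_le_square_iff mult_nonneg_nonneg power2_le_imp_le)
qed

lemma hnorm_triangle: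
  assumes x: "x \<in> vcar H" and y: "y \<in> vcar H"
  shows "hnorm H (vadd H x y) \<le> hnorm H x + hnorm H y"
proof -
  have "of_real ((hnorm H (vadd H x y))\<^sup>2) = hinner H (vadd H x y) (vadd H x y)"
    using inner_self add_closed x y by simp
  also have "\<dots> = hinner H x x + hinner H y y + (hinner H x y + cnj (hinner H x y))"
    using x y by (simp add: inner_add inner_add_right add_closed flip: inner_cnj)
  also have "\<dots> = of_real ((hnorm H x)\<^sup>2 + (hnorm H y)\<^sup>2 + 2 * Re (hinner H x y))"
    by (simp add: inner_self x y complex_add_cnj)
  finally have "(hnorm H (vadd H x y))\<^sup>2 = (hnorm H x)\<^sup>2 + (hnorm H y)\<^sup>2 + 2 * Re (hinner H x y)"
    using of_real_eq_iff by blast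
  also have "\<dots> \<le> (hnorm H x + hnorm H y)\<^sup>2"
    using Cauchy_Schwarz[OF x y] complex_Re_le_cmod[of "hinner H x y"] by (simp add: power2_sum)
  finally show ?thesis using hnorm_nonneg x y by (meson add_nonneg_nonneg power2_le_imp_le)
qed

lemma hnorm_diff_commute: "\<lbrakk>x \<in> vcar H; y \<in> vcar H\<rbrakk> \<Longrightarrow> hnorm H (vdiff H x y) = hnorm H (vdiff H y x)"
proof -
  assume *: "x \<in> vcar H" "y \<in> vcar H"
  have "vdiff H x y = vscale H (-1) (vdiff H y x)"
    using * by (simp add: vdiff_def scale_add scale_closed scale_scale scale_one add_comm)
  then show ?thesis using * by (simp add: hnorm_scale diff_closed)
qed

lemma hnorm_diff_triangle: "\<lbrakk>x \<in> vcar H; y \<in> vcar H; z \<in> vcar H\<rbrakk>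
   \<Longrightarrow> hnorm H (vdiff H x z) \<le> hnorm H (vdiff H x y) + hnorm H (vdiff H y z)"
  using hnorm_triangle[of "vdiff H x y" "vdiff H y z"] diff_triangle[of x y z] diff_closed by simp

lemma tendsto_unique:
  assumes "range x \<subseteq> vcar H" "l \<in> vcar H" "m \<in> vcar H"
    "N_tendsto H (hnorm H) x l" "N_tendsto H (hnorm H) x m"
  shows "l = m"
proof -
  have x: "x n \<in> vcar H" for n using assms by auto
  have "(\<lambda>n. hnorm H (vdiff H (x n) l) + hnorm H (vdiff H (x n) m)) \<longlonglongrightarrow> 0 + 0"
    using assms unfolding N_tendsto_def by (intro tendsto_add) auto
  moreover have "hnorm H (vdiff H l m) \<le> hnorm H (vdiff H (x n) l) + hnorm H (vdiff H (x n) m)" for n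
    using hnorm_diff_triangle[of l "x n" m] x assms hnorm_diff_commute[of l "x n"] by simp
  ultimately have "hnorm H (vdiff H l m) \<le> 0"
    by (intro LIMSEQ_le_const) auto
  then have "hnorm H (vdiff H l m) = 0" using hnorm_nonneg diff_closed assms by (meson order_antisym)
  then show ?thesis using hnorm_eq_zero diff_closed diff_eq_zero assms by metis
qed

lemma tendsto_hadd:
  assumes "range x \<subseteq> vcar H" "range y \<subseteq> vcar H" "l \<in> vcar H" "m \<in> vcar H"
    "N_tendsto H (hnorm H) x l" "N_tendsto H (hnorm H) y m"
  shows "N_tendsto H (hnorm H) (\<lambda>n. vadd H (x n) (y n)) (vadd H l m)"
  unfolding N_tendsto_def
proof (rule tendsto_sandwich[OF _ _ tendsto_const])
  have x: "x n \<in> vcar H" "y n \<in> vcar H" for n using assms by auto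
  show "(\<lambda>n. hnorm H (vdiff H (x n) l) + hnorm H (vdiff H (y n) m)) \<longlonglongrightarrow> 0"
    using assms unfolding N_tendsto_def by (auto intro: tendsto_eq_intros)
  show "\<forall>\<^sub>F n in sequentially. 0 \<le> hnorm H (vdiff H (vadd H (x n) (y n)) (vadd H l m))"
    using x assms by (intro always_eventually allI hnorm_nonneg diff_closed add_closed) auto
  show "\<forall>\<^sub>F n in sequentially. hnorm H (vdiff H (vadd H (x n) (y n)) (vadd H l m))
      \<le> hnorm H (vdiff H (x n) l) + hnorm H (vdiff H (y n) m)"
    using x assms hnorm_triangle[OF diff_closed diff_closed] by (simp add: diff_add_add)
qed

lemma linear_diff:
  assumes "linear_on H H' f" "complex_vs H'" "x \<in> vcar H" "y \<in> vcar H"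
  shows "f (vdiff H x y) = vdiff H' (f x) (f y)"
  using assms by (simp add: linear_on_def vdiff_def scale_closed)

lemma tendsto_bounded_op:
  assumes "bounded_op H T" "range x \<subseteq> vcar H" "l \<in> vcar H" "N_tendsto H (hnorm H) x l"
  shows "N_tendsto H (hnorm H) (\<lambda>n. T (x n)) (T l)"
proof -
  obtain C where C: "\<And>\<xi>. \<xi> \<in> vcar H \<Longrightarrow> hnorm H (T \<xi>) \<le> C * hnorm H \<xi>" and L: "linear_on H H T"
    using assms unfolding bounded_op_def by auto
  have x: "x n \<in> vcar H" for n using assms by auto
  show ?thesis unfolding N_tendsto_def
  proof (rule tendsto_sandwich[OF _ _ tendsto_const])
    show "(\<lambda>n. C * hnorm H (vdiff H (x n) l)) \<longlonglongrightarrow> 0"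
      using assms unfolding N_tendsto_def by (auto intro: tendsto_eq_intros)
    have T: "vdiff H (T (x n)) (T l) = T (vdiff H (x n) l)" for n
      using linear_diff[OF L] complex_vs_axioms x assms by metis
    have cl: "T (vdiff H (x n) l) \<in> vcar H" for n
      using L x assms diff_closed unfolding linear_on_def by blast
    show "\<forall>\<^sub>F n in sequentially. 0 \<le> hnorm H (vdiff H (T (x n)) (T l))"
      using T cl hnorm_nonneg by simp
    show "\<forall>\<^sub>F n in sequentially. hnorm H (vdiff H (T (x n)) (T l)) \<le> C * hnorm H (vdiff H (x n) l)"
      using T C x assms diff_closed by auto
  qed
qed

lemma tendsto_hinner:
  assumes "range x \<subseteq> vcar H" "l \<in> vcar H" "y \<in> vcar H" "N_tendsto H (hnorm H) x l"
  shows "(\<lambda>n. hinner H (x n) y) \<longlonglongrightarrow> hinner H l y"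
proof -
  have x: "x n \<in> vcar H" for n using assms by auto
  have "(\<lambda>n. hinner H (x n) y - hinner H l y) \<longlonglongrightarrow> 0"
  proof (rule Lim_null_comparison)
    show "\<forall>\<^sub>F n in sequentially. norm (hinner H (x n) y - hinner H l y) \<le> hnorm H (vdiff H (x n) l) * hnorm H y"
      using Cauchy_Schwarz x assms diff_closed by (auto simp flip: inner_diff)
    show "(\<lambda>n. hnorm H (vdiff H (x n) l) * hnorm H y) \<longlonglongrightarrow> 0"
      using assms unfolding N_tendsto_def by (auto intro: tendsto_eq_intros)
  qed
  then show ?thesis using LIM_zero_iff by blast
qed

lemma Cauchy_if_tendsto:
  assumes "range x \<subseteq> vcar H" "l \<in> vcar H" "N_tendsto H (hnorm H) x l"
  shows "N_Cauchy H (hnorm H) x"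
  unfolding N_Cauchy_def
proof (intro conjI allI impI assms(1))
  have x: "x n \<in> vcar H" for n using assms by auto
  fix e :: real assume "e > 0"
  then have "\<forall>\<^sub>F n in sequentially. hnorm H (vdiff H (x n) l) < e / 2"
    using assms(3) unfolding N_tendsto_def by (intro order_tendstoD) auto
  then obtain M where M: "\<And>n. n \<ge> M \<Longrightarrow> hnorm H (vdiff H (x n) l) < e / 2"
    unfolding eventually_sequentially by auto
  show "\<exists>M. \<forall>m\<ge>M. \<forall>n\<ge>M. hnorm H (vdiff H (x m) (x n)) < e"
  proof (intro exI allI impI)
    fix m n assume "M \<le> m" "M \<le> n"
    then show "hnorm H (vdiff H (x m) (x n)) < e"
      using hnorm_diff_triangle[of "x m" l "x n"] M[of m] M[of n] hnorm_diff_commute[of l "x n"] x assms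
      by simp
  qed
qed

lemma closed_subspace_hilbert:
  assumes W: "vsubspace H W" and cl: "N_closed H (hnorm H) W"
  shows "hilbert_space (H\<lparr>vcar := W\<rparr>)"
proof -
  have sub: "\<And>x. x \<in> W \<Longrightarrow> x \<in> vcar H" using W unfolding vsubspace_def by auto
  interpret S: complex_vs "H\<lparr>vcar := W\<rparr>" by (rule subspace_complex_vs[OF W])
  have n: "hnorm (H\<lparr>vcar := W\<rparr>) = hnorm H" by (auto simp: hnorm_def)
  have d: "vdiff (H\<lparr>vcar := W\<rparr>) = vdiff H" by (auto simp: vdiff_def fun_eq_iff)
  show ?thesis
  proof unfold_locales
    show "N_complete (H\<lparr>vcar := W\<rparr>) (hnorm (H\<lparr>vcar := W\<rparr>))"
      unfolding N_complete_def
    proof (intro allI impI)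
      fix x assume x: "N_Cauchy (H\<lparr>vcar := W\<rparr>) (hnorm (H\<lparr>vcar := W\<rparr>)) x"
      then have "N_Cauchy H (hnorm H) x" using sub unfolding N_Cauchy_def n d by auto
      then obtain l where l: "l \<in> vcar H" "N_tendsto H (hnorm H) x l"
        using complete unfolding N_complete_def by blast
      moreover have "l \<in> W" using cl x l unfolding N_closed_def N_Cauchy_def by auto
      ultimately show "\<exists>l\<in>vcar (H\<lparr>vcar := W\<rparr>). N_tendsto (H\<lparr>vcar := W\<rparr>) (hnorm (H\<lparr>vcar := W\<rparr>)) x l"
        unfolding N_tendsto_def n d by auto
    qed
  qed (auto simp: sub inner_add inner_scale inner_nonneg inner_eq_zero intro: inner_cnj)
qed

end

section \<open>Transport and restriction of representations\<close>

text \<open>The spectrum and the universal seminorm only see Hilbert spaces carried by sequences in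
  the algebra. An injection \<open>j\<close> on the carrier moves any Hilbert space to such a
  carrier; the operations are conjugated by the inverse of \<open>j\<close>.\<close>

definition transported_hilbert :: "('h \<Rightarrow> 'k) \<Rightarrow> ('h, 'm) hilb_scheme \<Rightarrow> 'k hilb" where
  "transported_hilbert j H = (let g = inv_into (vcar H) j in
    \<lparr> vcar = j ` vcar H,
      vadd = (\<lambda>u v. j (vadd H (g u) (g v))),
      vzero = j (vzero H),
      vscale = (\<lambda>c u. j (vscale H c (g u))),
      hinner = (\<lambda>u v. hinner H (g u) (g v)) \<rparr>)"

definition transported_rep :: "('h \<Rightarrow> 'k) \<Rightarrow> ('h, 'm) hilb_scheme \<Rightarrow> ('a \<Rightarrow> 'h \<Rightarrow> 'h) \<Rightarrow> 'a \<Rightarrow> 'k \<Rightarrow> 'k" where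
  "transported_rep j H \<pi> a u = j (\<pi> a (inv_into (vcar H) j u))"

lemma transported_simps:
  assumes "inj_on j (vcar H)"
  shows "vcar (transported_hilbert j H) = j ` vcar H"
    "\<lbrakk>x \<in> vcar H; y \<in> vcar H\<rbrakk> \<Longrightarrow> vadd (transported_hilbert j H) (j x) (j y) = j (vadd H x y)"
    "vzero (transported_hilbert j H) = j (vzero H)"
    "x \<in> vcar H \<Longrightarrow> vscale (transported_hilbert j H) c (j x) = j (vscale H c x)"
    "\<lbrakk>x \<in> vcar H; y \<in> vcar H\<rbrakk> \<Longrightarrow> hinner (transported_hilbert j H) (j x) (j y) = hinner H x y"
    "x \<in> vcar H \<Longrightarrow> hnorm (transported_hilbert j H) (j x) = hnorm H x"
    "x \<in> vcar H \<Longrightarrow> transported_rep j H \<pi> a (j x) = j (\<pi> a x)"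
  using assms by (auto simp: transported_hilbert_def transported_rep_def Let_def hnorm_def)

lemma hilbert_transported:
  assumes "hilbert_space H" and inj: "inj_on j (vcar H)"
  shows "hilbert_space (transported_hilbert j H)"
proof -
  interpret hilbert_space H by fact
  note s = transported_simps[OF inj]
  interpret J: complex_vs "transported_hilbert j H"
  proof unfold_locales
    fix u assume "u \<in> vcar (transported_hilbert j H)"
    then obtain x where x: "x \<in> vcar H" "u = j x" by (auto simp: s)
    then obtain y where "y \<in> vcar H" "vadd H x y = vzero H" using neg_ex by blast
    then show "\<exists>v\<in>vcar (transported_hilbert j H).
        vadd (transported_hilbert j H) u v = vzero (transported_hilbert j H)"
      using x by (intro bexI[of _ "j y"]) (auto simp: s)
  qed (auto simp: s add_closed zero_closed scale_closed add_assoc zero_add scale_add add_scale scale_scale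
          scale_one intro!: arg_cong[of _ _ j] add_comm)
  show ?thesis
  proof unfold_locales
    show "N_complete (transported_hilbert j H) (hnorm (transported_hilbert j H))"
      unfolding N_complete_def
    proof (intro allI impI)
      fix x assume x: "N_Cauchy (transported_hilbert j H) (hnorm (transported_hilbert j H)) x"
      define y where "y n = inv_into (vcar H) j (x n)" for n
      have y: "y n \<in> vcar H" "x n = j (y n)" for n
        using x unfolding N_Cauchy_def y_def by (auto simp: s image_subset_iff inv_into_into f_inv_into_f)
      have d: "hnorm (transported_hilbert j H) (vdiff (transported_hilbert j H) (j u) (j v)) = hnorm H (vdiff H u v)"
        if "u \<in> vcar H" "v \<in> vcar H" for u v
        using that by (simp add: vdiff_def s scale_closed add_closed)
      have "N_Cauchy H (hnorm H) y"
        using x y(1) unfolding N_Cauchy_def y(2) by (auto simp: d)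
      then obtain l where l: "l \<in> vcar H" "N_tendsto H (hnorm H) y l"
        using complete unfolding N_complete_def by blast
      then show "\<exists>l\<in>vcar (transported_hilbert j H). N_tendsto (transported_hilbert j H)
          (hnorm (transported_hilbert j H)) x l"
        by (intro bexI[of _ "j l"]) (auto simp: N_tendsto_def y d s)
    qed
  qed (auto simp: s add_closed scale_closed inner_add inner_scale inner_nonneg dest: inner_eq_zero intro: inner_cnj)
qed

lemma representationD:
  assumes "representation A H \<pi>"
  shows "hilbert_space H" "a \<in> vcar A \<Longrightarrow> bounded_op H (\<pi> a)"
    "\<lbrakk>a \<in> vcar A; \<xi> \<in> vcar H\<rbrakk> \<Longrightarrow> \<pi> a \<xi> \<in> vcar H"
    "\<lbrakk>a \<in> vcar A; \<xi> \<in> vcar H; \<eta> \<in> vcar H\<rbrakk> \<Longrightarrow> \<pi> a (vadd H \<xi> \<eta>) = vadd H (\<pi> a \<xi>) (\<pi> a \<eta>)"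
    "\<lbrakk>a \<in> vcar A; \<xi> \<in> vcar H\<rbrakk> \<Longrightarrow> \<pi> a (vscale H c \<xi>) = vscale H c (\<pi> a \<xi>)"
    "\<lbrakk>a \<in> vcar A; b \<in> vcar A; \<xi> \<in> vcar H\<rbrakk> \<Longrightarrow> \<pi> (vadd A a b) \<xi> = vadd H (\<pi> a \<xi>) (\<pi> b \<xi>)"
    "\<lbrakk>a \<in> vcar A; b \<in> vcar A; \<xi> \<in> vcar H\<rbrakk> \<Longrightarrow> \<pi> (atimes A a b) \<xi> = \<pi> a (\<pi> b \<xi>)"
    "\<lbrakk>a \<in> vcar A; \<xi> \<in> vcar H\<rbrakk> \<Longrightarrow> \<pi> (vscale A c a) \<xi> = vscale H c (\<pi> a \<xi>)"
    "\<lbrakk>a \<in> vcar A; \<xi> \<in> vcar H; \<eta> \<in> vcar H\<rbrakk> \<Longrightarrow> hinner H (\<pi> (astar A a) \<xi>) \<eta> = hinner H \<xi> (\<pi> a \<eta>)"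
  using assms unfolding representation_def bounded_op_def linear_on_def by auto

lemma representation_transported:
  assumes "representation A H \<pi>" and inj: "inj_on j (vcar H)"
    and star: "\<And>a. a \<in> vcar A \<Longrightarrow> astar A a \<in> vcar A"
  shows "representation A (transported_hilbert j H) (transported_rep j H \<pi>)"
proof -
  note r = representationD[OF assms(1)]
  note s = transported_simps[OF inj]
  have "bounded_op (transported_hilbert j H) (transported_rep j H \<pi> a)" if a: "a \<in> vcar A" for a
  proof -
    obtain C where "\<forall>\<xi>\<in>vcar H. hnorm H (\<pi> a \<xi>) \<le> C * hnorm H \<xi>"
      using r(2)[of a] a unfolding bounded_op_def by blast
    then have "\<forall>\<xi>\<in>vcar H. hnorm (transported_hilbert j H) (transported_rep j H \<pi> a (j \<xi>)) 
        \<le> C * hnorm (transported_hilbert j H) (j \<xi>)"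
      using a by (simp add: s r)
    moreover interpret hilbert_space H by (rule r)
    have "linear_on (transported_hilbert j H) (transported_hilbert j H) (transported_rep j H \<pi> a)"
      using a unfolding linear_on_def by (auto simp: s r add_closed scale_closed)
    ultimately show ?thesis unfolding bounded_op_def by (auto simp: s)
  qed
  then show ?thesis unfolding representation_def
    using hilbert_transported[OF r(1) inj] by (auto simp: s r star)
qed

lemma representation_restrict:
  assumes "representation A H \<pi>" "vsubspace H W" "N_closed H (hnorm H) W"
    and inv: "\<And>a \<xi>. a \<in> vcar A \<Longrightarrow> \<xi> \<in> W \<Longrightarrow> \<pi> a \<xi> \<in> W"
  shows "representation A (H\<lparr>vcar := W\<rparr>) \<pi>"
proof -
  note r = representationD[OF assms(1)]
  have sub: "\<And>x. x \<in> W \<Longrightarrow> x \<in> vcar H" using assms(2) unfolding vsubspace_def by auto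
  interpret hilbert_space H by (rule r)
  have n: "hnorm (H\<lparr>vcar := W\<rparr>) = hnorm H" by (auto simp: hnorm_def)
  have "bounded_op (H\<lparr>vcar := W\<rparr>) (\<pi> a)" if a: "a \<in> vcar A" for a
  proof -
    obtain C where "\<forall>\<xi>\<in>vcar H. hnorm H (\<pi> a \<xi>) \<le> C * hnorm H \<xi>"
      using r(2)[of a] a unfolding bounded_op_def by blast
    then have "\<exists>C. \<forall>\<xi>\<in>W. hnorm H (\<pi> a \<xi>) \<le> C * hnorm H \<xi>" using sub by blast
    then show ?thesis using a unfolding bounded_op_def linear_on_def n by (auto simp: r sub inv)
  qed
  then show ?thesis unfolding representation_def
    using closed_subspace_hilbert[OF assms(2,3)] by (auto simp: r sub)
qed

section \<open>Operator norms\<close>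

context hilbert_space
begin

lemma opnorm_bdd:
  assumes "bounded_op H T"
  shows "bdd_above {hnorm H (T \<xi>) | \<xi>. \<xi> \<in> vcar H \<and> hnorm H \<xi> \<le> 1}"
proof -
  obtain C where C: "\<And>\<xi>. \<xi> \<in> vcar H \<Longrightarrow> hnorm H (T \<xi>) \<le> C * hnorm H \<xi>"
    using assms unfolding bounded_op_def by auto
  \<comment> \<open>On the zero space the constant \<open>C\<close> may be negative, hence
    \<open>max C 0\<close>.\<close>
  have "hnorm H (T \<xi>) \<le> max C 0" if "\<xi> \<in> vcar H" "hnorm H \<xi> \<le> 1" for \<xi>
  proof -
    have "C * hnorm H \<xi> \<le> max C 0 * hnorm H \<xi>" using hnorm_nonneg that by (intro mult_right_mono) auto
    also have "\<dots> \<le> max C 0 * 1" using that by (intro mult_left_mono) auto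
    finally show ?thesis using C[OF that(1)] by simp
  qed
  then show ?thesis by (auto simp: bdd_above_def)
qed

lemma opnorm_nonneg:
  assumes "bounded_op H T" shows "0 \<le> opnorm H T"
proof -
  have "T (vzero H) \<in> vcar H" using assms zero_closed unfolding bounded_op_def linear_on_def by auto
  then have "0 \<le> hnorm H (T (vzero H))" by (rule hnorm_nonneg)
  also have "\<dots> \<le> opnorm H T"
    unfolding opnorm_def using zero_closed hnorm_zero
    by (intro cSup_upper opnorm_bdd[OF assms]) auto
  finally show ?thesis .
qed

lemma opnorm_apply:
  assumes T: "bounded_op H T" and x: "\<xi> \<in> vcar H"
  shows "hnorm H (T \<xi>) \<le> opnorm H T * hnorm H \<xi>"
proof (cases "hnorm H \<xi> = 0")
  case True
  obtain C where C: "\<And>\<xi>. \<xi> \<in> vcar H \<Longrightarrow> hnorm H (T \<xi>) \<le> C * hnorm H \<xi>"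
    using T unfolding bounded_op_def by auto
  then show ?thesis using True x by fastforce
next
  case False
  define r where "r = hnorm H \<xi>"
  have r: "r > 0" using False hnorm_nonneg[OF x] r_def by simp
  let ?u = "vscale H (of_real (1 / r)) \<xi>"
  have u: "?u \<in> vcar H" "hnorm H ?u \<le> 1"
    using x r by (auto simp: scale_closed hnorm_scale r_def norm_divide)
  have "T ?u = vscale H (of_real (1 / r)) (T \<xi>)" "T \<xi> \<in> vcar H"
    using T x unfolding bounded_op_def linear_on_def by auto
  then have "hnorm H (T ?u) = hnorm H (T \<xi>) / r" using r by (simp add: hnorm_scale norm_divide)
  moreover have "hnorm H (T ?u) \<le> opnorm H T"
    unfolding opnorm_def using u by (intro cSup_upper opnorm_bdd[OF T]) auto
  ultimately show ?thesis using r by (simp add: field_simps r_def)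
qed

lemma opnorm_le:
  assumes "\<And>\<xi>. \<xi> \<in> vcar H \<Longrightarrow> hnorm H \<xi> \<le> 1 \<Longrightarrow> hnorm H (T \<xi>) \<le> C"
  shows "opnorm H T \<le> C"
  unfolding opnorm_def using zero_closed hnorm_zero assms by (intro cSup_least) auto

end

section \<open>Isomorphisms of algebras with involution\<close>

text \<open>Closure under the operations is all that is established for the algebraic tensor
  product, and it suffices for transporting representations and completions.\<close>

definition operations_closed :: "('a, 'm) staralg_scheme \<Rightarrow> bool" where
  "operations_closed A \<longleftrightarrow> vzero A \<in> vcar A \<and> (\<forall>x\<in>vcar A. \<forall>y\<in>vcar A. vadd A x y \<in> vcar A) \<and>
     (\<forall>c. \<forall>x\<in>vcar A. vscale A c x \<in> vcar A) \<and>
     (\<forall>x\<in>vcar A. \<forall>y\<in>vcar A. atimes A x y \<in> vcar A) \<and> (\<forall>x\<in>vcar A. astar A x \<in> vcar A)"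

text \<open>The witness form of \<open>cstar_iso\<close>, available for algebras without a norm.
  Preservation of \<open>vzero\<close> is a separate hypothesis in the lemmas below, because it
  follows from linearity only where 0 times a vector is known to be \<open>vzero\<close>.\<close>

definition star_iso ::
  "('a \<Rightarrow> 'b) \<Rightarrow> ('a, 'm) staralg_scheme \<Rightarrow> ('b, 'k) staralg_scheme \<Rightarrow> bool" where
  "star_iso \<phi> A B \<longleftrightarrow> bij_betw \<phi> (vcar A) (vcar B) \<and> linear_on A B \<phi> \<and>
     (\<forall>x\<in>vcar A. \<forall>y\<in>vcar A. \<phi> (atimes A x y) = atimes B (\<phi> x) (\<phi> y)) \<and>
     (\<forall>x\<in>vcar A. \<phi> (astar A x) = astar B (\<phi> x))"

lemma cstar_isoI: "star_iso \<phi> A B \<Longrightarrow> cstar_iso A B"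
  unfolding star_iso_def cstar_iso_def by blast

lemma star_isoD:
  assumes "star_iso \<phi> A B"
  shows "bij_betw \<phi> (vcar A) (vcar B)" "x \<in> vcar A \<Longrightarrow> \<phi> x \<in> vcar B"
    "\<lbrakk>x \<in> vcar A; y \<in> vcar A\<rbrakk> \<Longrightarrow> \<phi> (vadd A x y) = vadd B (\<phi> x) (\<phi> y)"
    "x \<in> vcar A \<Longrightarrow> \<phi> (vscale A c x) = vscale B c (\<phi> x)"
    "\<lbrakk>x \<in> vcar A; y \<in> vcar A\<rbrakk> \<Longrightarrow> \<phi> (atimes A x y) = atimes B (\<phi> x) (\<phi> y)"
    "x \<in> vcar A \<Longrightarrow> \<phi> (astar A x) = astar B (\<phi> x)"
  using assms unfolding star_iso_def linear_on_def bij_betw_def by auto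

lemma operations_closedD:
  assumes "operations_closed A"
  shows "vzero A \<in> vcar A" "\<lbrakk>x \<in> vcar A; y \<in> vcar A\<rbrakk> \<Longrightarrow> vadd A x y \<in> vcar A"
    "x \<in> vcar A \<Longrightarrow> vscale A c x \<in> vcar A"
    "\<lbrakk>x \<in> vcar A; y \<in> vcar A\<rbrakk> \<Longrightarrow> atimes A x y \<in> vcar A"
    "x \<in> vcar A \<Longrightarrow> astar A x \<in> vcar A"
    "\<lbrakk>x \<in> vcar A; y \<in> vcar A\<rbrakk> \<Longrightarrow> vdiff A x y \<in> vcar A"
  using assms unfolding operations_closed_def vdiff_def by auto

lemma star_iso_inverse:
  assumes iso: "star_iso \<phi> A B" and A: "operations_closed A"
  shows "star_iso (inv_into (vcar A) \<phi>) B A"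
proof -
  note i = star_isoD[OF iso] and c = operations_closedD[OF A]
  let ?g = "inv_into (vcar A) \<phi>"
  have g: "?g (\<phi> x) = x" if "x \<in> vcar A" for x
    using that i(1) by (simp add: bij_betw_def)
  have s: "\<exists>x\<in>vcar A. y = \<phi> x" if "y \<in> vcar B" for y
    using that i(1) by (auto simp: bij_betw_def)
  show ?thesis unfolding star_iso_def linear_on_def
  proof (intro conjI ballI allI)
    show "bij_betw ?g (vcar B) (vcar A)" using i(1) by (rule bij_betw_inv_into)
  next
    fix y assume "y \<in> vcar B" then show "?g y \<in> vcar A" using s g by fastforce
  next
    fix y z assume "y \<in> vcar B" "z \<in> vcar B"
    then obtain u v where "u \<in> vcar A" "v \<in> vcar A" "y = \<phi> u" "z = \<phi> v" using s by meson
    then show "?g (vadd B y z) = vadd A (?g y) (?g z)" "?g (atimes B y z) = atimes A (?g y) (?g z)"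
      by (simp_all add: g c i(3,5)[symmetric])
  next
    fix k y assume "y \<in> vcar B"
    then obtain u where "u \<in> vcar A" "y = \<phi> u" using s by meson
    then show "?g (vscale B k y) = vscale A k (?g y)" by (simp add: g c i(4)[symmetric])
  next
    fix y assume "y \<in> vcar B"
    then obtain u where "u \<in> vcar A" "y = \<phi> u" using s by meson
    then show "?g (astar B y) = astar A (?g y)" by (simp add: g c i(6)[symmetric])
  qed
qed

lemma star_iso_operations_closed:
  assumes iso: "star_iso \<phi> A B" and A: "operations_closed A" and z: "\<phi> (vzero A) = vzero B"
  shows "operations_closed B"
proof -
  note i = star_isoD[OF iso] and c = operations_closedD[OF A]
  have s: "vcar B = \<phi> ` vcar A" using i(1) by (auto simp: bij_betw_def)
  show ?thesis unfolding operations_closed_def s using c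
    by (auto simp: s i(3-6)[symmetric] z[symmetric])
qed


section \<open>The universal seminorm and the completion\<close>

text \<open>A vector in an arbitrary representation generates a cyclic subspace whose elements are limits
  of sequences \<open>\<pi> (x n) \<xi>\<close>, so that this subspace is carried by sequences in the algebra.\<close>

lemma cyclic_representation:
  fixes A :: "('a, 'm) staralg_scheme" and H :: "('h, 'k) hilb_scheme"
  assumes rep: "representation A H \<pi>" and A: "operations_closed A" and \<xi>: "\<xi> \<in> vcar H"
  shows "\<exists>(H' :: (nat \<Rightarrow> 'a) hilb) \<pi>'. representation A H' \<pi>' \<and>
     (\<forall>a\<in>vcar A. hnorm H (\<pi> a \<xi>) \<le> opnorm H' (\<pi>' a) * hnorm H \<xi>)"
proof -
  note r = representationD[OF rep] and c = operations_closedD[OF A]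
  interpret hilbert_space H by (rule r)
  \<comment> \<open>Keeping the approximating sequence \<open>x\<close> itself in view is what later
    permits an encoding of the vectors of \<open>W\<close> by sequences in \<open>A\<close>.\<close>
  define approx where "approx \<eta> x \<longleftrightarrow> range x \<subseteq> vcar A \<and> N_tendsto H (hnorm H) (\<lambda>n. \<pi> (x n) \<xi>) \<eta>"
    for \<eta> and x :: "nat \<Rightarrow> 'a"
  define W where "W = {\<eta> \<in> vcar H. \<exists>x. approx \<eta> x}"
  have seq: "range (\<lambda>n. \<pi> (x n) \<xi>) \<subseteq> vcar H" if "range x \<subseteq> vcar A" for x :: "nat \<Rightarrow> 'a"
    using that r(3) \<xi> by blast
  have orbit: "\<pi> a \<xi> \<in> W" if "a \<in> vcar A" for a
    using that r(3) \<xi> unfolding W_def approx_def N_tendsto_def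
    by (auto intro!: exI[of _ "\<lambda>n. a"] simp: diff_self hnorm_zero)
  have zero: "vzero H \<in> W"
  proof -
    have "\<pi> (vscale A 0 (vzero A)) \<xi> = vzero H" using r(8)[OF c(1) \<xi>, of 0] r(3)[OF c(1) \<xi>] by (simp add: scale_zero_left)
    then show ?thesis using orbit[OF c(3)[OF c(1)], of 0] by simp
  qed
  have inv: "\<pi> a \<eta> \<in> W" if a: "a \<in> vcar A" and "\<eta> \<in> W" for a \<eta>
  proof -
    obtain x where x: "\<eta> \<in> vcar H" "range x \<subseteq> vcar A" "N_tendsto H (hnorm H) (\<lambda>n. \<pi> (x n) \<xi>) \<eta>"
      using \<open>\<eta> \<in> W\<close> unfolding W_def approx_def by auto
    have "N_tendsto H (hnorm H) (\<lambda>n. \<pi> a (\<pi> (x n) \<xi>)) (\<pi> a \<eta>)"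
      using tendsto_bounded_op[OF r(2)[OF a] seq[OF x(2)] x(1,3)] .
    moreover have "\<pi> a (\<pi> (x n) \<xi>) = \<pi> (atimes A a (x n)) \<xi>" for n
      using x a \<xi> by (subst r(7)) auto
    ultimately show ?thesis unfolding W_def approx_def
      using x a r(3) c(4) by (auto intro!: exI[of _ "\<lambda>n. atimes A a (x n)"])
  qed
  have sub: "vsubspace H W"
    unfolding vsubspace_def
  proof (intro conjI ballI allI zero)
    show "W \<subseteq> vcar H" by (auto simp: W_def)
  next
    fix \<eta> \<zeta> assume "\<eta> \<in> W" "\<zeta> \<in> W"
    then obtain x y where x: "\<eta> \<in> vcar H" "range x \<subseteq> vcar A" "N_tendsto H (hnorm H) (\<lambda>n. \<pi> (x n) \<xi>) \<eta>"
      and y: "\<zeta> \<in> vcar H" "range y \<subseteq> vcar A" "N_tendsto H (hnorm H) (\<lambda>n. \<pi> (y n) \<xi>) \<zeta>"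
      unfolding W_def approx_def by auto
    have "N_tendsto H (hnorm H) (\<lambda>n. vadd H (\<pi> (x n) \<xi>) (\<pi> (y n) \<xi>)) (vadd H \<eta> \<zeta>)"
      using tendsto_hadd[OF seq[OF x(2)] seq[OF y(2)] x(1) y(1) x(3) y(3)] .
    moreover have "vadd H (\<pi> (x n) \<xi>) (\<pi> (y n) \<xi>) = \<pi> (vadd A (x n) (y n)) \<xi>" for n
      using x y \<xi> by (subst r(6)) auto
    ultimately show "vadd H \<eta> \<zeta> \<in> W" unfolding W_def approx_def
      using x y add_closed c(2) by (auto intro!: exI[of _ "\<lambda>n. vadd A (x n) (y n)"] simp: image_subset_iff)
  next
    fix k \<eta> assume "\<eta> \<in> W"
    then obtain x where x: "\<eta> \<in> vcar H" "range x \<subseteq> vcar A" "N_tendsto H (hnorm H) (\<lambda>n. \<pi> (x n) \<xi>) \<eta>"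
      unfolding W_def approx_def by auto
    have xn: "x n \<in> vcar A" for n using x by auto
    have "hnorm H (vdiff H (vscale H k (\<pi> (x n) \<xi>)) (vscale H k \<eta>)) = cmod k * hnorm H (vdiff H (\<pi> (x n) \<xi>) \<eta>)" for n
      using xn r(3) \<xi> x(1) by (simp add: hnorm_scale diff_closed flip: scale_diff)
    then have "N_tendsto H (hnorm H) (\<lambda>n. vscale H k (\<pi> (x n) \<xi>)) (vscale H k \<eta>)"
      using x(3) unfolding N_tendsto_def by (auto intro: tendsto_eq_intros)
    moreover have "vscale H k (\<pi> (x n) \<xi>) = \<pi> (vscale A k (x n)) \<xi>" for n
      using xn \<xi> by (subst r(8)) auto
    ultimately show "vscale H k \<eta> \<in> W" unfolding W_def approx_def
      using x scale_closed c(3) by (auto intro!: exI[of _ "\<lambda>n. vscale A k (x n)"])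
  qed
  have closed: "N_closed H (hnorm H) W"
    unfolding N_closed_def
  proof (intro allI ballI impI)
    fix y l assume l: "l \<in> vcar H" and y: "range y \<subseteq> W \<and> N_tendsto H (hnorm H) y l"
    have yW: "y n \<in> W" "y n \<in> vcar H" for n using y by (auto simp: W_def)
    \<comment> \<open>Diagonal choice: the \<open>n\<close>-th member of a convergent sequence in
      \<open>W\<close> is replaced by an orbit vector at distance below
      \<open>1 / Suc n\<close>.\<close>
    have "\<exists>a\<in>vcar A. hnorm H (vdiff H (\<pi> a \<xi>) (y n)) < 1 / Suc n" for n
    proof -
      obtain x where x: "range x \<subseteq> vcar A" "(\<lambda>m. hnorm H (vdiff H (\<pi> (x m) \<xi>) (y n))) \<longlonglongrightarrow> 0"
        using yW(1)[of n] unfolding W_def approx_def N_tendsto_def by auto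
      then have "\<forall>\<^sub>F m in sequentially. hnorm H (vdiff H (\<pi> (x m) \<xi>) (y n)) < 1 / Suc n"
        by (intro order_tendstoD) auto
      then show ?thesis using x(1) unfolding eventually_sequentially by blast
    qed
    then obtain a where a: "\<And>n. a n \<in> vcar A" "\<And>n. hnorm H (vdiff H (\<pi> (a n) \<xi>) (y n)) < 1 / Suc n"
      by metis
    have "(\<lambda>n. hnorm H (vdiff H (\<pi> (a n) \<xi>) l)) \<longlonglongrightarrow> 0"
    proof (rule tendsto_sandwich[OF _ _ tendsto_const])
      show "\<forall>\<^sub>F n in sequentially. 0 \<le> hnorm H (vdiff H (\<pi> (a n) \<xi>) l)"
        using a l r(3) \<xi> by (intro always_eventually allI hnorm_nonneg diff_closed) auto
      have "hnorm H (vdiff H (\<pi> (a n) \<xi>) l) \<le> 1 / Suc n + hnorm H (vdiff H (y n) l)" for n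
        using hnorm_diff_triangle[of "\<pi> (a n) \<xi>" "y n" l] a(2)[of n] r(3)[OF a(1) \<xi>] yW l by force
      then show "\<forall>\<^sub>F n in sequentially. hnorm H (vdiff H (\<pi> (a n) \<xi>) l) \<le> 1 / Suc n + hnorm H (vdiff H (y n) l)"
        by simp
      show "(\<lambda>n. 1 / Suc n + hnorm H (vdiff H (y n) l)) \<longlonglongrightarrow> 0"
        using tendsto_add[OF LIMSEQ_inverse_real_of_nat, of "\<lambda>n. hnorm H (vdiff H (y n) l)" 0] y
        unfolding N_tendsto_def by (simp add: inverse_eq_divide)
    qed
    then show "l \<in> W" using a l unfolding W_def approx_def N_tendsto_def by auto
  qed
  \<comment> \<open>A vector is encoded by one sequence that approximates it; uniqueness of limits
    makes the encoding injective.\<close>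
  define j where "j \<eta> = (SOME x. approx \<eta> x)" for \<eta>
  have j: "approx \<eta> (j \<eta>)" if "\<eta> \<in> W" for \<eta>
    using that someI_ex[of "approx \<eta>"] unfolding W_def j_def by auto
  let ?W = "H\<lparr>vcar := W\<rparr>"
  have inj: "inj_on j (vcar ?W)"
  proof (rule inj_onI)
    fix \<eta> \<zeta> assume "\<eta> \<in> vcar ?W" "\<zeta> \<in> vcar ?W" "j \<eta> = j \<zeta>"
    then have *: "\<eta> \<in> vcar H" "\<zeta> \<in> vcar H" "approx \<eta> (j \<eta>)" "approx \<zeta> (j \<eta>)"
      using j[of \<eta>] j[of \<zeta>] by (auto simp: W_def)
    then show "\<eta> = \<zeta>"
      using tendsto_unique[OF seq, of "j \<eta>" \<eta> \<zeta>] unfolding approx_def by blast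
  qed
  let ?H = "transported_hilbert j ?W" and ?\<pi> = "transported_rep j ?W \<pi>"
  have repW: "representation A ?W \<pi>" by (rule representation_restrict[OF rep sub closed inv])
  have rep': "representation A ?H ?\<pi>" by (rule representation_transported[OF repW inj c(5)])
  interpret H': hilbert_space ?H using representationD(1)[OF rep'] .
  have hW: "hnorm ?W = hnorm H" by (auto simp: hnorm_def)
  have Wc: "\<eta> \<in> vcar H" if "\<eta> \<in> W" for \<eta> using that by (simp add: W_def)
  have bound: "hnorm H (\<pi> a \<eta>) \<le> opnorm ?H (?\<pi> a) * hnorm H \<eta>" if a: "a \<in> vcar A" and "\<eta> \<in> W" for a \<eta>
    using H'.opnorm_apply[OF representationD(2)[OF rep' a], of "j \<eta>"] inv[OF a \<open>\<eta> \<in> W\<close>] \<open>\<eta> \<in> W\<close>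
    by (simp add: transported_simps[OF inj] hW)
  show ?thesis
  proof (rule exI[of _ ?H], rule exI[of _ ?\<pi>], intro conjI ballI)
    show "representation A ?H ?\<pi>" by (rule rep')
  next
    fix a assume a: "a \<in> vcar A"
    let ?N = "opnorm ?H (?\<pi> a)" and ?\<eta> = "\<pi> a \<xi>"
    have N: "?N \<ge> 0" using H'.opnorm_nonneg representationD(2)[OF rep' a] by blast
    have \<eta>: "?\<eta> \<in> W" "?\<eta> \<in> vcar H" using orbit[OF a] Wc by auto
    \<comment> \<open>The bound by the operator norm holds on \<open>W\<close>, but
      \<open>\<xi>\<close> need not lie in \<open>W\<close> when the representation is degenerate.
      Both \<open>?\<eta>\<close> and \<open>?\<zeta>\<close> do lie in \<open>W\<close>: first
      \<open>?\<zeta>\<close> is bounded by \<open>?N\<close> times \<open>?\<eta>\<close>, then the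
      squared norm of \<open>?\<eta>\<close> equals the inner product of \<open>?\<zeta>\<close>
      with \<open>\<xi>\<close>.\<close>
    let ?\<zeta> = "\<pi> (astar A a) ?\<eta>"
    have \<zeta>: "?\<zeta> \<in> W" "?\<zeta> \<in> vcar H" using inv[OF c(5)[OF a] \<eta>(1)] Wc by auto
    have "(hnorm H ?\<zeta>)\<^sup>2 = cmod (hinner H ?\<zeta> ?\<zeta>)" using inner_self[OF \<zeta>(2)] by (simp add: norm_power)
    also have "\<dots> = cmod (hinner H ?\<eta> (\<pi> a ?\<zeta>))" using r(9)[OF a \<eta>(2) \<zeta>(2)] by simp
    also have "\<dots> \<le> hnorm H ?\<eta> * hnorm H (\<pi> a ?\<zeta>)" using Cauchy_Schwarz \<eta> \<zeta> r(3)[OF a] by blast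
    also have "\<dots> \<le> hnorm H ?\<eta> * (?N * hnorm H ?\<zeta>)"
      using bound[OF a \<zeta>(1)] hnorm_nonneg[OF \<eta>(2)] by (rule mult_left_mono)
    finally have 1: "hnorm H ?\<zeta> \<le> ?N * hnorm H ?\<eta>"
      using hnorm_nonneg[OF \<zeta>(2)] hnorm_nonneg[OF \<eta>(2)] N
      by (cases "hnorm H ?\<zeta> = 0") (auto simp: power2_eq_square mult.assoc mult.left_commute mult.commute)
    have "(hnorm H ?\<eta>)\<^sup>2 = cmod (hinner H ?\<eta> ?\<eta>)" using inner_self[OF \<eta>(2)] by (simp add: norm_power)
    also have "\<dots> = cmod (hinner H ?\<zeta> \<xi>)" using r(9)[OF a \<eta>(2) \<xi>] by simp
    also have "\<dots> \<le> hnorm H ?\<zeta> * hnorm H \<xi>" using Cauchy_Schwarz \<zeta> \<xi> by blast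
    also have "\<dots> \<le> ?N * hnorm H ?\<eta> * hnorm H \<xi>"
      using 1 hnorm_nonneg[OF \<xi>] by (rule mult_right_mono)
    finally show "hnorm H ?\<eta> \<le> ?N * hnorm H \<xi>"
      using hnorm_nonneg[OF \<xi>] hnorm_nonneg[OF \<eta>(2)] N
      by (cases "hnorm H ?\<eta> = 0") (auto simp: power2_eq_square mult.assoc mult.left_commute)
  qed
qed

text \<open>A bound over the representations on sequence carriers is a bound over all
  representations, because each vector is seen by a cyclic one. This permits a comparison of
  algebras whose elements have different types.\<close>

lemma opnorm_le_cyclic:
  fixes A :: "('a, 'm) staralg_scheme" and H :: "('h, 'k) hilb_scheme"
  assumes rep: "representation A H \<pi>" and A: "operations_closed A" and a: "a \<in> vcar A"
    and z: "\<And>(H' :: (nat \<Rightarrow> 'a) hilb) \<pi>'. representation A H' \<pi>' \<Longrightarrow> opnorm H' (\<pi>' a) \<le> z"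
  shows "opnorm H (\<pi> a) \<le> z"
proof -
  interpret hilbert_space H by (rule representationD[OF rep])
  show ?thesis
  proof (rule opnorm_le)
    fix \<xi> assume \<xi>: "\<xi> \<in> vcar H" "hnorm H \<xi> \<le> 1"
    obtain H' :: "(nat \<Rightarrow> 'a) hilb" and \<pi>' where *: "representation A H' \<pi>'"
        "hnorm H (\<pi> a \<xi>) \<le> opnorm H' (\<pi>' a) * hnorm H \<xi>"
      using cyclic_representation[OF rep A \<xi>(1)] a by blast
    have "0 \<le> opnorm H' (\<pi>' a)"
      using hilbert_space.opnorm_nonneg representationD(1,2)[OF *(1)] a by blast
    then have "opnorm H' (\<pi>' a) * hnorm H \<xi> \<le> opnorm H' (\<pi>' a) * 1"
      using \<xi> by (intro mult_left_mono) auto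
    then show "hnorm H (\<pi> a \<xi>) \<le> z" using * z[OF *(1)] by linarith
  qed
qed

lemma representation_comp:
  assumes rep: "representation B H \<pi>" and iso: "star_iso \<phi> A B"
  shows "representation A H (\<lambda>a. \<pi> (\<phi> a))"
  using rep star_isoD(2-)[OF iso] unfolding representation_def by auto

text \<open>The two suprema range over representations on different carrier types, so the sets are
  not compared directly. They have the same upper bounds, and \<open>Sup\<close> on the reals
  depends on a set only through its upper bounds; this also covers the unbounded case.\<close>

lemma universal_seminorm_iso:
  fixes A :: "('a, 'm) staralg_scheme" and B :: "('b, 'k) staralg_scheme"
  assumes iso: "star_iso \<phi> A B" and A: "operations_closed A" and B: "operations_closed B"
    and a: "a \<in> vcar A"
  shows "universal_seminorm B (\<phi> a) = universal_seminorm A a"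
proof -
  have half: "opnorm H (\<pi> (\<phi> a)) \<le> z"
    if "\<And>(H' :: (nat \<Rightarrow> 'a) hilb) \<pi>'. representation A H' \<pi>' \<Longrightarrow> opnorm H' (\<pi>' a) \<le> z"
      and "representation B H \<pi>" for z and H :: "(nat \<Rightarrow> 'b) hilb" and \<pi>
    using opnorm_le_cyclic[OF representation_comp[OF that(2) iso] A a] that(1) by blast
  let ?g = "inv_into (vcar A) \<phi>"
  have g: "?g (\<phi> a) = a" using star_isoD(1)[OF iso] a by (simp add: bij_betw_def)
  have half': "opnorm H (\<pi> a) \<le> z"
    if "\<And>(H' :: (nat \<Rightarrow> 'b) hilb) \<pi>'. representation B H' \<pi>' \<Longrightarrow> opnorm H' (\<pi>' (\<phi> a)) \<le> z"
      and "representation A H \<pi>" for z and H :: "(nat \<Rightarrow> 'a) hilb" and \<pi>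
    using opnorm_le_cyclic[OF representation_comp[OF that(2) star_iso_inverse[OF iso A]] B
        star_isoD(2)[OF iso a]] that(1) g by simp
  have "(\<forall>x\<in>{opnorm H (\<pi> a) | (H :: (nat \<Rightarrow> 'a) hilb) \<pi>. representation A H \<pi>}. x \<le> z) \<longleftrightarrow>
     (\<forall>x\<in>{opnorm H (\<pi> (\<phi> a)) | (H :: (nat \<Rightarrow> 'b) hilb) \<pi>. representation B H \<pi>}. x \<le> z)" for z
  proof (intro iffI ballI)
    fix x assume 1: "\<forall>x\<in>{opnorm H (\<pi> a) | (H :: (nat \<Rightarrow> 'a) hilb) \<pi>. representation A H \<pi>}. x \<le> z"
      and "x \<in> {opnorm H (\<pi> (\<phi> a)) | (H :: (nat \<Rightarrow> 'b) hilb) \<pi>. representation B H \<pi>}"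
    then obtain H :: "(nat \<Rightarrow> 'b) hilb" and \<pi> where "x = opnorm H (\<pi> (\<phi> a))" "representation B H \<pi>" by auto
    then show "x \<le> z" using half[of z H \<pi>] 1 by auto
  next
    fix x assume 1: "\<forall>x\<in>{opnorm H (\<pi> (\<phi> a)) | (H :: (nat \<Rightarrow> 'b) hilb) \<pi>. representation B H \<pi>}. x \<le> z"
      and "x \<in> {opnorm H (\<pi> a) | (H :: (nat \<Rightarrow> 'a) hilb) \<pi>. representation A H \<pi>}"
    then obtain H :: "(nat \<Rightarrow> 'a) hilb" and \<pi> where "x = opnorm H (\<pi> a)" "representation A H \<pi>" by auto
    then show "x \<le> z" using half'[of z H \<pi>] 1 by auto
  qed
  then show ?thesis unfolding universal_seminorm_def Sup_real_def by simp
qed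

lemma completion_rel_iso:
  assumes iso: "star_iso \<phi> A B" and A: "operations_closed A"
    and p: "\<And>a. a \<in> vcar A \<Longrightarrow> q (\<phi> a) = p a"
  shows "range x \<subseteq> vcar A \<Longrightarrow> N_Cauchy B q (\<phi> \<circ> x) \<longleftrightarrow> N_Cauchy A p x"
    and "range x \<subseteq> vcar A \<Longrightarrow> range y \<subseteq> vcar A \<Longrightarrow>
        (\<phi> \<circ> x, \<phi> \<circ> y) \<in> completion_rel B q \<longleftrightarrow> (x, y) \<in> completion_rel A p"
    and "range x \<subseteq> vcar A \<Longrightarrow> (\<lambda>x. \<phi> \<circ> x) ` (completion_rel A p `` {x}) = completion_rel B q `` {\<phi> \<circ> x}"
proof -
  note i = star_isoD[OF iso] and c = operations_closedD[OF A]
  have d: "q (vdiff B (\<phi> a) (\<phi> b)) = p (vdiff A a b)" if "a \<in> vcar A" "b \<in> vcar A" for a b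
  proof -
    have "vdiff B (\<phi> a) (\<phi> b) = \<phi> (vdiff A a b)" using that by (simp add: vdiff_def i c)
    then show ?thesis using p c(6) that by simp
  qed
  show 1: "N_Cauchy B q (\<phi> \<circ> x) \<longleftrightarrow> N_Cauchy A p x" if "range x \<subseteq> vcar A" for x
  proof -
    have "x n \<in> vcar A" for n using that by auto
    then show ?thesis unfolding N_Cauchy_def by (auto simp: d i)
  qed
  show 2: "(\<phi> \<circ> x, \<phi> \<circ> y) \<in> completion_rel B q \<longleftrightarrow> (x, y) \<in> completion_rel A p"
    if "range x \<subseteq> vcar A" "range y \<subseteq> vcar A" for x y
  proof -
    have "x n \<in> vcar A" "y n \<in> vcar A" for n using that by auto
    then show ?thesis using 1[OF that(1)] 1[OF that(2)] unfolding completion_rel_def by (auto simp: d i)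
  qed
  show "(\<lambda>x. \<phi> \<circ> x) ` (completion_rel A p `` {x}) = completion_rel B q `` {\<phi> \<circ> x}"
    if x: "range x \<subseteq> vcar A"
  proof (intro equalityI subsetI)
    fix w assume "w \<in> (\<lambda>x. \<phi> \<circ> x) ` (completion_rel A p `` {x})"
    then obtain y where y: "(x, y) \<in> completion_rel A p" "w = \<phi> \<circ> y" by auto
    then have "range y \<subseteq> vcar A" unfolding completion_rel_def N_Cauchy_def by auto
    then show "w \<in> completion_rel B q `` {\<phi> \<circ> x}" using 2[OF x] y by auto
  next
    fix w assume w: "w \<in> completion_rel B q `` {\<phi> \<circ> x}"
    then have "range w \<subseteq> vcar B" unfolding completion_rel_def N_Cauchy_def by auto
    then have w': "w n \<in> \<phi> ` vcar A" for n using i(1) by (auto simp: bij_betw_def)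
    define y where "y n = inv_into (vcar A) \<phi> (w n)" for n
    have "range y \<subseteq> vcar A" "w = \<phi> \<circ> y"
      using w' by (auto simp: y_def inv_into_into f_inv_into_f fun_eq_iff)
    then show "w \<in> (\<lambda>x. \<phi> \<circ> x) ` (completion_rel A p `` {x})" using w 2[OF x] by auto
  qed
qed

text \<open>The operations of a completion are unions of classes over representatives, and images
  commute with unions. Hence composition with \<open>\<phi>\<close>, applied elementwise to classes,
  respects the operations representative by representative, for an arbitrary function
  \<open>p\<close>.\<close>

lemma completion_iso:
  assumes iso: "star_iso \<phi> A B" and A: "operations_closed A" and z: "\<phi> (vzero A) = vzero B"
    and p: "\<And>a. a \<in> vcar A \<Longrightarrow> q (\<phi> a) = p a"
  shows "cstar_iso (completion A p) (completion B q)"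
proof -
  note i = star_isoD[OF iso] and c = operations_closedD[OF A]
  have R: "N_Cauchy B q (\<phi> \<circ> x) \<longleftrightarrow> N_Cauchy A p x"
    "(\<lambda>x. \<phi> \<circ> x) ` (completion_rel A p `` {x}) = completion_rel B q `` {\<phi> \<circ> x}"
    if "range x \<subseteq> vcar A" for x
    using completion_rel_iso(1,3)[where p = p and q = q, OF iso A _ that] p by blast+
  let ?R = "completion_rel A p" and ?S = "completion_rel B q"
  define \<Phi> where "\<Phi> X = (\<lambda>x. \<phi> \<circ> x) ` X" for X :: "(nat \<Rightarrow> 'a) set"
  have cls: "\<Phi> (?R `` {x}) = ?S `` {\<phi> \<circ> x}" if "range x \<subseteq> vcar A" for x
    using R(2)[OF that] by (simp add: \<Phi>_def)
  have car: "vcar (completion A p) = {x. N_Cauchy A p x} // ?R" "vcar (completion B q) = {x. N_Cauchy B q x} // ?S"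
    by (simp_all add: completion_def Let_def)
  have sub: "x n \<in> vcar A" if "X \<in> vcar (completion A p)" "x \<in> X" for X x n
    using that unfolding car quotient_def completion_rel_def N_Cauchy_def by auto
  have "star_iso \<Phi> (completion A p) (completion B q)"
    unfolding star_iso_def linear_on_def
  proof (intro conjI ballI allI)
    show bij: "bij_betw \<Phi> (vcar (completion A p)) (vcar (completion B q))"
    proof (rule bij_betw_imageI)
      have "inj_on (\<lambda>x. \<phi> \<circ> x) {x :: nat \<Rightarrow> 'a. range x \<subseteq> vcar A}"
        using i(1) unfolding bij_betw_def inj_on_def by (auto simp: fun_eq_iff image_subset_iff)
      then have "inj_on \<Phi> (Pow {x. range x \<subseteq> vcar A})"
        unfolding \<Phi>_def by (rule inj_on_image_Pow)
      then show "inj_on \<Phi> (vcar (completion A p))"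
        by (rule inj_on_subset) (use sub in auto)
      show "\<Phi> ` vcar (completion A p) = vcar (completion B q)"
      proof (intro equalityI subsetI)
        fix Y assume "Y \<in> \<Phi> ` vcar (completion A p)"
        then obtain x where x: "N_Cauchy A p x" "Y = \<Phi> (?R `` {x})" unfolding car quotient_def by auto
        then have "range x \<subseteq> vcar A" by (simp add: N_Cauchy_def)
        then show "Y \<in> vcar (completion B q)" using x cls R(1) unfolding car quotient_def
          by (auto intro!: exI[of _ "\<phi> \<circ> x"])
      next
        fix Y assume "Y \<in> vcar (completion B q)"
        then obtain w where w: "N_Cauchy B q w" "Y = ?S `` {w}" unfolding car quotient_def by auto
        then have w': "w n \<in> \<phi> ` vcar A" for n
          using i(1) unfolding N_Cauchy_def by (auto simp: bij_betw_def)
        define y where "y n = inv_into (vcar A) \<phi> (w n)" for n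
        have y: "range y \<subseteq> vcar A" "w = \<phi> \<circ> y"
          using w' by (auto simp: y_def inv_into_into f_inv_into_f fun_eq_iff)
        then have "N_Cauchy A p y" using w R(1)[OF y(1)] by simp
        then show "Y \<in> \<Phi> ` vcar (completion A p)"
          using cls[OF y(1)] w y unfolding car quotient_def by auto
      qed
    qed
    show "\<Phi> X \<in> vcar (completion B q)" if "X \<in> vcar (completion A p)" for X
      using bij that by (auto simp: bij_betw_def)
  next
    fix X Y assume X: "X \<in> vcar (completion A p)" and Y: "Y \<in> vcar (completion A p)"
    have "\<Phi> (vadd (completion A p) X Y) = (\<Union>x\<in>X. \<Union>y\<in>Y. \<Phi> (?R `` {\<lambda>n. vadd A (x n) (y n)}))"
      by (simp add: completion_def Let_def \<Phi>_def image_UN)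
    also have "\<dots> = (\<Union>x\<in>X. \<Union>y\<in>Y. ?S `` {\<lambda>n. vadd B (\<phi> (x n)) (\<phi> (y n))})"
      using sub[OF X] sub[OF Y] by (intro SUP_cong refl) (auto simp: cls image_subset_iff c i comp_def)
    also have "\<dots> = vadd (completion B q) (\<Phi> X) (\<Phi> Y)"
      by (simp add: completion_def Let_def \<Phi>_def)
    finally show "\<Phi> (vadd (completion A p) X Y) = vadd (completion B q) (\<Phi> X) (\<Phi> Y)" .
    have "\<Phi> (atimes (completion A p) X Y) = (\<Union>x\<in>X. \<Union>y\<in>Y. \<Phi> (?R `` {\<lambda>n. atimes A (x n) (y n)}))"
      by (simp add: completion_def Let_def \<Phi>_def image_UN)
    also have "\<dots> = (\<Union>x\<in>X. \<Union>y\<in>Y. ?S `` {\<lambda>n. atimes B (\<phi> (x n)) (\<phi> (y n))})"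
      using sub[OF X] sub[OF Y] by (intro SUP_cong refl) (auto simp: cls image_subset_iff c i comp_def)
    also have "\<dots> = atimes (completion B q) (\<Phi> X) (\<Phi> Y)"
      by (simp add: completion_def Let_def \<Phi>_def)
    finally show "\<Phi> (atimes (completion A p) X Y) = atimes (completion B q) (\<Phi> X) (\<Phi> Y)" .
  next
    fix X k assume X: "X \<in> vcar (completion A p)"
    have "\<Phi> (vscale (completion A p) k X) = (\<Union>x\<in>X. \<Phi> (?R `` {\<lambda>n. vscale A k (x n)}))"
      by (simp add: completion_def Let_def \<Phi>_def image_UN)
    also have "\<dots> = (\<Union>x\<in>X. ?S `` {\<lambda>n. vscale B k (\<phi> (x n))})"
      using sub[OF X] by (intro SUP_cong refl) (auto simp: cls image_subset_iff c i comp_def)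
    also have "\<dots> = vscale (completion B q) k (\<Phi> X)"
      by (simp add: completion_def Let_def \<Phi>_def)
    finally show "\<Phi> (vscale (completion A p) k X) = vscale (completion B q) k (\<Phi> X)" .
  next
    fix X assume X: "X \<in> vcar (completion A p)"
    have "\<Phi> (astar (completion A p) X) = (\<Union>x\<in>X. \<Phi> (?R `` {\<lambda>n. astar A (x n)}))"
      by (simp add: completion_def Let_def \<Phi>_def image_UN)
    also have "\<dots> = (\<Union>x\<in>X. ?S `` {\<lambda>n. astar B (\<phi> (x n))})"
      using sub[OF X] by (intro SUP_cong refl) (auto simp: cls image_subset_iff c i comp_def)
    also have "\<dots> = astar (completion B q) (\<Phi> X)"
      by (simp add: completion_def Let_def \<Phi>_def)
    finally show "\<Phi> (astar (completion A p) X) = astar (completion B q) (\<Phi> X)" .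
  qed
  then show ?thesis by (rule cstar_isoI)
qed

lemma enveloping_cstar_iso:
  assumes iso: "star_iso \<phi> A B" and A: "operations_closed A" and z: "\<phi> (vzero A) = vzero B"
  shows "cstar_iso (enveloping_cstar A) (enveloping_cstar B)"
  unfolding enveloping_cstar_def
  by (rule completion_iso[OF iso A z])
    (use universal_seminorm_iso[OF iso A star_iso_operations_closed[OF iso A z]] in auto)

section \<open>Functoriality of the tensor product\<close>

text \<open>The linear map between free vector spaces induced by a map \<open>h\<close> of
  generators: coefficients are added along the fibres of \<open>h\<close>.\<close>

definition pushforward :: "('u \<Rightarrow> 'w) \<Rightarrow> ('u \<Rightarrow> complex) \<Rightarrow> 'w \<Rightarrow> complex" where
  "pushforward h r = (\<lambda>z. \<Sum>u | r u \<noteq> 0. r u * point_mass (h u) z)"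

text \<open>Several functions can share one finite index set in place of their own supports;
  additivity then becomes distributivity of a finite sum.\<close>

lemma pushforward_superset:
  assumes "finite S" "{u. r u \<noteq> 0} \<subseteq> S"
  shows "pushforward h r z = (\<Sum>u\<in>S. r u * point_mass (h u) z)"
  unfolding pushforward_def using assms by (intro sum.mono_neutral_left) auto

lemma pushforward_add:
  assumes "finite {u. r u \<noteq> 0}" "finite {u. s u \<noteq> 0}"
  shows "pushforward h (\<lambda>u. r u + s u) z = pushforward h r z + pushforward h s z"
proof -
  let ?S = "{u. r u \<noteq> 0} \<union> {u. s u \<noteq> 0}"
  have "finite ?S" using assms by simp
  then show ?thesis
    by (subst (1 2 3) pushforward_superset[of ?S]) (auto simp: distrib_right sum.distrib)
qed

lemma pushforward_scale:
  assumes "finite {u. r u \<noteq> 0}"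
  shows "pushforward h (\<lambda>u. c * r u) z = c * pushforward h r z"
  using assms by (subst (1 2) pushforward_superset[of "{u. r u \<noteq> 0}"]) (auto simp: sum_distrib_left mult.assoc)

lemma finite_point_mass: "finite {u. point_mass a u \<noteq> 0}"
  by (rule finite_subset[of _ "{a}"]) (auto simp: point_mass_def)

lemma pushforward_point_mass: "pushforward h (point_mass a) z = point_mass (h a) z"
  by (subst pushforward_superset[of "{a}"]) (auto simp: point_mass_def)

lemma finite_support_sum:
  assumes "finite S" "\<And>i. i \<in> S \<Longrightarrow> finite {u. g i u \<noteq> (0 :: complex)}"
  shows "finite {u. (\<Sum>i\<in>S. g i u) \<noteq> 0}"
  by (rule finite_subset[of _ "\<Union>i\<in>S. {u. g i u \<noteq> 0}"])
    (use assms in \<open>auto elim: sum.not_neutral_contains_not_neutral\<close>)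

lemma pushforward_sum:
  assumes "finite S" "\<And>i. i \<in> S \<Longrightarrow> finite {u. g i u \<noteq> 0}"
  shows "pushforward h (\<lambda>u. \<Sum>i\<in>S. g i u) z = (\<Sum>i\<in>S. pushforward h (g i) z)"
  using assms
proof (induction S rule: finite_induct)
  case empty then show ?case by (simp add: pushforward_def)
next
  case (insert i S)
  have "pushforward h (\<lambda>u. g i u + (\<Sum>i\<in>S. g i u)) z = pushforward h (g i) z + pushforward h (\<lambda>u. \<Sum>i\<in>S. g i u) z"
    using insert by (intro pushforward_add finite_support_sum) auto
  then show ?case using insert by simp
qed

lemma pushforward_sum_point_mass:
  assumes "finite S"
  shows "pushforward h (\<lambda>z. \<Sum>i\<in>S. c i * point_mass (p i) z) z = (\<Sum>i\<in>S. c i * point_mass (h (p i)) z)"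
proof -
  have f: "finite {u. c i * point_mass (p i) u \<noteq> 0}" for i
    by (rule finite_subset[OF _ finite_point_mass[of "p i"]]) auto
  show ?thesis
    by (simp add: pushforward_sum[OF assms f] pushforward_scale[OF finite_point_mass] pushforward_point_mass)
qed

lemma pushforward_comp:
  assumes "finite {u. r u \<noteq> 0}"
  shows "pushforward k (pushforward h r) = pushforward (\<lambda>u. k (h u)) r"
  unfolding pushforward_def[of h r]
  by (rule ext, subst pushforward_sum_point_mass[OF assms]) (simp add: pushforward_def)

lemma pushforward_ident:
  assumes "finite {u. r u \<noteq> 0}" "\<And>u. r u \<noteq> 0 \<Longrightarrow> h u = u"
  shows "pushforward h r = r"
proof
  fix z
  have "pushforward h r z = (\<Sum>u | r u \<noteq> 0. if z = u then r u else 0)"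
    unfolding pushforward_def using assms(2) by (intro sum.cong) (auto simp: point_mass_def)
  also have "\<dots> = r z" using assms(1) by (simp add: sum.delta)
  finally show "pushforward h r z = r z" .
qed

lemma pushforward_support: "{z. pushforward h r z \<noteq> 0} \<subseteq> h ` {u. r u \<noteq> 0}"
proof
  fix z assume "z \<in> {z. pushforward h r z \<noteq> 0}"
  then obtain u where "r u \<noteq> 0" "r u * point_mass (h u) z \<noteq> 0"
    unfolding pushforward_def by (auto elim: sum.not_neutral_contains_not_neutral)
  then show "z \<in> h ` {u. r u \<noteq> 0}" by (auto simp: point_mass_def split: if_splits)
qed

lemma pushforward_free:
  assumes "f \<in> free_space A B" "\<And>u. u \<in> vcar A \<times> vcar B \<Longrightarrow> h u \<in> vcar A' \<times> vcar B'"
  shows "pushforward h f \<in> free_space A' B'"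
proof -
  have "finite {u. f u \<noteq> 0}" "{u. f u \<noteq> 0} \<subseteq> vcar A \<times> vcar B" using assms(1) by (auto simp: free_space_def)
  then have "finite (h ` {u. f u \<noteq> 0})" "h ` {u. f u \<noteq> 0} \<subseteq> vcar A' \<times> vcar B'"
    using assms(2) by (blast, blast)
  then have "finite {z. pushforward h f z \<noteq> 0}" "{z. pushforward h f z \<noteq> 0} \<subseteq> vcar A' \<times> vcar B'"
    using pushforward_support[of h f] by (auto intro: finite_subset)
  then show ?thesis unfolding free_space_def by simp
qed

lemma free_space_add: "\<lbrakk>f \<in> free_space A B; g \<in> free_space A B\<rbrakk> \<Longrightarrow> (\<lambda>z. f z + g z) \<in> free_space A B"
proof -
  assume *: "f \<in> free_space A B" "g \<in> free_space A B"
  have "{z. f z + g z \<noteq> 0} \<subseteq> {z. f z \<noteq> 0} \<union> {z. g z \<noteq> 0}" by auto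
  then show ?thesis using * finite_subset unfolding free_space_def by (fastforce intro: finite_subset)
qed

lemma free_space_scale: "f \<in> free_space A B \<Longrightarrow> (\<lambda>z. c * f z) \<in> free_space A B"
  unfolding free_space_def by (auto elim: rev_finite_subset)

lemma free_space_zero: "(\<lambda>z. 0) \<in> free_space A B"
  by (simp add: free_space_def)

lemma point_mass_free: "\<lbrakk>a \<in> vcar A; b \<in> vcar B\<rbrakk> \<Longrightarrow> point_mass (a, b) \<in> free_space A B"
  using finite_point_mass unfolding free_space_def by (auto simp: point_mass_def split: if_splits)

lemma relations_sum:
  assumes "finite S" "\<And>i. i \<in> S \<Longrightarrow> g i \<in> bilinear_relations A B"
  shows "(\<lambda>z. \<Sum>i\<in>S. g i z) \<in> bilinear_relations A B"
  using assms by (induction S rule: finite_induct) (auto intro: bilinear_relations.intros)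

text \<open>Relations have finite support, which is what the additivity laws of
  \<open>pushforward\<close> ask for.\<close>

lemma relations_free:
  assumes A: "complex_vs A" and B: "complex_vs B" and "r \<in> bilinear_relations A B"
  shows "r \<in> free_space A B"
proof -
  interpret A: complex_vs A by fact
  interpret B: complex_vs B by fact
  have diff: "(\<lambda>z. f z - g z) \<in> free_space A B" if "f \<in> free_space A B" "g \<in> free_space A B" for f g
    using free_space_add[OF that(1) free_space_scale[OF that(2), of "-1"]] by simp
  show ?thesis using assms(3)
    by induction (auto intro!: diff free_space_add free_space_scale point_mass_free free_space_zero
        simp: A.add_closed B.add_closed A.scale_closed B.scale_closed)
qed

text \<open>The field automorphism \<open>\<sigma>\<close> is the identity or conjugation; the latter is needed for the
  involution, which is conjugate linear.\<close>

lemma pushforward_relations: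
  assumes A: "complex_vs A" and B: "complex_vs B"
    and \<sigma>: "\<And>x y. \<sigma> (x + y) = \<sigma> x + \<sigma> y" "\<And>x y. \<sigma> (x * y) = \<sigma> x * \<sigma> y" "\<sigma> 1 = 1" "\<And>x. \<sigma> x = 0 \<longleftrightarrow> x = 0"
    and h: "\<And>x. x \<in> vcar A \<Longrightarrow> h x \<in> vcar A'"
      "\<And>x y. x \<in> vcar A \<Longrightarrow> y \<in> vcar A \<Longrightarrow> h (vadd A x y) = vadd A' (h x) (h y)"
      "\<And>c x. x \<in> vcar A \<Longrightarrow> h (vscale A c x) = vscale A' (\<sigma> c) (h x)"
    and k: "\<And>x. x \<in> vcar B \<Longrightarrow> k x \<in> vcar B'"
      "\<And>x y. x \<in> vcar B \<Longrightarrow> y \<in> vcar B \<Longrightarrow> k (vadd B x y) = vadd B' (k x) (k y)"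
      "\<And>c x. x \<in> vcar B \<Longrightarrow> k (vscale B c x) = vscale B' (\<sigma> c) (k x)"
    and r: "r \<in> bilinear_relations A B"
  shows "pushforward (\<lambda>u. (h (fst u), k (snd u))) (\<lambda>z. \<sigma> (r z)) \<in> bilinear_relations A' B'"
proof -
  interpret A: complex_vs A by fact
  interpret B: complex_vs B by fact
  let ?p = "\<lambda>r. pushforward (\<lambda>u. (h (fst u), k (snd u))) (\<lambda>z. \<sigma> (r z))"
  have \<sigma>0: "\<sigma> 0 = 0" using \<sigma>(4) by simp
  have \<sigma>m: "\<sigma> (- x) = - \<sigma> x" for x using \<sigma>(1)[of x "-x"] \<sigma>0 by (simp add: eq_neg_iff_add_eq_0 add.commute)
  have \<sigma>d: "\<sigma> (x - y) = \<sigma> x - \<sigma> y" for x y using \<sigma>(1)[of x "-y"] \<sigma>m by simp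
  have \<sigma>p: "\<sigma> (point_mass u z) = point_mass u z" for u z by (simp add: point_mass_def \<sigma>0 \<sigma>(3))
  have fin: "finite {z. \<sigma> (r z) \<noteq> 0}" if "r \<in> free_space A B" for r
    using that by (simp add: \<sigma>(4) free_space_def)
  have add: "?p (\<lambda>z. r z + s z) = (\<lambda>z. ?p r z + ?p s z)" if "r \<in> free_space A B" "s \<in> free_space A B" for r s
    by (rule ext) (simp only: \<sigma>(1) pushforward_add[OF fin[OF that(1)] fin[OF that(2)]])
  have sc: "?p (\<lambda>z. c * r z) = (\<lambda>z. \<sigma> c * ?p r z)" if "r \<in> free_space A B" for r c
    by (rule ext) (simp only: \<sigma>(2) pushforward_scale[OF fin[OF that]])
  have diff: "?p (\<lambda>z. r z - s z) = (\<lambda>z. ?p r z - ?p s z)" if "r \<in> free_space A B" "s \<in> free_space A B" for r s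
    using add[OF that(1) free_space_scale[OF that(2), of "-1"]] sc[OF that(2), of "-1"] by (simp add: \<sigma>m \<sigma>(3))
  have pm: "?p (point_mass (a, b)) = point_mass (h a, k b)" for a b
    by (simp add: \<sigma>p pushforward_point_mass fun_eq_iff)
  have fdiff: "(\<lambda>z. f z - g z) \<in> free_space A B" if "f \<in> free_space A B" "g \<in> free_space A B" for f g
    using free_space_add[OF that(1) free_space_scale[OF that(2), of "-1"]] by simp
  note free = point_mass_free free_space_scale fdiff A.add_closed B.add_closed A.scale_closed B.scale_closed
  show ?thesis using r
  \<comment> \<open>Each generating relation is sent to a relation of the same kind, with scalars
    passed through \<open>\<sigma>\<close>; sums and multiples follow from additivity of the
    pushforward.\<close>
  proof induction
    case (add_left a a' b)
    then show ?case
      using bilinear_relations.add_left[of "h a" A' "h a'" "k b" B'] by (simp add: diff free pm h k)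
  next
    case (add_right a b b')
    then show ?case
      using bilinear_relations.add_right[of "h a" A' "k b" B' "k b'"] by (simp add: diff free pm h k)
  next
    case (scale_left a b c)
    then show ?case
      using bilinear_relations.scale_left[of "h a" A' "k b" B' "\<sigma> c"] by (simp add: diff sc free pm h k)
  next
    case (scale_right a b c)
    then show ?case
      using bilinear_relations.scale_right[of "h a" A' "k b" B' "\<sigma> c"] by (simp add: diff sc free pm h k)
  next
    case zero
    then show ?case using bilinear_relations.zero by (simp add: \<sigma>0 pushforward_def)
  next
    case (plus f g)
    then show ?case using bilinear_relations.plus by (simp add: add relations_free[OF A B])
  next
    case (scale f c)
    then show ?case using bilinear_relations.scale by (simp add: sc relations_free[OF A B])
  qed
qed

definition tensor_times :: "('a, 'm) staralg_scheme \<Rightarrow> ('b, 'k) staralg_scheme \<Rightarrow>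
    ('a \<times> 'b \<Rightarrow> complex) \<Rightarrow> ('a \<times> 'b \<Rightarrow> complex) \<Rightarrow> 'a \<times> 'b \<Rightarrow> complex" where
  "tensor_times A B f g = (\<lambda>z.
     \<Sum>(u, v) | f u \<noteq> 0 \<and> g v \<noteq> 0 \<and> (atimes A (fst u) (fst v), atimes B (snd u) (snd v)) = z. f u * g v)"

definition tensor_star :: "('a, 'm) staralg_scheme \<Rightarrow> ('b, 'k) staralg_scheme \<Rightarrow>
    ('a \<times> 'b \<Rightarrow> complex) \<Rightarrow> 'a \<times> 'b \<Rightarrow> complex" where
  "tensor_star A B f = (\<lambda>z. \<Sum>u | f u \<noteq> 0 \<and> (astar A (fst u), astar B (snd u)) = z. cnj (f u))"

abbreviation "simple_times A B u v \<equiv> (atimes A (fst u) (fst v), atimes B (snd u) (snd v))"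

text \<open>As a double sum over fixed finite index sets the product is visibly bilinear in the
  coefficients.\<close>

lemma tensor_times_sum:
  assumes "finite S" "{u. f u \<noteq> 0} \<subseteq> S" "finite S'" "{v. g v \<noteq> 0} \<subseteq> S'"
  shows "tensor_times A B f g z = (\<Sum>u\<in>S. \<Sum>v\<in>S'. f u * g v * point_mass (simple_times A B u v) z)"
proof -
  have "(\<Sum>u\<in>S. \<Sum>v\<in>S'. f u * g v * point_mass (simple_times A B u v) z) =
      (\<Sum>(u, v)\<in>S \<times> S'. f u * g v * point_mass (simple_times A B u v) z)"
    by (simp add: sum.cartesian_product)
  also have "\<dots> = (\<Sum>(u, v) | f u \<noteq> 0 \<and> g v \<noteq> 0 \<and> simple_times A B u v = z. f u * g v * point_mass (simple_times A B u v) z)"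
    using assms by (intro sum.mono_neutral_right) (auto simp: point_mass_def split: if_splits)
  also have "\<dots> = tensor_times A B f g z"
    unfolding tensor_times_def by (intro sum.cong) (auto simp: point_mass_def)
  finally show ?thesis by simp
qed

text \<open>Conjugating the coefficients and then moving the generators brings the involution under
  \<open>pushforward_relations\<close>.\<close>

lemma tensor_star_pushforward:
  "finite {u. f u \<noteq> 0} \<Longrightarrow>
    tensor_star A B f = pushforward (\<lambda>u. (astar A (fst u), astar B (snd u))) (\<lambda>u. cnj (f u))"
proof
  fix z assume f: "finite {u. f u \<noteq> 0}"
  have "tensor_star A B f z = (\<Sum>u | f u \<noteq> 0. if (astar A (fst u), astar B (snd u)) = z then cnj (f u) else 0)"
    unfolding tensor_star_def using f by (subst sum.inter_filter[symmetric]) (auto simp: Collect_conj_eq)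
  also have "\<dots> = pushforward (\<lambda>u. (astar A (fst u), astar B (snd u))) (\<lambda>u. cnj (f u)) z"
    unfolding pushforward_def by (intro sum.cong) (auto simp: point_mass_def)
  finally show "tensor_star A B f z = pushforward (\<lambda>u. (astar A (fst u), astar B (snd u))) (\<lambda>u. cnj (f u)) z" .
qed

lemma algebraic_tensor_simps:
  "vcar (algebraic_tensor A B) = free_space A B // tensor_rel A B"
  "vzero (algebraic_tensor A B) = tensor_rel A B `` {\<lambda>z. 0}"
  "vadd (algebraic_tensor A B) X Y = (\<Union>f\<in>X. \<Union>g\<in>Y. tensor_rel A B `` {\<lambda>z. f z + g z})"
  "vscale (algebraic_tensor A B) c X = (\<Union>f\<in>X. tensor_rel A B `` {\<lambda>z. c * f z})"
  "atimes (algebraic_tensor A B) X Y = (\<Union>f\<in>X. \<Union>g\<in>Y. tensor_rel A B `` {tensor_times A B f g})"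
  "astar (algebraic_tensor A B) X = (\<Union>f\<in>X. tensor_rel A B `` {tensor_star A B f})"
  by (simp_all add: algebraic_tensor_def Let_def tensor_times_def tensor_star_def)

lemma equiv_tensor_rel: "equiv (free_space A B) (tensor_rel A B)"
proof (rule equivI)
  show "tensor_rel A B \<subseteq> free_space A B \<times> free_space A B" by (auto simp: tensor_rel_def)
  show "refl_on (free_space A B) (tensor_rel A B)"
    using bilinear_relations.zero by (auto simp: refl_on_def tensor_rel_def)
  show "sym (tensor_rel A B)"
  proof (rule symI)
    fix f g assume "(f, g) \<in> tensor_rel A B"
    then show "(g, f) \<in> tensor_rel A B"
      using bilinear_relations.scale[of "\<lambda>z. f z - g z" A B "-1"] by (auto simp: tensor_rel_def)
  qed
  show "trans (tensor_rel A B)"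
  proof (rule transI)
    fix f g h assume "(f, g) \<in> tensor_rel A B" "(g, h) \<in> tensor_rel A B"
    then show "(f, h) \<in> tensor_rel A B"
      using bilinear_relations.plus[of "\<lambda>z. f z - g z" A B "\<lambda>z. g z - h z"] by (auto simp: tensor_rel_def)
  qed
qed

context
  fixes A :: "('a, 'm) staralg_scheme" and B :: "('b, 'k) staralg_scheme"
  assumes A: "star_algebra A" and B: "star_algebra B"
begin

interpretation A: star_algebra A by (rule A)
interpretation B: star_algebra B by (rule B)

lemma tensor_times_free:
  assumes f: "f \<in> free_space A B" and g: "g \<in> free_space A B"
  shows "tensor_times A B f g \<in> free_space A B"
proof -
  let ?S = "(\<lambda>(u, v). simple_times A B u v) ` ({u. f u \<noteq> 0} \<times> {v. g v \<noteq> 0})"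
  have "{z. tensor_times A B f g z \<noteq> 0} \<subseteq> ?S"
  proof
    fix z assume "z \<in> {z. tensor_times A B f g z \<noteq> 0}"
    then obtain w where "w \<in> {(u, v). f u \<noteq> 0 \<and> g v \<noteq> 0 \<and> simple_times A B u v = z}"
      unfolding tensor_times_def by (auto elim: sum.not_neutral_contains_not_neutral)
    then show "z \<in> ?S" by force
  qed
  moreover have "finite ?S" "?S \<subseteq> vcar A \<times> vcar B"
    using f g unfolding free_space_def by (auto intro!: A.times_closed B.times_closed)
  ultimately show ?thesis unfolding free_space_def using finite_subset by auto
qed

text \<open>For a fixed simple tensor, right multiplication by it is linear in each tensor factor,
  so it pushes relations to relations. The product is a linear combination of such pushforwards over
  the support of \<open>g\<close>.\<close>

lemma tensor_times_relations_left:
  assumes r: "r \<in> bilinear_relations A B" and g: "g \<in> free_space A B"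
  shows "tensor_times A B r g \<in> bilinear_relations A B"
proof -
  have rf: "r \<in> free_space A B" using relations_free A.complex_vs_axioms B.complex_vs_axioms r by blast
  have fin: "finite {u. r u \<noteq> 0}" "finite {u. g u \<noteq> 0}" using rf g by (auto simp: free_space_def)
  have "tensor_times A B r g = (\<lambda>z. \<Sum>v | g v \<noteq> 0. g v * pushforward (\<lambda>u. simple_times A B u v) r z)"
  proof
    fix z
    have "tensor_times A B r g z = (\<Sum>u | r u \<noteq> 0. \<Sum>v | g v \<noteq> 0. r u * g v * point_mass (simple_times A B u v) z)"
      using fin by (intro tensor_times_sum) auto
    also have "\<dots> = (\<Sum>v | g v \<noteq> 0. \<Sum>u | r u \<noteq> 0. r u * g v * point_mass (simple_times A B u v) z)"
      by (rule sum.swap)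
    finally show "tensor_times A B r g z = (\<Sum>v | g v \<noteq> 0. g v * pushforward (\<lambda>u. simple_times A B u v) r z)"
      by (simp add: pushforward_def sum_distrib_left mult_ac)
  qed
  also have "\<dots> \<in> bilinear_relations A B"
  proof (rule relations_sum[OF fin(2)], rule bilinear_relations.scale)
    fix v assume "v \<in> {u. g u \<noteq> 0}"
    then have v: "fst v \<in> vcar A" "snd v \<in> vcar B" using g by (auto simp: free_space_def)
    show "pushforward (\<lambda>u. simple_times A B u v) r \<in> bilinear_relations A B"
      by (rule pushforward_relations[where \<sigma> = "\<lambda>x. x" and h = "\<lambda>x. atimes A x (fst v)" and k = "\<lambda>x. atimes B x (snd v)"
            and A = A and B = B and A' = A and B' = B])
        (use r v in \<open>simp_all add: A.times_closed B.times_closed A.add_times B.add_times A.scale_times B.scale_times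
           A.complex_vs_axioms B.complex_vs_axioms\<close>)
  qed
  finally show ?thesis .
qed

lemma tensor_times_relations_right:
  assumes r: "r \<in> bilinear_relations A B" and g: "g \<in> free_space A B"
  shows "tensor_times A B g r \<in> bilinear_relations A B"
proof -
  have rf: "r \<in> free_space A B" using relations_free A.complex_vs_axioms B.complex_vs_axioms r by blast
  have fin: "finite {u. r u \<noteq> 0}" "finite {u. g u \<noteq> 0}" using rf g by (auto simp: free_space_def)
  have "tensor_times A B g r = (\<lambda>z. \<Sum>v | g v \<noteq> 0. g v * pushforward (\<lambda>u. simple_times A B v u) r z)"
  proof
    fix z
    have "tensor_times A B g r z = (\<Sum>v | g v \<noteq> 0. \<Sum>u | r u \<noteq> 0. g v * r u * point_mass (simple_times A B v u) z)"
      using fin by (intro tensor_times_sum) auto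
    then show "tensor_times A B g r z = (\<Sum>v | g v \<noteq> 0. g v * pushforward (\<lambda>u. simple_times A B v u) r z)"
      by (simp add: pushforward_def sum_distrib_left mult_ac)
  qed
  also have "\<dots> \<in> bilinear_relations A B"
  proof (rule relations_sum[OF fin(2)], rule bilinear_relations.scale)
    fix v assume "v \<in> {u. g u \<noteq> 0}"
    then have v: "fst v \<in> vcar A" "snd v \<in> vcar B" using g by (auto simp: free_space_def)
    show "pushforward (\<lambda>u. simple_times A B v u) r \<in> bilinear_relations A B"
      by (rule pushforward_relations[where \<sigma> = "\<lambda>x. x" and h = "\<lambda>x. atimes A (fst v) x" and k = "\<lambda>x. atimes B (snd v) x"
            and A = A and B = B and A' = A and B' = B])
        (use r v in \<open>simp_all add: A.times_closed B.times_closed A.times_add B.times_add A.times_scale B.times_scale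
           A.complex_vs_axioms B.complex_vs_axioms\<close>)
  qed
  finally show ?thesis .
qed

text \<open>The product changes by (f - f') g + f' (g - g'). Since relations absorb multiplication
  on both sides, this makes the product independent of representatives.\<close>

lemma tensor_times_diff:
  assumes "f \<in> free_space A B" "f' \<in> free_space A B" "g \<in> free_space A B" "g' \<in> free_space A B"
  shows "tensor_times A B f g z - tensor_times A B f' g' z =
     tensor_times A B (\<lambda>z. f z - f' z) g z + tensor_times A B f' (\<lambda>z. g z - g' z) z"
proof -
  let ?S = "{u. f u \<noteq> 0} \<union> {u. f' u \<noteq> 0}" and ?T = "{u. g u \<noteq> 0} \<union> {u. g' u \<noteq> 0}"
  have "finite ?S" "finite ?T" using assms by (auto simp: free_space_def)
  then show ?thesis
  proof -
    assume fin: "finite ?S" "finite ?T"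
    have "tensor_times A B p q z = (\<Sum>u\<in>?S. \<Sum>v\<in>?T. p u * q v * point_mass (simple_times A B u v) z)"
      if "{u. p u \<noteq> 0} \<subseteq> ?S" "{u. q u \<noteq> 0} \<subseteq> ?T" for p q
      using that fin by (intro tensor_times_sum) auto
    note * = this
    have "tensor_times A B f g z - tensor_times A B f' g' z =
        (\<Sum>u\<in>?S. \<Sum>v\<in>?T. (f u * g v - f' u * g' v) * point_mass (simple_times A B u v) z)"
      by (subst (1 2) *) (auto simp: sum_subtractf left_diff_distrib)
    also have "\<dots> = (\<Sum>u\<in>?S. \<Sum>v\<in>?T. ((f u - f' u) * g v + f' u * (g v - g' v)) * point_mass (simple_times A B u v) z)"
      by (intro sum.cong refl arg_cong2[of _ _ _ _ "(*)"]) (simp add: algebra_simps)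
    also have "\<dots> = tensor_times A B (\<lambda>z. f z - f' z) g z + tensor_times A B f' (\<lambda>z. g z - g' z) z"
      by (subst (1 2) *) (auto simp: sum.distrib distrib_right)
    finally show ?thesis .
  qed
qed

lemma tensor_star_free:
  assumes "f \<in> free_space A B" shows "tensor_star A B f \<in> free_space A B"
proof -
  have "finite {u. f u \<noteq> 0}" "(\<lambda>u. cnj (f u)) \<in> free_space A B" using assms by (auto simp: free_space_def)
  then show ?thesis
    using pushforward_free[of "\<lambda>u. cnj (f u)" A B "\<lambda>u. (astar A (fst u), astar B (snd u))" A B]
    by (auto simp: tensor_star_pushforward A.star_closed B.star_closed)
qed

text \<open>The operations are unions over representatives. Independence of the representatives
  collapses each union to a single class, which is what membership in the quotient requires.\<close>

lemma algebraic_tensor_closed: "operations_closed (algebraic_tensor A B)"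
proof -
  let ?F = "free_space A B" and ?R = "tensor_rel A B"
  note eq = equiv_tensor_rel[of A B]
  have cls: "?R `` {f} = ?R `` {g}" if "f \<in> ?F" "g \<in> ?F" "(\<lambda>z. f z - g z) \<in> bilinear_relations A B" for f g
    using that by (intro equiv_class_eq[OF eq]) (auto simp: tensor_rel_def)
  have rel: "f \<in> ?F \<and> g \<in> ?F \<and> (\<lambda>z. f z - g z) \<in> bilinear_relations A B" if "(f, g) \<in> ?R" for f g
    using that by (simp add: tensor_rel_def)
  have add: "(\<lambda>f g. ?R `` {\<lambda>z. f z + g z}) respects2 ?R"
  proof (rule congruent2I'[of ?R ?R], rule cls)
    fix f f' g g' assume "(f, f') \<in> ?R" "(g, g') \<in> ?R"
    note * = rel[OF this(1)] rel[OF this(2)]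
    then show "(\<lambda>z. f z + g z) \<in> ?F" "(\<lambda>z. f' z + g' z) \<in> ?F" by (auto intro: free_space_add)
    have "(\<lambda>z. (f z - f' z) + (g z - g' z)) \<in> bilinear_relations A B"
      using * by (intro bilinear_relations.plus) auto
    then show "(\<lambda>z. f z + g z - (f' z + g' z)) \<in> bilinear_relations A B" by (simp add: algebra_simps)
  qed
  have times: "(\<lambda>f g. ?R `` {tensor_times A B f g}) respects2 ?R"
  proof (rule congruent2I'[of ?R ?R], rule cls)
    fix f f' g g' assume "(f, f') \<in> ?R" "(g, g') \<in> ?R"
    note * = rel[OF this(1)] rel[OF this(2)]
    then show "tensor_times A B f g \<in> ?F" "tensor_times A B f' g' \<in> ?F" by (auto intro: tensor_times_free)
    show "(\<lambda>z. tensor_times A B f g z - tensor_times A B f' g' z) \<in> bilinear_relations A B"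
      using * bilinear_relations.plus[OF tensor_times_relations_left tensor_times_relations_right,
        of "\<lambda>z. f z - f' z" g "\<lambda>z. g z - g' z" f'] by (simp add: tensor_times_diff)
  qed
  have scale: "(\<lambda>f. ?R `` {\<lambda>z. c * f z}) respects ?R" for c
  proof (rule congruentI, rule cls)
    fix f f' assume "(f, f') \<in> ?R"
    note * = rel[OF this(1)]
    then show "(\<lambda>z. c * f z) \<in> ?F" "(\<lambda>z. c * f' z) \<in> ?F" by (auto intro: free_space_scale)
    show "(\<lambda>z. c * f z - c * f' z) \<in> bilinear_relations A B"
      using * bilinear_relations.scale[of "\<lambda>z. f z - f' z" A B c] by (simp add: right_diff_distrib)
  qed
  have star: "(\<lambda>f. ?R `` {tensor_star A B f}) respects ?R"
  proof (rule congruentI, rule cls)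
    fix f f' assume "(f, f') \<in> ?R"
    note * = rel[OF this(1)]
    then show "tensor_star A B f \<in> ?F" "tensor_star A B f' \<in> ?F" by (auto intro: tensor_star_free)
    have fin: "finite {u. f u \<noteq> 0}" "finite {u. f' u \<noteq> 0}" using * by (auto simp: free_space_def)
    let ?h = "\<lambda>u. (astar A (fst u), astar B (snd u))"
    \<comment> \<open>Here the field automorphism \<open>\<sigma>\<close> is conjugation.\<close>
    have "pushforward ?h (\<lambda>z. cnj (f z - f' z)) \<in> bilinear_relations A B"
      by (rule pushforward_relations[where A = A and B = B and A' = A and B' = B])
        (use * in \<open>simp_all add: A.star_closed B.star_closed A.star_add B.star_add A.star_scale B.star_scale
           A.complex_vs_axioms B.complex_vs_axioms\<close>)
    moreover have "(\<lambda>z. tensor_star A B f z - tensor_star A B f' z) = pushforward ?h (\<lambda>z. cnj (f z - f' z))"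
    proof
      fix z
      show "tensor_star A B f z - tensor_star A B f' z = pushforward ?h (\<lambda>z. cnj (f z - f' z)) z"
      using pushforward_add[of "\<lambda>z. cnj (f z)" "\<lambda>z. -1 * cnj (f' z)" ?h z] pushforward_scale[of "\<lambda>z. cnj (f' z)" ?h "-1" z] fin
      by (simp add: tensor_star_pushforward)
    qed
    ultimately show "(\<lambda>z. tensor_star A B f z - tensor_star A B f' z) \<in> bilinear_relations A B" by simp
  qed
  show ?thesis unfolding operations_closed_def algebraic_tensor_simps
  proof (intro conjI ballI allI)
    show "?R `` {\<lambda>z. 0} \<in> ?F // ?R" by (intro quotientI free_space_zero)
  next
    fix X Y assume "X \<in> ?F // ?R" "Y \<in> ?F // ?R"
    then obtain f g where f: "f \<in> ?F" "X = ?R `` {f}" and g: "g \<in> ?F" "Y = ?R `` {g}" by (auto simp: quotient_def)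
    show "(\<Union>f\<in>X. \<Union>g\<in>Y. ?R `` {\<lambda>z. f z + g z}) \<in> ?F // ?R"
      using UN_equiv_class2[OF eq eq add f(1) g(1)] f g by (auto intro!: quotientI free_space_add)
    show "(\<Union>f\<in>X. \<Union>g\<in>Y. ?R `` {tensor_times A B f g}) \<in> ?F // ?R"
      using UN_equiv_class2[OF eq eq times f(1) g(1)] f g by (auto intro!: quotientI tensor_times_free)
  next
    fix X c assume "X \<in> ?F // ?R"
    then obtain f where f: "f \<in> ?F" "X = ?R `` {f}" by (auto simp: quotient_def)
    show "(\<Union>f\<in>X. ?R `` {\<lambda>z. c * f z}) \<in> ?F // ?R"
      using UN_equiv_class[OF eq scale f(1)] f by (auto intro!: quotientI free_space_scale)
  next
    fix X assume "X \<in> ?F // ?R"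
    then obtain f where f: "f \<in> ?F" "X = ?R `` {f}" by (auto simp: quotient_def)
    show "(\<Union>f\<in>X. ?R `` {tensor_star A B f}) \<in> ?F // ?R"
      using UN_equiv_class[OF eq star f(1)] f by (auto intro!: quotientI tensor_star_free)
  qed
qed

end

text \<open>Pushforward along \<open>\<phi>\<close> on the first factor has pushforward along the
  inverse of \<open>\<phi>\<close> as its inverse, and both preserve relations. So equivalence of
  representatives is preserved and reflected, and taking images of classes is a bijection of the
  quotients.\<close>

lemma algebraic_tensor_iso:
  fixes A :: "('a, 'm) staralg_scheme" and B :: "('b, 'k) staralg_scheme" and C :: "('c, 'l) staralg_scheme"
  assumes A: "star_algebra A" and C: "star_algebra C" and B: "star_algebra B" and iso: "star_iso \<phi> A C"
  shows "\<exists>\<Psi>. star_iso \<Psi> (algebraic_tensor A B) (algebraic_tensor C B) \<and>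
    \<Psi> (vzero (algebraic_tensor A B)) = vzero (algebraic_tensor C B)"
proof -
  interpret A: star_algebra A by fact
  interpret B: star_algebra B by fact
  interpret C: star_algebra C by fact
  have Acl: "operations_closed A"
    by (simp add: operations_closed_def A.zero_closed A.add_closed A.scale_closed A.times_closed A.star_closed)
  note i = star_isoD[OF iso]
  define \<phi>' where "\<phi>' = inv_into (vcar A) \<phi>"
  have iso': "star_iso \<phi>' C A" unfolding \<phi>'_def by (rule star_iso_inverse[OF iso Acl])
  note i' = star_isoD[OF iso']
  have inv: "\<phi>' (\<phi> a) = a" if "a \<in> vcar A" for a using that i(1) by (simp add: bij_betw_def \<phi>'_def)
  have inv': "\<phi> (\<phi>' c) = c" if "c \<in> vcar C" for c
    using that i(1) by (simp add: bij_betw_def \<phi>'_def f_inv_into_f)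
  define h :: "'a \<times> 'b \<Rightarrow> 'c \<times> 'b" where "h = (\<lambda>u. (\<phi> (fst u), snd u))"
  define h' :: "'c \<times> 'b \<Rightarrow> 'a \<times> 'b" where "h' = (\<lambda>u. (\<phi>' (fst u), snd u))"
  define P where "P = pushforward h"
  define P' where "P' = pushforward h'"
  have hcar: "h u \<in> vcar C \<times> vcar B" if "u \<in> vcar A \<times> vcar B" for u using that i(2) by (auto simp: h_def)
  have h'car: "h' u \<in> vcar A \<times> vcar B" if "u \<in> vcar C \<times> vcar B" for u using that i'(2) by (auto simp: h'_def)
  have h'h: "h' (h u) = u" if "u \<in> vcar A \<times> vcar B" for u using that inv by (auto simp: h_def h'_def)
  have hh': "h (h' u) = u" if "u \<in> vcar C \<times> vcar B" for u using that inv' by (auto simp: h_def h'_def)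
  have Pf: "P f \<in> free_space C B" if "f \<in> free_space A B" for f
    unfolding P_def using that hcar by (rule pushforward_free)
  have P'f: "P' f \<in> free_space A B" if "f \<in> free_space C B" for f
    unfolding P'_def using that h'car by (rule pushforward_free)
  have fin: "finite {u. f u \<noteq> 0}" "{u. f u \<noteq> 0} \<subseteq> vcar X \<times> vcar Y" if "f \<in> free_space X Y"
    for f and X :: "('x, 'p) staralg_scheme" and Y :: "('y, 'q) staralg_scheme" using that by (auto simp: free_space_def)
  have P'P: "P' (P f) = f" if "f \<in> free_space A B" for f
    unfolding P_def P'_def pushforward_comp[OF fin(1)[OF that]]
    using fin[OF that] h'h by (intro pushforward_ident) auto
  have PP': "P (P' f) = f" if "f \<in> free_space C B" for f
    unfolding P_def P'_def pushforward_comp[OF fin(1)[OF that]]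
    using fin[OF that] hh' by (intro pushforward_ident) auto
  have Padd: "P (\<lambda>z. f z + g z) = (\<lambda>z. P f z + P g z)" if "f \<in> free_space A B" "g \<in> free_space A B" for f g
    unfolding P_def by (rule ext) (rule pushforward_add[OF fin(1)[OF that(1)] fin(1)[OF that(2)]])
  have P'add: "P' (\<lambda>z. f z + g z) = (\<lambda>z. P' f z + P' g z)" if "f \<in> free_space C B" "g \<in> free_space C B" for f g
    unfolding P'_def by (rule ext) (rule pushforward_add[OF fin(1)[OF that(1)] fin(1)[OF that(2)]])
  have Pscale: "P (\<lambda>z. c * f z) = (\<lambda>z. c * P f z)" if "f \<in> free_space A B" for c f
    unfolding P_def by (rule ext) (rule pushforward_scale[OF fin(1)[OF that]])
  have P'scale: "P' (\<lambda>z. c * f z) = (\<lambda>z. c * P' f z)" if "f \<in> free_space C B" for c f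
    unfolding P'_def by (rule ext) (rule pushforward_scale[OF fin(1)[OF that]])
  have Pzero: "P (\<lambda>z. 0) = (\<lambda>z. 0)" by (simp add: P_def pushforward_def)
  have Prel: "P r \<in> bilinear_relations C B" if "r \<in> bilinear_relations A B" for r
    unfolding P_def h_def
    using pushforward_relations[where \<sigma> = "\<lambda>x. x" and h = \<phi> and k = "\<lambda>x. x" and A = A and B = B and A' = C and B' = B and r = r]
    by (simp add: that i A.complex_vs_axioms B.complex_vs_axioms)
  have P'rel: "P' r \<in> bilinear_relations A B" if "r \<in> bilinear_relations C B" for r
    unfolding P'_def h'_def
    using pushforward_relations[where \<sigma> = "\<lambda>x. x" and h = \<phi>' and k = "\<lambda>x. x" and A = C and B = B and A' = A and B' = B and r = r]
    by (simp add: that i' C.complex_vs_axioms B.complex_vs_axioms)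
  let ?R = "tensor_rel A B" and ?S = "tensor_rel C B"
  have rel: "(P f, P g) \<in> ?S \<longleftrightarrow> (f, g) \<in> ?R" if fg: "f \<in> free_space A B" "g \<in> free_space A B" for f g
  proof -
    have 1: "P (\<lambda>z. f z - g z) = (\<lambda>z. P f z - P g z)"
      using Padd[OF fg(1) free_space_scale[OF fg(2), of "-1"]] Pscale[OF fg(2), of "-1"] by simp
    have "P' (\<lambda>z. P f z - P g z) = (\<lambda>z. P' (P f) z - P' (P g) z)"
      using P'add[OF Pf[OF fg(1)] free_space_scale[OF Pf[OF fg(2)], of "-1"]] P'scale[OF Pf[OF fg(2)], of "-1"] by simp
    then have 2: "P' (\<lambda>z. P f z - P g z) = (\<lambda>z. f z - g z)" using P'P fg by simp
    show ?thesis using Prel[of "\<lambda>z. f z - g z"] P'rel[of "\<lambda>z. P f z - P g z"] 1 2 fg Pf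
      unfolding tensor_rel_def by auto
  qed
  define \<Psi> where "\<Psi> X = P ` X" for X
  have cls: "\<Psi> (?R `` {f}) = ?S `` {P f}" if f: "f \<in> free_space A B" for f
  proof (intro equalityI subsetI)
    fix w assume "w \<in> \<Psi> (?R `` {f})"
    then obtain g where "w = P g" "(f, g) \<in> ?R" by (auto simp: \<Psi>_def)
    moreover then have "g \<in> free_space A B" by (simp add: tensor_rel_def)
    ultimately show "w \<in> ?S `` {P f}" using rel f by auto
  next
    fix w assume w: "w \<in> ?S `` {P f}"
    then have wf: "w \<in> free_space C B" by (simp add: tensor_rel_def)
    then have "w = P (P' w)" using PP' by simp
    then show "w \<in> \<Psi> (?R `` {f})" using w rel[OF f P'f[OF wf]] by (auto simp: \<Psi>_def)
  qed
  have Ptimes: "P (tensor_times A B f g) = tensor_times C B (P f) (P g)"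
    if f: "f \<in> free_space A B" and g: "g \<in> free_space A B" for f g
  proof
    fix z
    let ?U = "{u. f u \<noteq> 0}" and ?V = "{v. g v \<noteq> 0}"
    \<comment> \<open>As \<open>h\<close> is injective on the generators in use, the pushforward
      merges no coefficients, and the double sum can be reindexed along \<open>h\<close>.\<close>
    have inj: "inj_on h (vcar A \<times> vcar B)" using h'h by (rule inj_on_inverseI)
    have val: "P f (h u) = f u" if "f \<in> free_space A B" "u \<in> vcar A \<times> vcar B" for f u
    proof -
      have "P f (h u) = (\<Sum>w | f w \<noteq> 0. if u = w then f w else 0)"
        unfolding P_def pushforward_def
        using fin[OF that(1)] that(2) inj by (intro sum.cong) (auto simp: point_mass_def dest: inj_onD)
      also have "\<dots> = f u" using fin(1)[OF that(1)] by (simp add: sum.delta)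
      finally show ?thesis .
    qed
    have hm: "h (simple_times A B u v) = simple_times C B (h u) (h v)"
      if "u \<in> vcar A \<times> vcar B" "v \<in> vcar A \<times> vcar B" for u v
      using that i by (auto simp: h_def)
    have "tensor_times A B f g = (\<lambda>z. \<Sum>(u, v)\<in>?U \<times> ?V. f u * g v * point_mass (simple_times A B u v) z)"
      by (rule ext) (simp only: tensor_times_sum[OF fin(1)[OF f] order_refl fin(1)[OF g] order_refl] sum.cartesian_product)
    then have "P (tensor_times A B f g) z =
        (\<Sum>w\<in>?U \<times> ?V. (f (fst w) * g (snd w)) * point_mass (h (simple_times A B (fst w) (snd w))) z)"
      using pushforward_sum_point_mass[of "?U \<times> ?V" h "\<lambda>w. f (fst w) * g (snd w)" "\<lambda>w. simple_times A B (fst w) (snd w)" z]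
        fin(1)[OF f] fin(1)[OF g] by (simp add: P_def case_prod_beta)
    also have "\<dots> = (\<Sum>u\<in>?U. \<Sum>v\<in>?V. f u * g v * point_mass (h (simple_times A B u v)) z)"
      by (simp add: sum.cartesian_product case_prod_beta)
    also have "\<dots> = (\<Sum>u\<in>?U. \<Sum>v\<in>?V. P f (h u) * P g (h v) * point_mass (simple_times C B (h u) (h v)) z)"
    proof (intro sum.cong refl)
      fix u v assume "u \<in> ?U" "v \<in> ?V"
      then have "u \<in> vcar A \<times> vcar B" "v \<in> vcar A \<times> vcar B" using fin(2)[OF f] fin(2)[OF g] by auto
      then show "f u * g v * point_mass (h (simple_times A B u v)) z =
          P f (h u) * P g (h v) * point_mass (simple_times C B (h u) (h v)) z"
        using val[OF f] val[OF g] hm by simp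
    qed
    also have "\<dots> = (\<Sum>u\<in>h ` ?U. \<Sum>v\<in>h ` ?V. P f u * P g v * point_mass (simple_times C B u v) z)"
      using fin(2)[OF f] fin(2)[OF g] inj by (subst (1 2) sum.reindex) (auto simp: inj_on_subset o_def)
    also have "\<dots> = tensor_times C B (P f) (P g) z"
      using fin(1)[OF f] fin(1)[OF g] pushforward_support[of h f] pushforward_support[of h g]
      by (intro tensor_times_sum[symmetric]) (auto simp: P_def)
    finally show "P (tensor_times A B f g) z = tensor_times C B (P f) (P g) z" .
  qed
  have Pstar: "P (tensor_star A B f) = tensor_star C B (P f)" if f: "f \<in> free_space A B" for f
  proof
    fix z
    let ?U = "{u. f u \<noteq> 0}" and ?s = "\<lambda>u. (astar A (fst u), astar B (snd u))" and ?t = "\<lambda>u. (astar C (fst u), astar B (snd u))"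
    have fin': "finite {u. cnj (f u) \<noteq> 0}" using fin[OF f] by simp
    have "P (tensor_star A B f) = pushforward (\<lambda>u. h (?s u)) (\<lambda>u. cnj (f u))"
      unfolding tensor_star_pushforward[OF fin(1)[OF f]] P_def by (rule pushforward_comp[OF fin'])
    also have "\<dots> = pushforward (\<lambda>u. ?t (h u)) (\<lambda>u. cnj (f u))"
      unfolding pushforward_def using fin(2)[OF f]
      by (intro ext sum.cong refl) (auto simp: h_def i)
    also have "\<dots> = pushforward ?t (pushforward h (\<lambda>u. cnj (f u)))"
      by (rule pushforward_comp[OF fin', symmetric])
    also have "pushforward h (\<lambda>u. cnj (f u)) = (\<lambda>u. cnj (P f u))"
      by (auto simp: P_def pushforward_def fun_eq_iff point_mass_def intro!: sum.cong)
    also have "pushforward ?t (\<lambda>u. cnj (P f u)) = tensor_star C B (P f)"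
      using fin(1)[OF Pf[OF f]] by (rule tensor_star_pushforward[symmetric])
    finally show "P (tensor_star A B f) z = tensor_star C B (P f) z" by simp
  qed
  have sub: "f \<in> free_space A B" if "X \<in> free_space A B // ?R" "f \<in> X" for X f
    using that by (auto simp: quotient_def tensor_rel_def)
  have "star_iso \<Psi> (algebraic_tensor A B) (algebraic_tensor C B)"
    unfolding star_iso_def linear_on_def algebraic_tensor_simps
  proof (intro conjI ballI allI)
    show bij: "bij_betw \<Psi> (free_space A B // ?R) (free_space C B // ?S)"
    proof (rule bij_betw_imageI)
      have "inj_on P (free_space A B)" by (rule inj_on_inverseI[where g = P']) (rule P'P)
      then have "inj_on \<Psi> (Pow (free_space A B))" unfolding \<Psi>_def by (rule inj_on_image_Pow)
      then show "inj_on \<Psi> (free_space A B // ?R)" by (rule inj_on_subset) (use sub in auto)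
      show "\<Psi> ` (free_space A B // ?R) = free_space C B // ?S"
      proof (intro equalityI subsetI)
        fix Y assume "Y \<in> \<Psi> ` (free_space A B // ?R)"
        then obtain f where "f \<in> free_space A B" "Y = \<Psi> (?R `` {f})" unfolding quotient_def by auto
        then show "Y \<in> free_space C B // ?S" using cls Pf by (auto intro: quotientI)
      next
        fix Y assume "Y \<in> free_space C B // ?S"
        then obtain w where w: "w \<in> free_space C B" "Y = ?S `` {w}" unfolding quotient_def by auto
        then have "Y = \<Psi> (?R `` {P' w})" using cls[OF P'f[OF w(1)]] PP' by simp
        then show "Y \<in> \<Psi> ` (free_space A B // ?R)" using P'f[OF w(1)] by (auto intro: quotientI)
      qed
    qed
    show "\<Psi> X \<in> free_space C B // ?S" if "X \<in> free_space A B // ?R" for X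
      using bij that by (auto simp: bij_betw_def)
  next
    fix X Y assume X: "X \<in> free_space A B // ?R" and Y: "Y \<in> free_space A B // ?R"
    have "\<Psi> (\<Union>f\<in>X. \<Union>g\<in>Y. ?R `` {\<lambda>z. f z + g z}) = (\<Union>f\<in>X. \<Union>g\<in>Y. \<Psi> (?R `` {\<lambda>z. f z + g z}))"
      by (simp add: \<Psi>_def image_UN)
    also have "\<dots> = (\<Union>f\<in>X. \<Union>g\<in>Y. ?S `` {\<lambda>z. P f z + P g z})"
      using sub[OF X] sub[OF Y] by (intro SUP_cong refl) (simp add: cls free_space_add Padd)
    also have "\<dots> = (\<Union>f\<in>\<Psi> X. \<Union>g\<in>\<Psi> Y. ?S `` {\<lambda>z. f z + g z})" by (simp add: \<Psi>_def)
    finally show "\<Psi> (\<Union>f\<in>X. \<Union>g\<in>Y. ?R `` {\<lambda>z. f z + g z}) = (\<Union>f\<in>\<Psi> X. \<Union>g\<in>\<Psi> Y. ?S `` {\<lambda>z. f z + g z})" .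
    have "\<Psi> (\<Union>f\<in>X. \<Union>g\<in>Y. ?R `` {tensor_times A B f g}) = (\<Union>f\<in>X. \<Union>g\<in>Y. \<Psi> (?R `` {tensor_times A B f g}))"
      by (simp add: \<Psi>_def image_UN)
    also have "\<dots> = (\<Union>f\<in>X. \<Union>g\<in>Y. ?S `` {tensor_times C B (P f) (P g)})"
      using sub[OF X] sub[OF Y] by (intro SUP_cong refl) (simp add: cls tensor_times_free[OF A B] Ptimes)
    also have "\<dots> = (\<Union>f\<in>\<Psi> X. \<Union>g\<in>\<Psi> Y. ?S `` {tensor_times C B f g})" by (simp add: \<Psi>_def)
    finally show "\<Psi> (\<Union>f\<in>X. \<Union>g\<in>Y. ?R `` {tensor_times A B f g}) = (\<Union>f\<in>\<Psi> X. \<Union>g\<in>\<Psi> Y. ?S `` {tensor_times C B f g})" .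
  next
    fix X c assume X: "X \<in> free_space A B // ?R"
    have "\<Psi> (\<Union>f\<in>X. ?R `` {\<lambda>z. c * f z}) = (\<Union>f\<in>X. \<Psi> (?R `` {\<lambda>z. c * f z}))"
      by (simp add: \<Psi>_def image_UN)
    also have "\<dots> = (\<Union>f\<in>X. ?S `` {\<lambda>z. c * P f z})"
      using sub[OF X] by (intro SUP_cong refl) (simp add: cls free_space_scale Pscale)
    finally show "\<Psi> (\<Union>f\<in>X. ?R `` {\<lambda>z. c * f z}) = (\<Union>f\<in>\<Psi> X. ?S `` {\<lambda>z. c * f z})" by (simp add: \<Psi>_def)
  next
    fix X assume X: "X \<in> free_space A B // ?R"
    have "\<Psi> (\<Union>f\<in>X. ?R `` {tensor_star A B f}) = (\<Union>f\<in>X. \<Psi> (?R `` {tensor_star A B f}))"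
      by (simp add: \<Psi>_def image_UN)
    also have "\<dots> = (\<Union>f\<in>X. ?S `` {tensor_star C B (P f)})"
      using sub[OF X] by (intro SUP_cong refl) (simp add: cls tensor_star_free[OF A B] Pstar)
    finally show "\<Psi> (\<Union>f\<in>X. ?R `` {tensor_star A B f}) = (\<Union>f\<in>\<Psi> X. ?S `` {tensor_star C B f})" by (simp add: \<Psi>_def)
  qed
  moreover have "\<Psi> (vzero (algebraic_tensor A B)) = vzero (algebraic_tensor C B)"
    using cls[OF free_space_zero] Pzero by (simp add: algebraic_tensor_simps)
  ultimately show ?thesis by blast
qed

lemma cstar_tensor_iso:
  assumes "star_algebra A" "star_algebra C" "star_algebra B" "star_iso \<phi> A C"
  shows "cstar_iso (cstar_tensor A B) (cstar_tensor C B)"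
  using algebraic_tensor_iso[OF assms] enveloping_cstar_iso[OF _ algebraic_tensor_closed[OF assms(1,3)]]
  unfolding cstar_tensor_def by blast

section \<open>Compact operators\<close>

lemma bounded_opD:
  assumes "T \<in> bounded_ops H"
  shows "bounded_op H T" "\<xi> \<in> vcar H \<Longrightarrow> T \<xi> \<in> vcar H" "\<xi> \<notin> vcar H \<Longrightarrow> T \<xi> = vzero H"
    "\<lbrakk>\<xi> \<in> vcar H; \<eta> \<in> vcar H\<rbrakk> \<Longrightarrow> T (vadd H \<xi> \<eta>) = vadd H (T \<xi>) (T \<eta>)"
    "\<xi> \<in> vcar H \<Longrightarrow> T (vscale H c \<xi>) = vscale H c (T \<xi>)"
  using assms unfolding bounded_ops_def bounded_op_def linear_on_def by auto

text \<open>The property under the \<open>THE\<close> that defines \<open>astar\<close> on compact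
  operators, as a relation, so that existence and uniqueness can be treated apart.\<close>

definition adjoint_of :: "('h, 'm) hilb_scheme \<Rightarrow> ('h \<Rightarrow> 'h) \<Rightarrow> ('h \<Rightarrow> 'h) \<Rightarrow> bool" where
  "adjoint_of H T S \<longleftrightarrow> S \<in> bounded_ops H \<and>
     (\<forall>\<xi>\<in>vcar H. \<forall>\<eta>\<in>vcar H. hinner H (S \<xi>) \<eta> = hinner H \<xi> (T \<eta>))"

context hilbert_space
begin

lemma bounded_opE:
  assumes "bounded_op H T"
  obtains C where "C > 0" "\<And>\<xi>. \<xi> \<in> vcar H \<Longrightarrow> hnorm H (T \<xi>) \<le> C * hnorm H \<xi>"
proof -
  obtain C where C: "\<And>\<xi>. \<xi> \<in> vcar H \<Longrightarrow> hnorm H (T \<xi>) \<le> C * hnorm H \<xi>"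
    using assms unfolding bounded_op_def by auto
  have "hnorm H (T \<xi>) \<le> max C 1 * hnorm H \<xi>" if "\<xi> \<in> vcar H" for \<xi>
    using C[OF that] mult_right_mono[OF max.cobounded1[of C 1] hnorm_nonneg[OF that]] by linarith
  then show thesis by (intro that[of "max C 1"]) auto
qed

lemma bounded_opsI:
  assumes "\<And>\<xi>. \<xi> \<in> vcar H \<Longrightarrow> T \<xi> \<in> vcar H" "\<And>\<xi>. \<xi> \<notin> vcar H \<Longrightarrow> T \<xi> = vzero H"
    "\<And>\<xi> \<eta>. \<lbrakk>\<xi> \<in> vcar H; \<eta> \<in> vcar H\<rbrakk> \<Longrightarrow> T (vadd H \<xi> \<eta>) = vadd H (T \<xi>) (T \<eta>)"
    "\<And>\<xi> c. \<xi> \<in> vcar H \<Longrightarrow> T (vscale H c \<xi>) = vscale H c (T \<xi>)"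
    "\<And>\<xi>. \<xi> \<in> vcar H \<Longrightarrow> hnorm H (T \<xi>) \<le> C * hnorm H \<xi>"
  shows "T \<in> bounded_ops H"
proof -
  have "\<exists>C. \<forall>\<xi>\<in>vcar H. hnorm H (T \<xi>) \<le> C * hnorm H \<xi>" using assms(5) by blast
  then show ?thesis using assms(1-4) unfolding bounded_ops_def bounded_op_def linear_on_def by auto
qed

lemma inner_ext:
  assumes "x \<in> vcar H" "y \<in> vcar H" "\<And>z. z \<in> vcar H \<Longrightarrow> hinner H x z = hinner H y z"
  shows "x = y"
proof -
  have d: "vdiff H x y \<in> vcar H" using assms diff_closed by blast
  have "hinner H (vdiff H x y) (vdiff H x y) = 0"
    using inner_diff(1)[of x y "vdiff H x y"] assms(1,2) assms(3)[OF d] d by simp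
  then show ?thesis using inner_eq_zero[OF d] diff_eq_zero assms(1,2) by blast
qed

lemma adjoint_unique:
  assumes "adjoint_of H T S" "adjoint_of H T S'" shows "S = S'"
proof
  fix \<xi> show "S \<xi> = S' \<xi>"
    using assms inner_ext[of "S \<xi>" "S' \<xi>"] bounded_opD(2,3)[of S H \<xi>] bounded_opD(2,3)[of S' H \<xi>]
    unfolding adjoint_of_def by (cases "\<xi> \<in> vcar H") auto
qed

lemma bounded_ops_add:
  assumes S: "S \<in> bounded_ops H" and T: "T \<in> bounded_ops H"
  shows "(\<lambda>\<xi>. vadd H (S \<xi>) (T \<xi>)) \<in> bounded_ops H"
proof -
  obtain C D where C: "\<And>\<xi>. \<xi> \<in> vcar H \<Longrightarrow> hnorm H (S \<xi>) \<le> C * hnorm H \<xi>"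
    and D: "\<And>\<xi>. \<xi> \<in> vcar H \<Longrightarrow> hnorm H (T \<xi>) \<le> D * hnorm H \<xi>"
    using bounded_opE bounded_opD(1) S T by metis
  show ?thesis
  proof (rule bounded_opsI)
    fix \<xi> assume "\<xi> \<in> vcar H"
    then show "hnorm H (vadd H (S \<xi>) (T \<xi>)) \<le> (C + D) * hnorm H \<xi>"
      using hnorm_triangle[of "S \<xi>" "T \<xi>"] C[of \<xi>] D[of \<xi>] bounded_opD(2)[OF S] bounded_opD(2)[OF T]
      by (fastforce simp: distrib_right)
  qed (auto simp: bounded_opD[OF S] bounded_opD[OF T] add_closed scale_add scale_closed zero_closed zero_add
      intro: add_swap)
qed

lemma bounded_ops_scale:
  assumes S: "S \<in> bounded_ops H" shows "(\<lambda>\<xi>. vscale H c (S \<xi>)) \<in> bounded_ops H"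
proof -
  obtain C where C: "\<And>\<xi>. \<xi> \<in> vcar H \<Longrightarrow> hnorm H (S \<xi>) \<le> C * hnorm H \<xi>"
    using bounded_opE bounded_opD(1) S by metis
  show ?thesis
  proof (rule bounded_opsI)
    fix \<xi> assume "\<xi> \<in> vcar H"
    then show "hnorm H (vscale H c (S \<xi>)) \<le> (cmod c * C) * hnorm H \<xi>"
      using C[of \<xi>] bounded_opD(2)[OF S] by (simp add: hnorm_scale mult.assoc mult_left_mono)
  qed (auto simp: bounded_opD[OF S] scale_closed scale_add scale_scale mult.commute scale_zero)
qed

lemma bounded_ops_comp:
  assumes S: "S \<in> bounded_ops H" and T: "T \<in> bounded_ops H"
  shows "S \<circ> T \<in> bounded_ops H"
proof -
  obtain C D where C: "C > 0" "\<And>\<xi>. \<xi> \<in> vcar H \<Longrightarrow> hnorm H (S \<xi>) \<le> C * hnorm H \<xi>"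
    and D: "\<And>\<xi>. \<xi> \<in> vcar H \<Longrightarrow> hnorm H (T \<xi>) \<le> D * hnorm H \<xi>"
    using bounded_opE bounded_opD(1) S T by metis
  have S0: "S (vzero H) = vzero H"
    using bounded_opD(5)[OF S zero_closed, of 0] bounded_opD(2)[OF S zero_closed] by (simp add: scale_zero_left scale_zero)
  show ?thesis
  proof (rule bounded_opsI)
    fix \<xi> assume \<xi>: "\<xi> \<in> vcar H"
    have "hnorm H (S (T \<xi>)) \<le> C * hnorm H (T \<xi>)" using C(2) bounded_opD(2)[OF T \<xi>] by blast
    also have "\<dots> \<le> C * (D * hnorm H \<xi>)" using C(1) D[OF \<xi>] by (intro mult_left_mono) auto
    finally show "hnorm H ((S \<circ> T) \<xi>) \<le> (C * D) * hnorm H \<xi>" by (simp add: mult.assoc)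
  qed (auto simp: bounded_opD[OF S] bounded_opD[OF T] S0)
qed

lemma N_tendsto_subseq:
  "N_tendsto H N x l \<Longrightarrow> strict_mono r \<Longrightarrow> N_tendsto H N (\<lambda>n. x (r n)) l"
  unfolding N_tendsto_def
  using LIMSEQ_subseq_LIMSEQ[of "\<lambda>n. N (vdiff H (x n) l)" 0 r] by (simp add: o_def)

lemma compact_opE:
  fixes x :: "nat \<Rightarrow> 'a"
  assumes "compact_op H T" "\<And>n. x n \<in> vcar H" "\<And>n. hnorm H (x n) \<le> 1"
  obtains r l where "strict_mono r" "l \<in> vcar H" "N_tendsto H (hnorm H) (\<lambda>n. T (x (r n))) l"
  using assms(1)[unfolded compact_op_def, rule_format, of x] assms(2,3) that by blast

lemma compact_op_add:
  assumes S: "S \<in> bounded_ops H" "compact_op H S" and T: "T \<in> bounded_ops H" "compact_op H T"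
  shows "compact_op H (\<lambda>\<xi>. vadd H (S \<xi>) (T \<xi>))"
  unfolding compact_op_def
proof (intro allI impI)
  fix x :: "nat \<Rightarrow> 'a" assume x: "\<forall>n. x n \<in> vcar H \<and> hnorm H (x n) \<le> 1"
  obtain r l where r: "strict_mono r" "l \<in> vcar H" "N_tendsto H (hnorm H) (\<lambda>n. T (x (r n))) l"
    using compact_opE[OF T(2)] x by blast
  obtain s m where s: "strict_mono s" "m \<in> vcar H" "N_tendsto H (hnorm H) (\<lambda>n. S (x (r (s n)))) m"
    using compact_opE[OF S(2), of "\<lambda>n. x (r n)"] x by blast
  have "N_tendsto H (hnorm H) (\<lambda>n. vadd H (S (x (r (s n)))) (T (x (r (s n))))) (vadd H m l)"
    using x bounded_opD(2)[OF S(1)] bounded_opD(2)[OF T(1)] s r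
    by (intro tendsto_hadd N_tendsto_subseq[OF r(3)]) auto
  then show "\<exists>r l. strict_mono r \<and> l \<in> vcar H \<and> N_tendsto H (hnorm H) (\<lambda>n. vadd H (S (x (r n))) (T (x (r n)))) l"
    using strict_mono_o[OF r(1) s(1)] add_closed[OF s(2) r(2)] unfolding o_def by blast
qed

lemma compact_op_bounded_comp:
  assumes S: "bounded_op H S" and T: "bounded_op H T" "compact_op H T"
  shows "compact_op H (\<lambda>\<xi>. S (T \<xi>))"
  unfolding compact_op_def
proof (intro allI impI)
  fix x :: "nat \<Rightarrow> 'a" assume x: "\<forall>n. x n \<in> vcar H \<and> hnorm H (x n) \<le> 1"
  obtain r l where r: "strict_mono r" "l \<in> vcar H" "N_tendsto H (hnorm H) (\<lambda>n. T (x (r n))) l"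
    using compact_opE[OF T(2)] x by blast
  have "range (\<lambda>n. T (x (r n))) \<subseteq> vcar H" "S l \<in> vcar H"
    using T(1) S x r unfolding bounded_op_def linear_on_def by auto
  then show "\<exists>r l. strict_mono r \<and> l \<in> vcar H \<and> N_tendsto H (hnorm H) (\<lambda>n. S (T (x (r n)))) l"
    using tendsto_bounded_op[OF S _ r(2,3)] r by blast
qed

text \<open>Schauder's theorem by the direct estimate |S d|^2 = <d, T S d>: if the images under
  \<open>T\<close> of the rescaled vectors \<open>S (x n)\<close> converge along a subsequence, then
  the vectors \<open>S (x n)\<close> are Cauchy along it.\<close>

lemma compact_op_adjoint:
  assumes T: "T \<in> bounded_ops H" "compact_op H T" and adj: "adjoint_of H T S"
  shows "compact_op H S"
  unfolding compact_op_def
proof (intro allI impI)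
  fix x :: "nat \<Rightarrow> 'a" assume x: "\<forall>n. x n \<in> vcar H \<and> hnorm H (x n) \<le> 1"
  have S: "S \<in> bounded_ops H" using adj by (simp add: adjoint_of_def)
  obtain C where C: "C > 0" "\<And>\<xi>. \<xi> \<in> vcar H \<Longrightarrow> hnorm H (S \<xi>) \<le> C * hnorm H \<xi>"
    using bounded_opE bounded_opD(1)[OF S] by metis
  \<comment> \<open>Compactness is stated for sequences in the unit ball; dividing by the bound
    \<open>C\<close> of \<open>S\<close> brings the vectors \<open>S (x n)\<close> there.\<close>
  define y where "y n = vscale H (of_real (1 / C)) (S (x n))" for n
  have Sx: "S (x n) \<in> vcar H" "x n \<in> vcar H" "hnorm H (x n) \<le> 1" for n using x bounded_opD(2)[OF S] by auto
  have "hnorm H (S (x n)) \<le> C" for n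
    using C Sx[of n] by (meson mult_left_le order.trans less_imp_le)
  then have y: "y n \<in> vcar H" "hnorm H (y n) \<le> 1" for n
    using Sx C(1) by (auto simp: y_def scale_closed hnorm_scale norm_divide)
  obtain r l where r: "strict_mono r" "l \<in> vcar H" "N_tendsto H (hnorm H) (\<lambda>n. T (y (r n))) l"
    using compact_opE[OF T(2), of y] y by blast
  have Ty: "T (y n) \<in> vcar H" for n using bounded_opD(2)[OF T(1) y(1)] .
  have cau: "N_Cauchy H (hnorm H) (\<lambda>n. T (y (r n)))"
    using Ty r by (intro Cauchy_if_tendsto) auto
  \<comment> \<open>The factor 2 bounds the distance of two vectors of the unit ball, and
    \<open>C\<close> undoes the rescaling in \<open>y\<close>.\<close>
  have key: "(hnorm H (vdiff H (S (x p)) (S (x q))))\<^sup>2 \<le> 2 * C * hnorm H (vdiff H (T (y p)) (T (y q)))" for p q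
  proof -
    let ?d = "vdiff H (x p) (x q)"
    have d: "?d \<in> vcar H" using Sx diff_closed by blast
    have "hnorm H ?d \<le> hnorm H (x p) + hnorm H (x q)"
      using Sx hnorm_diff_triangle[of "x p" "vzero H" "x q"] zero_closed hnorm_diff_commute[of "vzero H" "x q"]
      by (simp add: diff_zero)
    then have d2: "hnorm H ?d \<le> 2" using Sx(3)[of p] Sx(3)[of q] by linarith
    have Sd: "S ?d = vdiff H (S (x p)) (S (x q))" "S ?d \<in> vcar H"
      using bounded_opD[OF S] Sx d by (auto simp: vdiff_def scale_closed add_closed)
    have "T (S ?d) = vdiff H (T (S (x p))) (T (S (x q)))"
      using bounded_opD[OF T(1)] Sx by (simp add: Sd(1)) (simp add: vdiff_def scale_closed)
    also have "\<dots> = vscale H (of_real C) (vdiff H (T (y p)) (T (y q)))"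
      using C(1) bounded_opD[OF T(1)] Sx by (simp add: scale_diff scale_closed y_def scale_scale scale_one)
    finally have TS: "hnorm H (T (S ?d)) = C * hnorm H (vdiff H (T (y p)) (T (y q)))"
      using C(1) Ty by (simp add: hnorm_scale diff_closed)
    have "(hnorm H (S ?d))\<^sup>2 = cmod (hinner H (S ?d) (S ?d))" using inner_self[OF Sd(2)] by (simp add: norm_power)
    also have "hinner H (S ?d) (S ?d) = hinner H ?d (T (S ?d))" using adj d Sd(2) unfolding adjoint_of_def by blast
    also have "cmod (hinner H ?d (T (S ?d))) \<le> hnorm H ?d * hnorm H (T (S ?d))"
      using Cauchy_Schwarz d bounded_opD(2)[OF T(1) Sd(2)] by blast
    also have "\<dots> \<le> 2 * hnorm H (T (S ?d))"
      using d2 hnorm_nonneg[OF bounded_opD(2)[OF T(1) Sd(2)]] by (intro mult_right_mono) auto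
    finally have "(hnorm H (S ?d))\<^sup>2 \<le> 2 * (C * hnorm H (vdiff H (T (y p)) (T (y q))))" unfolding TS .
    then show ?thesis by (simp add: Sd(1))
  qed
  have "N_Cauchy H (hnorm H) (\<lambda>n. S (x (r n)))"
    unfolding N_Cauchy_def
  proof (intro conjI allI impI)
    show "range (\<lambda>n. S (x (r n))) \<subseteq> vcar H" using Sx by auto
    fix e :: real assume e: "e > 0"
    then have "e\<^sup>2 / (2 * C) > 0" using C by simp
    then obtain M where M: "\<And>m n. m \<ge> M \<Longrightarrow> n \<ge> M \<Longrightarrow> hnorm H (vdiff H (T (y (r m))) (T (y (r n)))) < e\<^sup>2 / (2 * C)"
      using cau unfolding N_Cauchy_def by meson
    show "\<exists>M. \<forall>m\<ge>M. \<forall>n\<ge>M. hnorm H (vdiff H (S (x (r m))) (S (x (r n)))) < e"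
    proof (intro exI allI impI)
      fix m n assume "M \<le> m" "M \<le> n"
      then have "2 * C * hnorm H (vdiff H (T (y (r m))) (T (y (r n)))) < e\<^sup>2"
        using M[of m n] C(1) by (simp add: field_simps)
      then have "(hnorm H (vdiff H (S (x (r m))) (S (x (r n)))))\<^sup>2 < e\<^sup>2" using key[of "r m" "r n"] by linarith
      then show "hnorm H (vdiff H (S (x (r m))) (S (x (r n)))) < e" using e power2_less_imp_less by fastforce
    qed
  qed
  then obtain m where "m \<in> vcar H" "N_tendsto H (hnorm H) (\<lambda>n. S (x (r n))) m"
    using complete unfolding N_complete_def by blast
  then show "\<exists>r l. strict_mono r \<and> l \<in> vcar H \<and> N_tendsto H (hnorm H) (\<lambda>n. S (x (r n))) l"
    using r(1) by blast
qed

text \<open>Existence of adjoints enters as a hypothesis; it is discharged for \<open>ell2\<close>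
  in coordinates. With uniqueness, each law of the involution reduces to checking the adjoint
  identity.\<close>

lemma star_algebra_compact_operators:
  assumes ex: "\<And>T. T \<in> bounded_ops H \<Longrightarrow> \<exists>S. adjoint_of H T S"
  shows "star_algebra (compact_operators H)"
proof -
  let ?K = "compact_operators H"
  have car: "T \<in> vcar ?K \<longleftrightarrow> T \<in> bounded_ops H \<and> compact_op H T" for T by (simp add: compact_operators_def)
  have op: "vadd ?K S T = (\<lambda>\<xi>. vadd H (S \<xi>) (T \<xi>))" "vzero ?K = (\<lambda>\<xi>. vzero H)"
    "vscale ?K c T = (\<lambda>\<xi>. vscale H c (T \<xi>))" "atimes ?K S T = S \<circ> T" for S T c
    by (simp_all add: compact_operators_def)
  have adj: "adjoint_of H T (astar ?K T)" if "T \<in> bounded_ops H" for T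
  proof -
    have "\<exists>!S. adjoint_of H T S" using ex[OF that] adjoint_unique by blast
    from theI'[OF this] show ?thesis by (simp add: compact_operators_def adjoint_of_def)
  qed
  have st: "astar ?K T = S" if "T \<in> bounded_ops H" "adjoint_of H T S" for S T
    using adj adjoint_unique that by blast
  have in_car: "T \<xi> \<in> vcar H" if "T \<in> bounded_ops H" for T \<xi>
    using bounded_opD[OF that] zero_closed by metis
  have zero: "(\<lambda>\<xi>. vzero H) \<in> vcar ?K"
    unfolding car compact_op_def N_tendsto_def
    by (auto simp: zero_closed zero_add scale_zero hnorm_zero diff_self hnorm_nonneg strict_mono_id
        intro!: bounded_opsI[of _ 1] exI[of _ id] bexI[of _ "vzero H"] exI[of _ "vzero H"])
  have scale: "(\<lambda>\<xi>. vscale H c (T \<xi>)) \<in> vcar ?K" if "T \<in> vcar ?K" for c T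
  proof -
    \<comment> \<open>A scalar multiple of a compact operator is viewed as a composition with a
      multiple of the identity, extended by \<open>vzero\<close> as \<open>bounded_ops\<close>
      demands.\<close>
    have id: "(\<lambda>\<xi>. if \<xi> \<in> vcar H then \<xi> else vzero H) \<in> bounded_ops H"
      by (rule bounded_opsI[of _ 1]) (auto simp: add_closed scale_closed)
    have "bounded_op H (\<lambda>\<xi>. vscale H c (if \<xi> \<in> vcar H then \<xi> else vzero H))"
      using bounded_opD(1)[OF bounded_ops_scale[OF id]] by simp
    from compact_op_bounded_comp[OF this bounded_opD(1)] that
    show ?thesis using bounded_ops_scale in_car by (simp add: car)
  qed
  have star: "adjoint_of H T (astar ?K T)" "astar ?K T \<in> bounded_ops H" "astar ?K T \<in> vcar ?K"
     if "T \<in> vcar ?K" for T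
    using adj that compact_op_adjoint adj unfolding car adjoint_of_def by auto
  have inner: "hinner H (astar ?K T \<xi>) \<eta> = hinner H \<xi> (T \<eta>)" "hinner H (T \<xi>) \<eta> = hinner H \<xi> (astar ?K T \<eta>)"
    if "T \<in> vcar ?K" "\<xi> \<in> vcar H" "\<eta> \<in> vcar H" for T \<xi> \<eta>
  proof -
    have *: "hinner H (astar ?K T \<xi>) \<eta> = hinner H \<xi> (T \<eta>)" if "\<xi> \<in> vcar H" "\<eta> \<in> vcar H" for \<xi> \<eta>
      using star(1)[OF \<open>T \<in> vcar ?K\<close>] that unfolding adjoint_of_def by blast
    then show "hinner H (astar ?K T \<xi>) \<eta> = hinner H \<xi> (T \<eta>)" using that by blast
    have T: "T \<in> bounded_ops H" "astar ?K T \<in> bounded_ops H" using that star by (auto simp: car)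
    show "hinner H (T \<xi>) \<eta> = hinner H \<xi> (astar ?K T \<eta>)"
      using *[of \<eta> \<xi>] inner_cnj[of \<eta> "T \<xi>"] inner_cnj[of "astar ?K T \<eta>" \<xi>] that in_car[OF T(1)] in_car[OF T(2)] by simp
  qed
  show ?thesis
  proof unfold_locales
    fix S T assume ST: "S \<in> vcar ?K" "T \<in> vcar ?K"
    then show c: "vadd ?K S T \<in> vcar ?K" using bounded_ops_add compact_op_add by (auto simp: car op)
    show c2: "atimes ?K S T \<in> vcar ?K"
      using ST bounded_ops_comp compact_op_bounded_comp[of S T] bounded_opD(1) by (auto simp: car op o_def)
    show "vadd ?K S T = vadd ?K T S" using ST in_car by (auto simp: car op intro!: ext add_comm)
    show "astar ?K (vadd ?K S T) = vadd ?K (astar ?K S) (astar ?K T)"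
      using ST c in_car star(2)[OF ST(1)] star(2)[OF ST(2)]
      by (intro st) (auto simp: car op adjoint_of_def inner_add inner_add_right inner intro!: bounded_ops_add)
    show "astar ?K (atimes ?K S T) = atimes ?K (astar ?K T) (astar ?K S)"
      using ST c2 in_car star(2)[OF ST(1)] star(2)[OF ST(2)]
      by (intro st) (auto simp: car op adjoint_of_def inner intro!: bounded_ops_comp)
    show "atimes ?K (vscale ?K c S) T = vscale ?K c (atimes ?K S T)" for c by (simp add: op o_def)
    show "atimes ?K S (vscale ?K c T) = vscale ?K c (atimes ?K S T)" for c
      using ST in_car bounded_opD(5)[of S H] by (auto simp: op o_def car)
  next
    fix T c assume T: "T \<in> vcar ?K"
    show s: "vscale ?K c T \<in> vcar ?K" using scale[OF T] by (simp add: op)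
    show "astar ?K (vscale ?K c T) = vscale ?K (cnj c) (astar ?K T)"
      using T s in_car star(2)[OF T]
      by (intro st) (auto simp: car op adjoint_of_def inner_scale inner_scale_right inner intro!: bounded_ops_scale)
    show "\<exists>S\<in>vcar ?K. vadd ?K T S = vzero ?K"
      using scale[OF T, of "-1"] T in_car by (intro bexI[of _ "\<lambda>\<xi>. vscale H (-1) (T \<xi>)"]) (auto simp: op car add_neg)
    show "astar ?K T \<in> vcar ?K" using star T by blast
    show "astar ?K (astar ?K T) = T"
      using T star[OF T] by (intro st) (auto simp: car adjoint_of_def inner)
  next
    fix R S T assume "R \<in> vcar ?K" "S \<in> vcar ?K" "T \<in> vcar ?K"
    then show "vadd ?K (vadd ?K R S) T = vadd ?K R (vadd ?K S T)"
      "atimes ?K R (vadd ?K S T) = vadd ?K (atimes ?K R S) (atimes ?K R T)"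
      using in_car bounded_opD(4)[of R H] by (auto simp: op car add_assoc)
  qed (auto simp: op car in_car zero[unfolded car] scale_add add_scale scale_scale scale_one zero_add)
qed

end

section \<open>The Hilbert space of square-summable sequences\<close>

lemma sum_square_le:
  fixes a b :: complex shows "(cmod (a + b))\<^sup>2 \<le> 2 * (cmod a)\<^sup>2 + 2 * (cmod b)\<^sup>2"
proof -
  have "(cmod (a + b))\<^sup>2 \<le> (cmod a + cmod b)\<^sup>2" by (intro power_mono norm_triangle_ineq) auto
  also have "\<dots> \<le> 2 * (cmod a)\<^sup>2 + 2 * (cmod b)\<^sup>2"
    using sum_squares_ge_zero[of "cmod a - cmod b" 0] by (simp add: power2_eq_square algebra_simps)
  finally show ?thesis .
qed

lemma ell2_simps:
  "x \<in> vcar ell2 \<longleftrightarrow> summable (\<lambda>n. (cmod (x n))\<^sup>2)" "vadd ell2 x y = (\<lambda>n. x n + y n)"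
  "vzero ell2 = (\<lambda>n. 0)" "vscale ell2 c x = (\<lambda>n. c * x n)" "hinner ell2 x y = (\<Sum>n. x n * cnj (y n))"
  "vdiff ell2 x y = (\<lambda>n. x n - y n)"
  by (simp_all add: ell2_def vdiff_def)

lemma ell2_add: "\<lbrakk>x \<in> vcar ell2; y \<in> vcar ell2\<rbrakk> \<Longrightarrow> (\<lambda>n. x n + y n) \<in> vcar ell2"
  unfolding ell2_simps
  by (rule summable_comparison_test'[of "\<lambda>n. 2 * (cmod (x n))\<^sup>2 + 2 * (cmod (y n))\<^sup>2" 0])
    (auto intro!: summable_add summable_mult sum_square_le)

lemma ell2_scale: "x \<in> vcar ell2 \<Longrightarrow> (\<lambda>n. c * x n) \<in> vcar ell2"
  by (simp add: ell2_simps norm_mult power_mult_distrib summable_mult)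

lemma ell2_inner_summable: "\<lbrakk>x \<in> vcar ell2; y \<in> vcar ell2\<rbrakk> \<Longrightarrow> summable (\<lambda>n. x n * cnj (y n))"
  unfolding ell2_simps
proof (rule summable_comparison_test'[of "\<lambda>n. (cmod (x n))\<^sup>2 + (cmod (y n))\<^sup>2" 0])
  fix n show "norm (x n * cnj (y n)) \<le> (cmod (x n))\<^sup>2 + (cmod (y n))\<^sup>2"
  proof -
    have "0 \<le> (cmod (x n) - cmod (y n))\<^sup>2" "0 \<le> cmod (x n) * cmod (y n)" by auto
    then show ?thesis unfolding power2_diff norm_mult complex_mod_cnj by linarith
  qed
qed (rule summable_add)

lemma ell2_inner_self: "x \<in> vcar ell2 \<Longrightarrow> hinner ell2 x x = of_real (\<Sum>n. (cmod (x n))\<^sup>2)"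
  by (simp add: ell2_simps suminf_of_real flip: complex_norm_square)

lemma ell2_hnorm: "x \<in> vcar ell2 \<Longrightarrow> hnorm ell2 x = sqrt (\<Sum>n. (cmod (x n))\<^sup>2)"
  by (simp add: hnorm_def ell2_inner_self)

lemma ell2_partial:
  assumes "x \<in> vcar ell2" shows "(\<Sum>n<N. (cmod (x n))\<^sup>2) \<le> (hnorm ell2 x)\<^sup>2"
  using assms sum_le_suminf[of "\<lambda>n. (cmod (x n))\<^sup>2" "{..<N}"]
  by (simp add: ell2_hnorm ell2_simps suminf_nonneg)

text \<open>A uniform bound on partial sums yields membership and the norm bound at once;
  completeness and the construction of adjoints both rest on this.\<close>

lemma ell2I:
  assumes "\<And>N. (\<Sum>n<N. (cmod (x n))\<^sup>2) \<le> C\<^sup>2" "C \<ge> 0"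
  shows "x \<in> vcar ell2" "hnorm ell2 x \<le> C"
proof -
  have s: "summable (\<lambda>n. (cmod (x n))\<^sup>2)" using assms
    by (intro bounded_imp_summable[of _ "C\<^sup>2"]) (auto simp only: lessThan_Suc_atMost[symmetric] zero_le_power2)
  then show x: "x \<in> vcar ell2" by (simp add: ell2_simps)
  have "(\<Sum>n. (cmod (x n))\<^sup>2) \<le> C\<^sup>2" using s assms by (intro suminf_le_const) auto
  then show "hnorm ell2 x \<le> C" using x assms by (simp add: ell2_hnorm real_le_lsqrt suminf_nonneg s)
qed

lemma ell2_coordinate: "x \<in> vcar ell2 \<Longrightarrow> cmod (x n) \<le> hnorm ell2 x"
proof -
  assume x: "x \<in> vcar ell2"
  have "(cmod (x n))\<^sup>2 \<le> (\<Sum>n<Suc n. (cmod (x n))\<^sup>2)" by (simp add: sum_nonneg)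
  then have "(cmod (x n))\<^sup>2 \<le> (hnorm ell2 x)\<^sup>2" using ell2_partial[OF x, of "Suc n"] by linarith
  moreover have "hnorm ell2 x \<ge> 0" using x by (simp add: ell2_hnorm suminf_nonneg ell2_simps)
  ultimately show ?thesis by (rule power2_le_imp_le)
qed

interpretation ell2: hilbert_space ell2
proof unfold_locales
  fix x y z assume xyz: "x \<in> vcar ell2" "y \<in> vcar ell2" "z \<in> vcar ell2"
  show "hinner ell2 (vadd ell2 x y) z = hinner ell2 x z + hinner ell2 y z"
    using xyz ell2_inner_summable by (simp add: ell2_simps(2,5) distrib_right suminf_add)
next
  fix x y c assume xy: "x \<in> vcar ell2" "y \<in> vcar ell2"
  show "hinner ell2 (vscale ell2 c x) y = c * hinner ell2 x y"
    using xy ell2_inner_summable by (simp add: ell2_simps(4,5) mult.assoc suminf_mult)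
  show "hinner ell2 y x = cnj (hinner ell2 x y)"
    using bounded_linear.suminf[OF bounded_linear_cnj ell2_inner_summable[OF xy]] by (simp add: ell2_simps(5) mult.commute)
next
  fix x assume x: "x \<in> vcar ell2"
  show "0 \<le> Re (hinner ell2 x x)" using x by (simp add: ell2_inner_self) (simp add: suminf_nonneg ell2_simps)
  assume "hinner ell2 x x = 0"
  then have "(\<Sum>n. (cmod (x n))\<^sup>2) = 0" using ell2_inner_self[OF x] by (metis of_real_eq_0_iff)
  then show "x = vzero ell2" using x suminf_eq_zero_iff[of "\<lambda>n. (cmod (x n))\<^sup>2"] by (auto simp: ell2_simps)
next
  show "N_complete ell2 (hnorm ell2)"
    unfolding N_complete_def
  proof (intro allI impI)
    fix x assume "N_Cauchy ell2 (hnorm ell2) x"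
    then have x: "x n \<in> vcar ell2" and
      cau: "\<And>e. e > 0 \<Longrightarrow> \<exists>M. \<forall>m\<ge>M. \<forall>n\<ge>M. hnorm ell2 (vdiff ell2 (x m) (x n)) < e" for n
      unfolding N_Cauchy_def by auto
    have d: "vdiff ell2 u v \<in> vcar ell2" if "u \<in> vcar ell2" "v \<in> vcar ell2" for u v
      using ell2_add[OF that(1) ell2_scale[OF that(2), of "-1"]] by (simp add: ell2_simps(6))
    have "Cauchy (\<lambda>n. x n k)" for k
    proof (rule metric_CauchyI)
      fix e :: real assume "e > 0"
      then obtain M where M: "\<forall>m\<ge>M. \<forall>n\<ge>M. hnorm ell2 (vdiff ell2 (x m) (x n)) < e" using cau by blast
      show "\<exists>M. \<forall>m\<ge>M. \<forall>n\<ge>M. dist (x m k) (x n k) < e"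
      proof (intro exI allI impI)
        fix m n assume "M \<le> m" "M \<le> n"
        then show "dist (x m k) (x n k) < e"
          using M ell2_coordinate[OF d[OF x x], of m n k] by (fastforce simp: dist_norm ell2_simps(6))
      qed
    qed
    then have "\<forall>k. \<exists>l. (\<lambda>n. x n k) \<longlonglongrightarrow> l" using Cauchy_convergent convergent_def by blast
    then obtain l where l: "\<And>k. (\<lambda>n. x n k) \<longlonglongrightarrow> l k" by metis
    \<comment> \<open>Finite partial sums pass to the coordinatewise limit, so the Cauchy estimate
      survives with \<open>l\<close> in place of \<open>x n\<close>. In particular
      \<open>x M - l\<close> is square-summable, and hence so is \<open>l\<close>.\<close>
    have tail: "\<exists>M. \<forall>m\<ge>M. vdiff ell2 (x m) l \<in> vcar ell2 \<and> hnorm ell2 (vdiff ell2 (x m) l) \<le> e" if "e > 0" for e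
    proof -
      obtain M where M: "\<forall>m\<ge>M. \<forall>n\<ge>M. hnorm ell2 (vdiff ell2 (x m) (x n)) < e" using cau \<open>e > 0\<close> by blast
      have "(\<Sum>k<N. (cmod (vdiff ell2 (x m) l k))\<^sup>2) \<le> e\<^sup>2" if m: "m \<ge> M" for m N
      proof (rule LIMSEQ_le_const2)
        show "(\<lambda>n. \<Sum>k<N. (cmod (vdiff ell2 (x m) (x n) k))\<^sup>2) \<longlonglongrightarrow> (\<Sum>k<N. (cmod (vdiff ell2 (x m) l k))\<^sup>2)"
          unfolding ell2_simps(6) by (intro tendsto_intros l)
        show "\<exists>K. \<forall>n\<ge>K. (\<Sum>k<N. (cmod (vdiff ell2 (x m) (x n) k))\<^sup>2) \<le> e\<^sup>2"
        proof (intro exI allI impI)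
          fix n assume "M \<le> n"
          then have "hnorm ell2 (vdiff ell2 (x m) (x n)) < e" using M m by blast
          moreover have "0 \<le> hnorm ell2 (vdiff ell2 (x m) (x n))"
            using d[OF x x, of m n] by (simp add: ell2_hnorm suminf_nonneg ell2_simps(1))
          ultimately have "(hnorm ell2 (vdiff ell2 (x m) (x n)))\<^sup>2 \<le> e\<^sup>2" by (intro power_mono) auto
          then show "(\<Sum>k<N. (cmod (vdiff ell2 (x m) (x n) k))\<^sup>2) \<le> e\<^sup>2"
            using ell2_partial[OF d[OF x[of m] x[of n]], of N] by linarith
        qed
      qed
      then show ?thesis using ell2I[of "vdiff ell2 (x m) l" e for m] \<open>e > 0\<close> by (meson less_imp_le)
    qed
    obtain M where M: "\<forall>m\<ge>M. vdiff ell2 (x m) l \<in> vcar ell2" using tail[of 1] by auto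
    have "l \<in> vcar ell2"
      using d[OF x[of M] M[rule_format, of M]] by (simp add: ell2_simps(6))
    moreover have "N_tendsto ell2 (hnorm ell2) x l"
      unfolding N_tendsto_def
    proof (rule LIMSEQ_I)
      fix e :: real assume "e > 0"
      then obtain N where N: "\<forall>m\<ge>N. vdiff ell2 (x m) l \<in> vcar ell2 \<and> hnorm ell2 (vdiff ell2 (x m) l) \<le> e / 2"
        using tail[of "e / 2"] by auto
      show "\<exists>no. \<forall>n\<ge>no. norm (hnorm ell2 (vdiff ell2 (x n) l) - 0) < e"
      proof (intro exI allI impI)
        fix n assume "n \<ge> N"
        then have *: "vdiff ell2 (x n) l \<in> vcar ell2" "hnorm ell2 (vdiff ell2 (x n) l) \<le> e / 2" using N by auto
        moreover have "0 \<le> hnorm ell2 (vdiff ell2 (x n) l)"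
          using *(1) by (simp add: ell2_hnorm suminf_nonneg ell2_simps(1))
        ultimately show "norm (hnorm ell2 (vdiff ell2 (x n) l) - 0) < e" using \<open>e > 0\<close> by simp
      qed
    qed
    ultimately show "\<exists>l\<in>vcar ell2. N_tendsto ell2 (hnorm ell2) x l" by blast
  qed
next
  fix x assume "x \<in> vcar ell2"
  then show "\<exists>y\<in>vcar ell2. vadd ell2 x y = vzero ell2"
    using ell2_scale[of x "-1"] by (intro bexI[of _ "\<lambda>n. -1 * x n"]) (auto simp: ell2_simps(2,3))
qed (auto simp: ell2_simps(2-4) ell2_add ell2_scale distrib_left distrib_right add_ac mult_ac, simp add: ell2_simps(1))

text \<open>The \<open>n\<close>-th coordinate of the adjoint at \<open>\<xi>\<close> is forced to
  be the inner product of \<open>\<xi>\<close> with the image of the \<open>n\<close>-th unit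
  vector. Partial sums against \<open>y\<close> are then inner products with \<open>T\<close> of a
  truncation of \<open>y\<close>, and truncations converge in norm.\<close>

lemma ell2_adjoint:
  assumes T: "T \<in> bounded_ops ell2"
  shows "\<exists>S. adjoint_of ell2 T S"
proof -
  note t = bounded_opD[OF T]
  obtain C where C: "C > 0" "\<And>\<xi>. \<xi> \<in> vcar ell2 \<Longrightarrow> hnorm ell2 (T \<xi>) \<le> C * hnorm ell2 \<xi>"
    using ell2.bounded_opE t(1) by metis
  define E :: "nat \<Rightarrow> nat \<Rightarrow> complex" where "E k = (\<lambda>n. if n = k then 1 else 0)" for k
  define trunc :: "nat \<Rightarrow> (nat \<Rightarrow> complex) \<Rightarrow> nat \<Rightarrow> complex" where "trunc N y = (\<lambda>n. if n < N then y n else 0)" for N y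
  have fin: "y \<in> vcar ell2" if "\<And>n. n \<ge> N \<Longrightarrow> y n = 0" for y and N :: nat
    unfolding ell2_simps using that by (intro summable_finite[of "{..<N}"]) auto
  have E: "E k \<in> vcar ell2" for k by (rule fin[of "Suc k"]) (auto simp: E_def)
  have tr: "trunc N y \<in> vcar ell2" for N y by (rule fin[of N]) (auto simp: trunc_def)
  define S where "S \<xi> = (if \<xi> \<in> vcar ell2 then (\<lambda>n. hinner ell2 \<xi> (T (E n))) else vzero ell2)" for \<xi>
  have part: "(\<Sum>n<N. S \<xi> n * cnj (y n)) = hinner ell2 \<xi> (T (trunc N y))" if \<xi>: "\<xi> \<in> vcar ell2" for \<xi> y N
  proof (induction N)
    case 0
    have "trunc 0 y = vscale ell2 0 (trunc 0 y)" by (simp add: trunc_def ell2_simps)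
    then have "T (trunc 0 y) = vzero ell2" using t(5)[OF tr, of 0 0 y] t(2)[OF tr, of 0 y]
      by (metis ell2.scale_zero_left)
    then show ?case using \<xi> by (simp add: ell2.inner_zero)
  next
    case (Suc N)
    have "trunc (Suc N) y = vadd ell2 (trunc N y) (vscale ell2 (y N) (E N))"
      by (auto simp: trunc_def E_def ell2_simps fun_eq_iff less_Suc_eq)
    then have "T (trunc (Suc N) y) = vadd ell2 (T (trunc N y)) (vscale ell2 (y N) (T (E N)))"
      using t(4,5) tr E ell2.scale_closed by simp
    then have "hinner ell2 \<xi> (T (trunc (Suc N) y)) = hinner ell2 \<xi> (T (trunc N y)) + cnj (y N) * hinner ell2 \<xi> (T (E N))"
      using \<xi> t(2) tr E by (simp add: ell2.inner_add_right ell2.inner_scale_right ell2.scale_closed)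
    then show ?case using Suc \<xi> by (simp add: S_def)
  qed
  have trn: "(hnorm ell2 (trunc N y))\<^sup>2 = (\<Sum>n<N. (cmod (y n))\<^sup>2)" for N y
  proof -
    have "(\<Sum>n. (cmod (trunc N y n))\<^sup>2) = (\<Sum>n<N. (cmod (trunc N y n))\<^sup>2)"
      by (intro suminf_finite) (auto simp: trunc_def)
    then show ?thesis using tr[of N y] by (simp add: ell2_hnorm sum_nonneg) (simp add: trunc_def)
  qed
  have Sbound: "S \<xi> \<in> vcar ell2 \<and> hnorm ell2 (S \<xi>) \<le> C * hnorm ell2 \<xi>" if \<xi>: "\<xi> \<in> vcar ell2" for \<xi>
  proof -
    have "(\<Sum>n<N. (cmod (S \<xi> n))\<^sup>2) \<le> (C * hnorm ell2 \<xi>)\<^sup>2" for N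
    proof -
      \<comment> \<open>Testing against the truncation of \<open>S \<xi>\<close> itself gives
        \<open>?s * ?s\<close> at most \<open>C * hnorm ell2 \<xi> * ?s\<close>, and one factor
        cancels.\<close>
      let ?s = "hnorm ell2 (trunc N (S \<xi>))"
      have "complex_of_real (\<Sum>n<N. (cmod (S \<xi> n))\<^sup>2) = (\<Sum>n<N. S \<xi> n * cnj (S \<xi> n))"
        by (simp only: of_real_sum complex_norm_square)
      then have "?s\<^sup>2 = cmod (hinner ell2 \<xi> (T (trunc N (S \<xi>))))"
        using part[OF \<xi>, where y="S \<xi>" and N=N] trn[of N "S \<xi>"] by (metis abs_power2 norm_of_real)
      also have "\<dots> \<le> hnorm ell2 \<xi> * hnorm ell2 (T (trunc N (S \<xi>)))"
        using ell2.Cauchy_Schwarz \<xi> t(2) tr by blast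
      also have "\<dots> \<le> hnorm ell2 \<xi> * (C * ?s)"
        using C tr ell2.hnorm_nonneg[OF \<xi>] by (intro mult_left_mono) auto
      finally have "?s * ?s \<le> (C * hnorm ell2 \<xi>) * ?s" by (simp add: power2_eq_square mult_ac)
      then have "?s \<le> C * hnorm ell2 \<xi>"
        using ell2.hnorm_nonneg[OF tr, of N "S \<xi>"] ell2.hnorm_nonneg[OF \<xi>] C(1)
        by (cases "?s = 0") (simp_all add: mult_le_cancel_right)
      then show ?thesis using trn[of N "S \<xi>"] ell2.hnorm_nonneg[OF tr] power_mono by metis
    qed
    then show ?thesis using ell2I[of "S \<xi>" "C * hnorm ell2 \<xi>"] ell2.hnorm_nonneg[OF \<xi>] C(1) by simp
  qed
  have "S \<in> bounded_ops ell2"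
  proof (rule ell2.bounded_opsI)
    fix \<xi> \<eta> assume "\<xi> \<in> vcar ell2" "\<eta> \<in> vcar ell2"
    then show "S (vadd ell2 \<xi> \<eta>) = vadd ell2 (S \<xi>) (S \<eta>)"
      using t(2)[OF E] by (simp add: S_def ell2.add_closed ell2.inner_add) (simp add: ell2_simps(2))
  next
    fix \<xi> c assume "\<xi> \<in> vcar ell2"
    then show "S (vscale ell2 c \<xi>) = vscale ell2 c (S \<xi>)"
      using t(2)[OF E] by (simp add: S_def ell2.scale_closed ell2.inner_scale) (simp add: ell2_simps(4))
  qed (use Sbound in \<open>auto simp: S_def\<close>)
  moreover have "hinner ell2 (S \<xi>) \<eta> = hinner ell2 \<xi> (T \<eta>)" if \<xi>: "\<xi> \<in> vcar ell2" and \<eta>: "\<eta> \<in> vcar ell2" for \<xi> \<eta>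
  proof (rule LIMSEQ_unique)
    show "(\<lambda>N. \<Sum>n<N. S \<xi> n * cnj (\<eta> n)) \<longlonglongrightarrow> hinner ell2 (S \<xi>) \<eta>"
      using ell2_inner_summable[of "S \<xi>" \<eta>] Sbound[OF \<xi>] \<eta> unfolding ell2_simps(5) by (intro summable_LIMSEQ) auto
    have "(\<lambda>N. (hnorm ell2 (vdiff ell2 (trunc N \<eta>) \<eta>))\<^sup>2) \<longlonglongrightarrow> 0"
    proof -
      have s: "summable (\<lambda>n. (cmod (\<eta> n))\<^sup>2)" using \<eta> by (simp add: ell2_simps)
      have "(hnorm ell2 (vdiff ell2 (trunc N \<eta>) \<eta>))\<^sup>2 = (\<Sum>n. (cmod (\<eta> n))\<^sup>2) - (\<Sum>n<N. (cmod (\<eta> n))\<^sup>2)" for N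
      proof -
        have d: "vdiff ell2 (trunc N \<eta>) \<eta> \<in> vcar ell2" using ell2.diff_closed tr \<eta> by blast
        have sd: "summable (\<lambda>n. (cmod (vdiff ell2 (trunc N \<eta>) \<eta> n))\<^sup>2)" using d by (simp add: ell2_simps(1))
        have "(hnorm ell2 (vdiff ell2 (trunc N \<eta>) \<eta>))\<^sup>2 = (\<Sum>n. (cmod (vdiff ell2 (trunc N \<eta>) \<eta> n))\<^sup>2)"
          using d sd by (simp add: ell2_hnorm suminf_nonneg)
        also have "\<dots> = (\<Sum>n. (cmod (vdiff ell2 (trunc N \<eta>) \<eta> (n + N)))\<^sup>2)"
          using suminf_split_initial_segment[OF sd, of N] by (simp add: ell2_simps(6) trunc_def)
        also have "\<dots> = (\<Sum>n. (cmod (\<eta> (n + N)))\<^sup>2)" by (simp add: ell2_simps(6) trunc_def)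
        also have "\<dots> = (\<Sum>n. (cmod (\<eta> n))\<^sup>2) - (\<Sum>n<N. (cmod (\<eta> n))\<^sup>2)" by (rule suminf_minus_initial_segment[OF s])
        finally show ?thesis .
      qed
      then show ?thesis using tendsto_diff[OF tendsto_const summable_LIMSEQ[OF s], of "\<Sum>n. (cmod (\<eta> n))\<^sup>2"] by simp
    qed
    then have "(\<lambda>N. sqrt ((hnorm ell2 (vdiff ell2 (trunc N \<eta>) \<eta>))\<^sup>2)) \<longlonglongrightarrow> sqrt 0" by (rule tendsto_real_sqrt)
    then have lim: "N_tendsto ell2 (hnorm ell2) (\<lambda>N. trunc N \<eta>) \<eta>"
      using ell2.hnorm_nonneg[OF ell2.diff_closed[OF tr \<eta>]] unfolding N_tendsto_def by simp
    have "N_tendsto ell2 (hnorm ell2) (\<lambda>N. T (trunc N \<eta>)) (T \<eta>)"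
      using tr by (intro ell2.tendsto_bounded_op[OF t(1) _ \<eta> lim]) auto
    then have "(\<lambda>N. hinner ell2 (T (trunc N \<eta>)) \<xi>) \<longlonglongrightarrow> hinner ell2 (T \<eta>) \<xi>"
      using t(2) tr \<eta> \<xi> by (intro ell2.tendsto_hinner) auto
    then have "(\<lambda>N. cnj (hinner ell2 (T (trunc N \<eta>)) \<xi>)) \<longlonglongrightarrow> cnj (hinner ell2 (T \<eta>) \<xi>)" by (rule tendsto_cnj)
    then show "(\<lambda>N. \<Sum>n<N. S \<xi> n * cnj (\<eta> n)) \<longlonglongrightarrow> hinner ell2 \<xi> (T \<eta>)"
      using part[OF \<xi>] ell2.inner_cnj[OF t(2)[OF tr] \<xi>] ell2.inner_cnj[OF t(2)[OF \<eta>] \<xi>] by simp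
  qed
  ultimately show ?thesis unfolding adjoint_of_def by blast
qed

lemma star_algebra_compacts: "star_algebra compacts"
  by (rule ell2.star_algebra_compact_operators) (rule ell2_adjoint)

section \<open>Two-by-two matrices\<close>

type_synonym mat2 = "bool \<Rightarrow> bool \<Rightarrow> complex"

definition mapply :: "mat2 \<Rightarrow> complex \<times> complex \<Rightarrow> complex \<times> complex" where
  "mapply m v = (m False False * fst v + m False True * snd v, m True False * fst v + m True True * snd v)"

definition mmul :: "mat2 \<Rightarrow> mat2 \<Rightarrow> mat2" where
  "mmul m n = (\<lambda>i j. m i False * n False j + m i True * n True j)"

definition madj :: "mat2 \<Rightarrow> mat2" where
  "madj m = (\<lambda>i j. cnj (m j i))"

text \<open>The norm on pairs of complex numbers is the Euclidean one, so this is the operator norm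
  on the Hilbert space of dimension two and satisfies the C*-identity.\<close>

definition mnorm :: "mat2 \<Rightarrow> real" where
  "mnorm m = onorm (mapply m)"

definition cscale :: "complex \<Rightarrow> complex \<times> complex \<Rightarrow> complex \<times> complex" where
  "cscale c v = (c * fst v, c * snd v)"

definition cinner :: "complex \<times> complex \<Rightarrow> complex \<times> complex \<Rightarrow> complex" where
  "cinner u v = fst u * cnj (fst v) + snd u * cnj (snd v)"

lemma norm_cscale: "norm (cscale c v) = cmod c * norm v"
  by (simp add: cscale_def norm_prod_def norm_mult power_mult_distrib real_sqrt_mult flip: distrib_left)

lemma cinner_self: "cinner v v = of_real ((norm v)\<^sup>2)"
  by (simp add: cinner_def norm_prod_def flip: complex_norm_square)

lemma inner_eq_Re_cinner: "inner u v = Re (cinner u v)"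
  by (simp add: cinner_def inner_prod_def inner_complex_def)

lemma cinner_madj: "cinner (mapply (madj m) u) v = cinner u (mapply m v)"
  by (simp add: cinner_def mapply_def madj_def algebra_simps)

lemma mapply_mmul: "mapply (mmul m n) v = mapply m (mapply n v)"
  by (simp add: mapply_def mmul_def algebra_simps)

lemma bounded_linear_mapply: "bounded_linear (mapply m)"
  by (rule linear_conv_bounded_linear[THEN iffD1], rule linearI) (auto simp: mapply_def algebra_simps scaleR_conv_of_real)

lemma mnorm_apply: "norm (mapply m v) \<le> mnorm m * norm v"
  unfolding mnorm_def by (rule onorm[OF bounded_linear_mapply])

lemma mnorm_nonneg: "0 \<le> mnorm m"
  unfolding mnorm_def by (rule onorm_pos_le[OF bounded_linear_mapply])

lemma mnorm_le: "0 \<le> b \<Longrightarrow> (\<And>v. norm (mapply m v) \<le> b * norm v) \<Longrightarrow> mnorm m \<le> b"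
  unfolding mnorm_def by (rule onorm_le) 

lemma mnorm_add: "mnorm (\<lambda>i j. m i j + n i j) \<le> mnorm m + mnorm n"
proof (rule mnorm_le)
  fix v
  have "mapply (\<lambda>i j. m i j + n i j) v = mapply m v + mapply n v" by (simp add: mapply_def algebra_simps)
  then have "norm (mapply (\<lambda>i j. m i j + n i j) v) \<le> norm (mapply m v) + norm (mapply n v)"
    by (simp add: norm_triangle_ineq)
  also have "\<dots> \<le> (mnorm m + mnorm n) * norm v"
    using mnorm_apply[of m v] mnorm_apply[of n v] by (simp add: distrib_right)
  finally show "norm (mapply (\<lambda>i j. m i j + n i j) v) \<le> (mnorm m + mnorm n) * norm v" .
qed (simp add: mnorm_nonneg)

lemma mnorm_scale_le: "mnorm (\<lambda>i j. c * m i j) \<le> cmod c * mnorm m"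
proof (rule mnorm_le)
  fix v
  have "mapply (\<lambda>i j. c * m i j) v = cscale c (mapply m v)" by (simp add: mapply_def cscale_def algebra_simps)
  then show "norm (mapply (\<lambda>i j. c * m i j) v) \<le> cmod c * mnorm m * norm v"
    using mnorm_apply[of m v] by (simp add: norm_cscale mult.assoc mult_left_mono)
qed (simp add: mnorm_nonneg)

lemma mnorm_scale: "mnorm (\<lambda>i j. c * m i j) = cmod c * mnorm m"
proof (cases "c = 0")
  case True then show ?thesis using mnorm_scale_le[of c m] mnorm_nonneg by (simp add: order_antisym)
next
  case False
  have "mnorm (\<lambda>i j. inverse c * (c * m i j)) \<le> cmod (inverse c) * mnorm (\<lambda>i j. c * m i j)"
    by (rule mnorm_scale_le)
  then have "cmod c * mnorm m \<le> mnorm (\<lambda>i j. c * m i j)"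
    using False by (simp add: norm_divide field_simps)
  then show ?thesis using mnorm_scale_le[of c m] by linarith
qed

lemma mnorm_mmul: "mnorm (mmul m n) \<le> mnorm m * mnorm n"
proof (rule mnorm_le)
  fix v
  have "norm (mapply m (mapply n v)) \<le> mnorm m * norm (mapply n v)" by (rule mnorm_apply)
  also have "\<dots> \<le> mnorm m * (mnorm n * norm v)" by (intro mult_left_mono mnorm_apply mnorm_nonneg)
  finally show "norm (mapply (mmul m n) v) \<le> mnorm m * mnorm n * norm v" by (simp add: mapply_mmul mult.assoc)
qed (simp add: mnorm_nonneg)

lemma mnorm_madj_le: "mnorm (madj m) \<le> mnorm m"
proof (rule mnorm_le)
  fix v
  let ?w = "mapply (madj m) v"
  have "(norm ?w)\<^sup>2 = Re (cinner ?w ?w)" by (simp add: cinner_self)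
  also have "\<dots> = inner v (mapply m ?w)" by (simp add: cinner_madj inner_eq_Re_cinner)
  also have "\<dots> \<le> norm v * norm (mapply m ?w)" by (rule norm_cauchy_schwarz)
  also have "\<dots> \<le> norm v * (mnorm m * norm ?w)" by (intro mult_left_mono mnorm_apply) auto
  finally have "norm ?w * norm ?w \<le> (mnorm m * norm v) * norm ?w" by (simp add: power2_eq_square mult_ac)
  then show "norm ?w \<le> mnorm m * norm v"
    by (cases "norm ?w = 0") (simp_all add: mult_le_cancel_right mnorm_nonneg)
qed (simp add: mnorm_nonneg)

lemma mnorm_cstar: "mnorm (mmul (madj m) m) = (mnorm m)\<^sup>2"
proof (rule antisym)
  have "mnorm (mmul (madj m) m) \<le> mnorm (madj m) * mnorm m" by (rule mnorm_mmul)
  also have "\<dots> \<le> mnorm m * mnorm m" by (intro mult_right_mono mnorm_madj_le mnorm_nonneg)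
  finally show "mnorm (mmul (madj m) m) \<le> (mnorm m)\<^sup>2" by (simp add: power2_eq_square)
  have "mnorm m \<le> sqrt (mnorm (mmul (madj m) m))"
  proof (rule mnorm_le)
    fix v
    have "(norm (mapply m v))\<^sup>2 = Re (cinner (mapply m v) (mapply m v))" by (simp add: cinner_self)
    also have "\<dots> = inner (mapply (mmul (madj m) m) v) v" by (simp add: mapply_mmul cinner_madj inner_eq_Re_cinner)
    also have "\<dots> \<le> norm (mapply (mmul (madj m) m) v) * norm v" by (rule norm_cauchy_schwarz)
    also have "\<dots> \<le> mnorm (mmul (madj m) m) * norm v * norm v" by (intro mult_right_mono mnorm_apply) auto
    finally have "(norm (mapply m v))\<^sup>2 \<le> (sqrt (mnorm (mmul (madj m) m)) * norm v)\<^sup>2"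
      by (simp add: power_mult_distrib real_sqrt_pow2[OF mnorm_nonneg]) (simp add: power2_eq_square mult.assoc)
    then show "norm (mapply m v) \<le> sqrt (mnorm (mmul (madj m) m)) * norm v"
      by (rule power2_le_imp_le) (simp add: mnorm_nonneg)
  qed (simp add: mnorm_nonneg)
  then have "(mnorm m)\<^sup>2 \<le> (sqrt (mnorm (mmul (madj m) m)))\<^sup>2" by (intro power_mono mnorm_nonneg)
  then show "(mnorm m)\<^sup>2 \<le> mnorm (mmul (madj m) m)" by (simp add: mnorm_nonneg)
qed

lemma mnorm_entry: "cmod (m i j) \<le> mnorm m"
proof -
  let ?v = "if j then (0 :: complex, 1 :: complex) else (1, 0)"
  have "cmod (m i j) \<le> norm (mapply m ?v)"
    using real_sqrt_sum_squares_ge1 real_sqrt_sum_squares_ge2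
    by (cases i; cases j) (auto simp: mapply_def norm_prod_def)
  also have "\<dots> \<le> mnorm m * norm ?v" by (rule mnorm_apply)
  finally show ?thesis by (simp add: norm_prod_def split: if_splits)
qed

text \<open>Four is the number of entries. The crude constant suffices, as it serves to pass from
  uniform bounds on entries to norm bounds in approximations.\<close>

lemma mnorm_bound:
  assumes "\<And>i j. cmod (m i j) \<le> b" shows "mnorm m \<le> 4 * b"
proof (rule mnorm_le)
  have b: "0 \<le> b" using assms[of True True] norm_ge_zero order_trans by blast
  then show "0 \<le> 4 * b" by simp
  fix v :: "complex \<times> complex"
  have f: "norm (fst v) \<le> norm v" "norm (snd v) \<le> norm v" using norm_fst_le[of "fst v" "snd v"] norm_snd_le[of "snd v" "fst v"] by simp_all
  have c: "cmod (m i False * fst v + m i True * snd v) \<le> 2 * b * norm v" for i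
  proof -
    have "cmod (m i False * fst v + m i True * snd v) \<le> cmod (m i False) * cmod (fst v) + cmod (m i True) * cmod (snd v)"
      using norm_triangle_ineq[of "m i False * fst v" "m i True * snd v"] by (simp add: norm_mult)
    also have "\<dots> \<le> b * norm v + b * norm v" by (intro add_mono mult_mono assms f b) auto
    finally show ?thesis by simp
  qed
  have "norm (mapply m v) \<le> cmod (fst (mapply m v)) + cmod (snd (mapply m v))"
    using norm_Pair_le[of "fst (mapply m v)" "snd (mapply m v)"] by simp
  then show "norm (mapply m v) \<le> 4 * b * norm v" using c[of False] c[of True] by (simp add: mapply_def)
qed


section \<open>The algebra\<close>

definition circle :: "complex set" where "circle = sphere 0 1"

text \<open>The angles lie in the interval from 0 to 1, below pi: \<open>Arg\<close> recovers them,
  and the complex conjugates of these points avoid the branch set while tending to 1.\<close>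

definition kpt :: "nat \<Rightarrow> complex" where "kpt n = cis (1 / real (Suc n))"

definition branch_set :: "complex set" where "branch_set = insert 1 (range kpt)"

text \<open>Points of the two circles are sequences of reals, as the definition of a trivial
  invariant asks: two coordinates for the point of the plane and a third one, 0 or 1, for the
  sheet.\<close>

definition pt :: "complex \<Rightarrow> bool \<Rightarrow> nat \<Rightarrow> real" where
  "pt t i = (\<lambda>n. if n = 0 then Re t else if n = 1 then Im t else if n = 2 \<and> i then 1 else 0)"

definition base :: "(nat \<Rightarrow> real) \<Rightarrow> complex" where "base y = Complex (y 0) (y 1)"

definition sheet :: "(nat \<Rightarrow> real) \<Rightarrow> bool" where "sheet y \<longleftrightarrow> y 2 = 1"

definition circles :: "(nat \<Rightarrow> real) set" where "circles = {pt t i | t i. t \<in> circle}"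

abbreviation two_circles :: "(nat \<Rightarrow> real) topology" where "two_circles \<equiv> top_of_set circles"

text \<open>The relation of having the same image in the glued space, written in coordinates before
  that space is available. It is identified with the equivalence groupoid of the gluing map once the
  spectrum is known.\<close>

definition gpd :: "((nat \<Rightarrow> real) \<times> (nat \<Rightarrow> real)) set" where
  "gpd = {(pt t i, pt t j) | t i j. t \<in> circle \<and> (i = j \<or> t \<notin> branch_set)}"

definition glue_groupoid :: "((nat \<Rightarrow> real) \<times> (nat \<Rightarrow> real)) groupoid" where
  "glue_groupoid = \<lparr> gtop = top_of_set gpd, grange = (\<lambda>(y1, y2). (y1, y1)),
      ginv = (\<lambda>(y1, y2). (y2, y1)), gmult = (\<lambda>(y1, y2) (y3, y4). (y1, y4)) \<rparr>"

abbreviation conv :: "kernel_function staralg" where "conv \<equiv> convolution_algebra glue_groupoid"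

text \<open>A function on the groupoid is read as a matrix over each point of the circle, with rows
  and columns indexed by sheets.\<close>

definition cf :: "kernel_function \<Rightarrow> complex \<Rightarrow> mat2" where
  "cf f t = (\<lambda>i j. f (pt t i, pt t j))"

text \<open>Vanishing outside \<open>gpd\<close> makes the matrices over \<open>branch_set\<close>
  diagonal, while continuity is asked of each entry on the whole circle. Product and involution are
  those of the convolution algebra, so the two algebras differ only in their carriers and the
  norm.\<close>

definition glue_alg :: "kernel_function cstar" where
  "glue_alg = \<lparr> vcar = {f. (\<forall>\<gamma>. \<gamma> \<notin> gpd \<longrightarrow> f \<gamma> = 0) \<and> (\<forall>i j. continuous_on circle (\<lambda>t. cf f t i j))},
     vadd = (\<lambda>f g \<gamma>. f \<gamma> + g \<gamma>), vzero = (\<lambda>\<gamma>. 0), vscale = (\<lambda>c f \<gamma>. c * f \<gamma>),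
     atimes = atimes conv, astar = astar conv, nrm = (\<lambda>f. SUP t\<in>circle. mnorm (cf f t)) \<rparr>"

lemma base_pt [simp]: "base (pt t i) = t" by (simp add: base_def pt_def)

lemma sheet_pt [simp]: "sheet (pt t i) = i" by (simp add: sheet_def pt_def)

lemma pt_eq [simp]: "pt t i = pt s j \<longleftrightarrow> t = s \<and> i = j"
proof
  assume "pt t i = pt s j"
  then have "base (pt t i) = base (pt s j)" "sheet (pt t i) = sheet (pt s j)" by simp_all
  then show "t = s \<and> i = j" by simp
qed simp

lemma pt_gpd [simp]: "(pt t i, pt s j) \<in> gpd \<longleftrightarrow> t = s \<and> t \<in> circle \<and> (i = j \<or> t \<notin> branch_set)"
  by (auto simp: gpd_def)

lemma compact_circle: "compact circle" by (simp add: circle_def)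

lemma circle_nonempty: "1 \<in> circle" by (simp add: circle_def)

lemma branch_set_circle: "branch_set \<subseteq> circle" by (auto simp: branch_set_def circle_def kpt_def)

lemma kpt_tendsto: "kpt \<longlonglongrightarrow> 1"
proof -
  have "(\<lambda>n. 1 / real (Suc n)) \<longlonglongrightarrow> 0" using LIMSEQ_inverse_real_of_nat by (simp add: inverse_eq_divide)
  then have "(\<lambda>n. cis (1 / real (Suc n))) \<longlonglongrightarrow> cis 0" by (rule tendsto_cis)
  then show ?thesis by (simp add: kpt_def[abs_def])
qed

lemma compact_branch_set: "compact branch_set"
  unfolding branch_set_def by (rule compact_sequence_with_limit[OF kpt_tendsto])

lemma closed_branch_set: "closed branch_set" using compact_branch_set compact_imp_closed by blast

lemma glue_simps:
  "vadd glue_alg f g = (\<lambda>\<gamma>. f \<gamma> + g \<gamma>)" "vzero glue_alg = (\<lambda>\<gamma>. 0)" "vscale glue_alg c f = (\<lambda>\<gamma>. c * f \<gamma>)"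
  "atimes glue_alg = atimes conv" "astar glue_alg = astar conv" "nrm glue_alg f = (SUP t\<in>circle. mnorm (cf f t))"
  "vdiff glue_alg f g = (\<lambda>\<gamma>. f \<gamma> - g \<gamma>)"
  by (simp_all add: glue_alg_def vdiff_def)

lemma glue_car: "f \<in> vcar glue_alg \<longleftrightarrow> (\<forall>\<gamma>. \<gamma> \<notin> gpd \<longrightarrow> f \<gamma> = 0) \<and> (\<forall>i j. continuous_on circle (\<lambda>t. cf f t i j))"
  by (simp add: glue_alg_def)

lemma cf_simps [simp]: "cf (\<lambda>\<gamma>. f \<gamma> + g \<gamma>) t i j = cf f t i j + cf g t i j" "cf (\<lambda>\<gamma>. c * f \<gamma>) t i j = c * cf f t i j"
  "cf (\<lambda>\<gamma>. 0) t i j = 0" "cf (\<lambda>\<gamma>. f \<gamma> - g \<gamma>) t i j = cf f t i j - cf g t i j"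
  by (simp_all add: cf_def)

lemma cf_branch: "f \<in> vcar glue_alg \<Longrightarrow> t \<in> branch_set \<Longrightarrow> i \<noteq> j \<Longrightarrow> cf f t i j = 0"
  by (simp add: glue_car cf_def)

lemma glue_ext:
  assumes "\<And>\<gamma>. \<gamma> \<notin> gpd \<Longrightarrow> f \<gamma> = 0" "\<And>\<gamma>. \<gamma> \<notin> gpd \<Longrightarrow> g \<gamma> = 0"
    "\<And>t i j. t \<in> circle \<Longrightarrow> cf f t i j = cf g t i j"
  shows "f = g"
proof
  fix \<gamma> show "f \<gamma> = g \<gamma>"
    using assms(1,2)[of \<gamma>] assms(3) by (cases "\<gamma> \<in> gpd") (auto simp: gpd_def cf_def)
qed

lemma conv_times_outside: "\<gamma> \<notin> gpd \<Longrightarrow> atimes conv f g \<gamma> = 0"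
  by (simp add: convolution_algebra_def glue_groupoid_def Let_def)

lemma conv_star_outside: "\<gamma> \<notin> gpd \<Longrightarrow> astar conv f \<gamma> = 0"
  by (simp add: convolution_algebra_def glue_groupoid_def Let_def)

text \<open>A range fibre has at most one point per sheet, so convolution is a sum over the two
  sheets; missing points contribute zero because \<open>f\<close> vanishes outside
  \<open>gpd\<close>.\<close>

lemma cf_times:
  assumes f: "\<And>\<gamma>. \<gamma> \<notin> gpd \<Longrightarrow> f \<gamma> = 0" and g: "\<And>\<gamma>. \<gamma> \<notin> gpd \<Longrightarrow> g \<gamma> = 0" and t: "t \<in> circle"
  shows "cf (atimes conv f g) t = mmul (cf f t) (cf g t)"
proof (intro ext)
  fix i j
  show "cf (atimes conv f g) t i j = mmul (cf f t) (cf g t) i j"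
  proof (cases "i = j \<or> t \<notin> branch_set")
    case True
    let ?h = "\<lambda>k. (pt t i, pt t k)"
    have "cf (atimes conv f g) t i j = (\<Sum>\<alpha> | \<alpha> \<in> gpd \<and> fst \<alpha> = pt t i \<and> f \<alpha> \<noteq> 0. f \<alpha> * g (snd \<alpha>, pt t j))"
      using True t by (auto simp: cf_def convolution_algebra_def glue_groupoid_def Let_def case_prod_beta intro!: sum.cong)
    also have "\<dots> = (\<Sum>\<alpha>\<in>?h ` UNIV. f \<alpha> * g (snd \<alpha>, pt t j))"
    proof (intro sum.mono_neutral_left subsetI ballI)
      fix \<alpha> assume "\<alpha> \<in> {\<alpha>. \<alpha> \<in> gpd \<and> fst \<alpha> = pt t i \<and> f \<alpha> \<noteq> 0}"
      then show "\<alpha> \<in> ?h ` UNIV" by (auto simp: gpd_def)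
    next
      fix \<alpha> assume "\<alpha> \<in> ?h ` UNIV - {\<alpha>. \<alpha> \<in> gpd \<and> fst \<alpha> = pt t i \<and> f \<alpha> \<noteq> 0}"
      then show "f \<alpha> * g (snd \<alpha>, pt t j) = 0" using f[of \<alpha>] by (cases "\<alpha> \<in> gpd") auto
    qed simp
    also have "\<dots> = (\<Sum>k\<in>UNIV. f (?h k) * g (pt t k, pt t j))"
      by (subst sum.reindex) (auto simp: inj_on_def)
    finally show ?thesis by (simp add: UNIV_bool cf_def mmul_def)
  next
    case False
    then have "f (pt t i, pt t j) = 0" "g (pt t i, pt t j) = 0" using f g by auto
    moreover have "atimes conv f g (pt t i, pt t j) = 0" using False by (intro conv_times_outside) auto
    ultimately show ?thesis using False by (cases i; cases j) (auto simp: cf_def mmul_def)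
  qed
qed

lemma cf_star:
  assumes f: "\<And>\<gamma>. \<gamma> \<notin> gpd \<Longrightarrow> f \<gamma> = 0" and t: "t \<in> circle"
  shows "cf (astar conv f) t = madj (cf f t)"
  using f t by (auto simp: fun_eq_iff cf_def madj_def convolution_algebra_def glue_groupoid_def Let_def)

lemma cf_glue:
  assumes "f \<in> vcar glue_alg" "t \<in> circle"
  shows "g \<in> vcar glue_alg \<Longrightarrow> cf (atimes glue_alg f g) t = mmul (cf f t) (cf g t)"
    "cf (astar glue_alg f) t = madj (cf f t)"
  using assms cf_times cf_star by (auto simp: glue_simps glue_car)

lemma cf_linear:
  "cf (vadd glue_alg f g) t = (\<lambda>i j. cf f t i j + cf g t i j)" "cf (vscale glue_alg c f) t = (\<lambda>i j. c * cf f t i j)"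
  "cf (vdiff glue_alg f g) t = (\<lambda>i j. cf f t i j - cf g t i j)" "cf (vzero glue_alg) t = (\<lambda>i j. 0)"
  by (simp_all add: glue_simps fun_eq_iff)

text \<open>Inverse to \<open>cf\<close>. It discards off-diagonal entries over
  \<open>branch_set\<close>, which is why \<open>mk_glue\<close> requires them to vanish.\<close>

definition mk :: "(complex \<Rightarrow> mat2) \<Rightarrow> kernel_function" where
  "mk a \<gamma> = (if \<gamma> \<in> gpd then a (base (fst \<gamma>)) (sheet (fst \<gamma>)) (sheet (snd \<gamma>)) else 0)"

lemma cf_mk: "t \<in> circle \<Longrightarrow> cf (mk a) t i j = (if i = j \<or> t \<notin> branch_set then a t i j else 0)"
  by (simp add: cf_def mk_def)

lemma mk_glue:
  assumes "\<And>i j. continuous_on circle (\<lambda>t. a t i j)" "\<And>t i j. t \<in> branch_set \<Longrightarrow> i \<noteq> j \<Longrightarrow> a t i j = 0"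
  shows "mk a \<in> vcar glue_alg" "t \<in> circle \<Longrightarrow> cf (mk a) t = a t"
proof -
  show *: "cf (mk a) t = a t" if "t \<in> circle" for t using that assms(2) by (auto simp: cf_mk fun_eq_iff)
  have "continuous_on circle (\<lambda>t. cf (mk a) t i j)" for i j
    using assms(1)[of i j] by (rule continuous_on_eq) (simp add: *)
  then show "mk a \<in> vcar glue_alg" unfolding glue_car by (auto simp: mk_def)
qed

lemma glue_closed:
  assumes f: "f \<in> vcar glue_alg"
  shows "g \<in> vcar glue_alg \<Longrightarrow> vadd glue_alg f g \<in> vcar glue_alg" "vscale glue_alg c f \<in> vcar glue_alg"
    "g \<in> vcar glue_alg \<Longrightarrow> atimes glue_alg f g \<in> vcar glue_alg" "astar glue_alg f \<in> vcar glue_alg"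
    "g \<in> vcar glue_alg \<Longrightarrow> vdiff glue_alg f g \<in> vcar glue_alg"
proof -
  note c = continuous_intros
  have cf: "continuous_on circle (\<lambda>t. cf f t i j)" for i j using f by (simp add: glue_car)
  show "vscale glue_alg c f \<in> vcar glue_alg" using f unfolding glue_car glue_simps by (auto intro!: c)
  show "astar glue_alg f \<in> vcar glue_alg" unfolding glue_car
  proof (intro conjI allI impI)
    fix i j show "continuous_on circle (\<lambda>t. cf (astar glue_alg f) t i j)"
      by (rule continuous_on_eq[of _ "\<lambda>t. cnj (cf f t j i)"])
        (auto intro!: c cf simp: cf_glue[OF f] madj_def)
  qed (simp add: glue_simps conv_star_outside)
  assume g: "g \<in> vcar glue_alg"
  then have cg: "continuous_on circle (\<lambda>t. cf g t i j)" for i j by (simp add: glue_car)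
  show "vadd glue_alg f g \<in> vcar glue_alg" using f g unfolding glue_car glue_simps by (auto intro!: c)
  show "vdiff glue_alg f g \<in> vcar glue_alg" using f g unfolding glue_car glue_simps by (auto intro!: c)
  show "atimes glue_alg f g \<in> vcar glue_alg" unfolding glue_car
  proof (intro conjI allI impI)
    fix i j show "continuous_on circle (\<lambda>t. cf (atimes glue_alg f g) t i j)"
      by (rule continuous_on_eq[of _ "\<lambda>t. mmul (cf f t) (cf g t) i j"])
        (auto intro!: c cf cg simp: cf_glue(1)[OF f _ g] mmul_def)
  qed (simp add: glue_simps conv_times_outside)
qed

lemma glue_eqI:
  assumes "f \<in> vcar glue_alg" "g \<in> vcar glue_alg" "\<And>t. t \<in> circle \<Longrightarrow> cf f t = cf g t"
  shows "f = g"
  using assms by (intro glue_ext) (auto simp: glue_car)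

lemma mmul_assoc: "mmul (mmul l m) n = mmul l (mmul m n)"
  by (auto simp: mmul_def fun_eq_iff algebra_simps)

lemma madj_mmul: "madj (mmul m n) = mmul (madj n) (madj m)"
  by (auto simp: mmul_def madj_def fun_eq_iff algebra_simps)

lemma star_algebra_glue: "star_algebra glue_alg"
proof unfold_locales
  fix f g h assume *: "f \<in> vcar glue_alg" "g \<in> vcar glue_alg" "h \<in> vcar glue_alg"
  show "atimes glue_alg (atimes glue_alg f g) h = atimes glue_alg f (atimes glue_alg g h)"
    using * by (intro glue_eqI) (simp_all add: glue_closed cf_glue mmul_assoc)
  show "atimes glue_alg f (vadd glue_alg g h) = vadd glue_alg (atimes glue_alg f g) (atimes glue_alg f h)"
    using * by (intro glue_eqI)
     (simp_all add: glue_closed cf_glue cf_linear, auto simp: fun_eq_iff mmul_def algebra_simps)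
  show "atimes glue_alg (vadd glue_alg f g) h = vadd glue_alg (atimes glue_alg f h) (atimes glue_alg g h)"
    using * by (intro glue_eqI)
     (simp_all add: glue_closed cf_glue cf_linear, auto simp: fun_eq_iff mmul_def algebra_simps)
next
  fix f g c assume *: "f \<in> vcar glue_alg" "g \<in> vcar glue_alg"
  show "atimes glue_alg (vscale glue_alg c f) g = vscale glue_alg c (atimes glue_alg f g)"
    using * by (intro glue_eqI)
     (simp_all add: glue_closed cf_glue cf_linear, auto simp: fun_eq_iff mmul_def algebra_simps)
  show "atimes glue_alg f (vscale glue_alg c g) = vscale glue_alg c (atimes glue_alg f g)"
    using * by (intro glue_eqI)
     (simp_all add: glue_closed cf_glue cf_linear, auto simp: fun_eq_iff mmul_def algebra_simps)
  show "astar glue_alg (vadd glue_alg f g) = vadd glue_alg (astar glue_alg f) (astar glue_alg g)"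
    using * by (intro glue_eqI)
     (simp_all add: glue_closed cf_glue cf_linear, auto simp: fun_eq_iff madj_def algebra_simps)
  show "astar glue_alg (atimes glue_alg f g) = atimes glue_alg (astar glue_alg g) (astar glue_alg f)"
    using * by (intro glue_eqI) (simp_all add: glue_closed cf_glue madj_mmul)
next
  fix f c assume *: "f \<in> vcar glue_alg"
  show "astar glue_alg (vscale glue_alg c f) = vscale glue_alg (cnj c) (astar glue_alg f)"
    using * by (intro glue_eqI)
     (simp_all add: glue_closed cf_glue cf_linear, auto simp: fun_eq_iff madj_def algebra_simps)
  show "astar glue_alg (astar glue_alg f) = f"
    using * by (intro glue_eqI) (simp_all add: glue_closed cf_glue madj_def)
  show "\<exists>g\<in>vcar glue_alg. vadd glue_alg f g = vzero glue_alg"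
    using glue_closed(2)[OF *, of "-1"] by (intro bexI[of _ "vscale glue_alg (-1) f"]) (auto simp: glue_simps)
next
  show "vzero glue_alg \<in> vcar glue_alg" by (simp add: glue_car glue_simps)
qed (auto simp: glue_closed, auto simp: glue_simps algebra_simps)

section \<open>The norm, completeness and the C*-identity\<close>

lemma glue_bdd:
  assumes "f \<in> vcar glue_alg" shows "bdd_above ((\<lambda>t. mnorm (cf f t)) ` circle)"
proof -
  have "\<exists>B. \<forall>t\<in>circle. cmod (cf f t i j) \<le> B" for i j
  proof -
    have "compact ((\<lambda>t. cf f t i j) ` circle)"
      using assms compact_circle by (intro compact_continuous_image) (auto simp: glue_car)
    then show ?thesis using compact_imp_bounded bounded_iff by (metis imageI)
  qed
  then obtain B where B: "\<And>i j t. t \<in> circle \<Longrightarrow> cmod (cf f t i j) \<le> B i j" by metis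
  define C where "C = (\<Sum>i\<in>UNIV. \<Sum>j\<in>UNIV. B i j)"
  have pos: "0 \<le> B i j" for i j using B[OF circle_nonempty, of i j] norm_ge_zero order_trans by blast
  have "cmod (cf f t i j) \<le> C" if "t \<in> circle" for t i j
    using B[OF that, of i j] pos by (cases i; cases j) (auto simp: C_def UNIV_bool add_nonneg_nonneg add_increasing add_increasing2)
  then have "mnorm (cf f t) \<le> 4 * C" if "t \<in> circle" for t using that by (intro mnorm_bound) auto
  then show ?thesis by (intro bdd_aboveI[of _ "4 * C"]) auto
qed

lemma mnorm_le_nrm: "f \<in> vcar glue_alg \<Longrightarrow> t \<in> circle \<Longrightarrow> mnorm (cf f t) \<le> nrm glue_alg f"
  unfolding glue_simps by (intro cSUP_upper glue_bdd)

lemma nrm_le: "(\<And>t. t \<in> circle \<Longrightarrow> mnorm (cf f t) \<le> C) \<Longrightarrow> nrm glue_alg f \<le> C"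
  unfolding glue_simps using circle_nonempty by (intro cSUP_least) auto

lemma nrm_nonneg: "f \<in> vcar glue_alg \<Longrightarrow> 0 \<le> nrm glue_alg f"
  using mnorm_le_nrm[OF _ circle_nonempty] mnorm_nonneg order_trans by blast

lemma cf_le_nrm: "f \<in> vcar glue_alg \<Longrightarrow> t \<in> circle \<Longrightarrow> cmod (cf f t i j) \<le> nrm glue_alg f"
  using mnorm_le_nrm mnorm_entry order_trans by blast

lemma value_le_nrm: "f \<in> vcar glue_alg \<Longrightarrow> cmod (f \<gamma>) \<le> nrm glue_alg f"
proof (cases "\<gamma> \<in> gpd")
  case True
  assume "f \<in> vcar glue_alg"
  then show ?thesis using True cf_le_nrm[of f] unfolding gpd_def cf_def by auto
next
  case False
  assume "f \<in> vcar glue_alg"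
  moreover then have "f \<gamma> = 0" using False unfolding glue_car by blast
  ultimately show ?thesis using nrm_nonneg by simp
qed

lemma nrm_le_values: "(\<And>\<gamma>. cmod (f \<gamma>) \<le> b) \<Longrightarrow> nrm glue_alg f \<le> 4 * b"
  by (intro nrm_le mnorm_bound) (auto simp: cf_def)

lemma glue_complete: "N_complete glue_alg (nrm glue_alg)"
  unfolding N_complete_def
proof (intro allI impI)
  fix x assume "N_Cauchy glue_alg (nrm glue_alg) x"
  then have x: "x n \<in> vcar glue_alg" and
    cau: "\<And>e. e > 0 \<Longrightarrow> \<exists>M. \<forall>m\<ge>M. \<forall>n\<ge>M. nrm glue_alg (vdiff glue_alg (x m) (x n)) < e" for n
    unfolding N_Cauchy_def by auto
  have diff: "cmod (x m \<gamma> - x n \<gamma>) \<le> nrm glue_alg (vdiff glue_alg (x m) (x n))" for m n \<gamma>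
    using value_le_nrm[OF glue_closed(5)[OF x x], of m n \<gamma>] by (simp add: glue_simps)
  have "Cauchy (\<lambda>n. x n \<gamma>)" for \<gamma>
  proof (rule metric_CauchyI)
    fix e :: real assume "e > 0"
    then obtain M where M: "\<forall>m\<ge>M. \<forall>n\<ge>M. nrm glue_alg (vdiff glue_alg (x m) (x n)) < e" using cau by blast
    have "dist (x m \<gamma>) (x n \<gamma>) < e" if "M \<le> m" "M \<le> n" for m n
    proof -
      have "nrm glue_alg (vdiff glue_alg (x m) (x n)) < e" using M that by blast
      then show ?thesis using diff[of m \<gamma> n] unfolding dist_norm by linarith
    qed
    then show "\<exists>M. \<forall>m\<ge>M. \<forall>n\<ge>M. dist (x m \<gamma>) (x n \<gamma>) < e" by blast
  qed
  then have "\<forall>\<gamma>. \<exists>l. (\<lambda>n. x n \<gamma>) \<longlonglongrightarrow> l" using Cauchy_convergent convergent_def by blast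
  then obtain l where l: "\<And>\<gamma>. (\<lambda>n. x n \<gamma>) \<longlonglongrightarrow> l \<gamma>" by metis
  \<comment> \<open>The norm controls all values at once, so letting the second index tend to
    infinity gives an estimate uniform over the groupoid.\<close>
  have unif: "\<exists>M. \<forall>n\<ge>M. \<forall>\<gamma>. cmod (x n \<gamma> - l \<gamma>) \<le> e" if "e > 0" for e
  proof -
    obtain M where M: "\<forall>m\<ge>M. \<forall>n\<ge>M. nrm glue_alg (vdiff glue_alg (x m) (x n)) < e" using cau \<open>e > 0\<close> by blast
    have "cmod (x n \<gamma> - l \<gamma>) \<le> e" if "n \<ge> M" for n \<gamma>
    proof (rule LIMSEQ_le_const2)
      show "(\<lambda>m. cmod (x n \<gamma> - x m \<gamma>)) \<longlonglongrightarrow> cmod (x n \<gamma> - l \<gamma>)" by (intro tendsto_intros l)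
      have "cmod (x n \<gamma> - x m \<gamma>) \<le> e" if "m \<ge> M" for m
        using diff[of n \<gamma> m] M \<open>n \<ge> M\<close> that by (meson less_imp_le order_trans)
      then show "\<exists>N. \<forall>m\<ge>N. cmod (x n \<gamma> - x m \<gamma>) \<le> e" by blast
    qed
    then show ?thesis by blast
  qed
  have "l \<in> vcar glue_alg" unfolding glue_car
  proof (intro conjI allI impI)
    fix \<gamma> assume "\<gamma> \<notin> gpd"
    then have "x n \<gamma> = 0" for n using x[of n] unfolding glue_car by blast
    then have "(\<lambda>n. x n \<gamma>) = (\<lambda>n. 0)" by simp
    then show "l \<gamma> = 0" using l[of \<gamma>] LIMSEQ_unique tendsto_const by metis
  next
    fix i j
    have ul: "uniform_limit circle (\<lambda>n t. cf (x n) t i j) (\<lambda>t. cf l t i j) sequentially"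
    proof (rule uniform_limitI)
      fix e :: real assume "e > 0"
      then obtain M where M: "\<forall>n\<ge>M. \<forall>\<gamma>. cmod (x n \<gamma> - l \<gamma>) \<le> e / 2" using unif[of "e / 2"] by auto
      have "dist (cf (x n) t i j) (cf l t i j) < e" if "n \<ge> M" for n t
        using M[rule_format, OF that, of "(pt t i, pt t j)"] \<open>e > 0\<close> unfolding cf_def dist_norm by linarith
      then show "\<forall>\<^sub>F n in sequentially. \<forall>t\<in>circle. dist (cf (x n) t i j) (cf l t i j) < e"
        unfolding eventually_sequentially by blast
    qed
    have cont: "\<forall>\<^sub>F n in sequentially. continuous_on circle (\<lambda>t. cf (x n) t i j)"
      using x unfolding glue_car by (intro always_eventually) blast
    show "continuous_on circle (\<lambda>t. cf l t i j)"
      by (rule uniform_limit_theorem[OF cont ul trivial_limit_sequentially])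
  qed
  moreover have "N_tendsto glue_alg (nrm glue_alg) x l"
    unfolding N_tendsto_def
  proof (rule LIMSEQ_I)
    fix e :: real assume "e > 0"
    \<comment> \<open>\<open>nrm_le_values\<close> loses a factor 4, so \<open>e / 8\<close> leads
      to a norm of at most \<open>e / 2\<close>.\<close>
    then obtain M where M: "\<forall>n\<ge>M. \<forall>\<gamma>. cmod (x n \<gamma> - l \<gamma>) \<le> e / 8" using unif[of "e / 8"] by auto
    have "norm (nrm glue_alg (vdiff glue_alg (x n) l) - 0) < e" if "n \<ge> M" for n
    proof -
      have "nrm glue_alg (vdiff glue_alg (x n) l) \<le> 4 * (e / 8)"
        unfolding glue_simps(7) using M that by (intro nrm_le_values) blast
      then show ?thesis using \<open>e > 0\<close> nrm_nonneg[OF glue_closed(5)[OF x \<open>l \<in> _\<close>], of n] by simp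
    qed
    then show "\<exists>no. \<forall>n\<ge>no. norm (nrm glue_alg (vdiff glue_alg (x n) l) - 0) < e" by blast
  qed
  ultimately show "\<exists>l\<in>vcar glue_alg. N_tendsto glue_alg (nrm glue_alg) x l" by blast
qed

lemma cstar_algebra_glue: "cstar_algebra glue_alg"
proof -
  interpret star_algebra glue_alg by (rule star_algebra_glue)
  show ?thesis
  proof unfold_locales
    fix f g assume fg: "f \<in> vcar glue_alg" "g \<in> vcar glue_alg"
    show "nrm glue_alg (vadd glue_alg f g) \<le> nrm glue_alg f + nrm glue_alg g"
    proof (rule nrm_le)
      fix t assume t: "t \<in> circle"
      have "cf (vadd glue_alg f g) t = (\<lambda>i j. cf f t i j + cf g t i j)" by (simp add: glue_simps fun_eq_iff)
      then show "mnorm (cf (vadd glue_alg f g) t) \<le> nrm glue_alg f + nrm glue_alg g"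
        using mnorm_add[of "cf f t" "cf g t"] mnorm_le_nrm[OF fg(1) t] mnorm_le_nrm[OF fg(2) t] by simp
    qed
    show "nrm glue_alg (atimes glue_alg f g) \<le> nrm glue_alg f * nrm glue_alg g"
    proof (rule nrm_le)
      fix t assume t: "t \<in> circle"
      have "mnorm (cf (atimes glue_alg f g) t) \<le> mnorm (cf f t) * mnorm (cf g t)"
        using cf_glue(1)[OF fg(1) t fg(2)] mnorm_mmul by simp
      also have "\<dots> \<le> nrm glue_alg f * nrm glue_alg g"
        using mnorm_le_nrm fg t mnorm_nonneg nrm_nonneg by (intro mult_mono) auto
      finally show "mnorm (cf (atimes glue_alg f g) t) \<le> nrm glue_alg f * nrm glue_alg g" .
    qed
  next
    fix f c assume f: "f \<in> vcar glue_alg"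
    show "0 \<le> nrm glue_alg f" using nrm_nonneg[OF f] .
    have "f = (\<lambda>\<gamma>. 0)" if "nrm glue_alg f = 0" using value_le_nrm[OF f] that by (auto simp: fun_eq_iff)
    moreover have "nrm glue_alg (\<lambda>\<gamma>. 0) = 0"
      using nrm_le_values[of "\<lambda>\<gamma>. 0" 0] nrm_nonneg[OF zero_closed] by (simp add: glue_simps(2))
    ultimately show "nrm glue_alg f = 0 \<longleftrightarrow> f = vzero glue_alg" by (auto simp: glue_simps(2))
    \<comment> \<open>Stated for every scalar and element, so that its use with
      \<open>inverse c\<close> on the scaled element gives the reverse inequality.\<close>
    have le: "nrm glue_alg (vscale glue_alg c f) \<le> cmod c * nrm glue_alg f" if "f \<in> vcar glue_alg" for c f
    proof (rule nrm_le)
      fix t assume t: "t \<in> circle"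
      have "cf (vscale glue_alg c f) t = (\<lambda>i j. c * cf f t i j)" by (simp add: glue_simps fun_eq_iff)
      then show "mnorm (cf (vscale glue_alg c f) t) \<le> cmod c * nrm glue_alg f"
        using mnorm_le_nrm[OF that t] by (simp add: mnorm_scale mult_left_mono)
    qed
    show "nrm glue_alg (vscale glue_alg c f) = cmod c * nrm glue_alg f"
    proof (cases "c = 0")
      case True
      then show ?thesis using le[OF f, of c] nrm_nonneg[OF scale_closed[OF f], of c] by simp
    next
      case False
      then have "nrm glue_alg f \<le> cmod (inverse c) * nrm glue_alg (vscale glue_alg c f)"
        using le[OF scale_closed[OF f], of "inverse c" c] f by (simp add: scale_scale scale_one)
      then show ?thesis using False le[OF f, of c] by (simp add: norm_divide field_simps)
    qed
    show "nrm glue_alg (atimes glue_alg (astar glue_alg f) f) = (nrm glue_alg f)\<^sup>2"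
    proof (rule antisym)
      have s: "mnorm (cf (atimes glue_alg (astar glue_alg f) f) t) = (mnorm (cf f t))\<^sup>2" if "t \<in> circle" for t
        using f that by (simp add: cf_glue star_closed mnorm_cstar)
      show "nrm glue_alg (atimes glue_alg (astar glue_alg f) f) \<le> (nrm glue_alg f)\<^sup>2"
        using mnorm_le_nrm[OF f] mnorm_nonneg by (intro nrm_le) (auto simp: s power_mono)
      have pos: "0 \<le> nrm glue_alg (atimes glue_alg (astar glue_alg f) f)"
        using nrm_nonneg times_closed star_closed f by blast
      have "nrm glue_alg f \<le> sqrt (nrm glue_alg (atimes glue_alg (astar glue_alg f) f))"
      proof (rule nrm_le)
        fix t assume "t \<in> circle"
        then show "mnorm (cf f t) \<le> sqrt (nrm glue_alg (atimes glue_alg (astar glue_alg f) f))"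
          using mnorm_le_nrm[of "atimes glue_alg (astar glue_alg f) f" t] s[of t] f
          by (intro real_le_rsqrt) (simp add: times_closed star_closed)
      qed
      then have "(nrm glue_alg f)\<^sup>2 \<le> (sqrt (nrm glue_alg (atimes glue_alg (astar glue_alg f) f)))\<^sup>2"
        using nrm_nonneg[OF f] by (intro power_mono) auto
      then show "(nrm glue_alg f)\<^sup>2 \<le> nrm glue_alg (atimes glue_alg (astar glue_alg f) f)" using pos by simp
    qed
  qed (rule glue_complete)
qed

text \<open>The element \<open>k\<close> below is \<open>s - sqrt (s\<^sup>2 - f* f)\<close>. The square root of a positive definite
  two-by-two matrix \<open>P\<close> is \<open>(P + d) / sqrt (tr P + 2 d)\<close> with \<open>d = sqrt (det P)\<close>.\<close>

lemma glue_sqrt: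
  assumes f: "f \<in> vcar glue_alg" and s: "nrm glue_alg f < s"
  shows "\<exists>k\<in>vcar glue_alg. astar glue_alg k = k \<and>
    vdiff glue_alg (vscale glue_alg (2 * of_real s) k) (atimes glue_alg k k) = atimes glue_alg (astar glue_alg f) f \<and>
    (\<forall>t\<in>circle. \<forall>i j. i \<noteq> j \<longrightarrow> cf (atimes glue_alg (astar glue_alg f) f) t i j = 0 \<longrightarrow> cf k t i j = 0)"
proof -
  let ?g = "atimes glue_alg (astar glue_alg f) f"
  have g: "?g \<in> vcar glue_alg" using f by (simp add: glue_closed)
  have s0: "s > 0" using nrm_nonneg[OF f] s by linarith
  \<comment> \<open>The matrix P = s^2 - f* f has diagonal entries \<open>p\<close>,
    \<open>q\<close> and upper off-diagonal entry \<open>- b\<close>. Further, \<open>D\<close> is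
    its determinant, \<open>d\<close> the root of \<open>D\<close>, and \<open>w\<close> the trace
    of the square root of P.\<close>
  define p where "p t = s\<^sup>2 - Re (cf ?g t False False)" for t
  define q where "q t = s\<^sup>2 - Re (cf ?g t True True)" for t
  define b where "b t = cf ?g t False True" for t
  define D where "D t = p t * q t - (cmod (b t))\<^sup>2" for t
  define d where "d t = sqrt (D t)" for t
  define w where "w t = sqrt (p t + q t + 2 * d t)" for t
  have gt: "cf ?g t = mmul (madj (cf f t)) (cf f t)" if "t \<in> circle" for t
    using f that by (simp add: cf_glue glue_closed)
  have ent: "cf ?g t False False = of_real (s\<^sup>2 - p t)" "cf ?g t True True = of_real (s\<^sup>2 - q t)"
    "cf ?g t True False = cnj (b t)" if "t \<in> circle" for t
    unfolding p_def q_def b_def gt[OF that] by (auto simp: mmul_def madj_def complex_eq_iff)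
  \<comment> \<open>The quadratic form of P at the vector (x, y) is positive, because the matrix of
    \<open>f\<close> stretches vectors by less than \<open>s\<close>.\<close>
  have form: "0 < p t * (cmod x)\<^sup>2 + q t * (cmod y)\<^sup>2 - 2 * Re (cnj x * b t * y)" if t: "t \<in> circle" and "x \<noteq> 0 \<or> y \<noteq> 0" for t x y
  proof -
    let ?v = "(x, y)" and ?m = "cf f t"
    have v: "norm ?v > 0" using that(2) by (simp add: zero_prod_def)
    have "norm (mapply ?m ?v) \<le> nrm glue_alg f * norm ?v"
      using mnorm_apply[of ?m ?v] mult_right_mono[OF mnorm_le_nrm[OF f t], of "norm ?v"] by simp
    also have "\<dots> < s * norm ?v" using s v by (rule mult_strict_right_mono)
    finally have "(norm (mapply ?m ?v))\<^sup>2 < (s * norm ?v)\<^sup>2" by (intro power_strict_mono) auto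
    moreover have "(s * norm ?v)\<^sup>2 = s\<^sup>2 * ((cmod x)\<^sup>2 + (cmod y)\<^sup>2)"
      by (simp add: power_mult_distrib norm_prod_def)
    moreover have "complex_of_real ((norm (mapply ?m ?v))\<^sup>2) = cinner (mapply (mmul (madj ?m) ?m) ?v) ?v"
      by (simp only: mapply_mmul cinner_madj cinner_self)
    then have "(norm (mapply ?m ?v))\<^sup>2 = Re (cinner (mapply (cf ?g t) ?v) ?v)"
      by (metis Re_complex_of_real gt[OF t])
    moreover have "cinner (mapply (cf ?g t) ?v) ?v
        = of_real (s\<^sup>2 - p t) * (x * cnj x) + of_real (s\<^sup>2 - q t) * (y * cnj y) + (cnj x * b t * y + cnj (cnj x * b t * y))"
      by (simp only: cinner_def mapply_def fst_conv snd_conv ent[OF t] b_def[symmetric])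
        (simp add: algebra_simps)
    then have "Re (cinner (mapply (cf ?g t) ?v) ?v) = (s\<^sup>2 - p t) * (cmod x)\<^sup>2 + (s\<^sup>2 - q t) * (cmod y)\<^sup>2 + 2 * Re (cnj x * b t * y)"
      by (simp only: complex_norm_square[symmetric] complex_add_cnj of_real_mult[symmetric] of_real_add[symmetric] Re_complex_of_real)
    ultimately show ?thesis by (simp add: algebra_simps)
  qed
  have p: "p t > 0" and q: "q t > 0" if "t \<in> circle" for t
    using form[OF that, of 1 0] form[OF that, of 0 1] by auto
  have D: "D t > 0" if t: "t \<in> circle" for t
  proof -
    \<comment> \<open>The test vector with entries \<open>b t\<close> and \<open>p t\<close> turns
      the form into \<open>p t * D t\<close>, so the determinant is positive.\<close>
    have "cnj (b t) * b t * complex_of_real (p t) = of_real ((cmod (b t))\<^sup>2 * p t)"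
      by (simp only: of_real_mult complex_norm_square) (simp add: mult_ac)
    then have "Re (cnj (b t) * b t * complex_of_real (p t)) = (cmod (b t))\<^sup>2 * p t" by (metis Re_complex_of_real)
    then have "0 < p t * (cmod (b t))\<^sup>2 + q t * (p t)\<^sup>2 - 2 * ((cmod (b t))\<^sup>2 * p t)"
      using form[OF t, of "b t" "of_real (p t)"] p[OF t] by simp
    also have "\<dots> = p t * D t" by (simp add: D_def power2_eq_square algebra_simps)
    finally show ?thesis using p[OF t] zero_less_mult_pos by blast
  qed
  have d: "d t > 0" "(d t)\<^sup>2 = D t" if "t \<in> circle" for t using D[OF that] by (auto simp: d_def)
  have w: "w t > 0" "(w t)\<^sup>2 = p t + q t + 2 * d t" if "t \<in> circle" for t
    using d(1)[OF that] p[OF that] q[OF that] by (auto simp: w_def)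
  have w': "w t \<noteq> 0" if "t \<in> circle" for t using w(1)[OF that] by simp
  have cg: "continuous_on circle (\<lambda>t. cf ?g t i j)" for i j using g by (simp add: glue_car)
  have cont: "continuous_on circle p" "continuous_on circle q" "continuous_on circle b"
    unfolding p_def q_def b_def by (intro continuous_intros cg)+
  then have contd: "continuous_on circle d" unfolding d_def D_def by (intro continuous_intros)
  then have contw: "continuous_on circle w" unfolding w_def by (intro continuous_intros cont)
  \<comment> \<open>This is s - (P + d) / w entry by entry; the off-diagonal entries of P carry a
    minus sign, which cancels.\<close>
  define a where "a t = (\<lambda>i j. if i \<and> j then of_real (s - (q t + d t) / w t) else if \<not> i \<and> \<not> j then of_real (s - (p t + d t) / w t)
      else if j then b t / of_real (w t) else cnj (b t) / of_real (w t))" for t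
  have ca: "continuous_on circle (\<lambda>t. a t i j)" for i j
    using w' by (cases i; cases j) (auto simp: a_def intro!: continuous_intros cont contd contw)
  \<comment> \<open>Over the branch set f* f is diagonal, hence so is the root; therefore
    \<open>mk a\<close> belongs to the algebra.\<close>
  have b0: "b t = 0" if "t \<in> branch_set" for t using cf_branch[OF g that, of False True] by (simp add: b_def)
  have a0: "a t i j = 0" if "t \<in> branch_set" "i \<noteq> j" for t i j using b0[OF that(1)] that by (auto simp: a_def)
  have k: "mk a \<in> vcar glue_alg" "t \<in> circle \<Longrightarrow> cf (mk a) t = a t" for t
    using mk_glue(1)[of a, OF ca] mk_glue(2)[of a, OF ca] a0 by (blast, blast)
  have sq: "2 * of_real s * a t i j - mmul (a t) (a t) i j = cf ?g t i j" if t: "t \<in> circle" for t i j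
  proof -
    let ?w = "complex_of_real (w t)"
    have w0: "?w \<noteq> 0" and w2: "?w * ?w = of_real (p t + q t + 2 * d t)"
      using w[OF t] by (auto simp: power2_eq_square simp flip: of_real_mult)
    have bb: "b t * cnj (b t) = of_real (p t * q t - (d t)\<^sup>2)"
      using d(2)[OF t] by (simp add: D_def flip: complex_norm_square)
    \<comment> \<open>\<open>x\<close> and \<open>y\<close> stand for \<open>p t\<close> and
      \<open>q t\<close> in either order, so that one computation serves both diagonal entries. It
      uses that |b|^2 equals x y - d^2 and w^2 equals x + y + 2 d.\<close>
    have diag: "2 * of_real s * of_real (s - (x + d t) / w t) - (of_real (s - (x + d t) / w t) * of_real (s - (x + d t) / w t) + b t / ?w * (cnj (b t) / ?w))
         = complex_of_real (s\<^sup>2 - x)" if "x = p t \<and> y = q t \<or> x = q t \<and> y = p t" for x y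
    proof -
      have bb': "b t * cnj (b t) = of_real (x * y - (d t)\<^sup>2)" using bb that by (auto simp: mult.commute)
      have wr: "w t * w t = x + y + 2 * d t" "w t \<noteq> 0" using w[OF t] that by (auto simp: power2_eq_square)
      have "2 * s * (s - (x + d t) / w t) - ((s - (x + d t) / w t) * (s - (x + d t) / w t) + (x * y - (d t)\<^sup>2) / (w t * w t)) = s\<^sup>2 - ((x + d t)\<^sup>2 + (x * y - (d t)\<^sup>2)) / (w t * w t)"
        using wr(2) by (simp add: field_simps power2_eq_square)
      also have "(x + d t)\<^sup>2 + (x * y - (d t)\<^sup>2) = x * (w t * w t)" unfolding wr(1) by (simp add: power2_eq_square algebra_simps)
      also have "s\<^sup>2 - x * (w t * w t) / (w t * w t) = s\<^sup>2 - x" using wr(2) by simp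
      finally have "complex_of_real (2 * s * (s - (x + d t) / w t) - ((s - (x + d t) / w t) * (s - (x + d t) / w t) + (x * y - (d t)\<^sup>2) / (w t * w t))) = of_real (s\<^sup>2 - x)"
        by (rule arg_cong)
      moreover have "b t / ?w * (cnj (b t) / ?w) = of_real ((x * y - (d t)\<^sup>2) / (w t * w t))"
        by (simp only: times_divide_times_eq bb' of_real_divide of_real_mult)
      ultimately show ?thesis by (simp only: of_real_diff of_real_mult of_real_add of_real_numeral)
    qed
    have off: "2 * of_real s * (z / ?w) - (of_real (s - (x + d t) / w t) * (z / ?w) + z / ?w * of_real (s - (y + d t) / w t)) = z"
      if "x = p t \<and> y = q t \<or> x = q t \<and> y = p t" for x y and z :: complex
    proof -
      have xy: "?w * ?w = of_real (x + y + 2 * d t)" using w2 that by (auto simp: add.commute)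
      have "2 * of_real s * (z / ?w) - (of_real (s - (x + d t) / w t) * (z / ?w) + z / ?w * of_real (s - (y + d t) / w t))
          = z * of_real (x + y + 2 * d t) / (?w * ?w)"
        using w0 by (simp add: field_simps)
      then show ?thesis using w0 by (simp only: xy[symmetric]) simp
    qed
    show ?thesis
      using diag[of "p t" "q t"] diag[of "q t" "p t"] off[of "p t" "q t" "b t"] off[of "q t" "p t" "cnj (b t)"] ent[OF t]
      by (cases i; cases j) (simp_all add: a_def mmul_def b_def[symmetric] mult_ac add_ac)
  qed
  show ?thesis
  proof (rule bexI[of _ "mk a"], intro conjI ballI allI impI)
    show 1: "mk a \<in> vcar glue_alg" by (rule k(1))
    show "astar glue_alg (mk a) = mk a"
    proof (rule glue_eqI)
      fix t assume t: "t \<in> circle"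
      have "madj (a t) i j = a t i j" for i j by (cases i; cases j) (auto simp: madj_def a_def)
      then show "cf (astar glue_alg (mk a)) t = cf (mk a) t" by (auto simp: cf_glue[OF 1 t] k(2) t fun_eq_iff)
    qed (use 1 in \<open>auto simp: glue_closed\<close>)
    show "vdiff glue_alg (vscale glue_alg (2 * of_real s) (mk a)) (atimes glue_alg (mk a) (mk a)) = ?g"
    proof (rule glue_eqI)
      fix t assume t: "t \<in> circle"
      have "cf (vdiff glue_alg (vscale glue_alg (2 * of_real s) (mk a)) (atimes glue_alg (mk a) (mk a))) t i j
          = 2 * of_real s * a t i j - mmul (a t) (a t) i j" for i j
        unfolding glue_simps(3,7) by (simp add: cf_glue(1)[OF 1 t 1] k(2)[OF t])
      then show "cf (vdiff glue_alg (vscale glue_alg (2 * of_real s) (mk a)) (atimes glue_alg (mk a) (mk a))) t = cf ?g t"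
        using sq[OF t] by (simp add: fun_eq_iff)
    qed (use 1 g in \<open>auto simp: glue_closed\<close>)
  next
    \<comment> \<open>The off-diagonal entries of the root are those of f* f divided by
      \<open>w t\<close>. Their common zeros keep \<open>k\<close> in the convolution algebra when
      \<open>f\<close> is there.\<close>
    fix t i j assume t: "t \<in> circle" and "i \<noteq> j" "cf ?g t i j = 0"
    then show "cf (mk a) t i j = 0" using ent(3)[OF t] unfolding k(2)[OF t]
      by (cases i; cases j) (auto simp: a_def b_def)
  qed
qed

text \<open>Contractivity follows from \<open>s\<^sup>2 - f* f = (s - k)\<^sup>2\<close>.\<close>

lemma representation_contractive:
  assumes rep: "representation B H \<pi>" and f: "f \<in> vcar glue_alg" "f \<in> vcar B" "astar B f \<in> vcar B"
    and sub: "\<And>c x. x \<in> vcar B \<Longrightarrow> vscale B c x \<in> vcar B" "\<And>x y. x \<in> vcar B \<Longrightarrow> y \<in> vcar B \<Longrightarrow> atimes B x y \<in> vcar B"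
    and op: "vadd B = vadd glue_alg" "vscale B = vscale glue_alg" "atimes B = atimes glue_alg" "astar B = astar glue_alg"
    and k: "\<And>k. k \<in> vcar glue_alg \<Longrightarrow>
      \<forall>t\<in>circle. \<forall>i j. i \<noteq> j \<longrightarrow> cf (atimes glue_alg (astar glue_alg f) f) t i j = 0 \<longrightarrow> cf k t i j = 0 \<Longrightarrow> k \<in> vcar B"
    and \<xi>: "\<xi> \<in> vcar H"
  shows "hnorm H (\<pi> f \<xi>) \<le> nrm glue_alg f * hnorm H \<xi>"
proof -
  note r = representationD[OF rep]
  interpret hilbert_space H by (rule r)
  have *: "hnorm H (\<pi> f \<xi>) \<le> s * hnorm H \<xi>" if s: "nrm glue_alg f < s" for s
  proof -
    obtain k where k1: "k \<in> vcar glue_alg" "astar glue_alg k = k" and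
      k2: "vdiff glue_alg (vscale glue_alg (2 * of_real s) k) (atimes glue_alg k k) = atimes glue_alg (astar glue_alg f) f"
      and k3: "\<forall>t\<in>circle. \<forall>i j. i \<noteq> j \<longrightarrow> cf (atimes glue_alg (astar glue_alg f) f) t i j = 0 \<longrightarrow> cf k t i j = 0"
      using glue_sqrt[OF f(1) s] by auto
    \<comment> \<open>For the full algebra this is immediate; for the convolution algebra the zero
      pattern of \<open>k\<close> decides it.\<close>
    have kB: "k \<in> vcar B" using k[OF k1(1) k3] .
    have s0: "s > 0" using nrm_nonneg[OF f(1)] s by linarith
    let ?x = "\<pi> f \<xi>" and ?y = "\<pi> k \<xi>"
    have xy: "?x \<in> vcar H" "?y \<in> vcar H" using r(3) f kB \<xi> by auto
    have eq: "atimes B (astar B f) f = vadd B (vscale B (2 * of_real s) k) (vscale B (-1) (atimes B k k))"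
      using k2 unfolding op vdiff_def by simp
    have "\<pi> (atimes B (astar B f) f) \<xi> = vadd H (vscale H (2 * of_real s) ?y) (vscale H (-1) (\<pi> k ?y))"
      unfolding eq using kB \<xi> sub by (simp add: r(6) r(7) r(8) sub)
    moreover have "\<pi> (atimes B (astar B f) f) \<xi> = \<pi> (astar B f) ?x" using r(7) f \<xi> by simp
    ultimately have e: "\<pi> (astar B f) ?x = vadd H (vscale H (2 * of_real s) ?y) (vscale H (-1) (\<pi> k ?y))" by simp
    have kk: "hinner H (\<pi> k ?y) \<xi> = hinner H ?y ?y"
      using r(9)[OF kB xy(2) \<xi>] k1(2) by (simp add: op)
    have ky: "\<pi> k ?y \<in> vcar H" using r(3) kB xy by blast
    have "complex_of_real ((hnorm H ?x)\<^sup>2) = hinner H ?x ?x" using inner_self xy by simp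
    also have "\<dots> = cnj (hinner H (\<pi> (astar B f) ?x) \<xi>)" using r(9)[OF f(2) xy(1) \<xi>] inner_self xy by simp
    also have "\<dots> = cnj (2 * of_real s * hinner H ?y \<xi> - of_real ((hnorm H ?y)\<^sup>2))"
      unfolding e using xy \<xi> ky by (simp add: inner_add inner_scale scale_closed kk inner_self)
    finally have "Re (complex_of_real ((hnorm H ?x)\<^sup>2)) = Re (cnj (2 * of_real s * hinner H ?y \<xi> - of_real ((hnorm H ?y)\<^sup>2)))"
      by (rule arg_cong)
    \<comment> \<open>Working with 2 s k - k^2 instead of the square of s - k keeps the unit out of
      the computation, so degenerate representations are covered as well.\<close>
    then have "(hnorm H ?x)\<^sup>2 = 2 * s * Re (hinner H ?y \<xi>) - (hnorm H ?y)\<^sup>2"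
      by simp
    also have "\<dots> \<le> 2 * s * (hnorm H ?y * hnorm H \<xi>) - (hnorm H ?y)\<^sup>2"
      using Cauchy_Schwarz[OF xy(2) \<xi>] complex_Re_le_cmod[of "hinner H ?y \<xi>"] s0 by (simp add: mult_left_mono)
    also have "\<dots> \<le> (s * hnorm H \<xi>)\<^sup>2"
      using zero_le_power2[of "s * hnorm H \<xi> - hnorm H ?y"] by (simp add: power2_diff mult_ac)
    finally show ?thesis using s0 hnorm_nonneg[OF \<xi>] by (meson mult_nonneg_nonneg less_imp_le power2_le_imp_le)
  qed
  show ?thesis
  proof (rule field_le_epsilon)
    fix e :: real assume e: "e > 0"
    \<comment> \<open>The excess over the norm is chosen so that its product with
      \<open>hnorm H \<xi>\<close> stays below \<open>e\<close>; adding 1 avoids a zero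
      denominator.\<close>
    let ?s = "nrm glue_alg f + e / (hnorm H \<xi> + 1)"
    have h: "hnorm H \<xi> \<ge> 0" using hnorm_nonneg \<xi> .
    have "hnorm H (\<pi> f \<xi>) \<le> ?s * hnorm H \<xi>" using e h by (intro *) simp
    also have "\<dots> \<le> nrm glue_alg f * hnorm H \<xi> + e" using e h by (simp add: distrib_right divide_le_eq mult_left_mono)
    finally show "hnorm H (\<pi> f \<xi>) \<le> nrm glue_alg f * hnorm H \<xi> + e" .
  qed
qed

section \<open>The groupoid algebra\<close>

lemma conv_simps:
  "vadd conv = vadd glue_alg" "vzero conv = vzero glue_alg" "vscale conv = vscale glue_alg"
  "atimes conv = atimes glue_alg" "astar conv = astar glue_alg" "vdiff conv = vdiff glue_alg"
  by (auto simp: glue_alg_def vdiff_def[abs_def] convolution_algebra_def Let_def fun_eq_iff)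

lemma conv_car: "f \<in> vcar conv \<longleftrightarrow> continuous_on gpd f \<and> (\<forall>\<gamma>. \<gamma> \<notin> gpd \<longrightarrow> f \<gamma> = 0) \<and>
    compactin (top_of_set gpd) (top_of_set gpd closure_of {\<gamma> \<in> gpd. f \<gamma> \<noteq> 0})"
  by (simp add: convolution_algebra_def Let_def glue_groupoid_def)

definition diagonal :: "mat2 \<Rightarrow> bool" where
  "diagonal m \<longleftrightarrow> m False True = 0 \<and> m True False = 0"

lemma diagonalD: "diagonal m \<Longrightarrow> i \<noteq> j \<Longrightarrow> m i j = 0"
  by (cases i; cases j) (auto simp: diagonal_def)

text \<open>For elements of \<open>glue_alg\<close> this is compactness of the support: the
  off-diagonal part of the groupoid lies over the open complement of \<open>branch_set\<close>, and
  a compact support there stays away from \<open>branch_set\<close>.\<close>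

definition near_zero :: "kernel_function \<Rightarrow> bool" where
  "near_zero f \<longleftrightarrow> (\<exists>V. open V \<and> branch_set \<subseteq> V \<and> (\<forall>t\<in>circle \<inter> V. diagonal (cf f t)))"

lemma pt_sheet [simp]: "pt t i 2 = of_bool i" by (simp add: pt_def)

lemma continuous_on_pt: "continuous_on S (\<lambda>t. pt t i)"
  unfolding pt_def
proof (rule continuous_on_coordinatewise_then_product)
  fix n :: nat
  show "continuous_on S (\<lambda>t. if n = 0 then Re t else if n = 1 then Im t else if n = 2 \<and> i then 1 else 0)"
    by (cases "n = 0"; cases "n = 1"; cases "n = 2 \<and> i") (auto intro!: continuous_intros)
qed

lemma continuous_on_coordinate: "continuous_on S (\<lambda>y :: nat \<Rightarrow> real. y n)"
  by (rule continuous_on_subset[OF continuous_on_product_coordinates]) simp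

lemma continuous_on_base: "continuous_on S base"
proof -
  have "base = (\<lambda>y. of_real (y 0) + \<i> * of_real (y 1))" by (auto simp: base_def fun_eq_iff complex_eq_iff)
  moreover have "continuous_on S (\<lambda>y :: nat \<Rightarrow> real. of_real (y 0) + \<i> * of_real (y 1))"
    by (intro continuous_intros continuous_on_coordinate)
  ultimately show ?thesis by metis
qed

text \<open>The part of the support that joins different sheets is compact, so its projection to the
  circle is closed and misses \<open>branch_set\<close>. Off-diagonal entries thus vanish near the
  branch set, and extending them by zero is continuous.\<close>

lemma conv_imp_near_zero:
  assumes f: "f \<in> vcar conv"
  shows "f \<in> vcar glue_alg" "near_zero f"
proof -
  let ?S = "top_of_set gpd closure_of {\<gamma> \<in> gpd. f \<gamma> \<noteq> 0}"
  have cont: "continuous_on gpd f" and zero: "\<And>\<gamma>. \<gamma> \<notin> gpd \<Longrightarrow> f \<gamma> = 0"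
    and cS: "compact ?S" and Sg: "?S \<subseteq> gpd"
    using f unfolding conv_car compactin_subtopology by auto
  have sup: "{\<gamma> \<in> gpd. f \<gamma> \<noteq> 0} \<subseteq> ?S" by (rule closure_of_subset) auto
  \<comment> \<open>The points of the circle over which the support contains an arrow between sheets
    \<open>i\<close> and \<open>j\<close>; the sheet coordinate cuts out a closed subset of the
    compact support.\<close>
  define Q where "Q i j = (base \<circ> fst) ` (?S \<inter> {\<gamma>. fst \<gamma> 2 = of_bool i} \<inter> {\<gamma>. snd \<gamma> 2 = of_bool j})" for i j :: bool
  have "closed {\<gamma> :: (nat \<Rightarrow> real) \<times> (nat \<Rightarrow> real). fst \<gamma> 2 = c}" "closed {\<gamma> :: (nat \<Rightarrow> real) \<times> (nat \<Rightarrow> real). snd \<gamma> 2 = c}" for c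
    by (intro closed_Collect_eq continuous_on_compose2[OF continuous_on_coordinate[of UNIV]] continuous_intros; simp)+
  then have cQ: "compact (Q i j)" for i j unfolding Q_def
    by (intro compact_continuous_image compact_Int_closed cS continuous_on_compose continuous_on_base continuous_intros)
  have QK: "Q i j \<inter> branch_set = {}" if "i \<noteq> j" for i j
  proof -
    have "base (fst \<gamma>) \<notin> branch_set" if "\<gamma> \<in> gpd" "fst \<gamma> 2 = of_bool i" "snd \<gamma> 2 = of_bool j" for \<gamma>
      using that \<open>i \<noteq> j\<close> by (cases i; cases j) (auto simp: gpd_def)
    then show ?thesis using Sg unfolding Q_def by auto
  qed
  have inQ: "t \<in> Q i j" if "t \<in> circle" "cf f t i j \<noteq> 0" for t i j
  proof -
    have "(pt t i, pt t j) \<in> {\<gamma> \<in> gpd. f \<gamma> \<noteq> 0}" using that zero by (auto simp: cf_def simp del: pt_gpd)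
    then have "(pt t i, pt t j) \<in> ?S \<inter> {\<gamma>. fst \<gamma> 2 = of_bool i} \<inter> {\<gamma>. snd \<gamma> 2 = of_bool j}"
      using sup by auto
    then show ?thesis unfolding Q_def by (force simp: image_iff)
  qed
  define V where "V = - (Q False True \<union> Q True False)"
  have V: "open V" unfolding V_def by (intro open_Compl closed_Un compact_imp_closed cQ)
  have KV: "branch_set \<subseteq> V" using QK unfolding V_def by blast
  have V0: "cf f t i j = 0" if "t \<in> circle" "t \<in> V" "i \<noteq> j" for t i j
    using inQ[OF that(1), of i j] that(2,3) unfolding V_def by (cases i; cases j) auto
  show "near_zero f" unfolding near_zero_def
    by (intro exI[of _ V] conjI ballI V KV) (auto simp: diagonal_def intro!: V0)
  have sub: "continuous_on S (\<lambda>t. cf f t i j)" if "(\<lambda>t. (pt t i, pt t j)) ` S \<subseteq> gpd" for S i j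
    unfolding cf_def using that
    by (intro continuous_on_compose2[OF cont, of S "\<lambda>t. (pt t i, pt t j)"] continuous_intros continuous_on_pt) auto
  have "continuous_on circle (\<lambda>t. cf f t i j)" for i j
  proof (cases "i = j")
    case True
    then show ?thesis by (intro sub) auto
  next
    case False
    \<comment> \<open>Two relatively open pieces: on the first the entry is a composition with
      \<open>f\<close>, on the second it is zero.\<close>
    have eq: "circle = (circle - branch_set) \<union> (circle \<inter> V)" using KV by auto
    have "continuous_on ((circle - branch_set) \<union> (circle \<inter> V)) (\<lambda>t. cf f t i j)"
    proof (rule continuous_on_Un_local_open)
      show "openin (top_of_set ((circle - branch_set) \<union> (circle \<inter> V))) (circle - branch_set)"
        unfolding eq[symmetric] using closed_branch_set by (simp add: Diff_eq open_Compl openin_open_Int)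
      show "openin (top_of_set ((circle - branch_set) \<union> (circle \<inter> V))) (circle \<inter> V)"
        unfolding eq[symmetric] using V by (simp add: openin_open_Int)
      show "continuous_on (circle - branch_set) (\<lambda>t. cf f t i j)" by (intro sub) auto
      show "continuous_on (circle \<inter> V) (\<lambda>t. cf f t i j)"
        by (rule continuous_on_eq[of _ "\<lambda>t. 0"]) (auto simp: V0 False)
    qed
    then show ?thesis using eq by simp
  qed
  then show "f \<in> vcar glue_alg" using zero unfolding glue_car by blast
qed

text \<open>The support is contained in the compact set of all diagonal points together with the
  off-diagonal points over \<open>circle - V\<close>, and this set lies in \<open>gpd\<close>
  because \<open>V\<close> contains \<open>branch_set\<close>.\<close>

lemma near_zero_imp_conv:
  assumes f: "f \<in> vcar glue_alg" and "near_zero f"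
  shows "f \<in> vcar conv"
proof -
  obtain V where V: "open V" "branch_set \<subseteq> V" "\<forall>t\<in>circle \<inter> V. diagonal (cf f t)"
    using assms(2) unfolding near_zero_def by metis
  have zero: "\<And>\<gamma>. \<gamma> \<notin> gpd \<Longrightarrow> f \<gamma> = 0" and c: "\<And>i j. continuous_on circle (\<lambda>t. cf f t i j)"
    using f unfolding glue_car by blast+
  have b: "base ` fst ` gpd \<subseteq> circle" by (auto simp: gpd_def)
  have cc: "continuous_on gpd (\<lambda>\<gamma>. cf f (base (fst \<gamma>)) i j)" for i j
    using b by (intro continuous_on_compose2[OF c, of gpd "\<lambda>\<gamma>. base (fst \<gamma>)"]
        continuous_on_compose2[OF continuous_on_base[of UNIV]] continuous_intros) auto
  have coord: "continuous_on gpd (\<lambda>\<gamma>. fst \<gamma> 2)" "continuous_on gpd (\<lambda>\<gamma>. snd \<gamma> 2)"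
    by (intro continuous_on_compose2[OF continuous_on_coordinate[of UNIV]] continuous_intros; simp)+
  text \<open>The sheet coordinates take the values 0 and 1 only, so they select the matrix entry.\<close>
  have cont: "continuous_on gpd f"
  proof (rule continuous_on_eq)
    show "continuous_on gpd (\<lambda>\<gamma>. of_real ((1 - fst \<gamma> 2) * (1 - snd \<gamma> 2)) * cf f (base (fst \<gamma>)) False False
        + of_real ((1 - fst \<gamma> 2) * snd \<gamma> 2) * cf f (base (fst \<gamma>)) False True
        + of_real (fst \<gamma> 2 * (1 - snd \<gamma> 2)) * cf f (base (fst \<gamma>)) True False
        + of_real (fst \<gamma> 2 * snd \<gamma> 2) * cf f (base (fst \<gamma>)) True True)"
      by (intro continuous_intros coord cc)
    fix \<gamma> assume "\<gamma> \<in> gpd"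
    then obtain t i j where "\<gamma> = (pt t i, pt t j)" by (auto simp: gpd_def)
    then show "of_real ((1 - fst \<gamma> 2) * (1 - snd \<gamma> 2)) * cf f (base (fst \<gamma>)) False False
        + of_real ((1 - fst \<gamma> 2) * snd \<gamma> 2) * cf f (base (fst \<gamma>)) False True
        + of_real (fst \<gamma> 2 * (1 - snd \<gamma> 2)) * cf f (base (fst \<gamma>)) True False
        + of_real (fst \<gamma> 2 * snd \<gamma> 2) * cf f (base (fst \<gamma>)) True True = f \<gamma>"
      by (cases i; cases j) (simp_all add: cf_def)
  qed
  define C where "C = (\<Union>i. \<Union>j. (\<lambda>t. (pt t i, pt t j)) ` (if i = j then circle else circle - V))"
  have "compact ((\<lambda>t. (pt t i, pt t j)) ` (if i = j then circle else circle - V))" for i j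
    using compact_circle V(1)
    by (intro compact_continuous_image continuous_intros continuous_on_pt) (auto intro: compact_diff)
  then have C: "compact C" unfolding C_def by (intro compact_UN) auto
  have Cg: "C \<subseteq> gpd" using V(2) by (auto simp: C_def split: if_splits)
  have sup: "{\<gamma> \<in> gpd. f \<gamma> \<noteq> 0} \<subseteq> C"
  proof
    fix \<gamma> assume "\<gamma> \<in> {\<gamma> \<in> gpd. f \<gamma> \<noteq> 0}"
    then obtain t i j where *: "\<gamma> = (pt t i, pt t j)" "t \<in> circle" "cf f t i j \<noteq> 0"
      by (auto simp: gpd_def cf_def)
    then have "t \<in> (if i = j then circle else circle - V)" using V(3) diagonalD by auto
    then show "\<gamma> \<in> C" unfolding C_def *(1) by blast
  qed
  have "closedin (top_of_set gpd) C" using Cg compact_imp_closed[OF C] by (rule closed_subset)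
  then have "top_of_set gpd closure_of {\<gamma> \<in> gpd. f \<gamma> \<noteq> 0} \<subseteq> C" using sup by (intro closure_of_minimal)
  moreover have "compactin (top_of_set gpd) C" using C Cg by (simp add: compactin_subtopology)
  ultimately have "compactin (top_of_set gpd) (top_of_set gpd closure_of {\<gamma> \<in> gpd. f \<gamma> \<noteq> 0})"
    using closed_compactin closedin_closure_of by blast
  then show ?thesis unfolding conv_car using cont zero by blast
qed

lemma conv_iff: "f \<in> vcar conv \<longleftrightarrow> f \<in> vcar glue_alg \<and> near_zero f"
  using conv_imp_near_zero near_zero_imp_conv by blast

text \<open>Two neighbourhoods are intersected, and an operation that preserves diagonal matrices at
  each point preserves the property. Unary operations use it with the same function twice.\<close>

lemma near_zeroI2:
  assumes "near_zero f" "near_zero g"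
    "\<And>t. t \<in> circle \<Longrightarrow> diagonal (cf f t) \<Longrightarrow> diagonal (cf g t) \<Longrightarrow> diagonal (cf h t)"
  shows "near_zero h"
proof -
  obtain V W where V: "open V" "branch_set \<subseteq> V" "\<forall>t\<in>circle \<inter> V. diagonal (cf f t)"
    and W: "open W" "branch_set \<subseteq> W" "\<forall>t\<in>circle \<inter> W. diagonal (cf g t)"
    using assms(1,2) unfolding near_zero_def by metis
  have "\<forall>t\<in>circle \<inter> (V \<inter> W). diagonal (cf h t)" using assms(3) V(3) W(3) by blast
  then show ?thesis unfolding near_zero_def using V(1,2) W(1,2)
    by (intro exI[of _ "V \<inter> W"]) auto
qed

lemma conv_closed:
  assumes f: "f \<in> vcar conv"
  shows "g \<in> vcar conv \<Longrightarrow> vadd glue_alg f g \<in> vcar conv" "vscale glue_alg c f \<in> vcar conv"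
    "g \<in> vcar conv \<Longrightarrow> atimes glue_alg f g \<in> vcar conv" "astar glue_alg f \<in> vcar conv"
    "g \<in> vcar conv \<Longrightarrow> vdiff glue_alg f g \<in> vcar conv"
proof -
  have f': "f \<in> vcar glue_alg" "near_zero f" using f by (auto simp: conv_iff)
  have "near_zero (vscale glue_alg c f)"
    by (rule near_zeroI2[OF f'(2) f'(2)]) (simp add: cf_linear diagonal_def)
  then show "vscale glue_alg c f \<in> vcar conv" using f'(1) by (simp add: conv_iff glue_closed)
  have "near_zero (astar glue_alg f)"
    by (rule near_zeroI2[OF f'(2) f'(2)]) (simp add: cf_glue[OF f'(1)] diagonal_def madj_def)
  then show "astar glue_alg f \<in> vcar conv" using f'(1) by (simp add: conv_iff glue_closed)
  assume g: "g \<in> vcar conv"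
  then have g': "g \<in> vcar glue_alg" "near_zero g" by (auto simp: conv_iff)
  have "near_zero (vadd glue_alg f g)" "near_zero (vdiff glue_alg f g)" "near_zero (atimes glue_alg f g)"
    by (rule near_zeroI2[OF f'(2) g'(2)],
        simp add: cf_linear cf_glue(1)[OF f'(1) _ g'(1)] diagonal_def mmul_def)+
  then show "vadd glue_alg f g \<in> vcar conv" "vdiff glue_alg f g \<in> vcar conv" "atimes glue_alg f g \<in> vcar conv"
    using f'(1) g'(1) by (simp_all add: conv_iff glue_closed)
qed

lemma zero_conv: "vzero glue_alg \<in> vcar conv"
  unfolding conv_iff near_zero_def by (auto simp: cf_linear diagonal_def glue_car glue_simps(2) intro!: exI[of _ UNIV])

subsection \<open>Fibre representations\<close>

text \<open>One construction serves both the whole plane over a point and the coordinate lines that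
  remain irreducible over the branch set.\<close>

definition fibre :: "(complex \<times> complex) set \<Rightarrow> (complex \<times> complex) hilb" where
  "fibre S = \<lparr> vcar = S, vadd = (+), vzero = 0, vscale = cscale, hinner = cinner \<rparr>"

definition fibre_space :: "(complex \<times> complex) set \<Rightarrow> bool" where
  "fibre_space S \<longleftrightarrow> closed S \<and> 0 \<in> S \<and> (\<forall>u\<in>S. \<forall>v\<in>S. u + v \<in> S) \<and> (\<forall>c. \<forall>v\<in>S. cscale c v \<in> S)"

lemma fibre_simps:
  "vcar (fibre S) = S" "vadd (fibre S) = (+)" "vzero (fibre S) = 0" "vscale (fibre S) = cscale"
  "hinner (fibre S) = cinner" "hnorm (fibre S) v = norm v" "vdiff (fibre S) u v = u - v"
  by (auto simp: fibre_def hnorm_def cinner_self vdiff_def cscale_def prod_eq_iff)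

lemma hilbert_fibre:
  assumes "fibre_space S" shows "hilbert_space (fibre S)"
proof unfold_locales
  show "N_complete (fibre S) (hnorm (fibre S))"
    unfolding N_complete_def
  proof (intro allI impI)
    fix x assume "N_Cauchy (fibre S) (hnorm (fibre S)) x"
    then have x: "range x \<subseteq> S" and "Cauchy x"
      unfolding N_Cauchy_def fibre_simps by (auto simp: Cauchy_def dist_norm)
    then obtain l where l: "x \<longlonglongrightarrow> l" using Cauchy_convergent convergent_def by blast
    then have "l \<in> S" using x assms unfolding fibre_space_def
      by (meson closed_sequentially rangeI subsetD)
    moreover have "(\<lambda>n. norm (x n - l)) \<longlonglongrightarrow> 0" using l by (simp add: LIM_zero tendsto_norm_zero)
    ultimately show "\<exists>l\<in>vcar (fibre S). N_tendsto (fibre S) (hnorm (fibre S)) x l"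
      unfolding N_tendsto_def fibre_simps by blast
  qed
  show "\<exists>y\<in>vcar (fibre S). vadd (fibre S) x y = vzero (fibre S)" if "x \<in> vcar (fibre S)" for x
  proof -
    have "cscale (-1) x \<in> S" using that assms unfolding fibre_space_def fibre_simps by blast
    then show ?thesis unfolding fibre_simps by (rule bexI[rotated]) (simp add: cscale_def prod_eq_iff)
  qed
  show "x = vzero (fibre S)" if "hinner (fibre S) x x = 0" for x
    using that by (simp add: fibre_simps cinner_self)
qed (use assms in \<open>simp_all add: fibre_simps fibre_space_def cinner_self\<close>,
    simp_all add: cinner_def cscale_def prod_eq_iff algebra_simps)

text \<open>A pair of complex numbers is stored in two constant functions, which puts the fibre into
  the carrier type that the spectrum and the universal seminorm prescribe.\<close>

definition code :: "complex \<times> complex \<Rightarrow> nat \<Rightarrow> kernel_function" where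
  "code v = (\<lambda>n \<gamma>. if n = 0 then fst v else snd v)"

lemma inj_code: "inj_on code S"
proof (rule inj_onI)
  fix u v assume "code u = code v"
  then have "code u n undefined = code v n undefined" for n by simp
  from this[of 0] this[of 1] show "u = v" by (simp add: code_def prod_eq_iff)
qed

definition fibre_hilb :: "(complex \<times> complex) set \<Rightarrow> (nat \<Rightarrow> kernel_function) hilb" where
  "fibre_hilb S = transported_hilbert code (fibre S)"

definition fibre_rep :: "(complex \<times> complex) set \<Rightarrow> complex \<Rightarrow> kernel_function \<Rightarrow>
    (nat \<Rightarrow> kernel_function) \<Rightarrow> nat \<Rightarrow> kernel_function" where
  "fibre_rep S t = transported_rep code (fibre S) (\<lambda>a. mapply (cf a t))"

lemma fibre_transported:
  "vcar (fibre_hilb S) = code ` S"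
  "\<lbrakk>u \<in> S; v \<in> S\<rbrakk> \<Longrightarrow> vadd (fibre_hilb S) (code u) (code v) = code (u + v)"
  "vzero (fibre_hilb S) = code 0"
  "v \<in> S \<Longrightarrow> vscale (fibre_hilb S) c (code v) = code (cscale c v)"
  "\<lbrakk>u \<in> S; v \<in> S\<rbrakk> \<Longrightarrow> hinner (fibre_hilb S) (code u) (code v) = cinner u v"
  "v \<in> S \<Longrightarrow> hnorm (fibre_hilb S) (code v) = norm v"
  "v \<in> S \<Longrightarrow> fibre_rep S t a (code v) = code (mapply (cf a t) v)"
  by (simp_all add: fibre_hilb_def fibre_rep_def transported_simps[OF inj_code] fibre_simps)

lemma representation_fibre:
  assumes S: "fibre_space S" and t: "t \<in> circle"
    and inv: "\<And>a v. a \<in> vcar glue_alg \<Longrightarrow> v \<in> S \<Longrightarrow> mapply (cf a t) v \<in> S"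
    and sub: "vcar B \<subseteq> vcar glue_alg" and star: "\<And>a. a \<in> vcar B \<Longrightarrow> astar B a \<in> vcar B"
    and op: "vadd B = vadd glue_alg" "vscale B = vscale glue_alg" "atimes B = atimes glue_alg" "astar B = astar glue_alg"
  shows "representation B (fibre_hilb S) (fibre_rep S t)"
proof -
  have "representation B (fibre S) (\<lambda>a. mapply (cf a t))"
    unfolding representation_def
  proof (intro conjI ballI allI)
    show "hilbert_space (fibre S)" by (rule hilbert_fibre[OF S])
  next
    fix a assume "a \<in> vcar B"
    then have a: "a \<in> vcar glue_alg" using sub by auto
    show "bounded_op (fibre S) (mapply (cf a t))"
      unfolding bounded_op_def linear_on_def fibre_simps
      by (intro conjI ballI allI exI[of _ "mnorm (cf a t)"] inv[OF a] mnorm_apply)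
        (auto simp: mapply_def cscale_def algebra_simps)
    fix \<xi> \<eta> assume "\<xi> \<in> vcar (fibre S)" "\<eta> \<in> vcar (fibre S)"
    show "hinner (fibre S) (mapply (cf (astar B a) t) \<xi>) \<eta> = hinner (fibre S) \<xi> (mapply (cf a t) \<eta>)"
      unfolding op fibre_simps cf_glue(2)[OF a t] by (rule cinner_madj)
  next
    fix a b \<xi> assume "a \<in> vcar B" "b \<in> vcar B"
    then have ab: "a \<in> vcar glue_alg" "b \<in> vcar glue_alg" using sub by auto
    show "mapply (cf (vadd B a b) t) \<xi> = vadd (fibre S) (mapply (cf a t) \<xi>) (mapply (cf b t) \<xi>)"
      unfolding op fibre_simps cf_linear by (simp add: mapply_def algebra_simps)
    show "mapply (cf (atimes B a b) t) \<xi> = mapply (cf a t) (mapply (cf b t) \<xi>)"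
      unfolding op cf_glue(1)[OF ab(1) t ab(2)] by (rule mapply_mmul)
  next
    fix c a \<xi>
    show "mapply (cf (vscale B c a) t) \<xi> = vscale (fibre S) c (mapply (cf a t) \<xi>)"
      unfolding op fibre_simps cf_linear by (simp add: mapply_def cscale_def algebra_simps)
  qed
  from representation_transported[OF this inj_code star] show ?thesis
    unfolding fibre_hilb_def fibre_rep_def .
qed

text \<open>The upper bound is contractivity of every representation. The lower bound comes from the
  representations by evaluation on the whole plane, at all points of the circle; over the branch set
  these are reducible but still give the norm of the matrix.\<close>

lemma universal_seminorm_conv:
  assumes f: "f \<in> vcar conv" shows "universal_seminorm conv f = nrm glue_alg f"
proof (rule antisym)
  have fg: "f \<in> vcar glue_alg" using f by (simp add: conv_iff)
  let ?S = "{opnorm H (\<pi> f) | (H :: (nat \<Rightarrow> kernel_function) hilb) \<pi>. representation conv H \<pi>}"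
  have UNIVs: "fibre_space UNIV" by (simp add: fibre_space_def)
  have rep: "representation conv (fibre_hilb UNIV) (fibre_rep UNIV t)" if "t \<in> circle" for t
    by (rule representation_fibre[OF UNIVs that]) (auto simp: conv_simps conv_closed conv_iff[THEN iffD1])
  have ub: "x \<le> nrm glue_alg f" if xS: "x \<in> ?S" for x
  proof -
    obtain H :: "(nat \<Rightarrow> kernel_function) hilb" and \<pi> where x: "x = opnorm H (\<pi> f)" and r: "representation conv H \<pi>"
      using xS by auto
    interpret hilbert_space H by (rule representationD[OF r])
    show ?thesis unfolding x
    proof (rule opnorm_le)
      fix \<xi> assume \<xi>: "\<xi> \<in> vcar H" "hnorm H \<xi> \<le> 1"
      let ?g = "atimes glue_alg (astar glue_alg f) f"
      have g: "?g \<in> vcar conv" using f by (simp add: conv_closed)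
      have "hnorm H (\<pi> f \<xi>) \<le> nrm glue_alg f * hnorm H \<xi>"
      proof (rule representation_contractive[OF r fg f])
        \<comment> \<open>Near the branch set f* f is diagonal, so the root \<open>k\<close> is
          diagonal there and stays in the convolution algebra.\<close>
        fix k assume k: "k \<in> vcar glue_alg"
          "\<forall>t\<in>circle. \<forall>i j. i \<noteq> j \<longrightarrow> cf ?g t i j = 0 \<longrightarrow> cf k t i j = 0"
        have gz: "near_zero ?g" using g by (simp add: conv_iff)
        have "diagonal (cf k t)" if "t \<in> circle" "diagonal (cf ?g t)" for t
          using k(2)[rule_format, OF that(1) _ diagonalD[OF that(2)], of False True]
            k(2)[rule_format, OF that(1) _ diagonalD[OF that(2)], of True False] by (simp add: diagonal_def)
        then have "near_zero k" by (intro near_zeroI2[OF gz gz])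
        then show "k \<in> vcar conv" using k(1) by (simp add: conv_iff)
      qed (use f \<xi> in \<open>simp_all add: conv_simps conv_closed\<close>)
      also have "\<dots> \<le> nrm glue_alg f * 1" using \<xi> nrm_nonneg[OF fg] by (intro mult_left_mono)
      finally show "hnorm H (\<pi> f \<xi>) \<le> nrm glue_alg f" by simp
    qed
  qed
  show "universal_seminorm conv f \<le> nrm glue_alg f"
    unfolding universal_seminorm_def using ub rep[OF circle_nonempty] by (intro cSup_least) auto
  show "nrm glue_alg f \<le> universal_seminorm conv f"
  proof (rule nrm_le)
    fix t assume t: "t \<in> circle"
    interpret hilbert_space "fibre_hilb UNIV" by (rule representationD[OF rep[OF t]])
    let ?N = "opnorm (fibre_hilb UNIV) (fibre_rep UNIV t f)"
    have b: "bounded_op (fibre_hilb UNIV) (fibre_rep UNIV t f)" by (rule representationD(2)[OF rep[OF t] f])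
    have "mnorm (cf f t) \<le> ?N"
    proof (rule mnorm_le[OF opnorm_nonneg[OF b]])
      fix v show "norm (mapply (cf f t) v) \<le> ?N * norm v"
        using opnorm_apply[OF b, of "code v"]
          inj_image_mem_iff[OF inj_code] by (simp add: fibre_transported)
    qed
    also have "?N \<le> universal_seminorm conv f"
      unfolding universal_seminorm_def using rep[OF t] ub by (intro cSup_upper bdd_aboveI[of _ "nrm glue_alg f"]) auto
    finally show "mnorm (cf f t) \<le> universal_seminorm conv f" .
  qed
qed

subsection \<open>The completion\<close>

text \<open>Soft thresholding: the modulus is lowered by \<open>e\<close> and the disc of radius
  \<open>e\<close> is sent to 0. The \<open>max\<close> keeps the denominator away from 0.\<close>

definition truncate :: "real \<Rightarrow> complex \<Rightarrow> complex" where
  "truncate e z = of_real (1 - e / max (cmod z) e) * z"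

lemma truncate:
  assumes "e > 0"
  shows "cmod (z - truncate e z) \<le> e" "cmod z \<le> e \<Longrightarrow> truncate e z = 0" "continuous_on UNIV (truncate e)"
proof -
  have m: "max (cmod z) e > 0" for z :: complex using assms by auto
  have "z - truncate e z = of_real (e / max (cmod z) e) * z" by (simp add: truncate_def algebra_simps)
  then have "cmod (z - truncate e z) = e * (cmod z / max (cmod z) e)"
    using m[of z] assms by (simp add: norm_mult norm_divide del: of_real_divide)
  also have "\<dots> \<le> e * 1" using m[of z] assms by (intro mult_left_mono) (auto simp: divide_le_eq)
  finally show "cmod (z - truncate e z) \<le> e" by simp
  show "truncate e z = 0" if "cmod z \<le> e" using that assms by (simp add: truncate_def max_def)
  have ne: "max (cmod z) e \<noteq> 0" for z :: complex using m[of z] by simp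
  show "continuous_on UNIV (truncate e)" unfolding truncate_def by (intro continuous_intros) (auto simp: ne simp del: max.absorb1)
qed

text \<open>Off-diagonal entries vanish on the branch set, hence are smaller than \<open>e\<close>
  on a neighbourhood of it. Thresholding them at \<open>e\<close> makes them zero there and moves
  every entry by at most \<open>e\<close>; the factor 4 comes from
  \<open>mnorm_bound\<close>.\<close>

lemma conv_dense:
  assumes a: "a \<in> vcar glue_alg" and e: "e > 0"
  shows "\<exists>f\<in>vcar conv. nrm glue_alg (vdiff glue_alg f a) \<le> 4 * e"
proof -
  define b where "b t = (\<lambda>i j. if i = j then cf a t i j else truncate e (cf a t i j))" for t
  have ca: "continuous_on circle (\<lambda>t. cf a t i j)" for i j using a by (simp add: glue_car)
  have cb: "continuous_on circle (\<lambda>t. b t i j)" for i j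
    unfolding b_def using ca continuous_on_compose2[OF truncate(3)[OF e] ca] by (cases "i = j") auto
  have b0: "b t i j = 0" if "t \<in> branch_set" "i \<noteq> j" for t i j
    using that cf_branch[OF a that] truncate(2)[OF e, of 0] e by (simp add: b_def)
  have f: "mk b \<in> vcar glue_alg" "cf (mk b) t = b t" if "t \<in> circle" for t
    using mk_glue(1)[of b, OF cb] mk_glue(2)[of b, OF cb] b0 that by (blast, blast)
  have fg: "mk b \<in> vcar glue_alg" using f(1) circle_nonempty by blast
  have "\<exists>V. open V \<and> {t \<in> circle. cmod (cf a t i j) < e} = circle \<inter> V" for i j
  proof -
    have "openin (top_of_set circle) (circle \<inter> (\<lambda>t. cmod (cf a t i j)) -` {..<e})"
      by (intro continuous_openin_preimage_gen continuous_intros ca)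
    moreover have "circle \<inter> (\<lambda>t. cmod (cf a t i j)) -` {..<e} = {t \<in> circle. cmod (cf a t i j) < e}" by auto
    ultimately show ?thesis by (auto simp: openin_open)
  qed
  then obtain V where V: "\<And>i j. open (V i j)" "\<And>i j. {t \<in> circle. cmod (cf a t i j) < e} = circle \<inter> V i j" by metis
  have "near_zero (mk b)" unfolding near_zero_def
  proof (intro exI[of _ "V False True \<inter> V True False"] conjI ballI)
    show "open (V False True \<inter> V True False)" using V(1) by auto
    show "branch_set \<subseteq> V False True \<inter> V True False"
    proof
      fix t assume t: "t \<in> branch_set"
      then have "t \<in> {t \<in> circle. cmod (cf a t i j) < e}" if "i \<noteq> j" for i j
        using cf_branch[OF a t that] e branch_set_circle by auto
      from this[of False True] this[of True False] show "t \<in> V False True \<inter> V True False" unfolding V(2) by auto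
    qed
    fix t assume t: "t \<in> circle \<inter> (V False True \<inter> V True False)"
    have off: "cf (mk b) t i j = 0" if "t \<in> circle \<inter> V i j" "i \<noteq> j" for i j
    proof -
      have "cmod (cf a t i j) \<le> e" using that(1) unfolding V(2)[symmetric] by auto
      then show ?thesis using t that(2) truncate(2)[OF e] by (simp add: f(2) b_def)
    qed
    show "diagonal (cf (mk b) t)" using t off[of False True] off[of True False] unfolding diagonal_def by simp
  qed
  then have "mk b \<in> vcar conv" using fg by (simp add: conv_iff)
  moreover have "nrm glue_alg (vdiff glue_alg (mk b) a) \<le> 4 * e"
  proof (intro nrm_le mnorm_bound)
    fix t i j assume t: "t \<in> circle"
    show "cmod (cf (vdiff glue_alg (mk b) a) t i j) \<le> e"
      using truncate(1)[OF e, of "cf a t i j"] e unfolding cf_linear f(2)[OF t]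
      by (cases i; cases j) (simp_all add: b_def norm_minus_commute)
  qed
  ultimately show ?thesis by blast
qed

interpretation glue: cstar_algebra glue_alg by (rule cstar_algebra_glue)

abbreviation (input) "gnorm \<equiv> nrm glue_alg"

lemma gnorm_diff_commute: "f \<in> vcar glue_alg \<Longrightarrow> g \<in> vcar glue_alg \<Longrightarrow> gnorm (vdiff glue_alg f g) = gnorm (vdiff glue_alg g f)"
proof -
  assume *: "f \<in> vcar glue_alg" "g \<in> vcar glue_alg"
  have "vdiff glue_alg f g = vscale glue_alg (-1) (vdiff glue_alg g f)" by (simp add: glue_simps)
  then show ?thesis using * by (simp add: glue.nrm_scale glue_closed)
qed

lemma gnorm_diff_triangle: "f \<in> vcar glue_alg \<Longrightarrow> g \<in> vcar glue_alg \<Longrightarrow> h \<in> vcar glue_alg \<Longrightarrow>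
    gnorm (vdiff glue_alg f h) \<le> gnorm (vdiff glue_alg f g) + gnorm (vdiff glue_alg g h)"
  using glue.nrm_triangle[of "vdiff glue_alg f g" "vdiff glue_alg g h"] glue.diff_triangle[of f g h]
  by (simp add: glue_closed)

text \<open>The point of the completion that corresponds to \<open>a\<close>: since
  \<open>glue_alg\<close> is complete, a class of Cauchy sequences in the convolution algebra is
  determined by its limit.\<close>

definition limit_class :: "kernel_function \<Rightarrow> (nat \<Rightarrow> kernel_function) set" where
  "limit_class a = {x. range x \<subseteq> vcar conv \<and> (\<lambda>n. gnorm (vdiff glue_alg (x n) a)) \<longlonglongrightarrow> 0}"

lemma tendsto_zero_sandwich:
  fixes f g :: "nat \<Rightarrow> real"
  assumes "g \<longlonglongrightarrow> 0" "\<And>n. 0 \<le> f n" "\<And>n. f n \<le> g n" shows "f \<longlonglongrightarrow> 0"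
  using assms by (intro tendsto_sandwich[OF _ _ tendsto_const assms(1)]) auto

text \<open>The convolution algebra with its universal seminorm is a dense subalgebra of the
  complete algebra \<open>glue_alg\<close> with the restricted norm, so its completion is
  \<open>glue_alg\<close>.\<close>

lemma groupoid_cstar_iso:
  "star_iso limit_class glue_alg (groupoid_cstar glue_groupoid)"
  "limit_class (vzero glue_alg) = vzero (groupoid_cstar glue_groupoid)"
proof -
  let ?p = "universal_seminorm conv" and ?d = "vdiff glue_alg"
  let ?R = "completion_rel conv ?p"
  have C: "groupoid_cstar glue_groupoid = completion conv ?p" by (simp add: groupoid_cstar_def enveloping_cstar_def)
  have cg: "f \<in> vcar glue_alg" if "f \<in> vcar conv" for f using that by (simp add: conv_iff)
  have p: "?p (vdiff conv f g) = gnorm (?d f g)" if "f \<in> vcar conv" "g \<in> vcar conv" for f g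
    using that universal_seminorm_conv conv_closed(5) by (simp add: conv_simps)
  have seq: "x n \<in> vcar conv" "x n \<in> vcar glue_alg" if "range x \<subseteq> vcar conv" for x n
    using that cg by auto
  have cauchy: "N_Cauchy conv ?p x \<longleftrightarrow> range x \<subseteq> vcar conv \<and> N_Cauchy glue_alg gnorm x" for x
  proof (cases "range x \<subseteq> vcar conv")
    case True
    then show ?thesis using seq[OF True] unfolding N_Cauchy_def by (auto simp: p)
  qed (auto simp: N_Cauchy_def)
  have lim: "range x \<subseteq> vcar conv" "(\<lambda>n. gnorm (?d (x n) a)) \<longlonglongrightarrow> 0" "\<And>n. x n \<in> vcar conv" "\<And>n. x n \<in> vcar glue_alg"
    if "x \<in> limit_class a" for x a using that seq[of x] by (simp_all add: limit_class_def)
  have lim_cauchy: "N_Cauchy conv ?p x" if x: "x \<in> limit_class a" and a: "a \<in> vcar glue_alg" for x a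
    unfolding cauchy unfolding N_Cauchy_def
  proof (intro conjI allI impI)
    show "range x \<subseteq> vcar conv" "range x \<subseteq> vcar glue_alg" using lim[OF x] by auto
    fix e :: real assume "e > 0"
    then have "\<forall>\<^sub>F n in sequentially. gnorm (?d (x n) a) < e / 2" using lim(2)[OF x] by (intro order_tendstoD) auto
    then obtain M where M: "\<And>n. n \<ge> M \<Longrightarrow> gnorm (?d (x n) a) < e / 2" unfolding eventually_sequentially by auto
    have "gnorm (?d (x m) (x n)) < e" if "m \<ge> M" "n \<ge> M" for m n
      using gnorm_diff_triangle[OF lim(4)[OF x] a lim(4)[OF x], of m n] M[OF that(1)] M[OF that(2)]
        gnorm_diff_commute[OF a lim(4)[OF x], of n] by linarith
    then show "\<exists>M. \<forall>m\<ge>M. \<forall>n\<ge>M. gnorm (?d (x m) (x n)) < e" by blast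
  qed
  \<comment> \<open>The class of one sequence with limit \<open>a\<close> consists of all sequences
    in the convolution algebra with that limit.\<close>
  have cls: "?R `` {x} = limit_class a" if x: "x \<in> limit_class a" and a: "a \<in> vcar glue_alg" for x a
  proof (intro equalityI subsetI)
    fix y assume "y \<in> ?R `` {x}"
    then have y: "range y \<subseteq> vcar conv" "(\<lambda>n. ?p (vdiff conv (x n) (y n))) \<longlonglongrightarrow> 0"
      unfolding completion_rel_def N_Cauchy_def by auto
    have l: "(\<lambda>n. gnorm (?d (x n) (y n)) + gnorm (?d (x n) a)) \<longlonglongrightarrow> 0"
      using tendsto_add[OF y(2) lim(2)[OF x]] p lim(3)[OF x] seq(1)[OF y(1)] by simp
    have "gnorm (?d (y n) a) \<le> gnorm (?d (x n) (y n)) + gnorm (?d (x n) a)" for n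
      using gnorm_diff_triangle[OF seq(2)[OF y(1)] lim(4)[OF x] a, of n n]
        gnorm_diff_commute[OF seq(2)[OF y(1)] lim(4)[OF x], of n n] by linarith
    then have "(\<lambda>n. gnorm (?d (y n) a)) \<longlonglongrightarrow> 0"
      using seq(2)[OF y(1)] a by (intro tendsto_zero_sandwich[OF l] nrm_nonneg glue_closed) auto
    then show "y \<in> limit_class a" using y(1) by (simp add: limit_class_def)
  next
    fix y assume y: "y \<in> limit_class a"
    have l: "(\<lambda>n. gnorm (?d (x n) a) + gnorm (?d (y n) a)) \<longlonglongrightarrow> 0"
      using tendsto_add[OF lim(2)[OF x] lim(2)[OF y]] by simp
    have "gnorm (?d (x n) (y n)) \<le> gnorm (?d (x n) a) + gnorm (?d (y n) a)" for n
      using gnorm_diff_triangle[OF lim(4)[OF x] a lim(4)[OF y], of n n]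
        gnorm_diff_commute[OF a lim(4)[OF y], of n] by linarith
    then have "(\<lambda>n. gnorm (?d (x n) (y n))) \<longlonglongrightarrow> 0"
      using lim(4)[OF x] lim(4)[OF y] by (intro tendsto_zero_sandwich[OF l] nrm_nonneg glue_closed) auto
    then show "y \<in> ?R `` {x}"
      using lim_cauchy[OF x a] lim_cauchy[OF y a] p lim(3)[OF x] lim(3)[OF y] unfolding completion_rel_def by simp
  qed
  have ne: "\<exists>x. x \<in> limit_class a" if a: "a \<in> vcar glue_alg" for a
  proof -
    have "\<exists>f\<in>vcar conv. gnorm (?d f a) \<le> 4 * inverse (real (Suc n))" for n
      by (rule conv_dense[OF a]) simp
    then obtain x where x: "\<And>n. x n \<in> vcar conv" "\<And>n. gnorm (?d (x n) a) \<le> 4 * inverse (real (Suc n))" by metis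
    have l: "(\<lambda>n. 4 * inverse (real (Suc n))) \<longlonglongrightarrow> 0"
      using tendsto_mult[OF tendsto_const LIMSEQ_inverse_real_of_nat, of 4] by simp
    have "(\<lambda>n. gnorm (?d (x n) a)) \<longlonglongrightarrow> 0"
      by (rule tendsto_zero_sandwich[OF l nrm_nonneg[OF glue_closed(5)[OF cg[OF x(1)] a]] x(2)])
    then have "x \<in> limit_class a" using x(1) unfolding limit_class_def by blast
    then show ?thesis by blast
  qed
  have inj: "a = b" if "x \<in> limit_class a" "x \<in> limit_class b" "a \<in> vcar glue_alg" "b \<in> vcar glue_alg" for x a b
  proof -
    have l: "(\<lambda>n. gnorm (?d (x n) a) + gnorm (?d (x n) b)) \<longlonglongrightarrow> 0"
      using tendsto_add[OF lim(2)[OF that(1)] lim(2)[OF that(2)]] by simp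
    have "gnorm (?d a b) \<le> gnorm (?d (x n) a) + gnorm (?d (x n) b)" for n
      using gnorm_diff_triangle[OF that(3) lim(4)[OF that(1)] that(4), of n]
        gnorm_diff_commute[OF that(3) lim(4)[OF that(1)], of n] by linarith
    then have "gnorm (?d a b) \<le> 0" by (intro LIMSEQ_le_const[OF l]) auto
    then have "gnorm (?d a b) = 0" using nrm_nonneg[OF glue_closed(5)[OF that(3,4)]] by simp
    then show ?thesis using that glue.nrm_eq_zero glue_closed glue.diff_eq_zero by metis
  qed
  have add: "(\<lambda>n. vadd glue_alg (x n) (y n)) \<in> limit_class (vadd glue_alg a b)"
    if x: "x \<in> limit_class a" and y: "y \<in> limit_class b" and a: "a \<in> vcar glue_alg" and b: "b \<in> vcar glue_alg" for x y a b
  proof -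
    have l: "(\<lambda>n. gnorm (?d (x n) a) + gnorm (?d (y n) b)) \<longlonglongrightarrow> 0"
      using tendsto_add[OF lim(2)[OF x] lim(2)[OF y]] by simp
    have "(\<lambda>n. gnorm (?d (vadd glue_alg (x n) (y n)) (vadd glue_alg a b))) \<longlonglongrightarrow> 0"
      using lim(4)[OF x] lim(4)[OF y] a b glue.nrm_triangle[OF glue_closed(5)[OF lim(4)[OF x] a] glue_closed(5)[OF lim(4)[OF y] b]]
      by (intro tendsto_zero_sandwich[OF l] nrm_nonneg glue_closed) (simp_all add: glue.diff_add_add)
    then show ?thesis using lim(3)[OF x] lim(3)[OF y] conv_closed unfolding limit_class_def by auto
  qed
  have scale: "(\<lambda>n. vscale glue_alg c (x n)) \<in> limit_class (vscale glue_alg c a)"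
    if x: "x \<in> limit_class a" and a: "a \<in> vcar glue_alg" for x a c
  proof -
    have l: "(\<lambda>n. cmod c * gnorm (?d (x n) a)) \<longlonglongrightarrow> 0"
      using tendsto_mult[OF tendsto_const lim(2)[OF x], of "cmod c"] by simp
    have "gnorm (?d (vscale glue_alg c (x n)) (vscale glue_alg c a)) = cmod c * gnorm (?d (x n) a)" for n
      using lim(4)[OF x] a by (simp add: glue.scale_diff[symmetric] glue.nrm_scale glue_closed)
    then show ?thesis using l lim(3)[OF x] conv_closed unfolding limit_class_def by auto
  qed
  have star: "(\<lambda>n. astar glue_alg (x n)) \<in> limit_class (astar glue_alg a)"
    if x: "x \<in> limit_class a" and a: "a \<in> vcar glue_alg" for x a
  proof -
    have "gnorm (?d (astar glue_alg (x n)) (astar glue_alg a)) \<le> gnorm (?d (x n) a)" for n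
    proof (rule nrm_le)
      fix t assume t: "t \<in> circle"
      have "cf (?d (astar glue_alg (x n)) (astar glue_alg a)) t = madj (cf (?d (x n) a) t)"
        using lim(4)[OF x] a t by (auto simp: cf_linear cf_glue madj_def fun_eq_iff)
      then show "mnorm (cf (?d (astar glue_alg (x n)) (astar glue_alg a)) t) \<le> gnorm (?d (x n) a)"
        using mnorm_madj_le[of "cf (?d (x n) a) t"] mnorm_le_nrm[OF glue_closed(5)[OF lim(4)[OF x] a] t, of n] by simp
    qed
    then have "(\<lambda>n. gnorm (?d (astar glue_alg (x n)) (astar glue_alg a))) \<longlonglongrightarrow> 0"
      using lim(4)[OF x] a by (intro tendsto_zero_sandwich[OF lim(2)[OF x]] nrm_nonneg glue_closed) auto
    then show ?thesis using lim(3)[OF x] conv_closed unfolding limit_class_def by auto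
  qed
  have times: "(\<lambda>n. atimes glue_alg (x n) (y n)) \<in> limit_class (atimes glue_alg a b)"
    if x: "x \<in> limit_class a" and y: "y \<in> limit_class b" and a: "a \<in> vcar glue_alg" and b: "b \<in> vcar glue_alg" for x y a b
  proof -
    note c = lim(4)[OF x] lim(4)[OF y] a b
    \<comment> \<open>From x y - a b = (x - a) y + a (y - b), with the norm of \<open>y n\<close>
      bounded by its distance to \<open>b\<close> plus the norm of \<open>b\<close>.\<close>
    let ?B = "\<lambda>n. gnorm (?d (x n) a) * (gnorm (?d (y n) b) + gnorm b) + gnorm a * gnorm (?d (y n) b)"
    have l: "?B \<longlonglongrightarrow> 0 * (0 + gnorm b) + gnorm a * 0"
      by (intro tendsto_intros lim(2)[OF x] lim(2)[OF y])
    then have l0: "?B \<longlonglongrightarrow> 0" by simp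
    have le: "gnorm (?d (atimes glue_alg (x n) (y n)) (atimes glue_alg a b)) \<le> ?B n" for n
    proof -
      have "?d (atimes glue_alg (x n) (y n)) (atimes glue_alg a b) =
          vadd glue_alg (atimes glue_alg (?d (x n) a) (y n)) (atimes glue_alg a (?d (y n) b))"
        using c by (intro glue_eqI) (simp_all add: glue_closed cf_glue cf_linear, auto simp: mmul_def fun_eq_iff algebra_simps)
      then have "gnorm (?d (atimes glue_alg (x n) (y n)) (atimes glue_alg a b)) \<le>
          gnorm (atimes glue_alg (?d (x n) a) (y n)) + gnorm (atimes glue_alg a (?d (y n) b))"
        using c by (simp add: glue.nrm_triangle glue_closed)
      also have "\<dots> \<le> gnorm (?d (x n) a) * gnorm (y n) + gnorm a * gnorm (?d (y n) b)"
        using c by (intro add_mono glue.nrm_times glue_closed)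
      also have "gnorm (y n) \<le> gnorm (?d (y n) b) + gnorm b"
        using glue.nrm_triangle[of "?d (y n) b" b] c glue.diff_add_cancel[of "y n" b] by (simp add: glue_closed)
      finally show ?thesis using nrm_nonneg[OF glue_closed(5)[OF c(1) a], of n] by (simp add: mult_left_mono)
    qed
    have "(\<lambda>n. gnorm (?d (atimes glue_alg (x n) (y n)) (atimes glue_alg a b))) \<longlonglongrightarrow> 0"
      by (rule tendsto_zero_sandwich[OF l0 nrm_nonneg le]) (intro glue_closed c)
    then show ?thesis using lim(3)[OF x] lim(3)[OF y] conv_closed unfolding limit_class_def by auto
  qed
  \<comment> \<open>All representatives yield the same class and there is at least one, so the
    unions that define the operations collapse.\<close>
  have UN: "(\<Union>x\<in>limit_class a. F x) = X" if "\<And>x. x \<in> limit_class a \<Longrightarrow> F x = X" "a \<in> vcar glue_alg"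
    for a and F :: "(nat \<Rightarrow> kernel_function) \<Rightarrow> (nat \<Rightarrow> kernel_function) set" and X
    using that ne[OF that(2)] by blast
  show "star_iso limit_class glue_alg (groupoid_cstar glue_groupoid)"
    unfolding star_iso_def linear_on_def C
  proof (intro conjI ballI allI)
    have car: "vcar (completion conv ?p) = {x. N_Cauchy conv ?p x} // ?R" by (simp add: completion_def Let_def)
    show bij: "bij_betw limit_class (vcar glue_alg) (vcar (completion conv ?p))"
    proof (rule bij_betw_imageI)
      show "inj_on limit_class (vcar glue_alg)"
      proof (rule inj_onI)
        fix a b assume a: "a \<in> vcar glue_alg" and b: "b \<in> vcar glue_alg" and eq: "limit_class a = limit_class b"
        obtain x where "x \<in> limit_class a" using ne[OF a] by blast
        then show "a = b" using inj[of x a b] a b eq by simp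
      qed
      show "limit_class ` vcar glue_alg = vcar (completion conv ?p)"
        unfolding car
      proof (intro equalityI subsetI)
        fix X assume "X \<in> limit_class ` vcar glue_alg"
        then obtain a x where "a \<in> vcar glue_alg" "X = limit_class a" "x \<in> limit_class a" using ne by blast
        then have "X = ?R `` {x}" "N_Cauchy conv ?p x" using cls[of x a] lim_cauchy[of x a] by auto
        then show "X \<in> {x. N_Cauchy conv ?p x} // ?R" by (auto simp: quotient_def)
      next
        fix X assume "X \<in> {x. N_Cauchy conv ?p x} // ?R"
        then obtain x where x: "N_Cauchy conv ?p x" "X = ?R `` {x}" by (auto simp: quotient_def)
        then obtain a where a: "a \<in> vcar glue_alg" "N_tendsto glue_alg gnorm x a"
          using glue_complete unfolding cauchy N_complete_def by blast
        then have "x \<in> limit_class a" using x(1) unfolding limit_class_def N_tendsto_def cauchy by auto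
        from cls[OF this a(1)] have "X = limit_class a" using x(2) by simp
        then show "X \<in> limit_class ` vcar glue_alg" using a(1) by blast
      qed
    qed
    show "limit_class a \<in> vcar (completion conv ?p)" if "a \<in> vcar glue_alg" for a
      using bij that by (auto simp: bij_betw_def)
  next
    fix a b assume a: "a \<in> vcar glue_alg" and b: "b \<in> vcar glue_alg"
    have "vadd (completion conv ?p) (limit_class a) (limit_class b) =
       (\<Union>x\<in>limit_class a. \<Union>y\<in>limit_class b. ?R `` {\<lambda>n. vadd glue_alg (x n) (y n)})"
      by (simp add: completion_def Let_def conv_simps)
    also have "\<dots> = limit_class (vadd glue_alg a b)"
      using a b by (intro UN cls add glue_closed)
    finally show "limit_class (vadd glue_alg a b) = vadd (completion conv ?p) (limit_class a) (limit_class b)" by simp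
    have "atimes (completion conv ?p) (limit_class a) (limit_class b) =
       (\<Union>x\<in>limit_class a. \<Union>y\<in>limit_class b. ?R `` {\<lambda>n. atimes glue_alg (x n) (y n)})"
      by (simp add: completion_def Let_def conv_simps)
    also have "\<dots> = limit_class (atimes glue_alg a b)"
      using a b by (intro UN cls times glue_closed)
    finally show "limit_class (atimes glue_alg a b) = atimes (completion conv ?p) (limit_class a) (limit_class b)" by simp
  next
    fix a c assume a: "a \<in> vcar glue_alg"
    have "vscale (completion conv ?p) c (limit_class a) = (\<Union>x\<in>limit_class a. ?R `` {\<lambda>n. vscale glue_alg c (x n)})"
      by (simp add: completion_def Let_def conv_simps)
    also have "\<dots> = limit_class (vscale glue_alg c a)"
      using a by (intro UN cls scale glue_closed)
    finally show "limit_class (vscale glue_alg c a) = vscale (completion conv ?p) c (limit_class a)" by simp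
  next
    fix a assume a: "a \<in> vcar glue_alg"
    have "astar (completion conv ?p) (limit_class a) = (\<Union>x\<in>limit_class a. ?R `` {\<lambda>n. astar glue_alg (x n)})"
      by (simp add: completion_def Let_def conv_simps)
    also have "\<dots> = limit_class (astar glue_alg a)"
      using a by (intro UN cls star glue_closed)
    finally show "limit_class (astar glue_alg a) = astar (completion conv ?p) (limit_class a)" by simp
  qed
  have "(\<lambda>n. vzero glue_alg) \<in> limit_class (vzero glue_alg)"
    using zero_conv glue.diff_self[OF glue.zero_closed] glue.nrm_eq_zero[OF glue.zero_closed]
    by (simp add: limit_class_def)
  then show "limit_class (vzero glue_alg) = vzero (groupoid_cstar glue_groupoid)"
    unfolding C using cls[OF _ glue.zero_closed] by (simp add: completion_def Let_def conv_simps)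
qed

text \<open>Transport supplies the axioms for the groupoid algebra, whose operations are unions over
  classes and awkward to compute with. They are needed for the functoriality of the tensor
  product.\<close>

lemma star_algebra_iso:
  assumes A: "star_algebra A" and iso: "star_iso \<phi> A B" and z: "\<phi> (vzero A) = vzero B"
  shows "star_algebra B"
proof -
  interpret A: star_algebra A by fact
  note i = star_isoD(3-6)[OF iso, symmetric] z[symmetric]
  have car: "vcar B = \<phi> ` vcar A" using star_isoD(1)[OF iso] by (auto simp: bij_betw_def)
  note cl = A.add_closed A.scale_closed A.times_closed A.star_closed A.zero_closed
  show ?thesis
  proof unfold_locales
    fix x assume "x \<in> vcar B"
    then obtain a where a: "a \<in> vcar A" "x = \<phi> a" by (auto simp: car)
    then obtain b where b: "b \<in> vcar A" "vadd A a b = vzero A" using A.neg_ex by blast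
    then show "\<exists>y\<in>vcar B. vadd B x y = vzero B" using a by (intro bexI[of _ "\<phi> b"]) (auto simp: i car)
  qed (auto simp: car i cl A.add_assoc A.zero_add A.scale_add A.add_scale A.scale_scale A.scale_one A.times_assoc
     A.times_add A.add_times A.scale_times A.times_scale A.star_star A.star_add A.star_scale A.star_times
     intro!: arg_cong[of _ _ \<phi>] A.add_comm)
qed

lemma star_algebra_groupoid: "star_algebra (groupoid_cstar glue_groupoid)"
  by (rule star_algebra_iso[where \<phi> = limit_class]) (rule star_algebra_glue groupoid_cstar_iso)+

lemma cstar_tensor_glue:
  "cstar_iso (cstar_tensor glue_alg compacts) (cstar_tensor (groupoid_cstar glue_groupoid) compacts)"
  using cstar_tensor_iso[OF star_algebra_glue star_algebra_groupoid
      star_algebra_compacts groupoid_cstar_iso(1)] .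

section \<open>Unitary equivalence\<close>

lemma unitarily_equivalent_refl: "unitarily_equivalent A r r"
  by (cases r) (auto simp: unitarily_equivalent_def linear_on_def intro!: exI[of _ id])

lemma unitarily_equivalent_sym:
  assumes e: "unitarily_equivalent A r s" and "complex_vs (fst r)"
    and inv: "\<And>a \<xi>. a \<in> vcar A \<Longrightarrow> \<xi> \<in> vcar (fst r) \<Longrightarrow> snd r a \<xi> \<in> vcar (fst r)"
  shows "unitarily_equivalent A s r"
proof -
  obtain H \<pi> H' \<pi>' where rs: "r = (H, \<pi>)" "s = (H', \<pi>')" by (cases r; cases s) auto
  interpret complex_vs H using assms(2) rs by simp
  obtain U where U: "bij_betw U (vcar H) (vcar H')"
    and add: "\<And>x y. x \<in> vcar H \<Longrightarrow> y \<in> vcar H \<Longrightarrow> U (vadd H x y) = vadd H' (U x) (U y)"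
    and sc: "\<And>c x. x \<in> vcar H \<Longrightarrow> U (vscale H c x) = vscale H' c (U x)"
    and inn: "\<And>x y. x \<in> vcar H \<Longrightarrow> y \<in> vcar H \<Longrightarrow> hinner H' (U x) (U y) = hinner H x y"
    and tw: "\<And>a x. a \<in> vcar A \<Longrightarrow> x \<in> vcar H \<Longrightarrow> U (\<pi> a x) = \<pi>' a (U x)"
    using e unfolding rs unitarily_equivalent_def linear_on_def by auto
  let ?V = "inv_into (vcar H) U"
  have VU: "?V (U x) = x" if "x \<in> vcar H" for x using U that by (simp add: bij_betw_def)
  have img: "vcar H' = U ` vcar H" using U by (simp add: bij_betw_def)
  have inv': "\<pi> a x \<in> vcar H" if "a \<in> vcar A" "x \<in> vcar H" for a x using inv that rs by simp
  show ?thesis unfolding rs unitarily_equivalent_def linear_on_def prod.case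
  proof (intro exI[of _ ?V] conjI ballI allI)
    show "bij_betw ?V (vcar H') (vcar H)" using U by (rule bij_betw_inv_into)
  qed (auto simp: img VU add[symmetric] sc[symmetric] inn[symmetric] tw[symmetric] inv' add_closed scale_closed)
qed

lemma unitarily_equivalent_trans:
  assumes "unitarily_equivalent A r s" "unitarily_equivalent A s u"
  shows "unitarily_equivalent A r u"
proof -
  obtain H \<pi> H' \<pi>' H'' \<pi>'' where rs: "r = (H, \<pi>)" "s = (H', \<pi>')" "u = (H'', \<pi>'')"
    by (cases r; cases s; cases u) auto
  obtain U where U: "bij_betw U (vcar H) (vcar H')" "linear_on H H' U"
    "\<forall>\<xi>\<in>vcar H. \<forall>\<eta>\<in>vcar H. hinner H' (U \<xi>) (U \<eta>) = hinner H \<xi> \<eta>"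
    "\<forall>a\<in>vcar A. \<forall>\<xi>\<in>vcar H. U (\<pi> a \<xi>) = \<pi>' a (U \<xi>)"
    using assms(1) unfolding rs unitarily_equivalent_def by auto
  obtain V where V: "bij_betw V (vcar H') (vcar H'')" "linear_on H' H'' V"
    "\<forall>\<xi>\<in>vcar H'. \<forall>\<eta>\<in>vcar H'. hinner H'' (V \<xi>) (V \<eta>) = hinner H' \<xi> \<eta>"
    "\<forall>a\<in>vcar A. \<forall>\<xi>\<in>vcar H'. V (\<pi>' a \<xi>) = \<pi>'' a (V \<xi>)"
    using assms(2) unfolding rs unitarily_equivalent_def by auto
  have cl: "U \<xi> \<in> vcar H'" if "\<xi> \<in> vcar H" for \<xi> using U(2) that by (simp add: linear_on_def)
  show ?thesis unfolding rs unitarily_equivalent_def prod.case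
  proof (intro exI[of _ "V \<circ> U"] conjI)
    show "bij_betw (V \<circ> U) (vcar H) (vcar H'')" using U(1) V(1) by (rule bij_betw_trans)
    show "linear_on H H'' (V \<circ> U)" using U(2) V(2) by (simp add: linear_on_def)
  qed (use U(3,4) V(3,4) cl in simp_all)
qed

text \<open>Membership of \<open>a\<close> in the kernel of the representation. Kernels depend only
  on the equivalence class, and they are all that the Jacobson topology sees.\<close>

definition kills :: "('h, 'k) hilb_scheme \<Rightarrow> ('a \<Rightarrow> 'h \<Rightarrow> 'h) \<Rightarrow> 'a \<Rightarrow> bool" where
  "kills H \<pi> a \<longleftrightarrow> (\<forall>\<xi>\<in>vcar H. \<pi> a \<xi> = vzero H)"

lemma kills_equivalent:
  assumes "unitarily_equivalent A (H, \<pi>) (H', \<pi>')" "hilbert_space H" "hilbert_space H'"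
    "\<And>\<xi>. \<xi> \<in> vcar H \<Longrightarrow> \<pi> a \<xi> \<in> vcar H" "a \<in> vcar A"
  shows "kills H \<pi> a \<longleftrightarrow> kills H' \<pi>' a"
proof -
  interpret H: hilbert_space H by fact
  interpret H': hilbert_space H' by fact
  obtain U where U: "bij_betw U (vcar H) (vcar H')" "linear_on H H' U"
    "\<forall>a\<in>vcar A. \<forall>\<xi>\<in>vcar H. U (\<pi> a \<xi>) = \<pi>' a (U \<xi>)"
    using assms(1) unfolding unitarily_equivalent_def by auto
  have U0: "U (vzero H) = vzero H'"
  proof -
    have "U (vscale H 0 (vzero H)) = vscale H' 0 (U (vzero H))" "U (vzero H) \<in> vcar H'"
      using U(2) H.zero_closed by (simp_all add: linear_on_def)
    then show ?thesis by (simp add: H.scale_zero H'.scale_zero_left)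
  qed
  have z: "U \<xi> = vzero H' \<longleftrightarrow> \<xi> = vzero H" if "\<xi> \<in> vcar H" for \<xi>
    using U(1) U0 that H.zero_closed by (metis bij_betw_imp_inj_on inj_onD)
  have img: "vcar H' = U ` vcar H" using U(1) by (simp add: bij_betw_def)
  have "kills H' \<pi>' a \<longleftrightarrow> (\<forall>\<xi>\<in>vcar H. \<pi>' a (U \<xi>) = vzero H')"
    unfolding kills_def img by simp
  also have "\<dots> \<longleftrightarrow> (\<forall>\<xi>\<in>vcar H. U (\<pi> a \<xi>) = vzero H')" using U(3) assms(5) by simp
  also have "\<dots> \<longleftrightarrow> kills H \<pi> a" unfolding kills_def using z assms(4) by simp
  finally show ?thesis by simp
qed

section \<open>Irreducible representations of the glued algebra\<close>

text \<open>Evaluation at a point fills all two-by-two matrices off the branch set and all diagonal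
  matrices on it.\<close>

lemma matrix_interpolation:
  assumes t: "t \<in> circle" and M: "t \<in> branch_set \<Longrightarrow> diagonal M"
  shows "\<exists>a\<in>vcar glue_alg. cf a t = M"
proof -
  \<comment> \<open>The distance to the branch set, normalised to be 1 at \<open>t\<close>, makes
    the off-diagonal entries vanish where they must. Over the branch set the target is diagonal and
    the weight 0 does.\<close>
  define w where "w s = (if t \<in> branch_set then 0 else infdist s branch_set / infdist t branch_set)" for s
  define b where "b s = (\<lambda>i j. if i = j then M i j else of_real (w s) * M i j)" for s
  have K: "branch_set \<noteq> {}" by (simp add: branch_set_def)
  have "continuous_on circle w" unfolding w_def by (cases "t \<in> branch_set") (auto intro!: continuous_intros simp: divide_inverse)
  then have cb: "continuous_on circle (\<lambda>s. b s i j)" for i j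
    unfolding b_def by (cases "i = j") (auto intro!: continuous_intros)
  have "w s = 0" if "s \<in> branch_set" for s using that by (simp add: w_def)
  then have b0: "b s i j = 0" if "s \<in> branch_set" "i \<noteq> j" for s i j using that unfolding b_def by simp
  have wt: "t \<notin> branch_set \<Longrightarrow> w t = 1"
    using in_closed_iff_infdist_zero[OF closed_branch_set K, of t] by (simp add: w_def)
  have "b t i j = M i j" for i j
    using wt diagonalD[OF M, of i j] by (cases "i = j"; cases "t \<in> branch_set") (simp_all add: b_def del: not_iff)
  then have "cf (mk b) t = M" using mk_glue(2)[of b, OF cb] b0 t by (simp add: fun_eq_iff)
  moreover have "mk b \<in> vcar glue_alg" using mk_glue(1)[of b, OF cb] b0 by simp
  ultimately show ?thesis by blast
qed

text \<open>Scalar functions are central; they locate the point of the circle at which an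
  irreducible representation lives.\<close>

definition scal :: "(complex \<Rightarrow> complex) \<Rightarrow> kernel_function" where
  "scal z = mk (\<lambda>s i j. if i = j then z s else 0)"

lemma scal:
  assumes "continuous_on circle z"
  shows "scal z \<in> vcar glue_alg" "t \<in> circle \<Longrightarrow> cf (scal z) t = (\<lambda>i j. if i = j then z t else 0)"
proof -
  have c: "continuous_on circle (\<lambda>s. if i = j then z s else 0)" for i j :: bool using assms by (cases "i = j") auto
  show "scal z \<in> vcar glue_alg" unfolding scal_def by (rule mk_glue(1)[OF c]) simp
  show "cf (scal z) t = (\<lambda>i j. if i = j then z t else 0)" if "t \<in> circle"
    unfolding scal_def by (rule mk_glue(2)[OF c _ that]) simp
qed

definition unit_entry :: "bool \<Rightarrow> mat2" where "unit_entry i = (\<lambda>k j. if k = i \<and> j = i then 1 else 0)"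

text \<open>The constant projection to one sheet. Being diagonal, it belongs to the algebra; it has
  rank one at every point of that sheet and separates the two sheets over the branch set.\<close>

definition corner :: "bool \<Rightarrow> kernel_function" where "corner i = mk (\<lambda>s. unit_entry i)"

lemma corner: "corner i \<in> vcar glue_alg" "t \<in> circle \<Longrightarrow> cf (corner i) t = unit_entry i"
  unfolding corner_def by (rule mk_glue, auto simp: unit_entry_def)+

lemma corner_idem: "atimes glue_alg (corner i) (corner i) = corner i" "astar glue_alg (corner i) = corner i"
proof -
  show "atimes glue_alg (corner i) (corner i) = corner i"
  proof (rule glue_eqI)
    fix t assume t: "t \<in> circle"
    have "mmul (unit_entry i) (unit_entry i) = unit_entry i"
      by (cases i) (auto simp: mmul_def unit_entry_def fun_eq_iff)
    then show "cf (atimes glue_alg (corner i) (corner i)) t = cf (corner i) t"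
      by (simp add: cf_glue(1)[OF corner(1) t corner(1)] corner(2)[OF t])
  qed (simp_all add: corner glue_closed)
  show "astar glue_alg (corner i) = corner i"
  proof (rule glue_eqI)
    fix t assume t: "t \<in> circle"
    have "madj (unit_entry i) = unit_entry i" by (auto simp: madj_def unit_entry_def fun_eq_iff)
    then show "cf (astar glue_alg (corner i)) t = cf (corner i) t"
      by (simp add: cf_glue(2)[OF corner(1) t] corner(2)[OF t])
  qed (simp_all add: corner glue_closed)
qed

definition comp :: "bool \<Rightarrow> complex \<times> complex \<Rightarrow> complex" where "comp i v = (if i then snd v else fst v)"

definition basis :: "bool \<Rightarrow> complex \<times> complex" where "basis i = (if i then (0, 1) else (1, 0))"

text \<open>The space of the irreducible representation at the point \<open>t\<close> of sheet
  \<open>i\<close>: the whole plane off the branch set, where both sheets give the same class, and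
  the coordinate line of sheet \<open>i\<close> on it.\<close>

definition fib :: "complex \<Rightarrow> bool \<Rightarrow> (complex \<times> complex) set" where
  "fib t i = {v. t \<in> branch_set \<longrightarrow> comp (\<not> i) v = 0}"

definition point_hilb :: "complex \<Rightarrow> bool \<Rightarrow> (nat \<Rightarrow> kernel_function) hilb" where
  "point_hilb t i = fibre_hilb (fib t i)"

definition point_rep :: "complex \<Rightarrow> bool \<Rightarrow> kernel_function \<Rightarrow> (nat \<Rightarrow> kernel_function) \<Rightarrow> nat \<Rightarrow> kernel_function" where
  "point_rep t i = fibre_rep (fib t i) t"

lemma comp_mapply: "comp i (mapply m v) = m i False * comp False v + m i True * comp True v"
  by (simp add: comp_def mapply_def)

lemma comp_eqI: "(\<And>i. comp i u = comp i v) \<Longrightarrow> u = v"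
proof -
  assume h: "\<And>i. comp i u = comp i v"
  show "u = v" using h[of True] h[of False] by (simp add: comp_def prod_eq_iff)
qed

lemma comp_simps [simp]: "comp i (u + v) = comp i u + comp i v" "comp i (cscale c v) = c * comp i v"
  "comp i 0 = 0" "comp i (basis j) = (if i = j then 1 else 0)" "comp i (u - v) = comp i u - comp i v"
  by (auto simp: comp_def cscale_def basis_def)

lemma basis_fib: "basis i \<in> fib t i" by (simp add: fib_def)

lemma fibre_space_fib: "fibre_space (fib t i)"
proof -
  have "closed {v. comp (\<not> i) v = 0}"
    by (cases i) (auto simp: comp_def intro!: closed_Collect_eq continuous_intros)
  then have "closed (fib t i)" unfolding fib_def by (cases "t \<in> branch_set") auto
  then show ?thesis unfolding fibre_space_def by (auto simp: fib_def)
qed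

lemma mapply_fib:
  assumes a: "a \<in> vcar glue_alg" and v: "v \<in> fib t i" shows "mapply (cf a t) v \<in> fib t i"
proof -
  have "comp (\<not> i) (mapply (cf a t) v) = 0" if t: "t \<in> branch_set"
    using v t cf_branch[OF a t, of False True] cf_branch[OF a t, of True False]
    unfolding comp_mapply by (cases i) (simp_all add: fib_def)
  then show ?thesis by (simp add: fib_def)
qed

lemma representation_point: "t \<in> circle \<Longrightarrow> representation glue_alg (point_hilb t i) (point_rep t i)"
  unfolding point_hilb_def point_rep_def
  by (rule representation_fibre[OF fibre_space_fib _ mapply_fib]) (simp_all add: glue_closed)

lemma point_simps:
  "vcar (point_hilb t i) = code ` fib t i" "vzero (point_hilb t i) = code 0"
  "v \<in> fib t i \<Longrightarrow> point_rep t i a (code v) = code (mapply (cf a t) v)"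
  by (simp_all add: point_hilb_def point_rep_def fibre_transported)

lemma code_eq [simp]: "code u = code v \<longleftrightarrow> u = v" using inj_code[of UNIV] by (auto dest: injD)

lemma kills_point:
  assumes "a \<in> vcar glue_alg"
  shows "kills (point_hilb t i) (point_rep t i) a \<longleftrightarrow>
    (if t \<in> branch_set then cf a t i i = 0 else (\<forall>k j. cf a t k j = 0))"
proof -
  have k: "kills (point_hilb t i) (point_rep t i) a \<longleftrightarrow> (\<forall>v\<in>fib t i. mapply (cf a t) v = 0)"
    unfolding kills_def by (auto simp: point_simps)
  show ?thesis
  proof (cases "t \<in> branch_set")
    case True
    have "mapply (cf a t) v = 0" if "v \<in> fib t i" "cf a t i i = 0" for v
    proof (rule comp_eqI)
      fix k show "comp k (mapply (cf a t) v) = comp k 0"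
        using that True cf_branch[OF assms True, of False True] cf_branch[OF assms True, of True False]
        unfolding comp_mapply by (cases i; cases k) (simp_all add: fib_def)
    qed
    moreover have "comp i (mapply (cf a t) (basis i)) = cf a t i i" unfolding comp_mapply by (cases i) simp_all
    ultimately show ?thesis unfolding k using True basis_fib[of i t] comp_simps(3)[of i] by metis
  next
    case False
    have "cf a t k j = comp k (mapply (cf a t) (basis j))" for k j unfolding comp_mapply by (cases j) simp_all
    moreover have "basis j \<in> fib t i" for j using False by (simp add: fib_def)
    moreover have "mapply (cf a t) v = 0" if "\<forall>k j. cf a t k j = 0" for v using that by (simp add: mapply_def zero_prod_def)
    ultimately show ?thesis unfolding k using False comp_simps(3) by metis
  qed
qed

text \<open>A nonzero vector of the fibre can be moved to any other one by an element of the
  algebra, so no proper invariant subspace is left.\<close>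

lemma irreducible_point:
  assumes t: "t \<in> circle" shows "irreducible_rep glue_alg (point_hilb t i) (point_rep t i)"
  unfolding irreducible_rep_def
proof (intro conjI allI impI)
  show rep: "representation glue_alg (point_hilb t i) (point_rep t i)" using t by (rule representation_point)
  have "\<not> kills (point_hilb t i) (point_rep t i) (corner i)"
    unfolding kills_point[OF corner(1)] by (auto simp: corner(2)[OF t] unit_entry_def)
  then show "\<exists>a\<in>vcar glue_alg. \<exists>\<xi>\<in>vcar (point_hilb t i). point_rep t i a \<xi> \<noteq> vzero (point_hilb t i)"
    using corner(1) unfolding kills_def by blast
  fix W assume W: "vsubspace (point_hilb t i) W \<and> N_closed (point_hilb t i) (hnorm (point_hilb t i)) W \<and>
      (\<forall>a\<in>vcar glue_alg. \<forall>\<xi>\<in>W. point_rep t i a \<xi> \<in> W)"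
  then have sub: "W \<subseteq> code ` fib t i" "code 0 \<in> W" by (auto simp: vsubspace_def point_simps)
  show "W = {vzero (point_hilb t i)} \<or> W = vcar (point_hilb t i)"
  proof (cases "W = {code 0}")
    case False
    then obtain v where v: "code v \<in> W" "v \<in> fib t i" "v \<noteq> 0" using sub by blast
    have "code u \<in> W" if u: "u \<in> fib t i" for u
    proof -
      \<comment> \<open>The rank one matrix that sends \<open>v\<close> to \<open>u\<close>. Over
        the branch set both vectors lie on one coordinate line, so it is diagonal and can be
        interpolated.\<close>
      define M where "M = (\<lambda>k j. comp k u * cnj (comp j v) / of_real ((norm v)\<^sup>2))"
      have "diagonal M" if "t \<in> branch_set"
        using that u v(2) by (cases i) (auto simp: diagonal_def M_def fib_def)
      then obtain a where a: "a \<in> vcar glue_alg" "cf a t = M" using matrix_interpolation[OF t] by blast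
      have n: "complex_of_real ((norm v)\<^sup>2) = cnj (comp False v) * comp False v + cnj (comp True v) * comp True v"
        unfolding cinner_self[symmetric] by (simp add: cinner_def comp_def mult.commute)
      have n0: "complex_of_real ((norm v)\<^sup>2) \<noteq> 0" using v(3) by simp
      have "mapply M v = u"
      proof (rule comp_eqI)
        fix k
        have "comp k (mapply M v) = comp k u * (cnj (comp False v) * comp False v + cnj (comp True v) * comp True v) / of_real ((norm v)\<^sup>2)"
          unfolding comp_mapply M_def by (simp add: algebra_simps add_divide_distrib)
        then show "comp k (mapply M v) = comp k u" unfolding n[symmetric] using n0 by simp
      qed
      then have "code u = point_rep t i a (code v)" using v(2) a(2) by (simp add: point_simps)
      then show ?thesis using W a(1) v(1) by simp
    qed
    then show ?thesis using sub by (auto simp: point_simps)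
  qed (simp add: point_simps)
qed

context
  fixes H :: "('h, 'k) hilb_scheme" and \<pi> :: "kernel_function \<Rightarrow> 'h \<Rightarrow> 'h"
  assumes irr: "irreducible_rep glue_alg H \<pi>"
begin

lemma irr_rep: "representation glue_alg H \<pi>" using irr by (simp add: irreducible_rep_def)

lemmas irr_rules = representationD[OF irr_rep]

interpretation hilbert_space H by (rule irr_rules)

lemma irr_contractive:
  "a \<in> vcar glue_alg \<Longrightarrow> \<xi> \<in> vcar H \<Longrightarrow> hnorm H (\<pi> a \<xi>) \<le> nrm glue_alg a * hnorm H \<xi>"
  by (rule representation_contractive[OF irr_rep]) (simp_all add: glue_closed)

lemma irr_zero: "a \<in> vcar glue_alg \<Longrightarrow> \<pi> a (vzero H) = vzero H"
  using irr_rules(5)[of a "vzero H" 0] irr_rules(3)[of a "vzero H"] by (simp add: scale_zero zero_closed scale_zero_left)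

lemma kills_times:
  assumes "a \<in> vcar glue_alg" "b \<in> vcar glue_alg" "kills H \<pi> b"
  shows "kills H \<pi> (atimes glue_alg a b)"
  using assms irr_zero irr_rules(7) unfolding kills_def by simp

lemma kills_add:
  assumes "a \<in> vcar glue_alg" "b \<in> vcar glue_alg" "kills H \<pi> a" "kills H \<pi> b"
  shows "kills H \<pi> (vadd glue_alg a b)"
  using assms irr_rules(6) unfolding kills_def by (simp add: zero_add zero_closed)

lemma not_kills_all: "\<exists>a\<in>vcar glue_alg. \<not> kills H \<pi> a"
  using irr unfolding irreducible_rep_def kills_def by blast

lemma irr_diff:
  assumes "a \<in> vcar glue_alg" "b \<in> vcar glue_alg" "\<xi> \<in> vcar H"
  shows "\<pi> (vdiff glue_alg a b) \<xi> = vdiff H (\<pi> a \<xi>) (\<pi> b \<xi>)"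
  using assms unfolding vdiff_def by (simp add: irr_rules(6,8) glue_closed)

lemma irr_subspace:
  assumes "vsubspace H W" "N_closed H (hnorm H) W" "\<And>a \<xi>. a \<in> vcar glue_alg \<Longrightarrow> \<xi> \<in> W \<Longrightarrow> \<pi> a \<xi> \<in> W"
    "w \<in> W" "w \<noteq> vzero H"
  shows "W = vcar H"
proof -
  have "W = {vzero H} \<or> W = vcar H" using irr assms(1-3) unfolding irreducible_rep_def by simp
  then show ?thesis using assms(4,5) by auto
qed

lemma scal_central:
  assumes "continuous_on circle z" "a \<in> vcar glue_alg"
  shows "atimes glue_alg (scal z) a = atimes glue_alg a (scal z)"
  using assms by (intro glue_eqI) (auto simp: cf_glue scal glue_closed mmul_def fun_eq_iff)

text \<open>Finitely many killed scalars combine to a killed sum of squared moduli, which has no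
  zero where some summand has none; this serves the compactness argument below.\<close>

lemma kills_scal_sum:
  assumes "finite D" "\<And>t. t \<in> D \<Longrightarrow> continuous_on circle (z t)" "\<And>t. t \<in> D \<Longrightarrow> kills H \<pi> (scal (z t))"
  shows "kills H \<pi> (scal (\<lambda>s. \<Sum>t\<in>D. cnj (z t s) * z t s))"
  using assms
proof (induction D rule: finite_induct)
  case empty
  have "scal (\<lambda>s. 0) = vscale glue_alg 0 (scal (\<lambda>s. 0))"
    by (intro glue_eqI) (auto simp: scal cf_linear glue_closed)
  then have "\<pi> (scal (\<lambda>s. 0)) \<xi> = vscale H 0 (\<pi> (scal (\<lambda>s. 0)) \<xi>)" if "\<xi> \<in> vcar H" for \<xi>
    using irr_rules(8)[of "scal (\<lambda>s. 0)" \<xi> 0] scal(1)[of "\<lambda>s. 0"] that by simp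
  then show ?case using irr_rules(3)[OF scal(1)[of "\<lambda>s. 0"]] by (simp add: kills_def scale_zero_left)
next
  case (insert t D)
  let ?f = "\<lambda>s. \<Sum>t\<in>D. cnj (z t s) * z t s"
  have c: "continuous_on circle ?f" "continuous_on circle (z t)" "continuous_on circle (\<lambda>s. cnj (z t s))"
    "continuous_on circle (\<lambda>s. cnj (z t s) * z t s)"
    "continuous_on circle (\<lambda>s. cnj (z t s) * z t s + ?f s)"
    using insert.prems by (auto intro!: continuous_intros)
  have "kills H \<pi> (atimes glue_alg (scal (\<lambda>s. cnj (z t s))) (scal (z t)))"
    using insert.prems by (intro kills_times scal c) auto
  moreover have "atimes glue_alg (scal (\<lambda>s. cnj (z t s))) (scal (z t)) = scal (\<lambda>s. cnj (z t s) * z t s)"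
    by (intro glue_eqI) (auto simp: scal c cf_glue glue_closed mmul_def fun_eq_iff)
  ultimately have "kills H \<pi> (vadd glue_alg (scal (\<lambda>s. cnj (z t s) * z t s)) (scal ?f))"
    using insert by (intro kills_add scal c) auto
  moreover have "vadd glue_alg (scal (\<lambda>s. cnj (z t s) * z t s)) (scal ?f) = scal (\<lambda>s. cnj (z t s) * z t s + ?f s)"
    by (intro glue_eqI) (auto simp: scal c cf_linear glue_closed fun_eq_iff)
  ultimately show ?case using insert.hyps by simp
qed

text \<open>The central subalgebra of scalar functions acts through evaluation at one point of the circle.\<close>

lemma support_point_exists: "\<exists>t\<in>circle. \<forall>z. continuous_on circle z \<and> z t \<noteq> 0 \<longrightarrow> \<not> kills H \<pi> (scal z)"
proof (rule ccontr)
  assume "\<not> ?thesis"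
  then have "\<forall>t\<in>circle. \<exists>z. continuous_on circle z \<and> z t \<noteq> 0 \<and> kills H \<pi> (scal z)" by blast
  then obtain z where z: "\<And>t. t \<in> circle \<Longrightarrow> continuous_on circle (z t)" "\<And>t. t \<in> circle \<Longrightarrow> z t t \<noteq> 0"
    "\<And>t. t \<in> circle \<Longrightarrow> kills H \<pi> (scal (z t))" by metis
  have "\<exists>U. open U \<and> {s \<in> circle. z t s \<noteq> 0} = circle \<inter> U" if "t \<in> circle" for t
  proof -
    have "openin (top_of_set circle) (circle \<inter> z t -` (- {0}))"
      by (intro continuous_openin_preimage_gen z that) auto
    moreover have "circle \<inter> z t -` (- {0}) = {s \<in> circle. z t s \<noteq> 0}" by auto
    ultimately show ?thesis by (auto simp: openin_open)
  qed
  then obtain U where U: "\<And>t. t \<in> circle \<Longrightarrow> open (U t)" "\<And>t. t \<in> circle \<Longrightarrow> {s \<in> circle. z t s \<noteq> 0} = circle \<inter> U t"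
    by metis
  have "circle \<subseteq> (\<Union>t\<in>circle. U t)" using U(2) z(2) by blast
  then obtain D where D: "D \<subseteq> circle" "finite D" "circle \<subseteq> (\<Union>t\<in>D. U t)"
    using compactE_image[OF compact_circle, of circle U] U(1) by metis
  \<comment> \<open>If a killed scalar were nonzero at every point, compactness would give a nowhere
    vanishing killed scalar \<open>g\<close>. Then every \<open>a\<close> equals \<open>a\<close>
    times the inverse of \<open>g\<close> times \<open>g\<close> and would be killed too.\<close>
  define g where "g = (\<lambda>s. \<Sum>t\<in>D. cnj (z t s) * z t s)"
  have kg: "kills H \<pi> (scal g)" unfolding g_def by (rule kills_scal_sum[OF D(2)]) (use z D(1) in auto)
  have cg: "continuous_on circle g" unfolding g_def by (intro continuous_intros z) (use D(1) in auto)
  have g0: "g s \<noteq> 0" if s: "s \<in> circle" for s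
  proof -
    obtain t where t: "t \<in> D" "s \<in> U t" using D(3) s by blast
    then have "z t s \<noteq> 0" using U(2)[of t] D(1) s by blast
    then have "0 < (\<Sum>t\<in>D. (cmod (z t s))\<^sup>2)" using D(2) t(1) by (intro sum_pos2[of D t]) auto
    moreover have "g s = of_real (\<Sum>t\<in>D. (cmod (z t s))\<^sup>2)"
      unfolding g_def of_real_sum by (intro sum.cong refl) (simp only: complex_norm_square mult.commute)
    ultimately show ?thesis by (metis less_irrefl of_real_eq_0_iff)
  qed
  have ci: "continuous_on circle (\<lambda>s. inverse (g s))" using g0 by (intro continuous_intros cg) auto
  have "kills H \<pi> a" if a: "a \<in> vcar glue_alg" for a
  proof -
    have "atimes glue_alg (atimes glue_alg a (scal (\<lambda>s. inverse (g s)))) (scal g) = a"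
      using a g0 by (intro glue_eqI) (auto simp: scal cg ci cf_glue glue_closed mmul_def fun_eq_iff)
    moreover have "kills H \<pi> (atimes glue_alg (atimes glue_alg a (scal (\<lambda>s. inverse (g s)))) (scal g))"
      by (intro kills_times glue_closed scal a cg ci kg)
    ultimately show ?thesis by simp
  qed
  then show False using not_kills_all by blast
qed

text \<open>The vectors annihilated by the central element \<open>scal w\<close> form a closed
  invariant subspace, which contains the nonzero image of \<open>scal u\<close>. Irreducibility
  makes it everything.\<close>

lemma kills_if_vanishing_product:
  assumes u: "continuous_on circle u" "\<not> kills H \<pi> (scal u)" and w: "continuous_on circle w"
    and uw: "\<And>s. s \<in> circle \<Longrightarrow> w s * u s = 0"
  shows "kills H \<pi> (scal w)"
proof -
  define W where "W = {\<eta> \<in> vcar H. \<pi> (scal w) \<eta> = vzero H}"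
  note sw = scal(1)[OF w] and su = scal(1)[OF u(1)]
  have uw0: "atimes glue_alg (scal w) (scal u) = vscale glue_alg 0 (scal u)"
    using uw by (intro glue_eqI) (auto simp: scal u(1) w cf_glue cf_linear glue_closed mmul_def fun_eq_iff)
  obtain \<xi> where \<xi>: "\<xi> \<in> vcar H" "\<pi> (scal u) \<xi> \<noteq> vzero H" using u(2) unfolding kills_def by blast
  have "\<pi> (scal w) (\<pi> (scal u) \<xi>) = vzero H"
    using irr_rules(7)[OF sw su \<xi>(1)] irr_rules(8)[OF su \<xi>(1), of 0] irr_rules(3)[OF su \<xi>(1)]
    by (simp add: uw0 scale_zero_left)
  then have in_W: "\<pi> (scal u) \<xi> \<in> W" using irr_rules(3)[OF su \<xi>(1)] by (simp add: W_def)
  have "W = vcar H"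
  proof (rule irr_subspace[OF _ _ _ in_W \<xi>(2)])
    show "vsubspace H W" unfolding vsubspace_def W_def
      by (auto simp: zero_closed irr_zero sw add_closed scale_closed irr_rules(4,5) zero_add scale_zero)
    show "N_closed H (hnorm H) W" unfolding N_closed_def
    proof (intro allI ballI impI)
      fix x l assume l: "l \<in> vcar H" and x: "range x \<subseteq> W \<and> N_tendsto H (hnorm H) x l"
      have xc: "range x \<subseteq> vcar H" and x0: "\<pi> (scal w) (x n) = vzero H" for n using x by (auto simp: W_def)
      have "N_tendsto H (hnorm H) (\<lambda>n. \<pi> (scal w) (x n)) (\<pi> (scal w) l)"
        using tendsto_bounded_op[OF irr_rules(2)[OF sw] xc l] x by blast
      then have "N_tendsto H (hnorm H) (\<lambda>n. vzero H) (\<pi> (scal w) l)" by (simp add: x0)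
      moreover have "N_tendsto H (hnorm H) (\<lambda>n. vzero H) (vzero H)"
        by (simp add: N_tendsto_def diff_self zero_closed hnorm_zero)
      ultimately have "\<pi> (scal w) l = vzero H"
        using tendsto_unique[of "\<lambda>n. vzero H"] irr_rules(3)[OF sw l] zero_closed by blast
      then show "l \<in> W" using l by (simp add: W_def)
    qed
  next
    fix a \<eta> assume a: "a \<in> vcar glue_alg" and "\<eta> \<in> W"
    then have \<eta>: "\<eta> \<in> vcar H" "\<pi> (scal w) \<eta> = vzero H" by (auto simp: W_def)
    have "\<pi> (scal w) (\<pi> a \<eta>) = \<pi> a (\<pi> (scal w) \<eta>)"
      using scal_central[OF w a] irr_rules(7)[OF sw a \<eta>(1)] irr_rules(7)[OF a sw \<eta>(1)] by simp
    then show "\<pi> a \<eta> \<in> W" using \<eta> irr_rules(3)[OF a \<eta>(1)] by (simp add: W_def irr_zero a)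
  qed
  then show ?thesis by (auto simp: W_def kills_def)
qed

text \<open>An element that vanishes at \<open>t\<close> is small near \<open>t\<close>, and a
  scalar cutoff that is 0 near \<open>t\<close> is killed. Removing the part under the cutoff leaves
  the operator unchanged and makes the norm arbitrarily small.\<close>

lemma support_point: "\<exists>t\<in>circle. \<forall>a\<in>vcar glue_alg. cf a t = (\<lambda>i j. 0) \<longrightarrow> kills H \<pi> a"
proof -
  obtain t where t: "t \<in> circle" "\<And>z. continuous_on circle z \<Longrightarrow> z t \<noteq> 0 \<Longrightarrow> \<not> kills H \<pi> (scal z)"
    using support_point_exists by metis
  have "kills H \<pi> a" if a: "a \<in> vcar glue_alg" and a0: "cf a t = (\<lambda>i j. 0)" for a
    unfolding kills_def
  proof
    fix \<xi> assume \<xi>: "\<xi> \<in> vcar H"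
    have small: "hnorm H (\<pi> a \<xi>) \<le> e * (4 * hnorm H \<xi>)" if e: "e > 0" for e
    proof -
      have ex: "\<exists>d>0. \<forall>s\<in>circle. dist s t < d \<longrightarrow> cmod (cf a s i j) < e" for i j
      proof -
        have "continuous_on circle (\<lambda>s. cf a s i j)" using a by (simp add: glue_car)
        then obtain d where "d > 0" "\<forall>s\<in>circle. dist s t < d \<longrightarrow> dist (cf a s i j) (cf a t i j) < e"
          using t(1) e unfolding continuous_on_iff by blast
        then show ?thesis by (auto simp: a0)
      qed
      then obtain d where d: "\<And>i j. d i j > 0" "\<And>i j. \<forall>s\<in>circle. dist s t < d i j \<longrightarrow> cmod (cf a s i j) < e" by metis
      define r where "r = Min (range (\<lambda>(i, j). d i j))"
      have "r \<in> range (\<lambda>(i, j). d i j)" unfolding r_def by (intro Min_in) auto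
      then have r: "r > 0" using d(1) by auto
      have rd: "r \<le> d i j" for i j unfolding r_def by (intro Min_le) auto
      \<comment> \<open>\<open>w\<close> rises from 0 at distance \<open>r / 2\<close> to 1 at
        distance \<open>r\<close>, and \<open>u\<close> lives within distance \<open>r / 2\<close>.
        Their product vanishes and \<open>u\<close> is 1 at \<open>t\<close>, so
        \<open>scal u\<close> is not killed and \<open>scal w\<close> is.\<close>
      define w where "w s = complex_of_real (min 1 (max 0 (2 * dist s t / r - 1)))" for s
      define u where "u s = complex_of_real (max 0 (1 - 2 * dist s t / r))" for s
      have cw: "continuous_on circle w" "continuous_on circle u"
        unfolding w_def u_def using r by (auto intro!: continuous_intros)
      have "w s * u s = 0" for s unfolding w_def u_def by (cases "2 * dist s t / r \<le> 1") auto
      then have kw: "kills H \<pi> (scal w)"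
        using t(2)[OF cw(2)] by (intro kills_if_vanishing_product[OF cw(2) _ cw(1)]) (auto simp: u_def)
      let ?a = "vdiff glue_alg a (atimes glue_alg a (scal w))"
      have aw: "atimes glue_alg a (scal w) \<in> vcar glue_alg" using a scal(1)[OF cw(1)] by (simp add: glue_closed)
      have "\<pi> ?a \<xi> = vdiff H (\<pi> a \<xi>) (vzero H)"
        using irr_diff[OF a aw \<xi>] kills_times[OF a scal(1)[OF cw(1)] kw] \<xi> by (simp add: kills_def)
      then have eq: "\<pi> ?a \<xi> = \<pi> a \<xi>" using irr_rules(3)[OF a \<xi>] by (simp add: diff_zero)
      have "nrm glue_alg ?a \<le> 4 * e"
      proof (intro nrm_le mnorm_bound)
        fix s i j assume s: "s \<in> circle"
        have "cf ?a s i j = (1 - w s) * cf a s i j"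
          unfolding cf_linear cf_glue(1)[OF a s scal(1)[OF cw(1)]]
          by (cases j) (simp_all add: scal(2)[OF cw(1) s] mmul_def algebra_simps)
        moreover have "cmod (1 - w s) \<le> 1"
        proof -
          have "1 - w s = of_real (1 - min 1 (max 0 (2 * dist s t / r - 1)))" by (simp add: w_def)
          then show ?thesis by (simp only: norm_of_real)
        qed
        moreover have "cmod (cf a s i j) \<le> e" if "dist s t < r" using d(2)[of i j] s that rd[of i j] by force
        moreover have "w s = 1" if "\<not> dist s t < r"
        proof -
          have "1 \<le> 2 * dist s t / r - 1" using that r by (simp add: field_simps)
          then show ?thesis by (simp add: w_def)
        qed
        ultimately show "cmod (cf ?a s i j) \<le> e"
          using e mult_mono[of "cmod (1 - w s)" 1 "cmod (cf a s i j)" e] by (cases "dist s t < r") (auto simp: norm_mult)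
      qed
      then have "nrm glue_alg ?a * hnorm H \<xi> \<le> (4 * e) * hnorm H \<xi>"
        using hnorm_nonneg[OF \<xi>] by (rule mult_right_mono)
      then show ?thesis
        using irr_contractive[OF glue_closed(5)[OF a aw] \<xi>] eq by (simp add: mult_ac)
    qed
    have "hnorm H (\<pi> a \<xi>) \<le> 0"
    proof (rule field_le_epsilon)
      fix d :: real assume d: "d > 0"
      have h: "0 \<le> hnorm H \<xi>" using hnorm_nonneg \<xi> .
      have "hnorm H (\<pi> a \<xi>) \<le> d / (4 * hnorm H \<xi> + 1) * (4 * hnorm H \<xi>)" using d h by (intro small) simp
      also have "\<dots> \<le> d" using d h by (simp add: divide_le_eq)
      finally show "hnorm H (\<pi> a \<xi>) \<le> 0 + d" by simp
    qed
    then have "hnorm H (\<pi> a \<xi>) = 0" using hnorm_nonneg[OF irr_rules(3)[OF a \<xi>]] by simp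
    then show "\<pi> a \<xi> = vzero H" using hnorm_eq_zero irr_rules(3)[OF a \<xi>] by blast
  qed
  then show ?thesis using t(1) by blast
qed

text \<open>The two corners add up to the unit.\<close>

lemma corner_not_killed: "\<exists>i. \<not> kills H \<pi> (corner i)"
proof (rule ccontr)
  assume "\<not> ?thesis"
  then have k: "kills H \<pi> (corner i)" for i by simp
  have "kills H \<pi> a" if a: "a \<in> vcar glue_alg" for a
  proof -
    have "kills H \<pi> (vadd glue_alg (atimes glue_alg a (corner False)) (atimes glue_alg a (corner True)))"
      by (intro kills_add kills_times glue_closed corner a k)
    moreover have "vadd glue_alg (atimes glue_alg a (corner False)) (atimes glue_alg a (corner True)) = a"
      using a by (intro glue_eqI) (auto simp: cf_glue cf_linear corner glue_closed mmul_def unit_entry_def fun_eq_iff)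
    ultimately show ?thesis by simp
  qed
  then show False using not_kills_all by blast
qed

text \<open>The intertwiner sends \<open>v\<close> to \<open>\<pi> a \<xi>\<close>, where \<open>\<xi>\<close> is a unit vector in the range of the corner
  projection and the value of \<open>a\<close> at the support point has \<open>v\<close> as its only column.\<close>

lemma classify:
  assumes t: "t \<in> circle" and supp: "\<forall>a\<in>vcar glue_alg. cf a t = (\<lambda>i j. 0) \<longrightarrow> kills H \<pi> a"
    and i: "\<not> kills H \<pi> (corner i)"
  shows "\<exists>U. bij_betw U (vcar (point_hilb t i)) (vcar H) \<and> linear_on (point_hilb t i) H U \<and>
       (\<forall>\<xi>\<in>vcar (point_hilb t i). \<forall>\<eta>\<in>vcar (point_hilb t i). hinner H (U \<xi>) (U \<eta>) = hinner (point_hilb t i) \<xi> \<eta>) \<and>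
       (\<forall>a\<in>vcar glue_alg. \<forall>\<xi>\<in>vcar (point_hilb t i). U (point_rep t i a \<xi>) = \<pi> a (U \<xi>))"
proof -
  \<comment> \<open>The representation factors through evaluation at \<open>t\<close>; each identity
    for the intertwiner becomes an identity between matrices.\<close>
  have dep: "\<pi> a \<zeta> = \<pi> b \<zeta>" if ab: "a \<in> vcar glue_alg" "b \<in> vcar glue_alg" "cf a t = cf b t" "\<zeta> \<in> vcar H" for a b \<zeta>
  proof -
    have "cf (vdiff glue_alg a b) t = (\<lambda>i j. 0)" using ab(3) by (simp add: cf_linear)
    then have "kills H \<pi> (vdiff glue_alg a b)" using supp glue_closed(5)[OF ab(1,2)] by blast
    then have "vdiff H (\<pi> a \<zeta>) (\<pi> b \<zeta>) = vzero H" using irr_diff ab by (simp add: kills_def)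
    then show ?thesis using diff_eq_zero irr_rules(3) ab by blast
  qed
  obtain \<eta> where \<eta>: "\<eta> \<in> vcar H" "\<pi> (corner i) \<eta> \<noteq> vzero H" using i unfolding kills_def by blast
  let ?\<eta> = "\<pi> (corner i) \<eta>"
  have e\<eta>: "?\<eta> \<in> vcar H" using irr_rules(3)[OF corner(1) \<eta>(1)] .
  have n\<eta>: "hnorm H ?\<eta> > 0" using hnorm_eq_zero[OF e\<eta>] \<eta>(2) hnorm_nonneg[OF e\<eta>] by simp
  define \<xi> where "\<xi> = vscale H (of_real (1 / hnorm H ?\<eta>)) ?\<eta>"
  have \<xi>: "\<xi> \<in> vcar H" using e\<eta> by (simp add: \<xi>_def scale_closed)
  have \<xi>1: "hnorm H \<xi> = 1" using n\<eta> e\<eta> by (simp add: \<xi>_def hnorm_scale norm_divide)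
  have e\<xi>: "\<pi> (corner i) \<xi> = \<xi>"
    using irr_rules(7)[OF corner(1)[of i] corner(1)[of i] \<eta>(1)] e\<eta> unfolding \<xi>_def by (simp add: corner_idem irr_rules(5) corner(1))
  have "\<exists>a\<in>vcar glue_alg. cf a t = (\<lambda>k j. if j = i then comp k v else 0)" if "v \<in> fib t i" for v
    by (rule matrix_interpolation[OF t]) (use that in \<open>cases i; auto simp: diagonal_def fib_def\<close>)
  then obtain col where col: "\<And>v. v \<in> fib t i \<Longrightarrow> col v \<in> vcar glue_alg"
    "\<And>v. v \<in> fib t i \<Longrightarrow> cf (col v) t = (\<lambda>k j. if j = i then comp k v else 0)" by metis
  define V where "V v = \<pi> (col v) \<xi>" for v
  have Vc: "V v \<in> vcar H" if "v \<in> fib t i" for v using irr_rules(3)[OF col(1)[OF that] \<xi>] by (simp add: V_def)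
  have fadd: "u + v \<in> fib t i" if "u \<in> fib t i" "v \<in> fib t i" for u v using that by (simp add: fib_def)
  have fdiff: "u - v \<in> fib t i" if "u \<in> fib t i" "v \<in> fib t i" for u v using that by (simp add: fib_def)
  have fsc: "cscale c v \<in> fib t i" if "v \<in> fib t i" for c v using that by (simp add: fib_def)
  have Vadd: "V (u + v) = vadd H (V u) (V v)" if uv: "u \<in> fib t i" "v \<in> fib t i" for u v
  proof -
    have "V (u + v) = \<pi> (vadd glue_alg (col u) (col v)) \<xi>" unfolding V_def
      using uv fadd[OF uv] \<xi> by (intro dep) (auto simp: col glue_closed cf_linear fun_eq_iff)
    then show ?thesis using irr_rules(6)[OF col(1)[OF uv(1)] col(1)[OF uv(2)] \<xi>] by (simp add: V_def)
  qed
  have Vsc: "V (cscale c v) = vscale H c (V v)" if v: "v \<in> fib t i" for c v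
  proof -
    have "V (cscale c v) = \<pi> (vscale glue_alg c (col v)) \<xi>" unfolding V_def
      using v fsc[OF v] \<xi> by (intro dep) (auto simp: col glue_closed cf_linear fun_eq_iff)
    then show ?thesis using irr_rules(8)[OF col(1)[OF v] \<xi>] by (simp add: V_def)
  qed
  \<comment> \<open>At \<open>t\<close>, the adjoint of the column \<open>v\<close> times the column
    \<open>u\<close> is the inner product of \<open>u\<close> and \<open>v\<close> times the corner
    matrix, and the corner fixes the unit vector \<open>\<xi>\<close>.\<close>
  have Vin: "hinner H (V u) (V v) = cinner u v" if uv: "u \<in> fib t i" "v \<in> fib t i" for u v
  proof -
    let ?s = "astar glue_alg (col v)"
    have s: "?s \<in> vcar glue_alg" using col(1)[OF uv(2)] by (simp add: glue_closed)
    have su: "atimes glue_alg ?s (col u) \<in> vcar glue_alg" using s col(1)[OF uv(1)] by (simp add: glue_closed)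
    have "hinner H (V u) (V v) = hinner H (\<pi> ?s (V u)) \<xi>"
      using irr_rules(9)[OF col(1)[OF uv(2)] Vc[OF uv(1)] \<xi>] by (simp add: V_def)
    also have "\<pi> ?s (V u) = \<pi> (atimes glue_alg ?s (col u)) \<xi>"
      unfolding V_def using irr_rules(7)[OF s col(1)[OF uv(1)] \<xi>] by simp
    also have "\<dots> = \<pi> (vscale glue_alg (cinner u v) (corner i)) \<xi>"
    proof (rule dep[OF su glue_closed(2)[OF corner(1)] _ \<xi>])
      show "cf (atimes glue_alg ?s (col u)) t = cf (vscale glue_alg (cinner u v) (corner i)) t"
        unfolding cf_glue(1)[OF s t col(1)[OF uv(1)]] cf_glue(2)[OF col(1)[OF uv(2)] t] cf_linear
          col(2)[OF uv(1)] col(2)[OF uv(2)] corner(2)[OF t]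
        by (auto simp: fun_eq_iff mmul_def madj_def unit_entry_def cinner_def comp_def mult.commute)
    qed
    also have "\<dots> = vscale H (cinner u v) \<xi>" using irr_rules(8)[OF corner(1) \<xi>] e\<xi> by simp
    finally show ?thesis using inner_scale[OF \<xi> \<xi>] inner_self[OF \<xi>] \<xi>1 by simp
  qed
  have Vtw: "V (mapply (cf a t) v) = \<pi> a (V v)" if a: "a \<in> vcar glue_alg" and v: "v \<in> fib t i" for a v
  proof -
    have "V (mapply (cf a t) v) = \<pi> (atimes glue_alg a (col v)) \<xi>" unfolding V_def
    proof (rule dep[OF col(1)[OF mapply_fib[OF a v]] glue_closed(3)[OF a col(1)[OF v]] _ \<xi>])
      show "cf (col (mapply (cf a t) v)) t = cf (atimes glue_alg a (col v)) t"
        unfolding col(2)[OF mapply_fib[OF a v]] cf_glue(1)[OF a t col(1)[OF v]] col(2)[OF v]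
        by (auto simp: fun_eq_iff mmul_def comp_mapply)
    qed
    then show ?thesis unfolding V_def using irr_rules(7)[OF a col(1)[OF v] \<xi>] by simp
  qed
  have Vn: "hnorm H (V v) = norm v" if "v \<in> fib t i" for v
    unfolding hnorm_def Vin[OF that that] by (simp add: cinner_self)
  have Vd: "V (u - v) = vdiff H (V u) (V v)" if uv: "u \<in> fib t i" "v \<in> fib t i" for u v
  proof -
    have e: "u - v = u + cscale (-1) v" by (simp add: cscale_def prod_eq_iff)
    show ?thesis unfolding e using Vadd[OF uv(1) fsc[OF uv(2)], of "-1"] Vsc[OF uv(2), of "-1"] by (simp add: vdiff_def)
  qed
  have Vinj: "inj_on V (fib t i)"
  proof (rule inj_onI)
    fix u v assume uv: "u \<in> fib t i" "v \<in> fib t i" "V u = V v"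
    then have "norm (u - v) = 0" using Vn[OF fdiff[OF uv(1,2)]] Vd[OF uv(1,2)] Vc[OF uv(2)] by (simp add: diff_self hnorm_zero)
    then show "u = v" by simp
  qed
  have f0: "0 \<in> fib t i" by (simp add: fib_def)
  have V0: "V 0 = vzero H"
    using Vn[OF f0] hnorm_eq_zero[OF Vc[OF f0]] by simp
  have Vsurj: "V ` fib t i = vcar H"
  \<comment> \<open>The image is closed because \<open>V\<close> is isometric on a complete fibre,
    and invariant by the intertwining identity; irreducibility gives surjectivity.\<close>
  proof (rule irr_subspace)
    show "vsubspace H (V ` fib t i)" unfolding vsubspace_def
    proof (intro conjI ballI allI)
      show "V ` fib t i \<subseteq> vcar H" using Vc by auto
      show "vzero H \<in> V ` fib t i" using V0 f0 by (metis imageI)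
      show "vadd H x y \<in> V ` fib t i" if xy: "x \<in> V ` fib t i" "y \<in> V ` fib t i" for x y
      proof -
        obtain u v where "u \<in> fib t i" "v \<in> fib t i" "x = V u" "y = V v" using xy by blast
        then show ?thesis using Vadd[of u v] fadd[of u v] by (metis imageI)
      qed
      show "vscale H c x \<in> V ` fib t i" if x: "x \<in> V ` fib t i" for c x
      proof -
        obtain u where "u \<in> fib t i" "x = V u" using x by blast
        then show ?thesis using Vsc[of u c] fsc[of u c] by (metis imageI)
      qed
    qed
    show "V (basis i) \<in> V ` fib t i" using basis_fib by blast
    have "basis i \<noteq> 0" by (cases i) (simp_all add: basis_def zero_prod_def)
    then have "V (basis i) \<noteq> V 0" using inj_onD[OF Vinj _ basis_fib f0] by blast
    then show "V (basis i) \<noteq> vzero H" using V0 by simp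
    show "\<pi> a \<zeta> \<in> V ` fib t i" if "a \<in> vcar glue_alg" "\<zeta> \<in> V ` fib t i" for a \<zeta>
      using that by (auto simp: Vtw[symmetric] mapply_fib)
    show "N_closed H (hnorm H) (V ` fib t i)" unfolding N_closed_def
    proof (intro allI ballI impI)
      fix x l assume l: "l \<in> vcar H" and x: "range x \<subseteq> V ` fib t i \<and> N_tendsto H (hnorm H) x l"
      then have "\<forall>n. \<exists>v\<in>fib t i. x n = V v" by (auto simp: image_iff subset_iff)
      then obtain v where v: "\<And>n. v n \<in> fib t i" "\<And>n. x n = V (v n)" by metis
      have xr: "range x \<subseteq> vcar H" using v(2) Vc[OF v(1)] by auto
      have dn: "hnorm H (vdiff H (V u) (V w)) = norm (u - w)" if "u \<in> fib t i" "w \<in> fib t i" for u w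
        using Vd[OF that] Vn[OF fdiff[OF that]] by simp
      have "N_Cauchy H (hnorm H) x" using Cauchy_if_tendsto[OF xr l] x by blast
      then have "Cauchy v" unfolding N_Cauchy_def Cauchy_def v(2) dist_norm by (simp add: dn v(1))
      then obtain w where w: "v \<longlonglongrightarrow> w" using Cauchy_convergent convergent_def by blast
      have "w \<in> fib t i"
        using fibre_space_fib[of t i] w v(1) unfolding fibre_space_def by (meson closed_sequentially)
      have "(\<lambda>n. norm (v n - w)) \<longlonglongrightarrow> 0" using w by (simp add: LIM_zero tendsto_norm_zero)
      then have "N_tendsto H (hnorm H) x (V w)"
        unfolding N_tendsto_def v(2) by (simp add: dn v(1) \<open>w \<in> fib t i\<close>)
      then have "l = V w" using tendsto_unique[OF xr l Vc[OF \<open>w \<in> fib t i\<close>]] x by blast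
      then show "l \<in> V ` fib t i" using \<open>w \<in> fib t i\<close> by blast
    qed
  qed
  define U where "U x = V (inv_into UNIV code x)" for x
  have Uc: "U (code v) = V v" for v using inj_code[of UNIV] by (simp add: U_def)
  show ?thesis
  proof (intro exI[of _ U] conjI ballI allI)
    show "bij_betw U (vcar (point_hilb t i)) (vcar H)"
      unfolding bij_betw_def point_simps
    proof
      show "inj_on U (code ` fib t i)" using Vinj by (auto simp: inj_on_def Uc)
      show "U ` code ` fib t i = vcar H" using Vsurj by (simp add: image_image Uc)
    qed
    show "linear_on (point_hilb t i) H U" unfolding linear_on_def point_simps
      by (auto simp: Uc Vc Vadd Vsc point_hilb_def fibre_transported)
    show "U (point_rep t i a \<xi>) = \<pi> a (U \<xi>)" if "a \<in> vcar glue_alg" "\<xi> \<in> vcar (point_hilb t i)" for a \<xi>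
      using that by (auto simp: point_simps Uc Vtw)
    show "hinner H (U \<xi>) (U \<eta>) = hinner (point_hilb t i) \<xi> \<eta>"
      if "\<xi> \<in> vcar (point_hilb t i)" "\<eta> \<in> vcar (point_hilb t i)" for \<xi> \<eta>
      using that by (auto simp: point_simps Uc Vin point_hilb_def fibre_transported)
  qed
qed

end

section \<open>The spectrum\<close>

abbreviation rep_rel :: "(kernel_function rep \<times> kernel_function rep) set" where
  "rep_rel \<equiv> {(r, s). r \<in> irreps glue_alg \<and> s \<in> irreps glue_alg \<and> unitarily_equivalent glue_alg r s}"

definition point :: "complex \<Rightarrow> bool \<Rightarrow> kernel_function rep set" where
  "point t i = rep_rel `` {(point_hilb t i, point_rep t i)}"

lemma equiv_rep_rel: "equiv (irreps glue_alg) rep_rel"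
proof (rule equivI)
  show "refl_on (irreps glue_alg) rep_rel"
    unfolding refl_on_def using unitarily_equivalent_refl by auto
  show "sym rep_rel"
  proof (rule symI)
    fix r s assume rs: "(r, s) \<in> rep_rel"
    then have r: "representation glue_alg (fst r) (snd r)" by (cases r) (auto simp: irreps_def irreducible_rep_def)
    have "unitarily_equivalent glue_alg s r"
      using rs hilbert_space.axioms(1)[OF representationD(1)[OF r]] representationD(3)[OF r]
      by (intro unitarily_equivalent_sym[of glue_alg r s]) auto
    then show "(s, r) \<in> rep_rel" using rs by auto
  qed
  show "trans rep_rel"
    by (rule transI) (use unitarily_equivalent_trans in blast)
qed auto

lemma point_irrep: "t \<in> circle \<Longrightarrow> (point_hilb t i, point_rep t i) \<in> irreps glue_alg"
  by (simp add: irreps_def irreducible_point)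

lemma point_self: "t \<in> circle \<Longrightarrow> (point_hilb t i, point_rep t i) \<in> point t i"
  using point_irrep unitarily_equivalent_refl by (simp add: point_def)

lemma point_spectrum: "t \<in> circle \<Longrightarrow> point t i \<in> spectrum_points glue_alg"
  unfolding point_def spectrum_points_def by (intro quotientI point_irrep)

lemma in_point:
  assumes "(H, \<pi>) \<in> point t i"
  shows "irreducible_rep glue_alg H \<pi>" "unitarily_equivalent glue_alg (point_hilb t i, point_rep t i) (H, \<pi>)"
  using assms by (auto simp: point_def irreps_def)

lemma kills_point_class:
  assumes t: "t \<in> circle" and c: "(H, \<pi>) \<in> point t i" and a: "a \<in> vcar glue_alg"
  shows "kills H \<pi> a \<longleftrightarrow> kills (point_hilb t i) (point_rep t i) a"
proof -
  note r = representationD[OF representation_point[OF t, of i]]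
  have H: "hilbert_space H" using in_point(1)[OF c] representationD(1) by (simp add: irreducible_rep_def) blast
  show ?thesis using kills_equivalent[OF in_point(2)[OF c] r(1) H r(3)[OF a] a] by simp
qed

lemma point_classify:
  assumes t: "t \<in> circle" and irr: "irreducible_rep glue_alg H \<pi>"
    and supp: "\<forall>a\<in>vcar glue_alg. cf a t = (\<lambda>i j. 0) \<longrightarrow> kills H \<pi> a" and i: "\<not> kills H \<pi> (corner i)"
  shows "rep_rel `` {(H, \<pi>)} = point t i"
proof -
  have "unitarily_equivalent glue_alg (point_hilb t i, point_rep t i) (H, \<pi>)"
    using classify[OF irr t supp i] by (simp add: unitarily_equivalent_def)
  then have "((point_hilb t i, point_rep t i), (H, \<pi>)) \<in> rep_rel"
    using point_irrep[OF t] irr by (simp add: irreps_def)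
  from equiv_class_eq[OF equiv_rep_rel this] show ?thesis by (simp only: point_def)
qed

lemma spectrum_points_glue: "spectrum_points glue_alg = {point t i | t i. t \<in> circle}"
proof (intro equalityI subsetI)
  fix c assume "c \<in> spectrum_points glue_alg"
  then obtain H \<pi> where irr: "irreducible_rep glue_alg H \<pi>" and c: "c = rep_rel `` {(H, \<pi>)}"
    unfolding spectrum_points_def quotient_def irreps_def by auto
  obtain t where t: "t \<in> circle" "\<forall>a\<in>vcar glue_alg. cf a t = (\<lambda>i j. 0) \<longrightarrow> kills H \<pi> a"
    using support_point[OF irr] by blast
  obtain i where "\<not> kills H \<pi> (corner i)" using corner_not_killed[OF irr] by blast
  then show "c \<in> {point t i | t i. t \<in> circle}" using point_classify[OF t(1) irr t(2)] c t(1) by blast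
qed (use point_spectrum in blast)

text \<open>Kernels separate what has to be separated: scalar functions distinguish points of the
  circle, and corners distinguish the sheets over the branch set. Off the branch set the other
  corner is not killed either, so the classification identifies the two classes.\<close>

lemma point_eq:
  assumes t: "t \<in> circle" and s: "s \<in> circle"
  shows "point t i = point s j \<longleftrightarrow> t = s \<and> (i = j \<or> t \<notin> branch_set)"
proof
  assume eq: "point t i = point s j"
  have k: "kills (point_hilb t i) (point_rep t i) a \<longleftrightarrow> kills (point_hilb s j) (point_rep s j) a"
    if "a \<in> vcar glue_alg" for a
    using kills_point_class[OF s _ that, of "point_hilb t i" "point_rep t i" j] point_self[OF t, of i] eq by simp
  have ts: "t = s"
  proof (rule ccontr)
    assume ne: "t \<noteq> s"
    \<comment> \<open>The distance to \<open>t\<close> is a scalar function that is killed at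
      \<open>t\<close> and at no other point.\<close>
    have c: "continuous_on circle (\<lambda>x. complex_of_real (dist x t))" by (intro continuous_intros)
    show False using k[OF scal(1)[OF c]] ne
      unfolding kills_point[OF scal(1)[OF c]] scal(2)[OF c t] scal(2)[OF c s] by (auto split: if_splits)
  qed
  moreover have "i = j" if "t \<in> branch_set"
    using k[OF corner(1)[of i]] that ts t unfolding kills_point[OF corner(1)]
    by (auto simp: corner(2) unit_entry_def split: if_splits)
  ultimately show "t = s \<and> (i = j \<or> t \<notin> branch_set)" by blast
next
  assume *: "t = s \<and> (i = j \<or> t \<notin> branch_set)"
  show "point t i = point s j"
  proof (cases "i = j")
    case False
    then have tb: "t \<notin> branch_set" using * by blast
    have supp: "\<forall>a\<in>vcar glue_alg. cf a t = (\<lambda>i j. 0) \<longrightarrow> kills (point_hilb t i) (point_rep t i) a"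
      by (simp add: kills_point)
    have "\<not> kills (point_hilb t i) (point_rep t i) (corner j)"
      using tb by (auto simp: kills_point corner(1) corner(2)[OF t] unit_entry_def)
    from point_classify[OF t irreducible_point[OF t] supp this] show ?thesis using * by (simp add: point_def)
  qed (use * in simp)
qed

definition ideal_open :: "kernel_function set \<Rightarrow> kernel_function rep set set" where
  "ideal_open I = {c \<in> spectrum_points glue_alg. \<exists>(H, \<pi>)\<in>c. \<exists>a\<in>I. \<exists>\<xi>\<in>vcar H. \<pi> a \<xi> \<noteq> vzero H}"

lemma spectrum_glue: "spectrum glue_alg = topology_generated_by {ideal_open I | I. closed_ideal glue_alg I}"
  by (simp add: spectrum_def ideal_open_def)

lemma point_in_ideal_open:
  assumes t: "t \<in> circle" and I: "I \<subseteq> vcar glue_alg"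
  shows "point t i \<in> ideal_open I \<longleftrightarrow> (\<exists>a\<in>I. if t \<in> branch_set then cf a t i i \<noteq> 0 else (\<exists>k j. cf a t k j \<noteq> 0))"
proof -
  have "point t i \<in> ideal_open I \<longleftrightarrow> (\<exists>(H, \<pi>)\<in>point t i. \<exists>a\<in>I. \<not> kills H \<pi> a)"
    unfolding ideal_open_def kills_def using point_spectrum[OF t, of i] by auto
  also have "\<dots> \<longleftrightarrow> (\<exists>a\<in>I. \<not> kills (point_hilb t i) (point_rep t i) a)"
  proof
    assume "\<exists>(H, \<pi>)\<in>point t i. \<exists>a\<in>I. \<not> kills H \<pi> a"
    then obtain H \<pi> a where *: "(H, \<pi>) \<in> point t i" "a \<in> I" "\<not> kills H \<pi> a" by blast
    then show "\<exists>a\<in>I. \<not> kills (point_hilb t i) (point_rep t i) a"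
      using kills_point_class[OF t *(1), of a] I by blast
  next
    assume "\<exists>a\<in>I. \<not> kills (point_hilb t i) (point_rep t i) a"
    then show "\<exists>(H, \<pi>)\<in>point t i. \<exists>a\<in>I. \<not> kills H \<pi> a" using point_self[OF t, of i] by blast
  qed
  also have "\<dots> \<longleftrightarrow> (\<exists>a\<in>I. if t \<in> branch_set then cf a t i i \<noteq> 0 else (\<exists>k j. cf a t k j \<noteq> 0))"
    using I by (intro bex_cong refl) (auto simp: kills_point subset_iff)
  finally show ?thesis .
qed

lemma topspace_spectrum: "topspace (spectrum glue_alg) = spectrum_points glue_alg"
proof -
  have "closed_ideal glue_alg (vcar glue_alg)"
    using star_algebra_glue unfolding closed_ideal_def vsubspace_def N_closed_def
    by (auto simp: glue_closed star_algebra_def complex_vs_def)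
  moreover have "spectrum_points glue_alg \<subseteq> ideal_open (vcar glue_alg)"
  proof
    fix c assume "c \<in> spectrum_points glue_alg"
    then obtain t i where t: "t \<in> circle" and c: "c = point t i" unfolding spectrum_points_glue by blast
    have "cf (corner i) t i i \<noteq> 0" by (simp add: corner(2)[OF t] unit_entry_def)
    then have "cf (corner i) t i i \<noteq> 0" "\<exists>k j. cf (corner i) t k j \<noteq> 0" by blast+
    then show "c \<in> ideal_open (vcar glue_alg)"
      unfolding c point_in_ideal_open[OF t order_refl] by (intro bexI[OF _ corner(1)[of i]]) auto
  qed
  moreover have "ideal_open I \<subseteq> spectrum_points glue_alg" for I by (auto simp: ideal_open_def)
  ultimately show ?thesis unfolding spectrum_glue topology_generated_by_topspace by blast
qed

definition glue_map :: "(nat \<Rightarrow> real) \<Rightarrow> kernel_function rep set" where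
  "glue_map y = point (base y) (sheet y)"

lemma glue_map_pt [simp]: "glue_map (pt t i) = point t i" by (simp add: glue_map_def)

lemma circles_pt [simp]: "pt t i \<in> circles \<longleftrightarrow> t \<in> circle" by (auto simp: circles_def)

lemma glue_map_image: "glue_map ` circles = topspace (spectrum glue_alg)"
  unfolding topspace_spectrum spectrum_points_glue circles_def by force

text \<open>The sheet coordinate takes the values 0 and 1 only, so the threshold 1/2 separates the
  sheets by open sets.\<close>

lemma openin_sheet:
  assumes "openin (top_of_set circle) G" shows "openin two_circles ((\<lambda>t. pt t i) ` G)"
proof -
  obtain V where V: "open V" "G = circle \<inter> V" using assms by (auto simp: openin_open)
  have "open (base -` V)" using V(1) continuous_on_base[of UNIV] by (simp add: continuous_on_open_vimage)
  moreover have "open {y :: nat \<Rightarrow> real. if i then y 2 > 1/2 else y 2 < 1/2}"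
    by (cases i) (auto intro!: open_Collect_less continuous_on_coordinate continuous_intros)
  ultimately have "open (base -` V \<inter> {y. if i then y 2 > 1/2 else y 2 < 1/2})" by (rule open_Int)
  moreover have "(\<lambda>t. pt t i) ` G = circles \<inter> (base -` V \<inter> {y. if i then y 2 > 1/2 else y 2 < 1/2})"
  proof (intro equalityI subsetI)
    fix y assume y: "y \<in> circles \<inter> (base -` V \<inter> {y. if i then y 2 > 1/2 else y 2 < 1/2})"
    then obtain t j where "y = pt t j" "t \<in> circle" by (auto simp: circles_def)
    moreover then have "j = i" using y by (cases i; cases j) auto
    ultimately show "y \<in> (\<lambda>t. pt t i) ` G" using y V(2) by auto
  qed (use V(2) in auto)
  ultimately show ?thesis unfolding openin_open by blast
qed

lemma openin_slice:
  assumes "openin two_circles V" shows "openin (top_of_set circle) {t \<in> circle. pt t i \<in> V}"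
proof -
  have "continuous_map (top_of_set circle) two_circles (\<lambda>t. pt t i)"
    by (auto simp: continuous_map_in_subtopology continuous_on_pt)
  from openin_continuous_map_preimage[OF this assms] show ?thesis by simp
qed

lemma openin_nonvanishing:
  assumes "a \<in> vcar glue_alg" shows "openin (top_of_set circle) {t \<in> circle. cf a t k j \<noteq> 0}"
proof -
  have c: "continuous_on circle (\<lambda>t. cf a t k j)" using assms by (simp add: glue_car)
  have "openin (top_of_set circle) (circle \<inter> (\<lambda>t. cf a t k j) -` (- {0}))"
    by (rule continuous_openin_preimage_gen[OF c]) (simp add: open_Compl)
  moreover have "circle \<inter> (\<lambda>t. cf a t k j) -` (- {0}) = {t \<in> circle. cf a t k j \<noteq> 0}" by auto
  ultimately show ?thesis by simp
qed

text \<open>It suffices to pull back the open set of an ideal. The condition at a point of sheet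
  \<open>i\<close> is that some element of the ideal has a nonzero entry, where over the branch set
  only the entry of that sheet counts.\<close>

lemma continuous_glue_map: "continuous_map two_circles (spectrum glue_alg) glue_map"
  unfolding spectrum_glue
proof (rule continuous_on_generated_topo)
  fix U assume "U \<in> {ideal_open I | I. closed_ideal glue_alg I}"
  then obtain I where U: "U = ideal_open I" and "closed_ideal glue_alg I" by blast
  then have I: "I \<subseteq> vcar glue_alg" by (auto simp: closed_ideal_def vsubspace_def)
  \<comment> \<open>Off the branch set any nonzero entry is allowed, and this part is open since the
    branch set is closed; the diagonal entry covers the branch set and is consistent with the
    condition elsewhere.\<close>
  define G where "G a i = {t \<in> circle. cf a t i i \<noteq> 0} \<union>
     (\<Union>k. \<Union>j. {t \<in> circle. cf a t k j \<noteq> 0} \<inter> (circle - branch_set))" for a i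
  have Kc: "openin (top_of_set circle) (circle - branch_set)"
    using closed_branch_set by (simp add: Diff_eq open_Compl openin_open_Int)
  have G: "openin (top_of_set circle) (G a i)" if "a \<in> I" for a i
    unfolding G_def using I that by (intro openin_Un openin_Union openin_Int Kc openin_nonvanishing ballI) (auto intro!: openin_Int Kc openin_nonvanishing)
  have mem: "t \<in> G a i \<longleftrightarrow> t \<in> circle \<and> (if t \<in> branch_set then cf a t i i \<noteq> 0 else (\<exists>k j. cf a t k j \<noteq> 0))" for a i t
    unfolding G_def by auto
  have "glue_map -` U \<inter> topspace two_circles = (\<Union>a\<in>I. \<Union>i. (\<lambda>t. pt t i) ` G a i)"
  proof (intro equalityI subsetI)
    fix y assume y: "y \<in> glue_map -` U \<inter> topspace two_circles"
    then obtain t i where t: "y = pt t i" "t \<in> circle" by (auto simp: circles_def)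
    then have "point t i \<in> ideal_open I" using y U by simp
    then show "y \<in> (\<Union>a\<in>I. \<Union>i. (\<lambda>t. pt t i) ` G a i)"
      unfolding point_in_ideal_open[OF t(2) I] using t mem by blast
  next
    fix y assume "y \<in> (\<Union>a\<in>I. \<Union>i. (\<lambda>t. pt t i) ` G a i)"
    then obtain a i t where *: "a \<in> I" "t \<in> G a i" "y = pt t i" by blast
    then have t: "t \<in> circle" using mem by blast
    then have "point t i \<in> ideal_open I" unfolding point_in_ideal_open[OF t I] using * mem by blast
    then show "y \<in> glue_map -` U \<inter> topspace two_circles" using * t U by simp
  qed
  moreover have "openin two_circles (\<Union>a\<in>I. \<Union>i. (\<lambda>t. pt t i) ` G a i)"
    by (intro openin_Union ballI) (auto intro!: openin_Union openin_sheet G)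
  ultimately show "openin two_circles (glue_map -` U \<inter> topspace two_circles)" by simp
next
  show "glue_map ` topspace two_circles \<subseteq> \<Union> {ideal_open I | I. closed_ideal glue_alg I}"
    using glue_map_image unfolding spectrum_glue topology_generated_by_topspace by simp
qed

text \<open>The ideal consists of the elements that vanish outside \<open>W\<close> and whose
  diagonal entry for the other sheet vanishes on the branch set. Points of the other sheet off the
  branch set satisfy its condition too, but they coincide with points of sheet
  \<open>i\<close>.\<close>

lemma openin_spectrum_sheet:
  assumes W: "openin (top_of_set circle) W"
  shows "openin (spectrum glue_alg) ((\<lambda>t. point t i) ` W)"
proof -
  have Wc: "W \<subseteq> circle" using W openin_imp_subset by blast
  define I where "I = {a \<in> vcar glue_alg. (\<forall>t\<in>circle - W. \<forall>k j. cf a t k j = 0) \<and> (\<forall>t\<in>branch_set. cf a t (\<not> i) (\<not> i) = 0)}"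
  have Ic: "I \<subseteq> vcar glue_alg" by (auto simp: I_def)
  interpret glue: cstar_algebra glue_alg by (rule cstar_algebra_glue)
  \<comment> \<open>Over the branch set the matrices are diagonal, so a diagonal entry is
    multiplicative there, and its vanishing is stable under multiplication.\<close>
  have diag0: "cf (atimes glue_alg a b) t (\<not> i) (\<not> i) = cf a t (\<not> i) (\<not> i) * cf b t (\<not> i) (\<not> i)"
    if "a \<in> vcar glue_alg" "b \<in> vcar glue_alg" "t \<in> branch_set" for a b t
    using that branch_set_circle cf_glue(1)[OF that(1) _ that(2), of t] cf_branch[OF that(1,3), of False True]
      cf_branch[OF that(1,3), of True False] by (cases i) (auto simp: mmul_def)
  have ideal: "closed_ideal glue_alg I"
    unfolding closed_ideal_def
  proof (intro conjI ballI)
    show "vsubspace glue_alg I" unfolding vsubspace_def I_def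
      by (auto simp: glue_closed cf_linear glue.zero_closed)
    show "N_closed glue_alg (nrm glue_alg) I" unfolding N_closed_def
    proof (intro allI ballI impI)
      fix x l assume l: "l \<in> vcar glue_alg" and x: "range x \<subseteq> I \<and> N_tendsto glue_alg (nrm glue_alg) x l"
      have xI: "x n \<in> I" for n using x by auto
      then have xc: "x n \<in> vcar glue_alg" for n using Ic by blast
      have lim: "(\<lambda>n. cf (x n) t k j) \<longlonglongrightarrow> cf l t k j" if t: "t \<in> circle" for t k j
      proof -
        have "(\<lambda>n. cf (x n) t k j - cf l t k j) \<longlonglongrightarrow> 0"
        proof (rule Lim_null_comparison)
          show "(\<lambda>n. nrm glue_alg (vdiff glue_alg (x n) l)) \<longlonglongrightarrow> 0" using x by (simp add: N_tendsto_def)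
          show "\<forall>\<^sub>F n in sequentially. norm (cf (x n) t k j - cf l t k j) \<le> nrm glue_alg (vdiff glue_alg (x n) l)"
            using cf_le_nrm[OF glue_closed(5)[OF xc l] t, of _ k j] by (simp add: cf_linear)
        qed
        then show ?thesis by (simp add: LIM_zero_iff)
      qed
      have z: "cf l t k j = 0" if "t \<in> circle" "\<And>n. cf (x n) t k j = 0" for t k j
        using lim[OF that(1), of k j] that(2) LIMSEQ_unique[OF _ tendsto_const[of 0]] by simp
      have 1: "cf (x n) t k j = 0" if "t \<in> circle - W" for n t k j using xI[of n] that unfolding I_def by blast
      have 2: "cf (x n) t (\<not> i) (\<not> i) = 0" if "t \<in> branch_set" for n t using xI[of n] that unfolding I_def by blast
      have 3: "cf l t k j = 0" if "t \<in> circle - W" for t k j using z[of t k j] 1[OF that] that by simp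
      have 4: "cf l t (\<not> i) (\<not> i) = 0" if "t \<in> branch_set" for t using z[of t "\<not> i" "\<not> i"] 2[OF that] that branch_set_circle by blast
      show "l \<in> I" unfolding I_def using l 3 4 by blast
    qed
  next
    fix a x assume a: "a \<in> vcar glue_alg" and x: "x \<in> I"
    then have xc: "x \<in> vcar glue_alg" and x1: "\<And>t k j. t \<in> circle - W \<Longrightarrow> cf x t k j = 0"
      and x2: "\<And>t. t \<in> branch_set \<Longrightarrow> cf x t (\<not> i) (\<not> i) = 0" unfolding I_def by blast+
    show "atimes glue_alg a x \<in> I" unfolding I_def
      using x1 x2 by (auto simp: glue_closed a xc diag0 cf_glue(1)[OF a _ xc] mmul_def)
    show "atimes glue_alg x a \<in> I" unfolding I_def
      using x1 x2 by (auto simp: glue_closed a xc diag0 cf_glue(1)[OF xc _ a] mmul_def)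
  qed
  have "ideal_open I = (\<lambda>t. point t i) ` W"
  proof (intro equalityI subsetI)
    fix c assume c: "c \<in> ideal_open I"
    then obtain t k where t: "t \<in> circle" "c = point t k" unfolding ideal_open_def spectrum_points_glue by blast
    then obtain a where a: "a \<in> I" "if t \<in> branch_set then cf a t k k \<noteq> 0 else (\<exists>k j. cf a t k j \<noteq> 0)"
      using c point_in_ideal_open[OF t(1) Ic] by blast
    have "\<exists>k j. cf a t k j \<noteq> 0" using a(2) by (auto split: if_splits)
    then have tW: "t \<in> W" using a(1) t(1) unfolding I_def by blast
    have "k = i" if "t \<in> branch_set"
    proof (rule ccontr)
      assume "k \<noteq> i"
      then have "k = (\<not> i)" by simp
      then show False using a that unfolding I_def by auto
    qed
    then have "c = point t i" unfolding t(2) point_eq[OF t(1) t(1)] by blast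
    then show "c \<in> (\<lambda>t. point t i) ` W" using tW by blast
  next
    fix c assume "c \<in> (\<lambda>t. point t i) ` W"
    then obtain t where t: "t \<in> W" "c = point t i" by blast
    then have tc: "t \<in> circle" using Wc by blast
    obtain V where V: "open V" "W = circle \<inter> V" using W by (auto simp: openin_open)
    then obtain r where r: "r > 0" "ball t r \<subseteq> V" using t(1) open_contains_ball by blast
    define z where "z s = complex_of_real (max 0 (1 - dist t s / r))" for s
    have cz: "continuous_on circle z" unfolding z_def using r by (auto intro!: continuous_intros)
    have z0: "z s = 0" if "s \<in> circle - W" for s
    proof -
      have "s \<notin> ball t r" using that V(2) r(2) by blast
      then show ?thesis using r(1) by (simp add: z_def)
    qed
    let ?a = "atimes glue_alg (scal z) (corner i)"
    have cfa: "cf ?a s k j = (if k = i \<and> j = i then z s else 0)" if "s \<in> circle" for s k j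
      unfolding cf_glue(1)[OF scal(1)[OF cz] that corner(1)] corner(2)[OF that] scal(2)[OF cz that]
      by (cases i; cases k; cases j) (simp_all add: mmul_def unit_entry_def)
    have "?a \<in> I" unfolding I_def using cfa z0 branch_set_circle
      by (auto simp: glue_closed scal(1)[OF cz] corner(1) subset_iff)
    moreover have "cf ?a t i i \<noteq> 0" using cfa[OF tc] by (simp add: z_def)
    ultimately have "point t i \<in> ideal_open I" unfolding point_in_ideal_open[OF tc Ic]
      by (intro bexI[of _ ?a]) auto
    then show "c \<in> ideal_open I" using t(2) by simp
  qed
  then have "(\<lambda>t. point t i) ` W \<in> {ideal_open I | I. closed_ideal glue_alg I}" using ideal by blast
  then show ?thesis unfolding spectrum_glue by (rule topology_generated_by_Basis)
qed

lemma open_glue_map: "open_map two_circles (spectrum glue_alg) glue_map"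
  unfolding open_map_def
proof (intro allI impI)
  fix V assume V: "openin two_circles V"
  then have Vc: "V \<subseteq> circles" using openin_imp_subset by blast
  have "glue_map ` V = (\<Union>i. (\<lambda>t. point t i) ` {t \<in> circle. pt t i \<in> V})"
  proof (intro equalityI subsetI)
    fix c assume "c \<in> glue_map ` V"
    then obtain y where y: "y \<in> V" "c = glue_map y" by blast
    then obtain t i where "y = pt t i" "t \<in> circle" using Vc by (auto simp: circles_def)
    then show "c \<in> (\<Union>i. (\<lambda>t. point t i) ` {t \<in> circle. pt t i \<in> V})" using y by auto
  next
    fix c assume "c \<in> (\<Union>i. (\<lambda>t. point t i) ` {t \<in> circle. pt t i \<in> V})"
    then obtain i t where "pt t i \<in> V" "c = point t i" by blast
    then show "c \<in> glue_map ` V" using glue_map_pt by (metis imageI)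
  qed
  moreover have "openin (spectrum glue_alg) (\<Union>i. (\<lambda>t. point t i) ` {t \<in> circle. pt t i \<in> V})"
    by (intro openin_Union) (auto intro!: openin_spectrum_sheet openin_slice V)
  ultimately show "openin (spectrum glue_alg) (glue_map ` V)" by simp
qed

text \<open>A whole sheet serves as the neighbourhood: its corner maps \<open>v\<close> to the
  multiple \<open>comp i v\<close> of one basis vector in every representation of that sheet, on the
  branch set and off it.\<close>

lemma Fell_algebra_glue: "Fell_algebra glue_alg"
  unfolding Fell_algebra_def
proof (intro conjI ballI)
  show "cstar_algebra glue_alg" by (rule cstar_algebra_glue)
  fix c0 assume "c0 \<in> spectrum_points glue_alg"
  then obtain t0 i where t0: "t0 \<in> circle" "c0 = point t0 i" unfolding spectrum_points_glue by blast
  let ?U = "(\<lambda>t. point t i) ` circle"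
  have "rank_one_projection H (\<pi> (corner i))" if t: "t \<in> circle" and c: "(H, \<pi>) \<in> point t i" for t H \<pi>
  proof -
    have irr: "irreducible_rep glue_alg H \<pi>" using in_point(1)[OF c] .
    note r = representationD[OF irr_rep[OF irr]]
    interpret hilbert_space H by (rule r)
    obtain U where U: "bij_betw U (vcar (point_hilb t i)) (vcar H)" "linear_on (point_hilb t i) H U"
      "\<forall>a\<in>vcar glue_alg. \<forall>\<xi>\<in>vcar (point_hilb t i). U (point_rep t i a \<xi>) = \<pi> a (U \<xi>)"
      using in_point(2)[OF c] unfolding unitarily_equivalent_def by auto
    have img: "vcar H = U ` code ` fib t i" using U(1) by (simp add: bij_betw_def point_simps)
    have e: "mapply (unit_entry i) v = cscale (comp i v) (basis i)" for v
      by (cases i) (auto simp: mapply_def unit_entry_def cscale_def comp_def basis_def)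
    let ?x = "U (code (basis i))"
    have bf: "code (basis i) \<in> vcar (point_hilb t i)" using basis_fib by (simp add: point_simps)
    have act: "\<pi> (corner i) (U (code v)) = vscale H (comp i v) ?x" if v: "v \<in> fib t i" for v
    proof -
      have "\<pi> (corner i) (U (code v)) = U (code (cscale (comp i v) (basis i)))"
        using U(3)[rule_format, OF corner(1)[of i], of "code v"] v by (simp add: point_simps corner(2)[OF t] e)
      also have "code (cscale (comp i v) (basis i)) = vscale (point_hilb t i) (comp i v) (code (basis i))"
        by (simp add: point_hilb_def fibre_transported basis_fib)
      also have "U \<dots> = vscale H (comp i v) ?x" using U(2) bf unfolding linear_on_def by blast
      finally show ?thesis .
    qed
    have fsc: "cscale k (basis i) \<in> fib t i" for k by (simp add: fib_def)
    show ?thesis unfolding rank_one_projection_def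
    proof (intro conjI ballI bexI)
      show "bounded_op H (\<pi> (corner i))" by (rule r(2)[OF corner(1)])
      show "\<pi> (corner i) (\<pi> (corner i) \<xi>) = \<pi> (corner i) \<xi>" if "\<xi> \<in> vcar H" for \<xi>
        using r(7)[OF corner(1)[of i] corner(1)[of i] that] by (simp add: corner_idem)
      show "hinner H (\<pi> (corner i) \<xi>) \<eta> = hinner H \<xi> (\<pi> (corner i) \<eta>)" if "\<xi> \<in> vcar H" "\<eta> \<in> vcar H" for \<xi> \<eta>
        using r(9)[OF corner(1)[of i] that] by (simp add: corner_idem)
      show xH: "?x \<in> vcar H" using img basis_fib by blast
      have "\<not> kills H \<pi> (corner i)"
        unfolding kills_point_class[OF t c corner(1)] kills_point[OF corner(1)]
        by (auto simp: corner(2)[OF t] unit_entry_def)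
      then obtain v where "v \<in> fib t i" "\<pi> (corner i) (U (code v)) \<noteq> vzero H" unfolding kills_def img by blast
      then show "?x \<noteq> vzero H" using act scale_zero by metis
      have "\<pi> (corner i) ` vcar H = (\<lambda>v. vscale H (comp i v) ?x) ` fib t i"
        unfolding img image_image using act by (intro image_cong refl)
      also have "\<dots> = {vscale H c ?x | c. True}"
      proof (intro equalityI subsetI)
        fix y assume "y \<in> {vscale H c ?x | c. True}"
        then obtain k where y: "y = vscale H k ?x" by blast
        show "y \<in> (\<lambda>v. vscale H (comp i v) ?x) ` fib t i"
          unfolding y by (rule image_eqI[OF _ fsc[of k]]) simp
      qed blast
      finally show "\<pi> (corner i) ` vcar H = {vscale H c ?x | c. True}" .
    qed
  qed
  then have "\<forall>c\<in>?U. \<forall>(H, \<pi>)\<in>c. rank_one_projection H (\<pi> (corner i))" by auto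
  moreover have "openin (spectrum glue_alg) ?U" by (rule openin_spectrum_sheet) simp
  ultimately show "\<exists>U. openin (spectrum glue_alg) U \<and> c0 \<in> U \<and>
      (\<exists>b\<in>vcar glue_alg. \<forall>c\<in>U. \<forall>(H, \<pi>)\<in>c. rank_one_projection H (\<pi> b))"
    using t0 corner(1) by blast
qed

section \<open>Smooth structures\<close>

lemma compact_circles: "compact circles"
proof -
  have eq: "circles = (\<lambda>t. pt t False) ` circle \<union> (\<lambda>t. pt t True) ` circle"
    unfolding circles_def by (auto, metis (full_types) imageI)
  show ?thesis unfolding eq by (intro compact_Un compact_continuous_image continuous_on_pt compact_circle)
qed

lemma compact_space_circles: "compact_space two_circles"
  using compact_circles by (simp add: compact_space_subtopology)

lemma Hausdorff_circles: "Hausdorff_space two_circles"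
  by (intro Hausdorff_space_subtopology) (use hausdorff in \<open>force simp: Hausdorff_space_def disjnt_def\<close>)

lemma second_countable_circles: "second_countable two_circles"
proof (rule second_countable_subtopology)
  obtain B :: "(nat \<Rightarrow> real) set set" where B: "countable B" "\<And>C. C \<in> B \<Longrightarrow> open C"
    "\<And>S. open S \<Longrightarrow> \<exists>U. U \<subseteq> B \<and> S = \<Union>U"
    using univ_second_countable by metis
  show "second_countable (euclidean :: (nat \<Rightarrow> real) topology)"
    unfolding second_countable_def
  proof (intro exI[of _ B] conjI allI impI ballI)
    fix U and x :: "nat \<Rightarrow> real" assume U: "openin euclidean U \<and> x \<in> U"
    then obtain \<U> where "\<U> \<subseteq> B" "U = \<Union>\<U>" using B(3)[of U] by auto
    then show "\<exists>V\<in>B. x \<in> V \<and> V \<subseteq> U" using U by blast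
  qed (use B in auto)
qed

text \<open>Common source of the charts and of the local homeomorphism property: for a continuous
  open map only injectivity on the open set remains to be checked.\<close>

lemma homeomorphic_map_restrict:
  assumes c: "continuous_map Y X f" and o: "open_map Y X f" and V: "openin Y V" and inj: "inj_on f V"
  shows "homeomorphic_map (subtopology Y V) (subtopology X (f ` V)) f"
proof (rule bijective_open_imp_homeomorphic_map)
  have VY: "V \<subseteq> topspace Y" using V openin_subset by blast
  have fX: "f ` V \<subseteq> topspace X" using openin_subset[of X "f ` V"] o V unfolding open_map_def by blast
  show "continuous_map (subtopology Y V) (subtopology X (f ` V)) f"
    using continuous_map_from_subtopology[OF c] by (auto simp: continuous_map_in_subtopology)
  show "open_map (subtopology Y V) (subtopology X (f ` V)) f"
    unfolding open_map_def
  proof (intro allI impI)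
    fix W assume "openin (subtopology Y V) W"
    then have W: "openin Y W" "W \<subseteq> V" using openin_open_subtopology[OF V] by auto
    then have "openin X (f ` W)" using o unfolding open_map_def by blast
    then have "openin (subtopology X (f ` V)) (f ` V \<inter> f ` W)" by (rule openin_subtopology_Int2)
    moreover have "f ` V \<inter> f ` W = f ` W" using W(2) by blast
    ultimately show "openin (subtopology X (f ` V)) (f ` W)" by simp
  qed
  show "f ` topspace (subtopology Y V) = topspace (subtopology X (f ` V))" using VY fX by (auto simp: inf_absorb2)
  show "inj_on f (topspace (subtopology Y V))" using inj VY by (simp add: inf_absorb2)
qed

section \<open>Angle charts of the circle\<close>

definition arc :: "bool \<Rightarrow> complex set" where "arc b = circle - {if b then -1 else 1}"

text \<open>Two branches of the argument: with values between -pi and pi away from -1, and, by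
  turning through pi, with values between 0 and 2 pi away from 1.\<close>

definition angle :: "bool \<Rightarrow> complex \<Rightarrow> real" where "angle b z = (if b then Arg z else Arg (- z) + pi)"

definition angles :: "bool \<Rightarrow> real set" where "angles b = (if b then {-pi<..<pi} else {0<..<2*pi})"

text \<open>The real line as the model space of dimension one, whose points are sequences that
  vanish from index 1 on.\<close>

definition line :: "real \<Rightarrow> nat \<Rightarrow> real" where "line r = (\<lambda>n. if n = 0 then r else 0)"

lemma nonpos_circle: "z \<in> circle \<Longrightarrow> z \<noteq> -1 \<Longrightarrow> z \<notin> \<real>\<^sub>\<le>\<^sub>0"
proof
  assume z: "z \<in> circle" "z \<noteq> -1" "z \<in> \<real>\<^sub>\<le>\<^sub>0"
  then obtain x where "z = of_real x" "x \<le> 0" by (auto elim!: nonpos_Reals_cases)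
  then show False using z(1,2) by (auto simp: circle_def dist_norm)
qed

lemma cis_Arg_circle: "z \<in> circle \<Longrightarrow> cis (Arg z) = z"
  using cis_Arg[of z] by (cases "z = 0") (auto simp: circle_def dist_norm sgn_eq)

lemma neg_circle: "- z \<in> circle \<longleftrightarrow> z \<in> circle" by (simp add: circle_def dist_norm)

lemma cis_add_pi: "cis (x + pi) = - cis x" by (simp add: cis_mult[symmetric])

lemma cis_angle:
  assumes "z \<in> arc b" shows "cis (angle b z) = z" "angle b z \<in> angles b" "isCont (angle b) z"
proof -
  have main: "cis (Arg w) = w" "Arg w \<in> {-pi<..<pi}" "isCont Arg w" if w: "w \<in> circle" "w \<noteq> -1" for w
  proof -
    show 1: "cis (Arg w) = w" using w by (simp add: cis_Arg_circle)
    have "Arg w \<noteq> pi" using 1 w(2) by auto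
    then show "Arg w \<in> {-pi<..<pi}" using Arg_bounded[of w] by auto
    show "isCont Arg w" using continuous_at_Arg[OF nonpos_circle[OF w]] .
  qed
  have z: "z \<in> circle" using assms by (simp add: arc_def)
  have "(b \<longrightarrow> z \<noteq> -1) \<and> (\<not> b \<longrightarrow> - z \<noteq> -1)" using assms by (auto simp: arc_def)
  then show "cis (angle b z) = z" "angle b z \<in> angles b"
    using main(1,2)[of z] main(1,2)[of "- z"] z by (auto simp: angle_def angles_def cis_add_pi neg_circle)
  show "isCont (angle b) z"
  proof (cases b)
    case True
    then have "angle b = Arg" by (simp add: angle_def[abs_def])
    then show ?thesis using main(3)[of z] z assms True by (simp add: arc_def)
  next
    case False
    then have e: "angle b = (\<lambda>z. Arg (- z) + pi)" by (simp add: angle_def[abs_def])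
    have "isCont Arg (- z)" using main(3)[of "- z"] z assms False by (auto simp: arc_def neg_circle)
    then have "isCont (\<lambda>z. Arg (- z)) z" by (intro isCont_o2[where f = uminus and g = Arg]) (auto intro: continuous_intros)
    then show ?thesis unfolding e by (intro continuous_intros)
  qed
qed

lemma angle_cis:
  assumes "r \<in> angles b" shows "angle b (cis r) = r" "cis r \<in> arc b"
proof -
  have c: "cis r \<in> circle" by (simp add: circle_def dist_norm)
  show 1: "angle b (cis r) = r"
  proof (cases b)
    case True
    then show ?thesis using assms by (simp add: angle_def angles_def Arg_cis)
  next
    case False
    have "- cis r = cis (r - pi)" using cis_add_pi[of "r - pi"] by simp
    then show ?thesis using assms False by (simp add: angle_def angles_def Arg_cis)
  qed
  have "cis r \<noteq> (if b then -1 else 1)"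
  proof
    assume e: "cis r = (if b then -1 else 1)"
    have "angle b (if b then -1 else 1) = (if b then pi else 2 * pi)"
      using Arg_cis[of pi] by (simp add: angle_def)
    then have "r = (if b then pi else 2 * pi)" using 1 e by simp
    then show False using assms by (auto simp: angles_def split: if_splits)
  qed
  then show "cis r \<in> arc b" using c by (simp add: arc_def)
qed

lemma open_angles: "open (angles b)" by (simp add: angles_def)

lemma isCont_cis: "isCont cis r"
  unfolding isCont_def by (intro tendsto_intros)

text \<open>Two angle functions differ by locally constant multiples of \<open>2 \<pi>\<close>.\<close>

lemma angle_transition:
  assumes r: "cis r \<in> arc b" shows "((\<lambda>x. angle b (cis x)) has_real_derivative 1) (at r)"
proof -
  have c: "isCont (\<lambda>x. angle b (cis x)) r"
    by (rule isCont_o2[where f = cis and g = "angle b", OF isCont_cis cis_angle(3)[OF r]])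
  let ?p = "if b then -1 else (1 :: complex)"
  have "cis r \<noteq> ?p" using r by (auto simp: arc_def)
  moreover have "(cis \<longlongrightarrow> cis r) (nhds r)"
    using isCont_cis[of r] by (simp add: isCont_def tendsto_at_iff_tendsto_nhds)
  ultimately have "\<forall>\<^sub>F x in nhds r. cis x \<noteq> ?p" by (intro tendsto_imp_eventually_ne)
  moreover have "\<forall>\<^sub>F x in nhds r. dist (angle b (cis x)) (angle b (cis r)) < pi"
  proof (rule tendstoD[OF _ pi_gt_zero])
    show "((\<lambda>x. angle b (cis x)) \<longlongrightarrow> angle b (cis r)) (nhds r)"
      using c tendsto_at_iff_tendsto_nhds[of "\<lambda>x. angle b (cis x)" r] by (simp add: isCont_def)
  qed
  \<comment> \<open>The change of the angle and the change of \<open>x\<close> are each below pi.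
    Their difference is a multiple of 2 pi of modulus below 2 pi, hence 0.\<close>
  moreover have "\<forall>\<^sub>F x in nhds r. dist x r < pi" by (auto simp: eventually_nhds_metric intro!: exI[of _ pi])
  ultimately have ev: "\<forall>\<^sub>F x in nhds r. angle b (cis x) = x + (angle b (cis r) - r)"
  proof eventually_elim
    case (elim x)
    have x: "cis x \<in> arc b" using elim(1) by (simp add: arc_def circle_def dist_norm)
    have "cis (angle b (cis x) - x) = 1" "cis (angle b (cis r) - r) = 1"
      using cis_angle(1)[OF x] cis_angle(1)[OF r] by (simp_all add: cis_divide[symmetric])
    then have "cis ((angle b (cis x) - x) - (angle b (cis r) - r)) = 1" (is "cis ?d = 1")
      by (simp add: cis_divide[symmetric])
    then have "cos ?d = 1" by (metis cis.simps(1) one_complex.simps(1))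
    then obtain n where n: "?d = of_int n * 2 * pi" using cos_one_2pi_int by blast
    have "\<bar>?d\<bar> < 2 * pi" using elim(2,3) unfolding dist_real_def by linarith
    then have "\<bar>real_of_int n\<bar> * (2 * pi) < 1 * (2 * pi)" unfolding n by (simp add: abs_mult)
    then have "\<bar>real_of_int n\<bar> < 1" using pi_gt_zero by (metis mult_less_cancel_right_pos mult_pos_pos zero_less_numeral)
    then have "n = 0" by linarith
    then show ?case using n by simp
  qed
  have "((\<lambda>x. x + (angle b (cis r) - r)) has_real_derivative 1) (at r)"
    by (auto intro!: derivative_eq_intros)
  then show ?thesis unfolding DERIV_cong_ev[OF refl ev refl] .
qed

lemma Euclidean_1: "Euclidean_space 1 = top_of_set {x. \<forall>i\<ge>1. x i = 0}"
  by (simp add: Euclidean_space_def euclidean_product_topology)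

lemma line_0 [simp]: "line r 0 = r" by (simp add: line_def)

lemma line_axis: "line r \<in> {x. \<forall>i\<ge>1. x i = 0}" by (simp add: line_def)

lemma axis_line: "y \<in> {x. \<forall>i\<ge>1. x i = 0} \<Longrightarrow> line (y 0) = y"
  by (auto simp: line_def fun_eq_iff)

lemma continuous_on_line: "continuous_on S line"
  unfolding line_def
proof (rule continuous_on_coordinatewise_then_product)
  fix n :: nat show "continuous_on S (\<lambda>r. if n = 0 then r else 0)"
    by (cases "n = 0") (auto intro: continuous_intros)
qed

lemma C_k_const: "C_k k n V (\<lambda>x. c)"
proof (induction k arbitrary: c)
  case 0 then show ?case by simp
next
  case (Suc k)
  show ?case unfolding C_k.simps
    by (intro conjI allI impI exI[of _ "\<lambda>x. 0"] Suc.IH ballI) auto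
qed

text \<open>A function of the single coordinate with derivative 1 everywhere has constant first
  partial derivative, so all orders of differentiability follow without induction on the
  function.\<close>

lemma C_k_translation:
  assumes W: "openin (Euclidean_space 1) W" and f: "\<And>y. y \<in> W \<Longrightarrow> f y = h (y 0)"
    and h: "\<And>y. y \<in> W \<Longrightarrow> (h has_real_derivative 1) (at (y 0))"
  shows "C_k k 1 W f"
proof -
  obtain O' where O': "open O'" "W = {x. \<forall>i\<ge>1. x i = 0} \<inter> O'"
    using W unfolding Euclidean_1 openin_open by blast
  have WA: "W \<subseteq> {x. \<forall>i\<ge>1. x i = 0}" using O' by blast
  have "continuous_on W (\<lambda>y. h (y 0))"
  proof (rule continuous_on_compose2[of "(\<lambda>y. y 0) ` W" h])
    show "continuous_on ((\<lambda>y. y 0) ` W) h"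
      using h DERIV_isCont by (auto simp: continuous_on_eq_continuous_at intro!: continuous_at_imp_continuous_on)
  qed (auto intro: continuous_on_coordinate)
  then have "continuous_on W f" by (rule continuous_on_eq) (simp add: f)
  moreover have "subtopology (Euclidean_space 1) W = top_of_set W"
    unfolding Euclidean_1 subtopology_subtopology using WA by (simp add: inf_absorb2)
  ultimately have c: "continuous_map (subtopology (Euclidean_space 1) W) euclideanreal f" by simp
  have der: "((\<lambda>t. f (x(i := t))) has_real_derivative 1) (at (x i))" if i: "i < 1" and x: "x \<in> W" for i x
  proof -
    have i0: "i = 0" using i by simp
    \<comment> \<open>Parameters \<open>t\<close> for which moving the coordinate to
      \<open>t\<close> stays in the open set; for these the function along the coordinate agrees
      with \<open>h\<close>, which transfers the derivative.\<close>
    define S where "S = (\<lambda>t. x(0 := t)) -` O'"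
    have "continuous_on UNIV (\<lambda>t. x(0 := t))"
    proof (rule continuous_on_coordinatewise_then_product)
      fix n :: nat show "continuous_on UNIV (\<lambda>t. (x(0 := t)) n)"
        by (cases "n = 0") (auto intro: continuous_intros)
    qed
    then have S: "open S" unfolding S_def using O'(1) by (simp add: continuous_on_open_vimage)
    have x0: "x 0 \<in> S" using x O'(2) by (simp add: S_def)
    have eqS: "h t = f (x(0 := t))" if "t \<in> S" for t
    proof -
      have "x(0 := t) \<in> W" using that x WA O'(2) by (auto simp: S_def)
      then show ?thesis using f by simp
    qed
    show ?thesis
      unfolding i0 by (rule has_field_derivative_transform_within_open[OF h[OF x] S x0 eqS])
  qed
  show ?thesis
  proof (cases k)
    case 0 then show ?thesis using c by simp
  next
    case (Suc m)
    show ?thesis unfolding Suc C_k.simps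
      using c der by (intro conjI allI impI exI[of _ "\<lambda>x. 1"] C_k_const) auto
  qed
qed

definition chart_map :: "('x \<Rightarrow> complex) \<Rightarrow> bool \<Rightarrow> 'x \<Rightarrow> nat \<Rightarrow> real" where
  "chart_map q b x = line (angle b (q x))"

definition chart_dom :: "((nat \<Rightarrow> real) \<Rightarrow> 'x) \<Rightarrow> bool \<Rightarrow> bool \<Rightarrow> 'x set" where
  "chart_dom \<psi> b i = \<psi> ` (\<lambda>t. pt t i) ` arc b"

text \<open>Serves the two circles and the glued space alike. The map \<open>q\<close> recovers the
  point of the circle from a point of the quotient, so angle functions descend to charts on the
  images of arcs of either sheet.\<close>

lemma smooth_atlas_glued:
  fixes X :: "'x topology"
  assumes c: "continuous_map two_circles X \<psi>" and o: "open_map two_circles X \<psi>"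
    and img: "\<psi> ` circles = topspace X" and q: "\<And>t i. t \<in> circle \<Longrightarrow> q (\<psi> (pt t i)) = t"
  shows "smooth_atlas 1 X {(chart_dom \<psi> b i, chart_map q b) | b i. True}"
proof -
  have arc_open: "openin (top_of_set circle) (arc b)" for b
    unfolding arc_def by (simp add: Diff_eq openin_open_Int open_Compl)
  have arc_circle: "arc b \<subseteq> circle" for b by (auto simp: arc_def)
  have Vo: "openin two_circles ((\<lambda>t. pt t i) ` arc b)" for b i by (rule openin_sheet[OF arc_open])
  have Uo: "openin X (chart_dom \<psi> b i)" for b i
    using o Vo unfolding chart_dom_def open_map_def by blast
  have qU: "q x \<in> arc b" if "x \<in> chart_dom \<psi> b i" for x b i
    using that q arc_circle[of b] unfolding chart_dom_def by (auto simp: subset_iff)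
  have chart_img: "chart_map q b ` chart_dom \<psi> b i = line ` angles b" for b i
  proof (intro equalityI subsetI)
    fix y assume "y \<in> chart_map q b ` chart_dom \<psi> b i"
    then obtain x where "x \<in> chart_dom \<psi> b i" "y = line (angle b (q x))" by (auto simp: chart_map_def)
    then show "y \<in> line ` angles b" using cis_angle(2)[OF qU] by blast
  next
    fix y assume "y \<in> line ` angles b"
    then obtain r where r: "r \<in> angles b" "y = line r" by blast
    have "\<psi> (pt (cis r) i) \<in> chart_dom \<psi> b i" using angle_cis(2)[OF r(1)] unfolding chart_dom_def by blast
    moreover have "chart_map q b (\<psi> (pt (cis r) i)) = y"
      using r angle_cis[OF r(1)] arc_circle[of b] q by (auto simp: chart_map_def subset_iff)
    ultimately show "y \<in> chart_map q b ` chart_dom \<psi> b i" by (metis imageI)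
  qed
  have line_open: "openin (Euclidean_space 1) (line ` angles b)" for b
  proof -
    have "open ((\<lambda>y :: nat \<Rightarrow> real. y 0) -` angles b)"
      by (rule open_vimage[OF open_angles continuous_on_coordinate])
    moreover have "line ` angles b = {x. \<forall>i\<ge>1. x i = 0} \<inter> (\<lambda>y :: nat \<Rightarrow> real. y 0) -` angles b"
    proof (intro equalityI subsetI)
      fix y :: "nat \<Rightarrow> real" assume "y \<in> {x. \<forall>i\<ge>1. x i = 0} \<inter> (\<lambda>y. y 0) -` angles b"
      then have yA: "y \<in> {x. \<forall>i\<ge>1. x i = 0}" and y0: "y 0 \<in> angles b" by simp_all
      show "y \<in> line ` angles b" 
        by (rule image_eqI[where x = "y 0"]) (simp_all only: axis_line[OF yA] y0)
    next
      fix y assume "y \<in> line ` angles b"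
      then obtain r where "y = line r" "r \<in> angles b" by blast
      then show "y \<in> {x. \<forall>i\<ge>1. x i = 0} \<inter> (\<lambda>y :: nat \<Rightarrow> real. y 0) -` angles b"
        using line_axis[of r] by simp
    qed
    ultimately show ?thesis unfolding Euclidean_1 openin_open by blast
  qed
  have inj\<psi>: "inj_on \<psi> ((\<lambda>t. pt t i) ` arc b)" for b i
  proof (rule inj_onI)
    fix x y assume xy: "x \<in> (\<lambda>t. pt t i) ` arc b" "y \<in> (\<lambda>t. pt t i) ` arc b" "\<psi> x = \<psi> y"
    obtain s where s: "x = pt s i" "s \<in> circle" using xy(1) arc_circle[of b] by auto
    obtain t where t: "y = pt t i" "t \<in> circle" using xy(2) arc_circle[of b] by auto
    have "s = q (\<psi> x)" unfolding s(1) by (rule q[OF s(2), symmetric])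
    also have "\<dots> = q (\<psi> y)" using xy(3) by simp
    also have "\<dots> = t" unfolding t(1) by (rule q[OF t(2)])
    finally show "x = y" unfolding s(1) t(1) by simp
  qed
  have homeo: "homeomorphic_map (subtopology X (chart_dom \<psi> b i)) (subtopology (Euclidean_space 1) (line ` angles b)) (chart_map q b)" for b i
  proof -
    let ?V = "(\<lambda>t. pt t i) ` arc b"
    have Vc: "?V \<subseteq> circles" using arc_circle[of b] by auto
    have sub1: "subtopology (Euclidean_space 1) (line ` angles b) = top_of_set (line ` angles b)"
      unfolding Euclidean_1 subtopology_subtopology using line_axis by (intro arg_cong[of _ _ top_of_set]) blast
    have sub2: "subtopology two_circles ?V = top_of_set ?V"
      unfolding subtopology_subtopology using Vc by (simp add: inf_absorb2)
    \<comment> \<open>The parametrisation of an arc by its angle, followed by \<open>\<psi>\<close>,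
      is the inverse of the chart.\<close>
    have h1: "homeomorphic_maps (top_of_set (line ` angles b)) (top_of_set ?V) (\<lambda>y. pt (cis (y 0)) i) (\<lambda>y. line (angle b (base y)))"
      unfolding homeomorphic_maps_def
    proof (intro conjI ballI)
      have "continuous_on (line ` angles b) (\<lambda>y. pt (cis (y 0)) i)"
        by (rule continuous_on_compose2[OF continuous_on_pt[of UNIV]]) (auto intro!: continuous_intros continuous_on_coordinate)
      then show "continuous_map (top_of_set (line ` angles b)) (top_of_set ?V) (\<lambda>y. pt (cis (y 0)) i)"
        using angle_cis(2) by (auto simp: continuous_map_in_subtopology)
      have "continuous_on (arc b) (angle b)" using cis_angle(3) by (auto intro: continuous_at_imp_continuous_on)
      then have "continuous_on ?V (\<lambda>y. angle b (base y))"
        by (rule continuous_on_compose2[OF _ continuous_on_base]) auto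
      then have "continuous_on ?V (\<lambda>y. line (angle b (base y)))"
        by (rule continuous_on_compose2[OF continuous_on_line[of UNIV]]) auto
      then show "continuous_map (top_of_set ?V) (top_of_set (line ` angles b)) (\<lambda>y. line (angle b (base y)))"
        using cis_angle(2)[where b = b] by (auto simp: continuous_map_in_subtopology)
    qed (use angle_cis(1) cis_angle(1) in auto)
    have "homeomorphic_map (subtopology two_circles ?V) (subtopology X (\<psi> ` ?V)) \<psi>"
      by (rule homeomorphic_map_restrict[OF c o Vo inj\<psi>])
    then obtain k where k: "homeomorphic_maps (top_of_set ?V) (subtopology X (\<psi> ` ?V)) \<psi> k"
      unfolding sub2 homeomorphic_map_maps by blast
    from homeomorphic_maps_compose[OF conjI[OF h1 k]]
    have "homeomorphic_map (subtopology X (\<psi> ` ?V)) (top_of_set (line ` angles b)) ((\<lambda>y. line (angle b (base y))) \<circ> k)"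
      using homeomorphic_maps_map by blast
    moreover have "((\<lambda>y. line (angle b (base y))) \<circ> k) x = chart_map q b x" if xV: "x \<in> topspace (subtopology X (\<psi> ` ?V))" for x
    proof -
      obtain t where t: "t \<in> arc b" "x = \<psi> (pt t i)" using xV by auto
      have "k x = pt t i" using k t unfolding homeomorphic_maps_def by auto
      then show ?thesis using t q[of t i] arc_circle[of b] by (auto simp: chart_map_def)
    qed
    ultimately show ?thesis unfolding chart_dom_def sub1 by (rule homeomorphic_map_eq)
  qed
  have chart: "chart 1 X (chart_dom \<psi> b i) (chart_map q b)" for b i
    unfolding chart_def chart_img using Uo line_open homeo by blast
  have cover: "(\<Union>b. \<Union>i. chart_dom \<psi> b i) = topspace X"
  proof (intro equalityI subsetI)
    fix x assume "x \<in> topspace X"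
    then obtain y where "y \<in> circles" "x = \<psi> y" using img by blast
    then obtain t i where t: "t \<in> circle" "x = \<psi> (pt t i)" by (auto simp: circles_def)
    then have "t \<in> arc True \<or> t \<in> arc False" by (auto simp: arc_def)
    then show "x \<in> (\<Union>b. \<Union>i. chart_dom \<psi> b i)" using t(2) unfolding chart_dom_def by blast
  qed (use Uo openin_subset in blast)
  have smooth: "smooth_map 1 (chart_map q b ` (chart_dom \<psi> b i \<inter> chart_dom \<psi> b' i'))
      (chart_map q b' \<circ> inv_into (chart_dom \<psi> b i) (chart_map q b))" for b i b' i'
    unfolding smooth_map_def
  proof (intro allI impI)
    fix k j assume j: "j < (1 :: nat)"
    let ?U = "chart_dom \<psi> b i" and ?U' = "chart_dom \<psi> b' i'" and ?\<phi> = "chart_map q b"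
    let ?W = "?\<phi> ` (?U \<inter> ?U')"
    have inj: "inj_on ?\<phi> ?U"
      using homeomorphic_imp_injective_map[OF homeo[of b i]] openin_subset[OF Uo[of b i]] by (simp add: inf_absorb2)
    have "openin (subtopology X ?U) (?U \<inter> ?U')" using Uo by (intro openin_subtopology_Int2)
    then have "openin (subtopology (Euclidean_space 1) (line ` angles b)) ?W"
      using homeomorphic_imp_open_map[OF homeo[of b i]] unfolding open_map_def by blast
    then have W: "openin (Euclidean_space 1) ?W" using openin_open_subtopology[OF line_open] by blast
    \<comment> \<open>Both charts read off the angle of the same point of the circle, so the
      coordinate change is \<open>angle b'\<close> after \<open>cis\<close>, whatever the sheets
      are.\<close>
    have y: "(chart_map q b' \<circ> inv_into ?U ?\<phi>) y = line (angle b' (cis (y 0))) \<and> cis (y 0) \<in> arc b'" if yW: "y \<in> ?W" for y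
    proof -
      obtain x where x: "x \<in> ?U" "x \<in> ?U'" "y = ?\<phi> x" using yW by blast
      have "inv_into ?U ?\<phi> y = x" using x inj by simp
      moreover have "cis (y 0) = q x" using cis_angle(1)[OF qU[OF x(1)]] x(3) by (simp add: chart_map_def)
      ultimately show ?thesis using qU[OF x(2)] by (simp add: chart_map_def)
    qed
    have j0: "j = 0" using j by simp
    show "C_k k 1 ?W (\<lambda>x. (chart_map q b' \<circ> inv_into ?U ?\<phi>) x j)"
      unfolding j0 by (rule C_k_translation[OF W, where h = "\<lambda>x. angle b' (cis x)"])
        (use y angle_transition in auto)
  qed
  let ?A = "{(chart_dom \<psi> b i, chart_map q b) | b i. True}"
  have "(\<Union>(U, \<phi>)\<in>?A. U) = (\<Union>b. \<Union>i. chart_dom \<psi> b i)" by auto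
  moreover have "\<forall>(U, \<phi>)\<in>?A. chart 1 X U \<phi>" using chart by blast
  moreover have "\<forall>(U, \<phi>)\<in>?A. \<forall>(U', \<phi>')\<in>?A. smooth_map 1 (\<phi> ` (U \<inter> U')) (\<phi>' \<circ> inv_into U \<phi>)"
    using smooth by blast
  ultimately show ?thesis unfolding smooth_atlas_def cover by blast
qed

lemma smooth_manifold_circles: "smooth_manifold two_circles"
proof -
  have "smooth_atlas 1 two_circles {(chart_dom id b i, chart_map base b) | b i. True}"
    by (rule smooth_atlas_glued) (auto simp: open_map_def)
  then show ?thesis
    unfolding smooth_manifold_def using second_countable_circles Hausdorff_circles by blast
qed

lemma smooth_spectrum: "smooth_nonHausdorff_manifold (spectrum glue_alg)"
proof -
  \<comment> \<open>All points glued together lie over the same point of the circle, so the choice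
    is unique by \<open>point_eq\<close>.\<close>
  define q where "q c = (SOME t. t \<in> circle \<and> (\<exists>i. c = point t i))" for c
  have q: "q (point t i) = t" if t: "t \<in> circle" for t i
    unfolding q_def by (rule some_equality) (use t point_eq in blast)+
  have "smooth_atlas 1 (spectrum glue_alg) {(chart_dom glue_map b i, chart_map q b) | b i. True}"
    by (rule smooth_atlas_glued[OF continuous_glue_map open_glue_map glue_map_image]) (simp add: q)
  moreover have "second_countable (spectrum glue_alg)"
    using second_countable_open_map_image[OF continuous_glue_map open_glue_map _ second_countable_circles] glue_map_image by simp
  moreover have "\<not> Hausdorff_space (spectrum glue_alg)"
  proof
    assume H: "Hausdorff_space (spectrum glue_alg)"
    have one: "1 \<in> branch_set" by (simp add: branch_set_def)
    \<comment> \<open>These points approach 1 through the lower half circle, while the branch set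
      has no point of negative imaginary part. The sheets are glued along them, so any
      neighbourhoods of the two points over 1 meet.\<close>
    define s where "s n = cis (- (1 / real (Suc n)))" for n
    have sc: "s n \<in> circle" for n by (simp add: s_def circle_def dist_norm)
    have small: "0 < 1 / real (Suc n)" "1 / real (Suc n) < pi" for n
    proof -
      show "0 < 1 / real (Suc n)" by simp
      have "1 / real (Suc n) \<le> 1" by simp
      then show "1 / real (Suc n) < pi" using pi_gt3 by linarith
    qed
    have sb: "s n \<notin> branch_set" for n
    proof
      assume "s n \<in> branch_set"
      moreover have "0 \<le> Im x" if "x \<in> branch_set" for x
        using that sin_gt_zero[OF small] by (auto simp: branch_set_def kpt_def less_imp_le simp del: of_nat_Suc)
      ultimately have "0 \<le> Im (s n)" by blast
      moreover have "0 < sin (1 / real (Suc n))" by (rule sin_gt_zero[OF small])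
      ultimately show False by (simp add: s_def)
    qed
    have "(\<lambda>n. cis (- inverse (real (Suc n)))) \<longlonglongrightarrow> cis (- 0)"
      by (intro tendsto_intros LIMSEQ_inverse_real_of_nat)
    then have lim: "s \<longlonglongrightarrow> 1" by (simp add: s_def[abs_def] inverse_eq_divide)
    have ne: "point 1 False \<noteq> point 1 True" using point_eq[of 1 1 False True] one circle_nonempty by blast
    then obtain U V where UV: "openin (spectrum glue_alg) U" "openin (spectrum glue_alg) V"
      "point 1 False \<in> U" "point 1 True \<in> V" "disjnt U V"
      using H point_spectrum[OF circle_nonempty] unfolding Hausdorff_space_def topspace_spectrum by meson
    have ev: "\<forall>\<^sub>F n in sequentially. point (s n) i \<in> U'"
      if U': "openin (spectrum glue_alg) U'" "point 1 i \<in> U'" for U' i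
    proof -
      have "openin two_circles {y \<in> circles. glue_map y \<in> U'}"
        using openin_continuous_map_preimage[OF continuous_glue_map U'(1)] by simp
      from openin_slice[OF this, of i] have "openin (top_of_set circle) {t \<in> circle. point t i \<in> U'}" by simp
      then obtain G where G: "open G" "{t \<in> circle. point t i \<in> U'} = circle \<inter> G" by (auto simp: openin_open)
      then have "1 \<in> G" using U'(2) circle_nonempty by blast
      then have "\<forall>\<^sub>F n in sequentially. s n \<in> G" using topological_tendstoD[OF lim G(1)] by blast
      then show ?thesis by eventually_elim (use G(2) sc in blast)
    qed
    have "\<forall>\<^sub>F n in sequentially. point (s n) False \<in> U \<and> point (s n) True \<in> V"
      using ev[OF UV(1,3)] ev[OF UV(2,4)] by eventually_elim blast
    then obtain n where "point (s n) False \<in> U" "point (s n) True \<in> V"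
      using eventually_happens'[OF sequentially_bot] by blast
    moreover have "point (s n) False = point (s n) True" using point_eq[OF sc sc] sb by blast
    ultimately show False using UV(5) unfolding disjnt_def by auto
  qed
  ultimately show ?thesis unfolding smooth_nonHausdorff_manifold_def by blast
qed

lemma local_homeomorphism_glue: "surjective_local_homeomorphism two_circles (spectrum glue_alg) glue_map"
  unfolding surjective_local_homeomorphism_def local_homeomorphism_def
proof (intro conjI ballI continuous_glue_map)
  show "glue_map ` topspace two_circles = topspace (spectrum glue_alg)" using glue_map_image by simp
  fix y assume "y \<in> topspace two_circles"
  then obtain t i where y: "y = pt t i" "t \<in> circle" by (auto simp: circles_def)
  let ?V = "(\<lambda>t. pt t i) ` circle"
  have V: "openin two_circles ?V" by (rule openin_sheet) simp
  have inj: "inj_on glue_map ?V" using point_eq by (auto simp: inj_on_def)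
  show "\<exists>V. openin two_circles V \<and> y \<in> V \<and> openin (spectrum glue_alg) (glue_map ` V) \<and>
      homeomorphic_map (subtopology two_circles V) (subtopology (spectrum glue_alg) (glue_map ` V)) glue_map"
    using V y open_glue_map homeomorphic_map_restrict[OF continuous_glue_map open_glue_map V inj]
    unfolding open_map_def by blast
qed

text \<open>By \<open>point_eq\<close> two points of the circles have the same image exactly when
  the pair lies in \<open>gpd\<close>, so the abstract groupoid of the gluing map is the concrete
  one.\<close>

lemma equivalence_groupoid_glue: "equivalence_groupoid two_circles glue_map = glue_groupoid"
proof -
  have "prod_topology two_circles two_circles = top_of_set (circles \<times> circles)"
    by (simp add: subtopology_Times[symmetric])
  moreover have "circles \<times> circles \<inter> {(y1, y2). y1 \<in> circles \<and> y2 \<in> circles \<and> glue_map y1 = glue_map y2} = gpd"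
  proof (intro equalityI subsetI)
    fix p assume p: "p \<in> circles \<times> circles \<inter> {(y1, y2). y1 \<in> circles \<and> y2 \<in> circles \<and> glue_map y1 = glue_map y2}"
    then obtain t i s j where *: "p = (pt t i, pt s j)" "t \<in> circle" "s \<in> circle" "point t i = point s j"
      by (auto simp: circles_def)
    then have "t = s" "i = j \<or> t \<notin> branch_set" using point_eq[of t s i j] by blast+
    then show "p \<in> gpd" unfolding *(1) pt_gpd using *(2) by blast
  next
    fix p assume "p \<in> gpd"
    then obtain t i j where "p = (pt t i, pt t j)" "t \<in> circle" "i = j \<or> t \<notin> branch_set" by (auto simp: gpd_def)
    moreover then have "point t i = point t j" using point_eq by blast
    ultimately show "p \<in> circles \<times> circles \<inter> {(y1, y2). y1 \<in> circles \<and> y2 \<in> circles \<and> glue_map y1 = glue_map y2}"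
      by simp
  qed
  ultimately show ?thesis
    by (simp add: equivalence_groupoid_def glue_groupoid_def subtopology_subtopology)
qed

lemma compact_spectrum: "compact_space (spectrum glue_alg)"
  using image_compactin[OF _ continuous_glue_map, of circles] compact_space_circles glue_map_image
  by (simp add: compact_space_def)

section \<open>Separability\<close>

text \<open>Elements are grouped by an accuracy \<open>1 / Suc k\<close>, a scale at which they oscillate by less than
  that, and their rounded values on a finite net of that scale; one element is chosen in each of the
  countably many groups.\<close>

lemma separable_glue: "separable glue_alg"
proof -
  \<comment> \<open>Accuracy \<open>k\<close> and scale \<open>m\<close> are separate indices:
    uniform continuity provides some \<open>m\<close> for each element and each
    \<open>k\<close>.\<close>
  define osc where "osc k m f \<longleftrightarrow> f \<in> vcar glue_alg \<and>
    (\<forall>s\<in>circle. \<forall>t\<in>circle. dist s t < 1 / real (Suc m) \<longrightarrow> (\<forall>i j. cmod (cf f s i j - cf f t i j) < 1 / real (Suc k)))" for k m f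
  have "\<exists>D. set D \<subseteq> circle \<and> circle \<subseteq> (\<Union>t\<in>set D. ball t (1 / real (Suc m)))" for m
  proof -
    have "\<exists>T\<subseteq>circle. finite T \<and> circle \<subseteq> (\<Union>t\<in>T. ball t (1 / real (Suc m)))"
      using compactE_image[OF compact_circle, of circle "\<lambda>t. ball t (1 / real (Suc m))"] by force
    then show ?thesis using finite_list by metis
  qed
  then obtain D where D: "\<And>m. set (D m) \<subseteq> circle" "\<And>m. circle \<subseteq> (\<Union>t\<in>set (D m). ball t (1 / real (Suc m)))" by metis
  \<comment> \<open>Rounding both parts down to multiples of \<open>1 / Suc k\<close> leaves
    countably many values; equal rounded values differ by at most \<open>2 / Suc k\<close>.\<close>
  define rnd where "rnd k z = (\<lfloor>Re z * real (Suc k)\<rfloor>, \<lfloor>Im z * real (Suc k)\<rfloor>)" for k z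
  define key where "key k m f = map (\<lambda>t. (rnd k (cf f t False False), rnd k (cf f t False True),
      rnd k (cf f t True False), rnd k (cf f t True True))) (D m)" for k m f
  define pick where "pick = (\<lambda>(k, m, c). SOME f. osc k m f \<and> key k m f = c)"
  let ?P = "{(k, m, key k m f) | k m f. osc k m f}"
  have pick: "osc k m (pick (k, m, key k m f)) \<and> key k m (pick (k, m, key k m f)) = key k m f" if "osc k m f" for k m f
    unfolding pick_def prod.case by (rule someI[of _ f]) (use that in simp)
  have floor1: "\<bar>x - y\<bar> \<le> 1 / real (Suc k)" if "\<lfloor>x * real (Suc k)\<rfloor> = \<lfloor>y * real (Suc k)\<rfloor>" for x y :: real and k
  proof -
    have "\<bar>x * real (Suc k) - y * real (Suc k)\<bar> \<le> 1" using that by linarith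
    then have "\<bar>x - y\<bar> * real (Suc k) \<le> 1" by (simp add: abs_mult flip: left_diff_distrib)
    then show ?thesis by (simp add: field_simps)
  qed
  have rnd_close: "cmod (z - w) \<le> 2 / real (Suc k)" if "rnd k z = rnd k w" for z w k
    using cmod_le[of "z - w"] floor1[of "Re z" k "Re w"] floor1[of "Im z" k "Im w"] that by (simp add: rnd_def)
  have close: "nrm glue_alg (vdiff glue_alg f g) \<le> 16 / real (Suc k)"
    if f: "osc k m f" and g: "osc k m g" and eq: "key k m f = key k m g" for k m f g
  proof -
    have "cmod (cf f s i j - cf g s i j) \<le> 4 / real (Suc k)" if s: "s \<in> circle" for s i j
    proof -
      obtain t where t: "t \<in> set (D m)" "s \<in> ball t (1 / real (Suc m))" using D(2)[of m] s by blast
      then have tc: "t \<in> circle" and d: "dist s t < 1 / real (Suc m)" using D(1)[of m] by (auto simp: dist_commute)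
      have "rnd k (cf f t i j) = rnd k (cf g t i j)"
        using eq t(1) by (cases i; cases j) (auto simp: key_def)
      then have 1: "cmod (cf f t i j - cf g t i j) \<le> 2 / real (Suc k)" by (rule rnd_close)
      have 2: "cmod (cf f s i j - cf f t i j) < 1 / real (Suc k)" using f s tc d unfolding osc_def by blast
      have 3: "cmod (cf g s i j - cf g t i j) < 1 / real (Suc k)" using g s tc d unfolding osc_def by blast
      have eq: "cf f s i j - cf g s i j = (cf f s i j - cf f t i j) + (cf f t i j - cf g t i j) - (cf g s i j - cf g t i j)" by simp
      have "cmod (cf f s i j - cf g s i j) \<le> cmod (cf f s i j - cf f t i j) + cmod (cf f t i j - cf g t i j) + cmod (cf g s i j - cf g t i j)"
        using norm_triangle_ineq4[of "(cf f s i j - cf f t i j) + (cf f t i j - cf g t i j)" "cf g s i j - cf g t i j", folded eq]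
          norm_triangle_ineq[of "cf f s i j - cf f t i j" "cf f t i j - cf g t i j"] by linarith
      then show ?thesis using 1 2 3 by (simp add: divide_inverse)
    qed
    \<comment> \<open>Each entry differs by at most 1 + 2 + 1 units of \<open>1 / Suc k\<close>: two
      oscillations and the rounding. The outer factor 4 is from \<open>mnorm_bound\<close>.\<close>
    then have "nrm glue_alg (vdiff glue_alg f g) \<le> 4 * (4 / real (Suc k))"
      by (intro nrm_le mnorm_bound) (simp add: cf_linear)
    then show ?thesis by simp
  qed
  have scale: "\<exists>m. osc k m f" if f: "f \<in> vcar glue_alg" for k f
  proof -
    have "\<exists>d>0. \<forall>s\<in>circle. \<forall>t\<in>circle. dist s t < d \<longrightarrow> cmod (cf f s i j - cf f t i j) < 1 / real (Suc k)" for i j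
    proof -
      have "uniformly_continuous_on circle (\<lambda>t. cf f t i j)"
        using f compact_circle by (intro compact_uniformly_continuous) (auto simp: glue_car)
      then have "\<exists>d>0. \<forall>x\<in>circle. \<forall>x'\<in>circle. dist x' x < d \<longrightarrow> dist (cf f x' i j) (cf f x i j) < 1 / real (Suc k)"
        unfolding uniformly_continuous_on_def by (metis of_nat_0_less_iff zero_less_Suc zero_less_divide_1_iff)
      then show ?thesis unfolding dist_norm by (metis norm_minus_commute)
    qed
    then obtain d where d: "\<And>i j. d i j > 0"
      "\<And>i j. \<forall>s\<in>circle. \<forall>t\<in>circle. dist s t < d i j \<longrightarrow> cmod (cf f s i j - cf f t i j) < 1 / real (Suc k)" by metis
    define r where "r = Min (range (\<lambda>(i, j). d i j))"
    have "r \<in> range (\<lambda>(i, j). d i j)" unfolding r_def by (intro Min_in) auto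
    then have "r > 0" using d(1) by auto
    then obtain m where m: "inverse (real (Suc m)) < r" using reals_Archimedean by blast
    have rd: "r \<le> d i j" for i j unfolding r_def by (intro Min_le) auto
    have "osc k m f" unfolding osc_def
    proof (intro conjI ballI impI allI f)
      fix s t i j assume "s \<in> circle" "t \<in> circle" "dist s t < 1 / real (Suc m)"
      moreover then have "dist s t < d i j" using m rd[of i j] by (simp add: inverse_eq_divide)
      ultimately show "cmod (cf f s i j - cf f t i j) < 1 / real (Suc k)" using d(2)[of i j] by blast
    qed
    then show ?thesis by blast
  qed
  show ?thesis unfolding separable_def
  proof (intro exI[of _ "pick ` ?P"] conjI ballI allI impI)
    show "pick ` ?P \<subseteq> vcar glue_alg"
    proof
      fix g assume "g \<in> pick ` ?P"
      then obtain k m f where "osc k m f" "g = pick (k, m, key k m f)" by blast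
      then have "osc k m g" using pick[of k m f] by simp
      then show "g \<in> vcar glue_alg" by (simp add: osc_def)
    qed
    \<comment> \<open>Keys are lists of integers, so the triples live in a countable type.\<close>
    show "countable (pick ` ?P)" by (intro countable_image countableI_type)
    fix f e assume f: "f \<in> vcar glue_alg" and e: "(0 :: real) < e"
    obtain k where "inverse (real (Suc k)) < e / 16" using reals_Archimedean[of "e / 16"] e by auto
    then have k: "16 / real (Suc k) < e" by (simp add: inverse_eq_divide field_simps)
    obtain m where m: "osc k m f" using scale[OF f] by blast
    let ?g = "pick (k, m, key k m f)"
    have "nrm glue_alg (vdiff glue_alg f ?g) \<le> 16 / real (Suc k)"
      using pick[OF m] by (intro close[OF m]) simp_all
    then have "nrm glue_alg (vdiff glue_alg f ?g) < e" using k by linarith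
    moreover have "?g \<in> pick ` ?P" using m by blast
    ultimately show "\<exists>d\<in>pick ` ?P. nrm glue_alg (vdiff glue_alg f d) < e" by blast
  qed
qed

section \<open>K-theory\<close>

lemma star_algebra_unitization:
  assumes "star_algebra A" shows "star_algebra (unitization A)"
proof -
  interpret star_algebra A by fact
  have op: "vcar (unitization A) = vcar A \<times> UNIV" "vzero (unitization A) = (vzero A, 0)"
    "\<And>a l b m. vadd (unitization A) (a, l) (b, m) = (vadd A a b, l + m)"
    "\<And>c a l. vscale (unitization A) c (a, l) = (vscale A c a, c * l)"
    "\<And>a l b m. atimes (unitization A) (a, l) (b, m) = (vadd A (atimes A a b) (vadd A (vscale A l b) (vscale A m a)), l * m)"
    "\<And>a l. astar (unitization A) (a, l) = (astar A a, cnj l)"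
    by (simp_all add: unitization_def)
  note cl = add_closed zero_closed scale_closed times_closed star_closed
  have left_comm: "vadd A x (vadd A y z) = vadd A y (vadd A x z)" if "x \<in> vcar A" "y \<in> vcar A" "z \<in> vcar A" for x y z
    using that add_assoc add_comm by metis
  note ac = add_assoc add_comm left_comm
  note lin = scale_add add_scale scale_scale times_add add_times scale_times times_scale star_add star_scale star_times times_assoc
  show ?thesis
  proof unfold_locales
    fix x assume "x \<in> vcar (unitization A)"
    then obtain a l where x: "x = (a, l)" "a \<in> vcar A" by (cases x) (auto simp: op)
    then show "\<exists>y\<in>vcar (unitization A). vadd (unitization A) x y = vzero (unitization A)"
      by (intro bexI[of _ "(vscale A (-1) a, - l)"]) (auto simp: op cl add_neg)
  next
    fix x y z assume "x \<in> vcar (unitization A)" "y \<in> vcar (unitization A)" "z \<in> vcar (unitization A)"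
    then obtain a l b m c n where *: "x = (a, l)" "y = (b, m)" "z = (c, n)" "a \<in> vcar A" "b \<in> vcar A" "c \<in> vcar A"
      by (cases x; cases y; cases z) (auto simp: op)
    show "atimes (unitization A) (atimes (unitization A) x y) z = atimes (unitization A) x (atimes (unitization A) y z)"
      using * by (simp add: op cl lin ac mult_ac)
    show "atimes (unitization A) x (vadd (unitization A) y z) = vadd (unitization A) (atimes (unitization A) x y) (atimes (unitization A) x z)"
      using * by (simp add: op cl lin ac distrib_left)
    show "atimes (unitization A) (vadd (unitization A) x y) z = vadd (unitization A) (atimes (unitization A) x z) (atimes (unitization A) y z)"
      using * by (simp add: op cl lin ac distrib_right)
  next
    fix x y c assume "x \<in> vcar (unitization A)" "y \<in> vcar (unitization A)"
    then obtain a l b m where *: "x = (a, l)" "y = (b, m)" "a \<in> vcar A" "b \<in> vcar A"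
      by (cases x; cases y) (auto simp: op)
    show "atimes (unitization A) (vscale (unitization A) c x) y = vscale (unitization A) c (atimes (unitization A) x y)"
      using * by (simp add: op cl lin mult_ac)
    show "atimes (unitization A) x (vscale (unitization A) c y) = vscale (unitization A) c (atimes (unitization A) x y)"
      using * by (simp add: op cl lin mult_ac)
    show "astar (unitization A) (atimes (unitization A) x y) = atimes (unitization A) (astar (unitization A) y) (astar (unitization A) x)"
      using * by (simp add: op cl lin ac mult_ac)
  qed (auto simp: op cl lin zero_add scale_one star_star add_assoc algebra_simps intro: add_comm)
qed

section \<open>Matrices and block sums\<close>

lemma vsum_closed:
  assumes "complex_vs B" "\<And>l. l < k \<Longrightarrow> f l \<in> vcar B" shows "vsum B f k \<in> vcar B"
  using assms(2)
proof (induction k)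
  case 0 then show ?case using complex_vs.zero_closed[OF assms(1)] by simp
next
  case (Suc k) then show ?case using complex_vs.add_closed[OF assms(1)] by simp
qed

lemma vsum_zero: "complex_vs B \<Longrightarrow> (\<And>l. l < k \<Longrightarrow> f l = vzero B) \<Longrightarrow> vsum B f k = vzero B"
  by (induction k) (simp_all add: complex_vs.zero_add complex_vs.zero_closed)

lemma vsum_cong: "(\<And>l. l < k \<Longrightarrow> f l = g l) \<Longrightarrow> vsum B f k = vsum B g k"
  by (induction k) simp_all

lemma vsum_split:
  assumes "complex_vs B" "\<And>l. l < m + n \<Longrightarrow> f l \<in> vcar B"
  shows "vsum B f (m + n) = vadd B (vsum B f m) (vsum B (\<lambda>l. f (m + l)) n)"
  using assms(2)
proof (induction n)
  case 0 then show ?case using complex_vs.add_zero[OF assms(1)] vsum_closed[OF assms(1), of m f] by simp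
next
  case (Suc n)
  interpret complex_vs B by fact
  have "vsum B f m \<in> vcar B" "vsum B (\<lambda>l. f (m + l)) n \<in> vcar B" "f (m + n) \<in> vcar B"
    using Suc.prems vsum_closed[OF assms(1)] by auto
  then show ?case using Suc by (simp add: add_assoc)
qed

lemma matrices_closed: "complex_vs B \<Longrightarrow> a \<in> matrices B m n \<Longrightarrow> a i j \<in> vcar B"
  unfolding matrices_def using complex_vs.zero_closed by (metis (mono_tags, lifting) mem_Collect_eq)

context star_algebra
begin

lemma zero_times: "x \<in> vcar A \<Longrightarrow> atimes A (vzero A) x = vzero A" "x \<in> vcar A \<Longrightarrow> atimes A x (vzero A) = vzero A"
  using scale_times[of "vzero A" x 0] times_scale[of x "vzero A" 0] zero_closed times_closed
  by (simp_all add: scale_zero_left)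

lemma star_zero: "astar A (vzero A) = vzero A"
  using star_scale[of "vzero A" 0] zero_closed star_closed by (simp add: scale_zero_left)

text \<open>Splitting the inner sum of the matrix product at \<open>m\<close> separates the two
  blocks; mixed terms contain a zero factor.\<close>

lemma dsum_projection:
  assumes "x \<in> projections A" "y \<in> projections A" shows "dsum A x y \<in> projections A"
proof -
  obtain m p n q where xy: "x = (m, p)" "y = (n, q)" by (cases x; cases y) auto
  have p: "p \<in> matrices A m m" "mat_times A m p p = p" "mat_star A p = p"
    and q: "q \<in> matrices A n n" "mat_times A n q q = q" "mat_star A q = q"
    using assms by (auto simp: xy projections_def)
  define d where "d = snd (dsum A x y)"
  have d: "d i j = (if i < m \<and> j < m then p i j else if m \<le> i \<and> m \<le> j then q (i - m) (j - m) else vzero A)" for i j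
    by (simp add: d_def xy dsum_def)
  note pc = matrices_closed[OF complex_vs_axioms p(1)] and qc = matrices_closed[OF complex_vs_axioms q(1)]
  have dc: "d i j \<in> vcar A" for i j using pc qc zero_closed by (simp add: d)
  have p0: "p i j = vzero A" if "\<not> (i < m \<and> j < m)" for i j using p(1) that unfolding matrices_def by (metis (mono_tags, lifting) mem_Collect_eq)
  have q0: "q i j = vzero A" if "\<not> (i < n \<and> j < n)" for i j using q(1) that unfolding matrices_def by (metis (mono_tags, lifting) mem_Collect_eq)
  have q0': "q (i - m) (j - m) = vzero A" if "m \<le> i" "m \<le> j" "\<not> (i < m + n \<and> j < m + n)" for i j
    by (rule q0) (use that in linarith)
  have dm: "d \<in> matrices A (m + n) (m + n)"
    unfolding matrices_def mem_Collect_eq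
  proof (intro allI)
    fix i j show "if i < m + n \<and> j < m + n then d i j \<in> vcar A else d i j = vzero A"
      using dc q0' by (auto simp: d)
  qed
  have "mat_star A d = d"
  proof (intro ext)
    fix i j
    have "astar A (p j i) = p i j" "astar A (q (j - m) (i - m)) = q (i - m) (j - m)"
      using fun_cong[OF fun_cong[OF p(3)]] fun_cong[OF fun_cong[OF q(3)]] by (simp_all add: mat_star_def)
    then show "mat_star A d i j = d i j" by (auto simp: mat_star_def d star_zero)
  qed
  moreover have "mat_times A (m + n) d d = d"
  proof (intro ext)
    fix i j
    have "mat_times A (m + n) d d i j = vadd A (vsum A (\<lambda>l. atimes A (d i l) (d l j)) m) (vsum A (\<lambda>l. atimes A (d i (m + l)) (d (m + l) j)) n)"
      unfolding mat_times_def by (rule vsum_split[OF complex_vs_axioms]) (simp add: times_closed dc)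
    also have "vsum A (\<lambda>l. atimes A (d i l) (d l j)) m = (if i < m \<and> j < m then p i j else vzero A)"
    proof (cases "i < m \<and> j < m")
      case True
      then have "vsum A (\<lambda>l. atimes A (d i l) (d l j)) m = mat_times A m p p i j"
        unfolding mat_times_def by (intro vsum_cong) (simp add: d)
      then show ?thesis using True p(2) by simp
    next
      case False
      then have "vsum A (\<lambda>l. atimes A (d i l) (d l j)) m = vzero A"
        by (intro vsum_zero[OF complex_vs_axioms]) (auto simp: d zero_times pc zero_closed)
      then show ?thesis unfolding if_not_P[OF False] .
    qed
    also have "vsum A (\<lambda>l. atimes A (d i (m + l)) (d (m + l) j)) n = (if m \<le> i \<and> m \<le> j then q (i - m) (j - m) else vzero A)"
    proof (cases "m \<le> i \<and> m \<le> j")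
      case True
      then have "vsum A (\<lambda>l. atimes A (d i (m + l)) (d (m + l) j)) n = mat_times A n q q (i - m) (j - m)"
        unfolding mat_times_def by (intro vsum_cong) (simp add: d)
      then show ?thesis using True q(2) by simp
    next
      case False
      then have "vsum A (\<lambda>l. atimes A (d i (m + l)) (d (m + l) j)) n = vzero A"
        by (intro vsum_zero[OF complex_vs_axioms]) (auto simp: d zero_times qc zero_closed)
      then show ?thesis unfolding if_not_P[OF False] .
    qed
    also have "vadd A (if i < m \<and> j < m then p i j else vzero A)
        (if m \<le> i \<and> m \<le> j then q (i - m) (j - m) else vzero A) = d i j"
      using pc qc by (auto simp: d zero_add add_zero zero_closed)
    finally show "mat_times A (m + n) d d i j = d i j" .
  qed
  moreover have "dsum A x y = (m + n, d)" by (simp add: d_def xy dsum_def)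
  ultimately show ?thesis using dm by (simp add: projections_def)
qed

lemma MvN_refl: "x \<in> projections A \<Longrightarrow> MvN_equivalent A x x"
  by (cases x) (auto simp: projections_def MvN_equivalent_def intro!: bexI)

lemma zero_projection: "(n, \<lambda>i j. vzero A) \<in> projections A"
  by (auto simp: projections_def matrices_def mat_times_def mat_star_def fun_eq_iff zero_closed star_zero zero_times
      intro!: vsum_zero[OF complex_vs_axioms])

text \<open>The empty projection serves as the stabilising summand.\<close>

lemma K0_rel_refl: "x \<in> projections A \<Longrightarrow> y \<in> projections A \<Longrightarrow> ((x, y), (x, y)) \<in> K0_rel A"
  unfolding K0_rel_def using zero_projection[of 0] MvN_refl dsum_projection by blast

end

lemma star_algebra_complex: "star_algebra complex_alg"
  by unfold_locales (auto simp: complex_alg_def algebra_simps intro!: exI[of _ "- x" for x])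

section \<open>Traces of projections under characters\<close>

definition mat_trace :: "('a \<Rightarrow> complex) \<Rightarrow> 'a sqmat \<Rightarrow> complex" where
  "mat_trace \<tau> = (\<lambda>(n, p). \<Sum>i<n. \<tau> (p i i))"

text \<open>Additivity and multiplicativity into the commutative complex numbers are what makes the
  trace of a matrix invariant under Murray-von Neumann equivalence.\<close>

definition character :: "('a, 'm) staralg_scheme \<Rightarrow> ('a \<Rightarrow> complex) \<Rightarrow> bool" where
  "character B \<tau> \<longleftrightarrow> star_algebra B \<and>
     (\<forall>x\<in>vcar B. \<forall>y\<in>vcar B. \<tau> (vadd B x y) = \<tau> x + \<tau> y \<and> \<tau> (atimes B x y) = \<tau> x * \<tau> y)"

lemma character_zero:
  assumes "character B \<tau>" shows "\<tau> (vzero B) = 0"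
proof -
  interpret star_algebra B using assms by (simp add: character_def)
  have "\<tau> (vadd B (vzero B) (vzero B)) = \<tau> (vzero B) + \<tau> (vzero B)" using assms zero_closed unfolding character_def by blast
  then show ?thesis by (simp add: zero_add zero_closed)
qed

lemma character_vsum:
  assumes "character B \<tau>" "\<And>l. l < k \<Longrightarrow> f l \<in> vcar B"
  shows "\<tau> (vsum B f k) = (\<Sum>l<k. \<tau> (f l))"
  using assms(2)
proof (induction k)
  case 0 then show ?case using character_zero[OF assms(1)] by simp
next
  case (Suc k)
  interpret star_algebra B using assms by (simp add: character_def)
  have "vsum B f k \<in> vcar B" "f k \<in> vcar B" using Suc.prems by (auto intro: vsum_closed[OF complex_vs_axioms])
  then have "\<tau> (vadd B (vsum B f k) (f k)) = \<tau> (vsum B f k) + \<tau> (f k)" using assms(1) unfolding character_def by blast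
  then show ?case using Suc by simp
qed

lemma mat_trace_MvN:
  assumes \<tau>: "character B \<tau>" and "MvN_equivalent B x y" shows "mat_trace \<tau> x = mat_trace \<tau> y"
proof -
  interpret star_algebra B using \<tau> by (simp add: character_def)
  obtain n p m q where xy: "x = (n, p)" "y = (m, q)" by (cases x; cases y) auto
  then obtain v where v: "v \<in> matrices B m n" "mat_times B m (mat_star B v) v = p" "mat_times B n v (mat_star B v) = q"
    using assms(2) by (auto simp: MvN_equivalent_def)
  note vc = matrices_closed[OF complex_vs_axioms v(1)]
  have \<tau>t: "\<tau> (atimes B a b) = \<tau> a * \<tau> b" if "a \<in> vcar B" "b \<in> vcar B" for a b
    using \<tau> that unfolding character_def by blast
  have "\<tau> (p i i) = (\<Sum>l<m. \<tau> (astar B (v l i)) * \<tau> (v l i))" for i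
    unfolding v(2)[symmetric] mat_times_def mat_star_def
    by (subst character_vsum[OF \<tau>]) (simp_all add: times_closed star_closed vc \<tau>t)
  moreover have "\<tau> (q l l) = (\<Sum>i<n. \<tau> (v l i) * \<tau> (astar B (v l i)))" for l
    unfolding v(3)[symmetric] mat_times_def mat_star_def
    by (subst character_vsum[OF \<tau>]) (simp_all add: times_closed star_closed vc \<tau>t)
  ultimately have "mat_trace \<tau> x = (\<Sum>i<n. \<Sum>l<m. \<tau> (astar B (v l i)) * \<tau> (v l i))"
    "mat_trace \<tau> y = (\<Sum>l<m. \<Sum>i<n. \<tau> (astar B (v l i)) * \<tau> (v l i))"
    by (simp_all add: mat_trace_def xy mult.commute)
  then show ?thesis by (simp add: sum.swap[of _ "{..<n}"])
qed

lemma mat_trace_dsum: "mat_trace \<tau> (dsum B x y) = mat_trace \<tau> x + mat_trace \<tau> y"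
proof -
  obtain m p n q where xy: "x = (m, p)" "y = (n, q)" by (cases x; cases y) auto
  have "(\<Sum>i<m + n. \<tau> (snd (dsum B (m, p) (n, q)) i i)) = (\<Sum>i<m. \<tau> (p i i)) + (\<Sum>i<n. \<tau> (q i i))" for n
    by (induction n) (simp_all add: dsum_def)
  then show ?thesis by (simp add: mat_trace_def xy dsum_def)
qed

lemma mat_trace_K0_rel:
  assumes "character B \<tau>" "((p, q), (p', q')) \<in> K0_rel B"
  shows "mat_trace \<tau> p - mat_trace \<tau> q = mat_trace \<tau> p' - mat_trace \<tau> q'"
proof -
  obtain r where "MvN_equivalent B (dsum B (dsum B p q') r) (dsum B (dsum B p' q) r)"
    using assms(2) unfolding K0_rel_def by blast
  from mat_trace_MvN[OF assms(1) this] show ?thesis by (simp add: mat_trace_dsum algebra_simps)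
qed

text \<open>The homomorphism from K_0 to the complex numbers induced by a character, evaluated on an
  arbitrary representative of the class.\<close>

definition class_trace :: "('a \<Rightarrow> complex) \<Rightarrow> ('a sqmat \<times> 'a sqmat) set \<Rightarrow> complex" where
  "class_trace \<tau> X = (case SOME z. z \<in> X of (p, q) \<Rightarrow> mat_trace \<tau> p - mat_trace \<tau> q)"

lemma class_trace_unique:
  assumes "z0 \<in> X" "\<And>p q. (p, q) \<in> X \<Longrightarrow> mat_trace \<tau> p - mat_trace \<tau> q = c"
  shows "class_trace \<tau> X = c"
  using someI[of "\<lambda>z. z \<in> X", OF assms(1)] assms(2) unfolding class_trace_def by (auto split: prod.split)

lemma class_trace:
  assumes "character B \<tau>" "p \<in> projections B" "q \<in> projections B"
  shows "class_trace \<tau> (K0_rel B `` {(p, q)}) = mat_trace \<tau> p - mat_trace \<tau> q"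
proof (rule class_trace_unique)
  show "(p, q) \<in> K0_rel B `` {(p, q)}" using star_algebra.K0_rel_refl assms unfolding character_def by blast
next
  fix p' q' assume "(p', q') \<in> K0_rel B `` {(p, q)}"
  then have "((p, q), (p', q')) \<in> K0_rel B" by simp
  from mat_trace_K0_rel[OF assms(1) this] show "mat_trace \<tau> p' - mat_trace \<tau> q' = mat_trace \<tau> p - mat_trace \<tau> q" by simp
qed

text \<open>A product in \<open>K0_unital\<close> is a union over representatives of both factors,
  so the value is checked on every member of that union and nonemptiness is shown
  separately.\<close>

lemma class_trace_mult:
  assumes \<tau>: "character B \<tau>" and X: "X \<in> carrier (K0_unital B)" and Y: "Y \<in> carrier (K0_unital B)"
  shows "class_trace \<tau> (X \<otimes>\<^bsub>K0_unital B\<^esub> Y) = class_trace \<tau> X + class_trace \<tau> Y"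
proof -
  interpret star_algebra B using \<tau> by (simp add: character_def)
  obtain p q p' q' where X': "X = K0_rel B `` {(p, q)}" "p \<in> projections B" "q \<in> projections B"
    and Y': "Y = K0_rel B `` {(p', q')}" "p' \<in> projections B" "q' \<in> projections B"
    using X Y unfolding K0_unital_def quotient_def by auto
  have XY: "X \<otimes>\<^bsub>K0_unital B\<^esub> Y = (\<Union>(p, q)\<in>X. \<Union>(p', q')\<in>Y. K0_rel B `` {(dsum B p p', dsum B q q')})"
    by (simp add: K0_unital_def)
  have "(p, q) \<in> X" "(p', q') \<in> Y" unfolding X'(1) Y'(1) using K0_rel_refl X' Y' by blast+
  moreover have "(dsum B p p', dsum B q q') \<in> K0_rel B `` {(dsum B p p', dsum B q q')}"
    using K0_rel_refl dsum_projection X' Y' by blast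
  ultimately have ne: "(dsum B p p', dsum B q q') \<in> X \<otimes>\<^bsub>K0_unital B\<^esub> Y" unfolding XY by blast
  show ?thesis
  proof (rule class_trace_unique[OF ne])
    fix a b assume "(a, b) \<in> X \<otimes>\<^bsub>K0_unital B\<^esub> Y"
    then obtain s t s' t' where st: "(s, t) \<in> X" "(s', t') \<in> Y" "((dsum B s s', dsum B t t'), (a, b)) \<in> K0_rel B"
      unfolding XY by blast
    have 1: "((p, q), (s, t)) \<in> K0_rel B" "((p', q'), (s', t')) \<in> K0_rel B" using st(1,2) by (simp_all add: X' Y')
    have "mat_trace \<tau> a - mat_trace \<tau> b = (mat_trace \<tau> s - mat_trace \<tau> t) + (mat_trace \<tau> s' - mat_trace \<tau> t')"
      using mat_trace_K0_rel[OF \<tau> st(3)] by (simp add: mat_trace_dsum add_diff_add)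
    also have "\<dots> = (mat_trace \<tau> p - mat_trace \<tau> q) + (mat_trace \<tau> p' - mat_trace \<tau> q')"
      unfolding mat_trace_K0_rel[OF \<tau> 1(1)] mat_trace_K0_rel[OF \<tau> 1(2)] ..
    also have "\<dots> = class_trace \<tau> X + class_trace \<tau> Y"
      unfolding X'(1) Y'(1) class_trace[OF \<tau> X'(2,3)] class_trace[OF \<tau> Y'(2,3)] ..
    finally show "mat_trace \<tau> a - mat_trace \<tau> b = class_trace \<tau> X + class_trace \<tau> Y" .
  qed
qed

section \<open>K_0 of the complex numbers\<close>

lemma vsum_complex: "vsum complex_alg f k = (\<Sum>l<k. f l)"
  by (induction k) (simp_all add: complex_alg_def)

definition complex_projection :: "nat \<Rightarrow> (nat \<Rightarrow> nat \<Rightarrow> complex) \<Rightarrow> bool" where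
  "complex_projection n p \<longleftrightarrow> (\<forall>i j. \<not> (i < n \<and> j < n) \<longrightarrow> p i j = 0) \<and>
     (\<forall>i j. (\<Sum>l<n. p i l * p l j) = p i j) \<and> (\<forall>i j. cnj (p j i) = p i j)"

lemma projections_complex: "(n, p) \<in> projections complex_alg \<longleftrightarrow> complex_projection n p"
  unfolding projections_def matrices_def mat_times_def mat_star_def vsum_complex complex_projection_def
  by (auto simp: complex_alg_def fun_eq_iff)

text \<open>For a self-adjoint idempotent each diagonal entry is the squared length of its row.
  Hence the trace is real and nonnegative, and it vanishes only for the zero matrix.\<close>

lemma complex_projection_trace:
  assumes "complex_projection n p"
  shows "(\<Sum>i<n. p i i) = of_real (\<Sum>i<n. \<Sum>l<n. (cmod (p i l))\<^sup>2)"
proof -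
  have "p i i = of_real (\<Sum>l<n. (cmod (p i l))\<^sup>2)" for i
  proof -
    have "p i i = (\<Sum>l<n. p i l * p l i)" using assms unfolding complex_projection_def by simp
    also have "\<dots> = (\<Sum>l<n. p i l * cnj (p i l))" using assms unfolding complex_projection_def by simp
    finally show ?thesis by (simp add: complex_norm_square del: of_real_power)
  qed
  then have "(\<Sum>i<n. p i i) = (\<Sum>i<n. of_real (\<Sum>l<n. (cmod (p i l))\<^sup>2))" by (rule sum.cong[OF refl])
  then show ?thesis by simp
qed

lemma complex_projection_zero:
  assumes "complex_projection n p" "(\<Sum>i<n. p i i) = 0" shows "p i j = 0"
proof (cases "i < n \<and> j < n")
  case True
  have "complex_of_real (\<Sum>i<n. \<Sum>l<n. (cmod (p i l))\<^sup>2) = 0"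
    using assms(2) unfolding complex_projection_trace[OF assms(1)] .
  then have "(\<Sum>i<n. \<Sum>l<n. (cmod (p i l))\<^sup>2) = 0" by (simp only: of_real_eq_0_iff)
  then have "(\<Sum>l<n. (cmod (p i l))\<^sup>2) = 0" using True by (subst (asm) sum_nonneg_eq_0_iff) (auto intro: sum_nonneg)
  then show ?thesis using True by (subst (asm) sum_nonneg_eq_0_iff) auto
qed (use assms(1) in \<open>auto simp: complex_projection_def\<close>)

text \<open>A nonzero trace provides a nonzero diagonal entry; the corresponding column, divided by
  the square root of that entry, is a unit vector fixed by the projection, and the projection to its
  line can be subtracted.\<close>

lemma complex_projection_split:
  assumes p: "complex_projection n p" and nz: "(\<Sum>i<n. p i i) \<noteq> 0"
  shows "\<exists>u. (\<forall>i\<ge>n. u i = 0) \<and> (\<Sum>i<n. cnj (u i) * u i) = 1 \<and>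
    complex_projection n (\<lambda>i j. p i j - u i * cnj (u j)) \<and> (\<forall>i. (\<Sum>l<n. (p i l - u i * cnj (u l)) * u l) = 0)"
proof -
  have p0: "p i j = 0" if "\<not> (i < n \<and> j < n)" for i j using p that unfolding complex_projection_def by blast
  have pp: "(\<Sum>l<n. p i l * p l j) = p i j" for i j using p unfolding complex_projection_def by blast
  have ps: "cnj (p j i) = p i j" for i j using p unfolding complex_projection_def by blast
  obtain j where j: "j < n" "p j j \<noteq> 0" using nz by (metis (no_types, lifting) lessThan_iff sum.neutral)
  define c where "c = (\<Sum>l<n. (cmod (p l j))\<^sup>2)"
  have "p j j = (\<Sum>l<n. cnj (p l j) * p l j)" by (simp add: ps pp)
  then have c: "p j j = of_real c" by (simp add: c_def complex_norm_square mult.commute del: of_real_power)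
  have "c \<ge> 0" unfolding c_def by (intro sum_nonneg) simp
  then have cpos: "c > 0" using c j by (cases "c = 0") auto
  define u where "u i = p i j / of_real (sqrt c)" for i
  have ss: "complex_of_real (sqrt c) * of_real (sqrt c) = of_real c" using cpos by (simp flip: of_real_mult)
  have s0: "complex_of_real (sqrt c) \<noteq> 0" using cpos by simp
  have u0: "u i = 0" if "i \<ge> n" for i using p0 that by (simp add: u_def)
  have uu: "(\<Sum>i<n. cnj (u i) * u i) = 1"
  proof -
    have "(\<Sum>i<n. cnj (u i) * u i) = (\<Sum>i<n. p j i * p i j) / of_real c"
      unfolding sum_divide_distrib by (rule sum.cong) (simp_all add: u_def ps flip: ss)
    then show ?thesis using pp j(2) c by simp
  qed
  have pu: "(\<Sum>l<n. p i l * u l) = u i" for i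
  proof -
    have "(\<Sum>l<n. p i l * u l) = (\<Sum>l<n. p i l * p l j) / of_real (sqrt c)" by (simp add: u_def sum_divide_distrib)
    then show ?thesis by (simp add: pp u_def)
  qed
  have up: "(\<Sum>l<n. cnj (u l) * p l k) = cnj (u k)" for k
  proof -
    have "cnj (\<Sum>l<n. p k l * u l) = (\<Sum>l<n. cnj (u l) * p l k)" by (simp add: ps mult.commute)
    then show ?thesis by (simp add: pu)
  qed
  have "(\<Sum>l<n. (p i l - u i * cnj (u l)) * (p l k - u l * cnj (u k))) = p i k - u i * cnj (u k)" for i k
  proof -
    have "(\<Sum>l<n. (p i l - u i * cnj (u l)) * (p l k - u l * cnj (u k)))
      = (\<Sum>l<n. p i l * p l k) - (\<Sum>l<n. p i l * u l) * cnj (u k) - u i * (\<Sum>l<n. cnj (u l) * p l k)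
        + u i * (\<Sum>l<n. cnj (u l) * u l) * cnj (u k)"
      by (simp add: sum_distrib_left sum_distrib_right sum_subtractf sum.distrib algebra_simps)
    then show ?thesis by (simp add: pp pu up uu)
  qed
  moreover have "(\<Sum>l<n. (p i l - u i * cnj (u l)) * u l) = 0" for i
  proof -
    have "(\<Sum>l<n. (p i l - u i * cnj (u l)) * u l) = (\<Sum>l<n. p i l * u l) - u i * (\<Sum>l<n. cnj (u l) * u l)"
      by (simp add: sum_distrib_left sum_subtractf algebra_simps)
    then show ?thesis by (simp add: pu uu)
  qed
  moreover have "p i k - u i * cnj (u k) = 0" if "\<not> (i < n \<and> k < n)" for i k
    using that p0[of i k] u0[of i] u0[of k] by (cases "i < n") auto
  ultimately show ?thesis using u0 uu
    by (intro exI[of _ u]) (simp add: complex_projection_def ps mult.commute)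
qed

text \<open>The squared length of v u is the inner product of v* v u with u, so v* v u = 0 forces v
  u = 0.\<close>

lemma annihilate_through_square:
  fixes v p :: "nat \<Rightarrow> nat \<Rightarrow> complex"
  assumes "\<And>i j. (\<Sum>l<m. cnj (v l i) * v l j) = p i j" "\<And>i. (\<Sum>j<n. p i j * u j) = 0" "l < m"
  shows "(\<Sum>j<n. v l j * u j) = 0"
proof -
  define y where "y l = (\<Sum>j<n. v l j * u j)" for l
  have "(\<Sum>l<m. cnj (y l) * y l) = (\<Sum>l<m. \<Sum>i<n. \<Sum>j<n. cnj (u i) * (cnj (v l i) * v l j * u j))"
    by (simp add: y_def sum_distrib_left sum_distrib_right mult_ac)
  also have "\<dots> = (\<Sum>i<n. \<Sum>j<n. \<Sum>l<m. cnj (u i) * (cnj (v l i) * v l j * u j))"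
    by (simp add: sum.swap[of _ _ "{..<m}"])
  also have "\<dots> = (\<Sum>i<n. cnj (u i) * (\<Sum>j<n. p i j * u j))"
    by (simp add: sum_distrib_left sum_distrib_right mult_ac flip: assms(1))
  also have "\<dots> = 0" by (simp add: assms(2))
  finally have "of_real (\<Sum>l<m. (cmod (y l))\<^sup>2) = (0 :: complex)" by (simp add: complex_norm_square mult.commute del: of_real_power)
  then have "(\<Sum>l<m. (cmod (y l))\<^sup>2) = 0" by (simp only: of_real_eq_0_iff)
  then have "(cmod (y l))\<^sup>2 = 0" using assms(3) by (subst (asm) sum_nonneg_eq_0_iff) auto
  then show ?thesis by (simp add: y_def)
qed

text \<open>Both projections are split into a rank one projection and a projection of smaller trace.\<close>

lemma complex_MvN:
  assumes "complex_projection n p" "complex_projection m q" "(\<Sum>i<n. p i i) = (\<Sum>i<m. q i i)"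
    "Re (\<Sum>i<n. p i i) < real N"
  shows "\<exists>v. (\<forall>l i. \<not> (l < m \<and> i < n) \<longrightarrow> v l i = 0) \<and> (\<forall>i j. (\<Sum>l<m. cnj (v l i) * v l j) = p i j)
    \<and> (\<forall>i j. (\<Sum>l<n. v i l * cnj (v j l)) = q i j)"
  using assms
proof (induction N arbitrary: p q)
  case 0
  \<comment> \<open>\<open>N\<close> bounds the trace, which drops by exactly 1 at each split. The
    induction thus ends without knowing that traces are integers: below 0 there is no trace.\<close>
  have "0 \<le> Re (\<Sum>i<n. p i i)" unfolding complex_projection_trace[OF 0(1)] Re_complex_of_real by (intro sum_nonneg) simp
  then show ?case using 0 by simp
next
  case (Suc N)
  show ?case
  proof (cases "(\<Sum>i<n. p i i) = 0")
    case True
    then show ?thesis using complex_projection_zero[OF Suc.prems(1)] complex_projection_zero[OF Suc.prems(2)] Suc.prems(3)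
      by (intro exI[of _ "\<lambda>l i. 0"]) simp
  next
    case False
    obtain u where u: "\<forall>i\<ge>n. u i = 0" "(\<Sum>i<n. cnj (u i) * u i) = 1"
      "complex_projection n (\<lambda>i j. p i j - u i * cnj (u j))" "\<forall>i. (\<Sum>l<n. (p i l - u i * cnj (u l)) * u l) = 0"
      using complex_projection_split[OF Suc.prems(1) False] by (elim exE conjE)
    have nz: "(\<Sum>i<m. q i i) \<noteq> 0" using False Suc.prems(3) by metis
    obtain w where w: "\<forall>i\<ge>m. w i = 0" "(\<Sum>i<m. cnj (w i) * w i) = 1"
      "complex_projection m (\<lambda>i j. q i j - w i * cnj (w j))" "\<forall>i. (\<Sum>l<m. (q i l - w i * cnj (w l)) * w l) = 0"
      using complex_projection_split[OF Suc.prems(2) nz] by (elim exE conjE)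
    have tr: "(\<Sum>i<n. p i i - u i * cnj (u i)) = (\<Sum>i<n. p i i) - 1" "(\<Sum>i<m. q i i - w i * cnj (w i)) = (\<Sum>i<m. q i i) - 1"
      using u(2) w(2) by (simp_all add: sum_subtractf mult.commute)
    have "Re (\<Sum>i<n. p i i - u i * cnj (u i)) < real N" using Suc.prems(4) unfolding tr by simp
    then obtain v where v0: "\<forall>l i. \<not> (l < m \<and> i < n) \<longrightarrow> v l i = 0"
      and v1: "\<forall>i j. (\<Sum>l<m. cnj (v l i) * v l j) = p i j - u i * cnj (u j)"
      and v2: "\<forall>i j. (\<Sum>l<n. v i l * cnj (v j l)) = q i j - w i * cnj (w j)"
      using Suc.IH[OF u(3) w(3)] unfolding tr Suc.prems(3) by (elim meta_impE exE conjE) simp_all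
    \<comment> \<open>The partial isometry of the remainders annihilates the vectors that were split
      off, so all mixed terms in the products below vanish.\<close>
    have vu: "(\<Sum>j<n. v l j * u j) = 0" for l
      using annihilate_through_square[OF v1[rule_format] u(4)[rule_format], of l] v0 by (cases "l < m") simp_all
    have vw: "(\<Sum>j<m. cnj (v j l) * w j) = 0" for l
      using annihilate_through_square[where v = "\<lambda>l j. cnj (v j l)" and m = n and l = l, OF _ w(4)[rule_format]] v2 v0
      by (cases "l < n") simp_all
    have uv: "(\<Sum>j<n. cnj (v l j) * cnj (u j)) = 0" for l using arg_cong[OF vu[of l], of cnj] by simp
    have wv: "(\<Sum>j<m. cnj (w j) * v j l) = 0" for l using arg_cong[OF vw[of l], of cnj] by (simp add: mult.commute)
    \<comment> \<open>The rank one partial isometry from the line of \<open>u\<close> to the line of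
      \<open>w\<close> is added.\<close>
    let ?v = "\<lambda>l i. v l i + w l * cnj (u i)"
    have "(\<Sum>l<m. cnj (?v l i) * ?v l j) = p i j" for i j
    proof -
      have "(\<Sum>l<m. cnj (?v l i) * ?v l j) = (\<Sum>l<m. cnj (v l i) * v l j) + (\<Sum>l<m. cnj (v l i) * w l) * cnj (u j)
        + u i * (\<Sum>l<m. cnj (w l) * v l j) + u i * (\<Sum>l<m. cnj (w l) * w l) * cnj (u j)"
        by (simp add: sum_distrib_left sum_distrib_right sum.distrib algebra_simps)
      then show ?thesis by (simp add: v1 vw wv w(2))
    qed
    moreover have "(\<Sum>l<n. ?v i l * cnj (?v j l)) = q i j" for i j
    proof -
      have "(\<Sum>l<n. ?v i l * cnj (?v j l)) = (\<Sum>l<n. v i l * cnj (v j l)) + (\<Sum>l<n. v i l * u l) * cnj (w j)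
        + w i * (\<Sum>l<n. cnj (v j l) * cnj (u l)) + w i * (\<Sum>l<n. cnj (u l) * u l) * cnj (w j)"
        by (simp add: sum_distrib_left sum_distrib_right sum.distrib algebra_simps)
      then show ?thesis by (simp add: v2 vu uv u(2))
    qed
    moreover have "\<forall>l i. \<not> (l < m \<and> i < n) \<longrightarrow> ?v l i = 0" using v0 u(1) w(1) by (metis add_0 complex_cnj_zero mult_eq_0_iff not_le)
    ultimately show ?thesis by (intro exI[of _ ?v]) blast
  qed
qed

lemma MvN_complex:
  assumes "x \<in> projections complex_alg" "y \<in> projections complex_alg" "mat_trace id x = mat_trace id y"
  shows "MvN_equivalent complex_alg x y"
proof -
  obtain n p m q where xy: "x = (n, p)" "y = (m, q)" by (cases x; cases y) auto
  obtain N where "Re (\<Sum>i<n. p i i) < real N" using reals_Archimedean2 by blast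
  moreover have "complex_projection n p" "complex_projection m q" "(\<Sum>i<n. p i i) = (\<Sum>i<m. q i i)"
    using assms by (simp_all add: xy projections_complex mat_trace_def)
  ultimately obtain v where "\<forall>l i. \<not> (l < m \<and> i < n) \<longrightarrow> v l i = 0" "\<forall>i j. (\<Sum>l<m. cnj (v l i) * v l j) = p i j"
    "\<forall>i j. (\<Sum>l<n. v i l * cnj (v j l)) = q i j"
    using complex_MvN by blast
  then show ?thesis
    unfolding MvN_equivalent_def matrices_def mat_times_def mat_star_def vsum_complex xy
    by (auto simp: complex_alg_def fun_eq_iff intro!: exI[of _ v])
qed

lemma character_complex: "character complex_alg id"
  using star_algebra_complex by (simp add: character_def complex_alg_def)

text \<open>Projections over the complex numbers are classified by their trace, so a formal
  difference with equal traces is trivial. This identifies elements of the kernel that defines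
  \<open>K0\<close>.\<close>

lemma K0_class_complex:
  assumes "p \<in> projections complex_alg" "q \<in> projections complex_alg" "mat_trace id p = mat_trace id q"
  shows "K0_rel complex_alg `` {(p, q)} = one (K0_unital complex_alg)"
proof -
  interpret star_algebra complex_alg by (rule star_algebra_complex)
  let ?z = "(0, \<lambda>i j. vzero complex_alg) :: complex sqmat"
  have z: "?z \<in> projections complex_alg" "mat_trace id ?z = 0" by (auto simp: zero_projection mat_trace_def)
  have *: "((a, b), (a', b')) \<in> K0_rel complex_alg \<longleftrightarrow> a' \<in> projections complex_alg \<and> b' \<in> projections complex_alg \<and>
      mat_trace id a' = mat_trace id b'"
    if "a \<in> projections complex_alg" "b \<in> projections complex_alg" "mat_trace id a = mat_trace id b" for a b a' b'
  proof
    assume r: "((a, b), (a', b')) \<in> K0_rel complex_alg"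
    show "a' \<in> projections complex_alg \<and> b' \<in> projections complex_alg \<and> mat_trace id a' = mat_trace id b'"
      using mat_trace_K0_rel[OF character_complex r] that(3) r by (simp add: K0_rel_def)
  next
    assume r: "a' \<in> projections complex_alg \<and> b' \<in> projections complex_alg \<and> mat_trace id a' = mat_trace id b'"
    then have "MvN_equivalent complex_alg (dsum complex_alg (dsum complex_alg a b') ?z) (dsum complex_alg (dsum complex_alg a' b) ?z)"
      using that z by (intro MvN_complex dsum_projection) (simp_all add: mat_trace_dsum)
    then show "((a, b), (a', b')) \<in> K0_rel complex_alg" unfolding K0_rel_def using r that z by blast
  qed
  have "K0_rel complex_alg `` {(p, q)} = K0_rel complex_alg `` {(?z, ?z)}"
    using *[OF assms] *[OF z(1) z(1) refl] by auto
  then show ?thesis by (simp add: K0_unital_def)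
qed

section \<open>Scalar parts in the unitization and membership in K_0\<close>

lemma unitization_simps:
  "vcar (unitization A) = vcar A \<times> UNIV" "vzero (unitization A) = (vzero A, 0)"
  "vadd (unitization A) (a, l) (b, m) = (vadd A a b, l + m)"
  "atimes (unitization A) (a, l) (b, m) = (vadd A (atimes A a b) (vadd A (vscale A l b) (vscale A m a)), l * m)"
  "astar (unitization A) (a, l) = (astar A a, cnj l)"
  by (simp_all add: unitization_def)

lemma snd_unitization:
  "snd (vadd (unitization A) x y) = snd x + snd y" "snd (atimes (unitization A) x y) = snd x * snd y"
  "snd (astar (unitization A) x) = cnj (snd x)" "snd (vzero (unitization A)) = 0"
  by (cases x; cases y; simp add: unitization_def)+

lemma character_snd: "star_algebra A \<Longrightarrow> character (unitization A) snd"
  by (simp add: character_def star_algebra_unitization snd_unitization)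

lemma snd_projection:
  assumes "(n, p) \<in> projections (unitization A)" shows "(n, \<lambda>i j. snd (p i j)) \<in> projections complex_alg"
proof -
  have s: "snd (vsum (unitization A) f k) = (\<Sum>l<k. snd (f l))" for f k
    by (induction k) (simp_all add: snd_unitization)
  have p: "p \<in> matrices (unitization A) n n" "\<And>i j. vsum (unitization A) (\<lambda>l. atimes (unitization A) (p i l) (p l j)) n = p i j"
    "\<And>i j. astar (unitization A) (p j i) = p i j"
    using assms by (auto simp: projections_def mat_times_def mat_star_def fun_eq_iff)
  have "p i j = vzero (unitization A)" if "\<not> (i < n \<and> j < n)" for i j
    using p(1) that unfolding matrices_def by (metis (mono_tags, lifting) mem_Collect_eq)
  then have "\<not> (i < n \<and> j < n) \<Longrightarrow> snd (p i j) = 0" for i j by (simp add: snd_unitization)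
  moreover have "(\<Sum>l<n. snd (p i l) * snd (p l j)) = snd (p i j)" for i j
    using arg_cong[OF p(2)[of i j], of snd] by (simp add: s snd_unitization)
  moreover have "cnj (snd (p j i)) = snd (p i j)" for i j
    using arg_cong[OF p(3)[of j i], of snd] by (simp add: snd_unitization)
  ultimately show ?thesis by (simp add: projections_complex complex_projection_def)
qed

text \<open>The scalar part is a character of the unitization, so equality of scalar traces holds
  for every representative of the class; each of them is then sent to the neutral class over the
  complex numbers.\<close>

lemma K0_carrier_if_trace:
  assumes A: "star_algebra A" and p: "p \<in> projections (unitization A)" and q: "q \<in> projections (unitization A)"
    and eq: "mat_trace snd p = mat_trace snd q"
  shows "K0_rel (unitization A) `` {(p, q)} \<in> carrier (K0 A)"
proof -
  let ?B = "unitization A" and ?X = "K0_rel (unitization A) `` {(p, q)}"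
  have "K0_rel complex_alg `` {((n, \<lambda>i j. snd (a i j)), (m, \<lambda>i j. snd (b i j)))} = one (K0_unital complex_alg)"
    if "((n, a), (m, b)) \<in> ?X" for n a m b
  proof (rule K0_class_complex)
    have r: "((p, q), ((n, a), (m, b))) \<in> K0_rel ?B" using that by simp
    then have "(n, a) \<in> projections ?B" "(m, b) \<in> projections ?B" by (auto simp: K0_rel_def)
    then show "(n, \<lambda>i j. snd (a i j)) \<in> projections complex_alg" "(m, \<lambda>i j. snd (b i j)) \<in> projections complex_alg"
      by (simp_all add: snd_projection)
    show "mat_trace id (n, \<lambda>i j. snd (a i j)) = mat_trace id (m, \<lambda>i j. snd (b i j))"
      using mat_trace_K0_rel[OF character_snd[OF A] r] eq by (simp add: mat_trace_def)
  qed
  moreover have "(p, q) \<in> ?X" using star_algebra.K0_rel_refl[OF star_algebra_unitization[OF A] p q] by simp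
  ultimately have "K0_map complex_alg snd ?X = one (K0_unital complex_alg)"
    unfolding K0_map_def by fast
  moreover have "?X \<in> carrier (K0_unital ?B)" using p q by (simp add: K0_unital_def quotientI)
  ultimately show ?thesis by (simp add: K0_def kernel_def)
qed

lemma (in star_algebra) one_by_one_projection:
  assumes "e \<in> vcar A" "atimes A e e = e" "astar A e = e"
  shows "(1, \<lambda>i j. if i = 0 \<and> j = 0 then e else vzero A) \<in> projections A"
  using assms by (auto simp: projections_def matrices_def mat_times_def mat_star_def fun_eq_iff zero_closed zero_add star_zero zero_times)

text \<open>The characters assemble to an additive map from the K-theory to complex sequences. A
  finite generating set has image in a space of finite dimension, whereas the projections
  \<open>e m\<close> produce all the standard unit vectors.\<close>

lemma infinitely_generated_K_theory:
  assumes A: "star_algebra A" and \<tau>: "\<And>n :: nat. character (unitization A) (\<tau> n)"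
    and e: "\<And>m. e m \<in> vcar A" "\<And>m. atimes A (e m) (e m) = e m" "\<And>m. astar A (e m) = e m"
    and \<tau>e: "\<And>n m. \<tau> n (e m, 0) = (if n = m then 1 else 0)"
  shows "\<not> finitely_generated (K_theory A)"
proof
  let ?B = "unitization A" and ?K = "K_theory A"
  assume "finitely_generated ?K"
  then obtain S where S: "S \<subseteq> carrier ?K" "finite S" "generate ?K S = carrier ?K"
    unfolding finitely_generated_def by blast
  interpret B: star_algebra ?B by (rule star_algebra_unitization[OF A])
  interpret A: star_algebra A by fact
  interpret V: vector_space "\<lambda>c (f :: nat \<Rightarrow> complex) n. c * f n"
    by unfold_locales (simp_all add: fun_eq_iff algebra_simps)
  define \<Phi> where "\<Phi> z = (\<lambda>n :: nat. class_trace (\<tau> n) (fst z) :: complex)" for z :: "(('a \<times> complex) sqmat \<times> ('a \<times> complex) sqmat) set \<times> ('a \<times> complex) sqmat set"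
  have car: "fst z \<in> carrier (K0_unital ?B)" if "z \<in> carrier ?K" for z
    using that by (auto simp: K_theory_def DirProd_def K0_def kernel_def)
  have \<Phi>_mult: "\<Phi> (x \<otimes>\<^bsub>?K\<^esub> y) = \<Phi> x + \<Phi> y" if "x \<in> carrier ?K" "y \<in> carrier ?K" for x y
  proof -
    have "fst (x \<otimes>\<^bsub>?K\<^esub> y) = fst x \<otimes>\<^bsub>K0_unital ?B\<^esub> fst y"
      by (cases x; cases y) (simp add: K_theory_def DirProd_def K0_def)
    then show ?thesis using class_trace_mult[OF \<tau> car[OF that(1)] car[OF that(2)]] by (simp add: \<Phi>_def fun_eq_iff)
  qed
  \<comment> \<open>\<open>generate\<close> also produces the neutral element and inverses of
    generators. Their images are put into the spanning set, since \<open>K_theory A\<close> has not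
    been shown to be a group.\<close>
  let ?F = "\<Phi> ` (S \<union> m_inv ?K ` S \<union> {\<one>\<^bsub>?K\<^esub>})"
  have span: "\<Phi> z \<in> V.span ?F" if "z \<in> generate ?K S" for z
    using that
  proof (induction rule: generate.induct)
    case (eng x y)
    have "\<Phi> (x \<otimes>\<^bsub>?K\<^esub> y) = \<Phi> x + \<Phi> y" using eng.hyps unfolding S(3) by (rule \<Phi>_mult)
    then show ?case using V.span_add[OF eng.IH] by (simp only:)
  qed (auto intro: V.span_base)
  \<comment> \<open>The classes are differences of the one-by-one projection \<open>(e m, 0)\<close>
    and the empty projection \<open>O'\<close>. Both have scalar trace 0, which places the
    difference in the kernel.\<close>
  define P where "P m = (1 :: nat, \<lambda>(i :: nat) (j :: nat). if i = 0 \<and> j = 0 then (e m, 0 :: complex) else vzero ?B)" for m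
  define O' where "O' = (0 :: nat, \<lambda>(i :: nat) (j :: nat). vzero ?B)"
  have proj: "P m \<in> projections ?B" "O' \<in> projections ?B" for m
  proof -
    show "P m \<in> projections ?B" unfolding P_def
      using e[of m] A.zero_closed
      by (intro B.one_by_one_projection) (simp_all add: unitization_simps A.scale_zero_left A.add_zero)
    show "O' \<in> projections ?B" unfolding O'_def by (rule B.zero_projection)
  qed
  have tr: "mat_trace f (P m) = f (e m, 0)" "mat_trace f O' = 0" for f :: "'a \<times> complex \<Rightarrow> complex" and m
    by (simp_all add: mat_trace_def P_def O'_def)
  \<comment> \<open>The second component is the class of the empty unitary, the neutral element of
    K_1.\<close>
  define Z where "Z m = (K0_rel ?B `` {(P m, O')}, K1_rel ?B `` {O'})" for m
  have "(\<lambda>i j. vzero ?B) \<in> unitaries ?B 0"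
    by (simp add: unitaries_def matrices_def mat_times_def mat_unit_def)
  then have "K1_rel ?B `` {O'} \<in> carrier (K1 A)" by (auto simp: K1_def Let_def O'_def intro!: quotientI)
  then have Z: "Z m \<in> carrier ?K" for m
    using K0_carrier_if_trace[OF A proj(1)[of m] proj(2)] tr by (simp add: Z_def K_theory_def DirProd_def)
  define d where "d m = (\<lambda>n :: nat. if n = m then 1 else 0 :: complex)" for m
  have "\<Phi> (Z m) = d m" for m
    unfolding \<Phi>_def Z_def fst_conv class_trace[OF \<tau> proj(1)[of m] proj(2)] tr d_def \<tau>e by simp
  then have "d m \<in> V.span ?F" for m using span Z S(3) by metis
  then have "range d \<subseteq> V.span ?F" by blast
  moreover have "V.independent (range d)"
  proof
    assume "V.dependent (range d)"
    then obtain m where m: "d m \<in> V.span (range d - {d m})" unfolding V.dependent_def by blast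
    have "V.span (range d - {d m}) \<subseteq> {f. f m = 0}"
      by (rule V.span_minimal) (auto simp: V.subspace_def d_def)
    then have "d m m = 0" using m by blast
    then show False by (simp add: d_def)
  qed
  moreover have "finite ?F" using S(2) by simp
  ultimately have "finite (range d)" using V.independent_span_bound by blast
  moreover have "inj d" by (rule injI) (metis d_def zero_neq_one)
  ultimately show False using finite_imageD infinite_UNIV_nat by blast
qed

section \<open>Isolated branch points and bump projections\<close>

lemma Arg_kpt: "Arg (kpt n) = 1 / real (Suc n)"
  unfolding kpt_def
proof (rule Arg_cis)
  have "1 / real (Suc n) \<le> 1" "0 < 1 / real (Suc n)" by simp_all
  then have "- pi < 1 / real (Suc n) \<and> 1 / real (Suc n) \<le> pi" using pi_gt3 by linarith
  then show "1 / real (Suc n) \<in> {-pi<..pi}" unfolding greaterThanAtMost_iff .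
qed

lemma inj_kpt: "inj kpt"
proof (rule injI)
  fix m n assume "kpt m = kpt n"
  then have "1 / real (Suc m) = 1 / real (Suc n)" unfolding Arg_kpt[symmetric] by simp
  then show "m = n" by simp
qed

lemma kpt_neq_one: "kpt n \<noteq> 1"
proof
  assume "kpt n = 1"
  then have "1 / real (Suc n) = Arg 1" unfolding Arg_kpt[symmetric] by simp
  then show False by simp
qed

text \<open>Replacing the \<open>m\<close>-th term by the limit 1 leaves a convergent sequence,
  whose range together with 1 is closed, contains the rest of the branch set and misses
  \<open>kpt m\<close>.\<close>

lemma kpt_isolated: "\<exists>\<delta>>0. \<forall>t\<in>branch_set - {kpt m}. \<delta> \<le> dist (kpt m) t"
proof -
  define f where "f n = (if n = m then 1 else kpt n)" for n
  have "eventually (\<lambda>n. kpt n = f n) sequentially"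
    using eventually_gt_at_top[of m] by eventually_elim (simp add: f_def)
  then have "f \<longlonglongrightarrow> 1" using kpt_tendsto by (rule Lim_transform_eventually[rotated])
  then have "closed (insert 1 (range f))" using compact_sequence_with_limit compact_imp_closed by blast
  moreover have "kpt m \<notin> insert 1 (range f)"
    using kpt_neq_one inj_kpt by (auto simp: f_def inj_eq split: if_splits)
  ultimately obtain \<delta> where "\<delta> > 0" "\<forall>t\<in>insert 1 (range f). \<delta> \<le> dist (kpt m) t"
    using separate_point_closed by metis
  moreover have "branch_set - {kpt m} \<subseteq> insert 1 (range f)" by (auto simp: branch_set_def f_def)
  ultimately show ?thesis by blast
qed

definition point_char :: "complex \<Rightarrow> kernel_function \<times> complex \<Rightarrow> complex" where
  "point_char t = (\<lambda>(a, l). cf a t False False + l)"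

text \<open>Over the branch set the matrices are diagonal, so the entry of the first sheet is
  multiplicative there; adding the scalar is its unital extension to the unitization.\<close>

lemma character_point:
  assumes t: "t \<in> branch_set" shows "character (unitization glue_alg) (point_char t)"
proof -
  have tc: "t \<in> circle" using t branch_set_circle by blast
  have "cf (atimes glue_alg a b) t False False = cf a t False False * cf b t False False"
    if "a \<in> vcar glue_alg" "b \<in> vcar glue_alg" for a b
    using cf_glue(1)[OF that(1) tc that(2)] cf_branch[OF that(1) t, of False True] by (simp add: mmul_def)
  then show ?thesis unfolding character_def using star_algebra_unitization[OF star_algebra_glue]
    by (auto simp: unitization_simps point_char_def cf_linear algebra_simps)
qed

text \<open>The range of the bump projection below turns from the first sheet at \<open>kpt m\<close> to the second sheet
  at all other points of \<open>branch_set\<close>.\<close>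

lemma bump_projection:
  "\<exists>e\<in>vcar glue_alg. atimes glue_alg e e = e \<and> astar glue_alg e = e \<and>
     (\<forall>n. cf e (kpt n) False False = (if n = m then 1 else 0))"
proof -
  obtain \<delta> where \<delta>: "\<delta> > 0" "\<forall>t\<in>branch_set - {kpt m}. \<delta> \<le> dist (kpt m) t" using kpt_isolated by blast
  \<comment> \<open>\<open>c\<close> and \<open>s\<close> play the roles of cosine and sine. The
    tent \<open>c\<close> is 1 at \<open>kpt m\<close> and, by the choice of
    \<open>\<delta>\<close>, is 0 at every other branch point, so one of the two vanishes at each
    branch point.\<close>
  define c where "c t = max 0 (1 - dist (kpt m) t / \<delta>)" for t
  define s where "s t = sqrt (1 - (c t)\<^sup>2)" for t
  have c01: "0 \<le> c t" "c t \<le> 1" for t using \<delta>(1) by (auto simp: c_def)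
  have cs: "c t * c t + s t * s t = 1" for t
  proof -
    have "(c t)\<^sup>2 \<le> 1" using c01[of t] by (simp add: abs_square_le_1)
    then show ?thesis by (simp add: s_def flip: power2_eq_square)
  qed
  have c_kpt: "c (kpt m) = 1" by (simp add: c_def)
  have c0: "c t = 0" if "t \<in> branch_set" "t \<noteq> kpt m" for t
    using bspec[OF \<delta>(2), of t] that \<delta>(1) by (simp add: c_def max_def field_simps)
  have cont: "continuous_on circle c" "continuous_on circle s"
    unfolding c_def[abs_def] s_def[abs_def] using \<delta>(1) by (auto intro!: continuous_intros)
  define v where "v t i = complex_of_real (if i then s t else c t)" for t i
  have v_cont: "continuous_on circle (\<lambda>t. v t i)" for i
    using cont by (cases i) (simp_all add: v_def continuous_on_of_real)
  \<comment> \<open>The projection to the line of the real unit vector \<open>v t\<close>; its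
    off-diagonal entry is \<open>c t * s t\<close>, which is 0 on the branch set.\<close>
  define a :: "complex \<Rightarrow> mat2" where "a t i j = v t i * v t j" for t i j
  have a_cont: "continuous_on circle (\<lambda>t. a t i j)" for i j
    unfolding a_def by (intro continuous_on_mult v_cont)
  have a0: "a t i j = 0" if "t \<in> branch_set" "i \<noteq> j" for t i j
  proof -
    have "s (kpt m) = 0" by (simp add: s_def c_kpt)
    then have "c t * s t = 0" using c0[OF that(1)] by (cases "t = kpt m") simp_all
    then show ?thesis using that(2) by (cases i; cases j) (auto simp: a_def v_def)
  qed
  have e: "mk a \<in> vcar glue_alg" using a_cont a0 by (rule mk_glue(1))
  have cfe: "cf (mk a) t = a t" if "t \<in> circle" for t using a_cont a0 that by (rule mk_glue(2))
  have vv: "v t False * v t False + v t True * v t True = 1" for t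
    using cs[of t] unfolding v_def by (simp flip: of_real_mult of_real_add)
  have aa: "mmul (a t) (a t) = a t" for t
  proof (intro ext)
    fix i j
    have "mmul (a t) (a t) i j = v t i * (v t False * v t False + v t True * v t True) * v t j"
      by (simp add: mmul_def a_def algebra_simps)
    then show "mmul (a t) (a t) i j = a t i j" by (simp add: vv a_def)
  qed
  have as: "madj (a t) = a t" for t by (auto simp: madj_def a_def v_def fun_eq_iff)
  show ?thesis
  proof (intro bexI[OF _ e] conjI allI)
    show "atimes glue_alg (mk a) (mk a) = mk a" by (rule glue_eqI) (simp_all add: e glue_closed cf_glue cfe aa)
    show "astar glue_alg (mk a) = mk a" by (rule glue_eqI) (simp_all add: e glue_closed cf_glue cfe as)
    fix n
    have "kpt n \<in> branch_set" by (simp add: branch_set_def)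
    moreover have "kpt n = kpt m \<longleftrightarrow> n = m" using inj_kpt by (auto simp: inj_eq)
    ultimately show "cf (mk a) (kpt n) False False = (if n = m then 1 else 0)"
      using cfe[of "kpt n"] branch_set_circle c0[of "kpt n"] c_kpt by (auto simp: a_def v_def)
  qed
qed

lemma K_theory_glue: "\<not> finitely_generated (K_theory glue_alg)"
proof -
  have "\<forall>m. \<exists>e. e \<in> vcar glue_alg \<and> atimes glue_alg e e = e \<and> astar glue_alg e = e \<and>
     (\<forall>n. cf e (kpt n) False False = (if n = m then 1 else 0))"
    using bump_projection by blast
  then obtain e where e: "\<forall>m. e m \<in> vcar glue_alg \<and> atimes glue_alg (e m) (e m) = e m \<and> astar glue_alg (e m) = e m \<and>
     (\<forall>n. cf (e m) (kpt n) False False = (if n = m then 1 else 0))"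
    by (elim choice[THEN exE])
  have "character (unitization glue_alg) (point_char (kpt n))" for n
    by (rule character_point) (simp add: branch_set_def)
  then show ?thesis
    by (rule infinitely_generated_K_theory[OF star_algebra_glue, of _ e]) (use e in \<open>simp_all add: point_char_def\<close>)
qed

lemma trivial_Dixmier_Douady_glue: "trivial_Dixmier_Douady glue_alg"
  unfolding trivial_Dixmier_Douady_def
proof (intro conjI exI[of _ two_circles] exI[of _ glue_map])
  show "locally_compact_space two_circles"
    using compact_space_circles by (rule compact_imp_locally_compact_space)
  show "cstar_iso (cstar_tensor glue_alg compacts) (cstar_tensor (groupoid_cstar (equivalence_groupoid two_circles glue_map)) compacts)"
    unfolding equivalence_groupoid_glue by (rule cstar_tensor_glue)
qed (rule Fell_algebra_glue separable_glue second_countable_circles Hausdorff_circles local_homeomorphism_glue)+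

theorem mainTheorem5:
  shows "\<exists>A :: kernel_function cstar.
    Fell_algebra A \<and> trivial_Dixmier_Douady A \<and>
    compact_space (spectrum A) \<and> smooth_nonHausdorff_manifold (spectrum A) \<and>
    (\<exists>(M :: (nat \<Rightarrow> real) topology) \<psi>.
       compact_space M \<and> smooth_manifold M \<and>
       surjective_local_homeomorphism M (spectrum A) \<psi>) \<and>
    \<not> finitely_generated (K_theory A)"
  using Fell_algebra_glue trivial_Dixmier_Douady_glue compact_spectrum smooth_spectrum compact_space_circles
    smooth_manifold_circles local_homeomorphism_glue K_theory_glue by blast

end
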